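(* Let $\Gamma$ be an Artin algebra and let $(M,\theta)$ be a multiplicative bimodule for $\Gamma$, where $M$ is a tensor nilpotent $\Gamma$-bimodule. If (i) the bimodule $M$ is perfect over $\Gamma$, or (ii) the bimodule $M$ is right perfect over $\Gamma$ and $\theta=0$, then $(M,\theta)$ is removable. In particular, $$\mathrm{fin.dim}\,(\Gamma\ltimes_\theta M)<\infty\iff\mathrm{fin.dim}\,\Gamma<\infty,$$ and the equivalence remains valid if $\mathrm{fin.dim}$ is replaced by $\mathrm{Fin.dim}$ or by $\mathrm{gl.dim}$.
   Context: A multiplicative bimodule for a ring $\Gamma$ is a pair $(M,\theta)$ with $M$ a non-zero $\Gamma$-bimodule and $\theta:M\otimes_\Gamma M\to M$ a $\Gamma$-bimodule homomorphism that is associative: $\theta\circ(\theta\otimes 1_M)=\theta\circ(1_M\otimes\theta)$. The split extension $E=\Gamma\ltimes_\theta M$ is the ring with underlying abelian group $\Gamma\oplus M$ and multiplication $(\gamma_1,m_1)(\gamma_2,m_2)=(\gamma_1\gamma_2,\ \gamma_1m_2+m_1\gamma_2+\theta(m_1\otimes m_2))$; $\widetilde M=0\oplus M$ is an ideal of $E$. Standing convention: for an Artin algebra $\Gamma$ over a commutative artinian ring $k$, all $\Gamma$-bimodules $M$ are such that $k$ acts centrally on $M$ and $M$ is finitely generated over $k$ (so $E$ is an Artin $k$-algebra). $(M,\theta)$ is nilpotent if $\theta^N=0$ for some $N\ge1$, where $\theta^0=\mathrm{id}_M$ and $\theta^r=\theta\circ(\theta^{r-1}\otimes1_M):M^{\otimes_\Gamma(r+1)}\to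 M$. A nilpotent $(M,\theta)$ over an Artin algebra is two-sided removable if $\mathrm{pd}\,\widetilde M_E<\infty$ and $\mathrm{pd}\,{}_E\widetilde M<\infty$; only left removable if $\mathrm{pd}\,\widetilde M_E<\infty$, $\mathrm{pd}\,{}_E\widetilde M=\infty$ and $\theta=0$; removable if it is two-sided or only left removable. A non-zero bimodule $M$ is tensor nilpotent if $M^{\otimes_\Gamma i}=0$ for some $i>1$. A $\Gamma$-bimodule $M$ is right perfect if $\mathrm{Tor}_i^\Gamma(M^{\otimes_\Gamma j},M)=0$ for all $i,j\ge1$ and $\mathrm{pd}\,M_\Gamma<\infty$; left perfect is defined analogously ($\mathrm{Tor}_i^\Gamma(M,M^{\otimes_\Gamma j})=0$ for all $i,j\ge1$ and $\mathrm{pd}\,{}_\Gamma M<\infty$); perfect means left and right perfect. $\mathrm{fin.dim}\,R$ (resp. $\mathrm{Fin.dim}\,R$) is the supremum of the projective dimensions of finitely generated (resp. all) left $R$-modules of finite projective dimension; $\mathrm{gl.dim}$ is the global dimension. *)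

theory Defs
  imports "HOL-Library.Extended_Nat" "HOL-Algebra.Free_Abelian_Groups" "HOL-Algebra.Ideal"
    "HOL-Algebra.Module"
begin

section \<open>Modules over a not necessarily commutative ring\<close>

text \<open>
  HOL-Algebra's locale \<^locale>\<open>module\<close> requires a commutative ring. We keep its record type, whose
  ring multiplication and unit are irrelevant here. Right modules over \<open>R\<close> are left modules over the
  opposite ring; in that reading \<open>r \<odot>\<^bsub>X\<^esub> x\<close> stands for \<open>x r\<close>.
\<close>

locale left_module = R?: ring R + X?: abelian_group X
  for R (structure) and X (structure) +
  assumes smult_closed: "\<lbrakk>a \<in> carrier R; x \<in> carrier X\<rbrakk> \<Longrightarrow> a \<odot>\<^bsub>X\<^esub> x \<in> carrier X"
    and smult_l_distr: "\<lbrakk>a \<in> carrier R; b \<in> carrier R; x \<in> carrier X\<rbrakk>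
          \<Longrightarrow> (a \<oplus>\<^bsub>R\<^esub> b) \<odot>\<^bsub>X\<^esub> x = a \<odot>\<^bsub>X\<^esub> x \<oplus>\<^bsub>X\<^esub> b \<odot>\<^bsub>X\<^esub> x"
    and smult_r_distr: "\<lbrakk>a \<in> carrier R; x \<in> carrier X; y \<in> carrier X\<rbrakk>
          \<Longrightarrow> a \<odot>\<^bsub>X\<^esub> (x \<oplus>\<^bsub>X\<^esub> y) = a \<odot>\<^bsub>X\<^esub> x \<oplus>\<^bsub>X\<^esub> a \<odot>\<^bsub>X\<^esub> y"
    and smult_assoc: "\<lbrakk>a \<in> carrier R; b \<in> carrier R; x \<in> carrier X\<rbrakk>
          \<Longrightarrow> (a \<otimes>\<^bsub>R\<^esub> b) \<odot>\<^bsub>X\<^esub> x = a \<odot>\<^bsub>X\<^esub> (b \<odot>\<^bsub>X\<^esub> x)"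
    and smult_one: "x \<in> carrier X \<Longrightarrow> \<one>\<^bsub>R\<^esub> \<odot>\<^bsub>X\<^esub> x = x"

definition opp :: "('r, 's) ring_scheme \<Rightarrow> ('r, 's) ring_scheme" where
  "opp R = R\<lparr>mult := (\<lambda>x y. y \<otimes>\<^bsub>R\<^esub> x)\<rparr>"

definition with_smult :: "('x, 's) ring_scheme \<Rightarrow> ('r \<Rightarrow> 'x \<Rightarrow> 'x) \<Rightarrow> ('r, 'x) module" where
  "with_smult A s = \<lparr>carrier = carrier A, mult = mult A, one = one A,
                     zero = zero A, add = add A, smult = s\<rparr>"

definition zero_module :: "('x, 's) ring_scheme \<Rightarrow> bool" where
  "zero_module X \<longleftrightarrow> carrier X = {\<zero>\<^bsub>X\<^esub>}"

definition module_hom ::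
  "('r, 's) ring_scheme \<Rightarrow> ('r, 'x) module \<Rightarrow> ('r, 'y) module \<Rightarrow> ('x \<Rightarrow> 'y) set" where
  "module_hom R X Y = {f \<in> hom (add_monoid X) (add_monoid Y).
     \<forall>r\<in>carrier R. \<forall>x\<in>carrier X. f (r \<odot>\<^bsub>X\<^esub> x) = r \<odot>\<^bsub>Y\<^esub> f x}"

definition fin_gen :: "('r, 's) ring_scheme \<Rightarrow> ('r, 'x) module \<Rightarrow> bool" where
  "fin_gen R X \<longleftrightarrow> (\<exists>S. finite S \<and> S \<subseteq> carrier X \<and>
     (\<forall>x\<in>carrier X. \<exists>c\<in>S \<rightarrow> carrier R. x = (\<Oplus>\<^bsub>X\<^esub>s\<in>S. c s \<odot>\<^bsub>X\<^esub> s)))"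


section \<open>Projective dimension and finitistic dimensions\<close>

text \<open>
  HOL cannot quantify over types inside a formula, so classes of modules are bounded by a type.
  The type \<open>('r, 'x) big\<close> is infinite and at least as large as \<open>'r\<close> and \<open>'x\<close>. Hence, for a module
  over a ring on \<open>'r\<close> whose carrier lies in \<open>'x\<close>, it contains copies of the free module on the
  carrier, of all submodules of it, of the free modules on these, and so on. So lifting against
  surjections between modules in \<open>('r, 'x) big\<close> characterises projectivity (the free cover is among
  them), and every module in \<open>'x\<close> has a projective resolution in \<open>('r, 'x) big\<close>, of minimal length.
\<close>

type_synonym ('r, 'x) big = "('r \<times> 'x) list"

definition projective :: "('r, 's) ring_scheme \<Rightarrow> ('r, 'p) module \<Rightarrow> bool" where
  "projective R P \<longleftrightarrow> left_module R P \<and>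
     (\<forall>(A :: ('r, ('r, 'p) big) module) (B :: ('r, ('r, 'p) big) module) g f.
        left_module R A \<and> left_module R B \<and>
        g \<in> module_hom R A B \<and> g ` carrier A = carrier B \<and> f \<in> module_hom R P B
        \<longrightarrow> (\<exists>h\<in>module_hom R P A. \<forall>x\<in>carrier P. g (h x) = f x))"

definition proj_resolution ::
  "('r, 's) ring_scheme \<Rightarrow> ('r, 'x) module \<Rightarrow>
   (nat \<Rightarrow> ('r, 'p) module) \<Rightarrow> (nat \<Rightarrow> 'p \<Rightarrow> 'p) \<Rightarrow> ('p \<Rightarrow> 'x) \<Rightarrow> bool" where
  "proj_resolution R X P d e \<longleftrightarrow>
     (\<forall>n. projective R (P n)) \<and>
     (\<forall>n. d n \<in> module_hom R (P (Suc n)) (P n)) \<and>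
     e \<in> module_hom R (P 0) X \<and>
     e ` carrier (P 0) = carrier X \<and>
     a_kernel (P 0) X e = d 0 ` carrier (P 1) \<and>
     (\<forall>n. a_kernel (P (Suc n)) (P n) (d n) = d (Suc n) ` carrier (P (Suc (Suc n))))"

text \<open>The zero module gets projective dimension 0; there is no value below it in \<^typ>\<open>enat\<close>.\<close>

definition pd :: "('r, 's) ring_scheme \<Rightarrow> ('r, 'x) module \<Rightarrow> enat" where
  "pd R X = Inf {enat n | n. \<exists>(P :: nat \<Rightarrow> ('r, ('r, 'x) big) module) d e.
     proj_resolution R X P d e \<and> (\<forall>i>n. zero_module (P i))}"

text \<open>
  A finitely generated module is isomorphic to some \<open>R\<^sup>n / K\<close>, whose elements are sets of
  \<open>n\<close>-tuples; so the type below contains a copy of every finitely generated \<open>R\<close>-module.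
\<close>

definition fin_dim :: "('r, 's) ring_scheme \<Rightarrow> enat" where
  "fin_dim R = Sup {pd R X | X :: ('r, (nat \<Rightarrow> 'r) set) module.
     left_module R X \<and> fin_gen R X \<and> pd R X < \<infinity>}"

text \<open>\<open>'u\<close> plays the role of the universe from which the modules are taken.\<close>

definition Fin_dim :: "'u itself \<Rightarrow> ('r, 's) ring_scheme \<Rightarrow> enat" where
  "Fin_dim _ R = Sup {pd R X | X :: ('r, 'u) module. left_module R X \<and> pd R X < \<infinity>}"

definition gl_dim :: "'u itself \<Rightarrow> ('r, 's) ring_scheme \<Rightarrow> enat" where
  "gl_dim _ R = Sup {pd R X | X :: ('r, 'u) module. left_module R X}"


section \<open>Tensor products and Tor\<close>

definition tensor_rels ::
  "('r, 's) ring_scheme \<Rightarrow> ('r, 'x) module \<Rightarrow> ('r, 'y) module \<Rightarrow> ('x \<times> 'y \<Rightarrow>\<^sub>0 int) set" where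
  "tensor_rels R X Y =
     {frag_of (x \<oplus>\<^bsub>X\<^esub> x', y) - frag_of (x, y) - frag_of (x', y) | x x' y.
        x \<in> carrier X \<and> x' \<in> carrier X \<and> y \<in> carrier Y} \<union>
     {frag_of (x, y \<oplus>\<^bsub>Y\<^esub> y') - frag_of (x, y) - frag_of (x, y') | x y y'.
        x \<in> carrier X \<and> y \<in> carrier Y \<and> y' \<in> carrier Y} \<union>
     {frag_of (r \<odot>\<^bsub>X\<^esub> x, y) - frag_of (x, r \<odot>\<^bsub>Y\<^esub> y) | r x y.
        r \<in> carrier R \<and> x \<in> carrier X \<and> y \<in> carrier Y}"

definition tensor_sub ::
  "('r, 's) ring_scheme \<Rightarrow> ('r, 'x) module \<Rightarrow> ('r, 'y) module \<Rightarrow> ('x \<times> 'y \<Rightarrow>\<^sub>0 int) set" where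
  "tensor_sub R X Y = generate (free_Abelian_group (carrier X \<times> carrier Y)) (tensor_rels R X Y)"

text \<open>\<open>X \<otimes>\<^sub>R Y\<close> for a right module \<open>X\<close> (over \<^term>\<open>opp R\<close>) and a left module \<open>Y\<close>; its
  group operation is written multiplicatively, as for every group in HOL-Algebra.\<close>

definition tensor ::
  "('r, 's) ring_scheme \<Rightarrow> ('r, 'x) module \<Rightarrow> ('r, 'y) module \<Rightarrow> ('x \<times> 'y \<Rightarrow>\<^sub>0 int) set monoid" where
  "tensor R X Y = free_Abelian_group (carrier X \<times> carrier Y) Mod tensor_sub R X Y"

text \<open>The map \<open>1 \<otimes> f : X \<otimes>\<^sub>R Y \<rightarrow> X \<otimes>\<^sub>R Y'\<close>; all members of the union are the same coset.\<close>

definition tensor_map ::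
  "('r, 's) ring_scheme \<Rightarrow> ('r, 'x) module \<Rightarrow> ('r, 'y') module \<Rightarrow> ('y \<Rightarrow> 'y')
   \<Rightarrow> ('x \<times> 'y \<Rightarrow>\<^sub>0 int) set \<Rightarrow> ('x \<times> 'y' \<Rightarrow>\<^sub>0 int) set" where
  "tensor_map R X Y' f C = (\<Union>c\<in>C. tensor_sub R X Y'
     #>\<^bsub>free_Abelian_group (carrier X \<times> carrier Y')\<^esub> frag_extend (\<lambda>(x, y). frag_of (x, f y)) c)"

definition tensor_homology ::
  "('r, 's) ring_scheme \<Rightarrow> ('r, 'x) module \<Rightarrow> (nat \<Rightarrow> ('r, 'p) module) \<Rightarrow> (nat \<Rightarrow> 'p \<Rightarrow> 'p)
   \<Rightarrow> nat \<Rightarrow> ('x \<times> 'p \<Rightarrow>\<^sub>0 int) set set monoid" where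
  "tensor_homology R X P d i =
    (let T = (\<lambda>j. tensor R X (P j));
         D = (\<lambda>j. tensor_map R X (P j) (d j));
         Z = (case i of 0 \<Rightarrow> carrier (T 0) | Suc j \<Rightarrow> kernel (T i) (T j) (D j))
     in (T i)\<lparr>carrier := Z\<rparr> Mod (D i ` carrier (T (Suc i))))"

text \<open>\<open>Tor\<^sub>i\<^sup>R(X, Y) = 0\<close>. The group is defined up to isomorphism by any projective resolution of
  \<open>Y\<close>, and resolutions in the chosen type exist.\<close>

definition Tor_zero ::
  "('r, 's) ring_scheme \<Rightarrow> nat \<Rightarrow> ('r, 'x) module \<Rightarrow> ('r, 'y) module \<Rightarrow> bool" where
  "Tor_zero R i X Y \<longleftrightarrow> (\<forall>(P :: nat \<Rightarrow> ('r, ('r, 'y) big) module) d e.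
     proj_resolution R Y P d e \<longrightarrow> trivial_group (tensor_homology R X P d i))"


section \<open>Bimodules and their tensor powers\<close>

record ('r, 'x) bimodule = "('r, 'x) module" +
  rsmult :: "'x \<Rightarrow> 'r \<Rightarrow> 'x"

definition left_of :: "('r, 'x) bimodule \<Rightarrow> ('r, 'x) module" where
  "left_of M = with_smult M (smult M)"

definition right_of :: "('r, 'x) bimodule \<Rightarrow> ('r, 'x) module" where
  "right_of M = with_smult M (\<lambda>r x. rsmult M x r)"

definition bimodule :: "('r, 's) ring_scheme \<Rightarrow> ('r, 'x) bimodule \<Rightarrow> bool" where
  "bimodule R M \<longleftrightarrow> left_module R (left_of M) \<and> left_module (opp R) (right_of M) \<and>
     (\<forall>r\<in>carrier R. \<forall>s\<in>carrier R. \<forall>x\<in>carrier M.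
        rsmult M (r \<odot>\<^bsub>M\<^esub> x) s = r \<odot>\<^bsub>M\<^esub> rsmult M x s)"

definition bimodule_hom ::
  "('r, 's) ring_scheme \<Rightarrow> ('r, 'x) bimodule \<Rightarrow> ('r, 'y) bimodule \<Rightarrow> ('x \<Rightarrow> 'y) set" where
  "bimodule_hom R M N =
     module_hom R (left_of M) (left_of N) \<inter> module_hom (opp R) (right_of M) (right_of N)"

text \<open>
  The \<open>n\<close>-fold tensor power (\<open>n \<ge> 1\<close>) is the free abelian group on words of length \<open>n\<close> over \<open>M\<close>
  modulo additivity in each letter and balancedness between neighbouring letters. Working with words
  rather than iterating a binary tensor product keeps all powers in one type.
\<close>

definition words :: "('r, 'm) bimodule \<Rightarrow> nat \<Rightarrow> 'm list set" where
  "words M n = {w. length w = n \<and> set w \<subseteq> carrier M}"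

definition tpow_rels ::
  "('r, 's) ring_scheme \<Rightarrow> ('r, 'm) bimodule \<Rightarrow> nat \<Rightarrow> ('m list \<Rightarrow>\<^sub>0 int) set" where
  "tpow_rels R M n =
     {frag_of (u @ [x \<oplus>\<^bsub>M\<^esub> y] @ v) - frag_of (u @ [x] @ v) - frag_of (u @ [y] @ v) | u v x y.
        u @ [x] @ v \<in> words M n \<and> y \<in> carrier M} \<union>
     {frag_of (u @ [rsmult M x r, y] @ v) - frag_of (u @ [x, r \<odot>\<^bsub>M\<^esub> y] @ v) | u v x y r.
        u @ [x, y] @ v \<in> words M n \<and> r \<in> carrier R}"

definition tpow_sub ::
  "('r, 's) ring_scheme \<Rightarrow> ('r, 'm) bimodule \<Rightarrow> nat \<Rightarrow> ('m list \<Rightarrow>\<^sub>0 int) set" where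
  "tpow_sub R M n = generate (free_Abelian_group (words M n)) (tpow_rels R M n)"

definition tpow_class ::
  "('r, 's) ring_scheme \<Rightarrow> ('r, 'm) bimodule \<Rightarrow> nat \<Rightarrow> ('m list \<Rightarrow>\<^sub>0 int) \<Rightarrow> ('m list \<Rightarrow>\<^sub>0 int) set" where
  "tpow_class R M n c = tpow_sub R M n #>\<^bsub>free_Abelian_group (words M n)\<^esub> c"

definition tpow ::
  "('r, 's) ring_scheme \<Rightarrow> ('r, 'm) bimodule \<Rightarrow> nat \<Rightarrow> ('r, ('m list \<Rightarrow>\<^sub>0 int) set) bimodule" where
  "tpow R M n =
    (let Q = free_Abelian_group (words M n) Mod tpow_sub R M n in
     \<lparr>carrier = carrier Q, mult = undefined, one = undefined, zero = one Q, add = mult Q,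
      smult = (\<lambda>r C. \<Union>c\<in>C. tpow_class R M n
                 (frag_extend (\<lambda>w. frag_of ((r \<odot>\<^bsub>M\<^esub> hd w) # tl w)) c)),
      rsmult = (\<lambda>C r. \<Union>c\<in>C. tpow_class R M n
                 (frag_extend (\<lambda>w. frag_of (butlast w @ [rsmult M (last w) r])) c))\<rparr>)"

definition pure :: "('r, 's) ring_scheme \<Rightarrow> ('r, 'm) bimodule \<Rightarrow> 'm list \<Rightarrow> ('m list \<Rightarrow>\<^sub>0 int) set" where
  "pure R M w = tpow_class R M (length w) (frag_of w)"

text \<open>The additive map on a tensor power of \<open>M\<close> with the given values on elementary tensors: it is
  extended additively to formal sums of words, where it is constant on each coset.\<close>

definition tpow_lift :: "('r, 'm) bimodule \<Rightarrow> ('m list \<Rightarrow> 'm) \<Rightarrow> ('m list \<Rightarrow>\<^sub>0 int) set \<Rightarrow> 'm" where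
  "tpow_lift M f C =
     the_elem ((\<lambda>c. \<Oplus>\<^bsub>M\<^esub>w\<in>Poly_Mapping.keys c. add_pow M (Poly_Mapping.lookup c w) (f w)) ` C)"

definition tensor_nilpotent :: "('r, 's) ring_scheme \<Rightarrow> ('r, 'm) bimodule \<Rightarrow> bool" where
  "tensor_nilpotent R M \<longleftrightarrow> \<not> zero_module M \<and> (\<exists>i>1. zero_module (tpow R M i))"

definition right_perfect :: "('r, 's) ring_scheme \<Rightarrow> ('r, 'm) bimodule \<Rightarrow> bool" where
  "right_perfect R M \<longleftrightarrow>
     (\<forall>i\<ge>1. \<forall>j\<ge>1. Tor_zero R i (right_of (tpow R M j)) (left_of M)) \<and>
     pd (opp R) (right_of M) < \<infinity>"

definition left_perfect :: "('r, 's) ring_scheme \<Rightarrow> ('r, 'm) bimodule \<Rightarrow> bool" where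
  "left_perfect R M \<longleftrightarrow>
     (\<forall>i\<ge>1. \<forall>j\<ge>1. Tor_zero R i (right_of M) (left_of (tpow R M j))) \<and>
     pd R (left_of M) < \<infinity>"

definition perfect :: "('r, 's) ring_scheme \<Rightarrow> ('r, 'm) bimodule \<Rightarrow> bool" where
  "perfect R M \<longleftrightarrow> left_perfect R M \<and> right_perfect R M"


section \<open>Artin algebras\<close>

definition artinian_cring :: "('k, 's) ring_scheme \<Rightarrow> bool" where
  "artinian_cring k \<longleftrightarrow> cring k \<and>
     (\<forall>I :: nat \<Rightarrow> 'k set. (\<forall>n. ideal (I n) k \<and> I (Suc n) \<subseteq> I n) \<longrightarrow> (\<exists>N. \<forall>n\<ge>N. I n = I N))"

text \<open>The \<open>k\<close>-algebra structure is given by the structure map \<open>\<phi>\<close> into the centre.\<close>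

definition artin_algebra ::
  "('k, 's) ring_scheme \<Rightarrow> ('r, 't) ring_scheme \<Rightarrow> ('k \<Rightarrow> 'r) \<Rightarrow> bool" where
  "artin_algebra k R \<phi> \<longleftrightarrow> artinian_cring k \<and> ring R \<and> \<phi> \<in> ring_hom k R \<and>
     (\<forall>a\<in>carrier k. \<forall>x\<in>carrier R. \<phi> a \<otimes>\<^bsub>R\<^esub> x = x \<otimes>\<^bsub>R\<^esub> \<phi> a) \<and>
     fin_gen k (with_smult R (\<lambda>a x. \<phi> a \<otimes>\<^bsub>R\<^esub> x))"

definition central_fin_gen :: "('k, 's) ring_scheme \<Rightarrow> ('k \<Rightarrow> 'r) \<Rightarrow> ('r, 'm) bimodule \<Rightarrow> bool" where
  "central_fin_gen k \<phi> M \<longleftrightarrow>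
     (\<forall>a\<in>carrier k. \<forall>x\<in>carrier M. \<phi> a \<odot>\<^bsub>M\<^esub> x = rsmult M x (\<phi> a)) \<and>
     fin_gen k (with_smult M (\<lambda>a x. \<phi> a \<odot>\<^bsub>M\<^esub> x))"


section \<open>Multiplicative bimodules and split extensions\<close>

text \<open>Associativity is evaluated on the elementary tensors \<open>x \<otimes> y \<otimes> z\<close>, which generate \<open>M \<otimes> M \<otimes> M\<close>.\<close>

definition mult_bimodule ::
  "('r, 's) ring_scheme \<Rightarrow> ('r, 'm) bimodule \<Rightarrow> (('m list \<Rightarrow>\<^sub>0 int) set \<Rightarrow> 'm) \<Rightarrow> bool" where
  "mult_bimodule R M \<theta> \<longleftrightarrow> bimodule R M \<and> \<not> zero_module M \<and>
     \<theta> \<in> bimodule_hom R (tpow R M 2) M \<and>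
     (\<forall>x\<in>carrier M. \<forall>y\<in>carrier M. \<forall>z\<in>carrier M.
        \<theta> (pure R M [\<theta> (pure R M [x, y]), z]) = \<theta> (pure R M [x, \<theta> (pure R M [y, z])]))"

definition mult_zero ::
  "('r, 's) ring_scheme \<Rightarrow> ('r, 'm) bimodule \<Rightarrow> (('m list \<Rightarrow>\<^sub>0 int) set \<Rightarrow> 'm) \<Rightarrow> bool" where
  "mult_zero R M \<theta> \<longleftrightarrow> (\<forall>t\<in>carrier (tpow R M 2). \<theta> t = \<zero>\<^bsub>M\<^esub>)"

text \<open>\<open>\<theta>\<^sup>r : M\<^sup>\<otimes>\<^sup>(\<^sup>r\<^sup>+\<^sup>1\<^sup>) \<rightarrow> M\<close>; on elementary tensors the recursion \<open>\<theta>\<^sup>r = \<theta> \<circ> (\<theta>\<^sup>r\<^sup>-\<^sup>1 \<otimes> 1)\<close> is a left fold.\<close>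

definition mult_pow ::
  "('r, 's) ring_scheme \<Rightarrow> ('r, 'm) bimodule \<Rightarrow> (('m list \<Rightarrow>\<^sub>0 int) set \<Rightarrow> 'm)
   \<Rightarrow> ('m list \<Rightarrow>\<^sub>0 int) set \<Rightarrow> 'm" where
  "mult_pow R M \<theta> = tpow_lift M (\<lambda>w. foldl (\<lambda>x y. \<theta> (pure R M [x, y])) (hd w) (tl w))"

definition mult_nilpotent ::
  "('r, 's) ring_scheme \<Rightarrow> ('r, 'm) bimodule \<Rightarrow> (('m list \<Rightarrow>\<^sub>0 int) set \<Rightarrow> 'm) \<Rightarrow> bool" where
  "mult_nilpotent R M \<theta> \<longleftrightarrow>
     (\<exists>N\<ge>1. \<forall>t\<in>carrier (tpow R M (Suc N)). mult_pow R M \<theta> t = \<zero>\<^bsub>M\<^esub>)"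

definition split_ext ::
  "('r, 's) ring_scheme \<Rightarrow> ('r, 'm) bimodule \<Rightarrow> (('m list \<Rightarrow>\<^sub>0 int) set \<Rightarrow> 'm) \<Rightarrow> ('r \<times> 'm) ring" where
  "split_ext R M \<theta> =
    \<lparr>carrier = carrier R \<times> carrier M,
     mult = (\<lambda>(a, x) (b, y). (a \<otimes>\<^bsub>R\<^esub> b,
               a \<odot>\<^bsub>M\<^esub> y \<oplus>\<^bsub>M\<^esub> rsmult M x b \<oplus>\<^bsub>M\<^esub> \<theta> (pure R M [x, y]))),
     one = (\<one>\<^bsub>R\<^esub>, \<zero>\<^bsub>M\<^esub>),
     zero = (\<zero>\<^bsub>R\<^esub>, \<zero>\<^bsub>M\<^esub>),
     add = (\<lambda>(a, x) (b, y). (a \<oplus>\<^bsub>R\<^esub> b, x \<oplus>\<^bsub>M\<^esub> y))\<rparr>"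

definition ideal_module :: "'x ring \<Rightarrow> 'x set \<Rightarrow> ('x, 'x) module" where
  "ideal_module E I = with_smult (E\<lparr>carrier := I\<rparr>) (mult E)"

definition ext_ideal :: "('r, 's) ring_scheme \<Rightarrow> ('r, 'm) bimodule \<Rightarrow> ('r \<times> 'm) set" where
  "ext_ideal R M = {\<zero>\<^bsub>R\<^esub>} \<times> carrier M"

definition pd_ideal_left ::
  "('r, 's) ring_scheme \<Rightarrow> ('r, 'm) bimodule \<Rightarrow> (('m list \<Rightarrow>\<^sub>0 int) set \<Rightarrow> 'm) \<Rightarrow> enat" where
  "pd_ideal_left R M \<theta> = (let E = split_ext R M \<theta> in pd E (ideal_module E (ext_ideal R M)))"

definition pd_ideal_right ::
  "('r, 's) ring_scheme \<Rightarrow> ('r, 'm) bimodule \<Rightarrow> (('m list \<Rightarrow>\<^sub>0 int) set \<Rightarrow> 'm) \<Rightarrow> enat" where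
  "pd_ideal_right R M \<theta> =
    (let E = split_ext R M \<theta> in pd (opp E) (ideal_module (opp E) (ext_ideal R M)))"

definition two_sided_removable ::
  "('r, 's) ring_scheme \<Rightarrow> ('r, 'm) bimodule \<Rightarrow> (('m list \<Rightarrow>\<^sub>0 int) set \<Rightarrow> 'm) \<Rightarrow> bool" where
  "two_sided_removable R M \<theta> \<longleftrightarrow> mult_nilpotent R M \<theta> \<and>
     pd_ideal_right R M \<theta> < \<infinity> \<and> pd_ideal_left R M \<theta> < \<infinity>"

definition only_left_removable ::
  "('r, 's) ring_scheme \<Rightarrow> ('r, 'm) bimodule \<Rightarrow> (('m list \<Rightarrow>\<^sub>0 int) set \<Rightarrow> 'm) \<Rightarrow> bool" where
  "only_left_removable R M \<theta> \<longleftrightarrow> mult_nilpotent R M \<theta> \<and>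
     pd_ideal_right R M \<theta> < \<infinity> \<and> pd_ideal_left R M \<theta> = \<infinity> \<and> mult_zero R M \<theta>"

definition removable ::
  "('r, 's) ring_scheme \<Rightarrow> ('r, 'm) bimodule \<Rightarrow> (('m list \<Rightarrow>\<^sub>0 int) set \<Rightarrow> 'm) \<Rightarrow> bool" where
  "removable R M \<theta> \<longleftrightarrow> two_sided_removable R M \<theta> \<or> only_left_removable R M \<theta>"

text \<open>
  A common universe for modules over \<open>\<Gamma>\<close> (on \<open>'r\<close>) and over \<open>\<Gamma> \<ltimes> M\<close> (on \<open>'r \<times> 'm\<close>). It is at least as
  large as both rings; since \<open>'x\<close> is arbitrary, any given module can be transported into it.
\<close>

type_synonym ('r, 'm, 'x) module_universe = "('r \<times> 'm, 'x) big"

end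

theory Submission
 imports Defs "HOL-Library.Function_Algebras" "HOL-Library.Product_Plus"
begin

text \<open>
Write \<open>E\<close> for the split extension of \<open>\<Gamma>\<close> by \<open>M\<close> and \<open>I\<close> for its ideal \<open>0 \<oplus> M\<close>. If the left \<open>E\<close>-module \<open>K\<close> restricts to
\<open>T\<close> over \<open>\<Gamma>\<close>, then the kernel of \<open>E \<otimes>\<^sub>\<Gamma> K \<rightarrow> K\<close> restricts to \<open>M \<otimes>\<^sub>\<Gamma> T\<close>. Starting with \<open>K = I\<close> one meets the tensor powers of \<open>M\<close>, so the
process stops by tensor nilpotency; the vanishing of Tor bounds the projective dimensions on the way, hence the one of \<open>I\<close>.
A finite projective dimension of \<open>I\<close> on the right makes \<open>\<Gamma> \<otimes>\<^sub>E _\<close> preserve exactness of an \<open>E\<close>-resolution beyond a fixed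
degree; if the result splits at some place beyond it, so does the resolution itself, as \<open>I\<close> is nilpotent. In the same way \<open>E \<otimes>\<^sub>\<Gamma> _\<close> preserves
exactness beyond a fixed degree, and \<open>\<Gamma> \<otimes>\<^sub>E E = \<Gamma>\<close> brings a splitting back. So both rings bound the same lengths, up to a constant.

To calculate with free resolutions as families of matrices, rings and modules are replaced by isomorphic copies that are subgroups
of types of class \<open>ab_group_add\<close>; these exist since every abelian group embeds into a power of the circle group.
\<close>

section \<open>Abelian groups as subgroups of types\<close>

text \<open>Finiteness of projective dimension is tracked on one free resolution: it is split at
  place \<open>n\<close> if some \<open>\<sigma>\<close> satisfies \<open>d \<sigma> d = d\<close>.
  This does not depend on the resolution, persists at all later places and, for matrices, is an
  equation that every ring homomorphism preserves entrywise. So a change of rings costs nothing for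
  splittings; the obstacle is exactness after the change, and this is where Tor groups of
  \<open>M\<close> or of the ideal enter. They are given through resolutions of one tensor factor
  and needed for the other, hence a double complex that balances Tor. Modules are kept as pairs
  \<open>(X, D)\<close> standing for \<open>X/D\<close>, so that cokernels and mapping cones need no
  quotient types. A finite value of one of the three dimensions then means that a single place
  serves for all resolutions of a certain kind, finite bases being required for
  \<open>fin_dim\<close>; kernels must then be finitely generated again, so the Artin algebras have
  to be shown noetherian.\<close>

notation (input) iff (infixr "<->" 25)
abbreviation "tinv == the_inv_into"
abbreviation "fkeys == Poly_Mapping.keys"

definition subgrp :: "'a::ab_group_add set => bool" where
 "subgrp A <-> 0 : A & (ALL x:A. ALL y:A. x - y : A)"

lemma subgrp_0: "subgrp A ==> 0 : A" by (simp add: subgrp_def)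

lemma subgrp_diff: "subgrp A ==> x : A ==> y : A ==> x - y : A" by (simp add: subgrp_def)

lemma subgrp_uminus: "subgrp A ==> x : A ==> - x : A" using subgrp_diff[of A 0 x] by (simp add: subgrp_0)

lemma subgrp_add: "subgrp A ==> x : A ==> y : A ==> x + y : A" using subgrp_diff[of A x "- y"] by (simp add: subgrp_uminus)

lemma subgrp_sum: "subgrp A ==> (!!i. i : I ==> f i : A) ==> sum f I : A" by (induction I rule: infinite_finite_induct) (auto simp: subgrp_0 subgrp_add)

lemma subgrpI:
 "0 : A ==> (!!x y. x : A ==> y : A ==> x + y : A) ==> (!!x. x : A ==> - x : A) ==> subgrp A" by (metis (no_types, lifting) diff_conv_add_uminus subgrp_def)

lemma subgrp_UNIV [simp]: "subgrp UNIV" by (simp add: subgrp_def)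

lemma subgrp_single [simp]: "subgrp {0}" by (simp add: subgrp_def)

lemma subgrp_Times: "subgrp A ==> subgrp B ==> subgrp (A \<times> B)" by (auto simp: subgrp_def zero_prod_def)

lemma subgrp_inter: "subgrp A ==> subgrp B ==> subgrp (A \<inter> B)" by (auto simp: subgrp_def)

lemmas subgrp_intros = subgrp_0 subgrp_diff subgrp_uminus subgrp_add

definition additive_on :: "'a::ab_group_add set => ('a => 'b::ab_group_add) => bool" where
 "additive_on A f <-> (ALL x:A. ALL y:A. f (x + y) = f x + f y)"

lemma additive_on_add: "additive_on A f ==> x : A ==> y : A ==> f (x + y) = f x + f y" by (simp add: additive_on_def)

lemma additive_on_0: "additive_on A f ==> subgrp A ==> f 0 = 0" using additive_on_add[of A f 0 0] by (simp add: subgrp_0)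

lemma additive_on_uminus: "additive_on A f ==> subgrp A ==> x : A ==> f (- x) = - f x" using additive_on_0[of A f] additive_on_add[of A f x "- x"] by (simp add: subgrp_uminus eq_neg_iff_add_eq_0 add.commute)

lemma additive_on_diff:
 assumes "additive_on A f" "subgrp A" "x : A" "y : A"
 shows "f (x - y) = f x - f y" using additive_on_uminus[of A f y] additive_on_add[of A f x "- y"] assms by (simp add: subgrp_uminus)

lemma additive_on_sum:
 assumes "additive_on A f" "subgrp A" "!!i. i : I ==> g i : A"
 shows "f (sum g I) = (\<Sum>i\<in>I. f (g i))" using assms(3)
proof (induction I rule: infinite_finite_induct)
 case (insert i I)
 then have "sum g I : A" "g i : A" using assms(2) by (auto intro: subgrp_sum)
 then show ?case using insert assms(1) by (simp add: additive_on_def)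
qed (simp_all add: additive_on_0[OF assms(1,2)])

lemma subgrp_image:
 assumes "subgrp A" "additive_on A f" shows "subgrp (f ` A)" unfolding subgrp_def
proof (intro conjI ballI)
 show "0 : f ` A" using additive_on_0[OF assms(2,1)] subgrp_0[OF assms(1)] by (metis imageI)
 fix x y assume "x : f ` A" "y : f ` A"
 then obtain a b where "a : A" "b : A" "x = f a" "y = f b" by blast
 then show "x - y : f ` A" using additive_on_diff[OF assms(2,1), of a b] subgrp_diff[OF assms(1), of a b] by (metis imageI)
qed

lemma subgrp_preimage:
 assumes "subgrp A" "additive_on A f" "subgrp B" shows "subgrp {x\<in>A. f x : B}" unfolding subgrp_def using assms by (auto simp: additive_on_0 additive_on_diff subgrp_intros)

definition biadd :: "'a::ab_group_add set => 'b::ab_group_add set => ('a => 'b => 'c::ab_group_add) => bool" where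
 "biadd A B f <-> (ALL b:B. additive_on A (%a. f a b)) & (ALL a:A. additive_on B (f a))"

lemma biaddI:
 assumes "!!a a' b. a : A ==> a' : A ==> b : B ==> f (a + a') b = f a b + f a' b"
  and "!!a b b'. a : A ==> b : B ==> b' : B ==> f a (b + b') = f a b + f a b'"
 shows "biadd A B f" using assms by (auto simp: biadd_def additive_on_def)

lemma biadd_left: "biadd A B f ==> b : B ==> additive_on A (%a. f a b)" by (simp add: biadd_def)

lemma biadd_right: "biadd A B f ==> a : A ==> additive_on B (f a)" by (simp add: biadd_def)

lemma biadd_add:
 "biadd A B f ==> a : A ==> a' : A ==> b : B ==> f (a + a') b = f a b + f a' b"
 "biadd A B f ==> a : A ==> b : B ==> b' : B ==> f a (b + b') = f a b + f a b'" by (auto simp: biadd_def additive_on_def)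

lemma biadd_flip: "biadd A B f ==> biadd B A (%b a. f a b)" by (auto simp: biadd_def)

subsection \<open>Integer multiples\<close>

text \<open>At most one of the two sums is non-empty, so this is the integer multiple for either
  sign.\<close>

definition zmul :: "int => 'a::ab_group_add => 'a" where
 "zmul k x = (\<Sum>i<nat k. x) - (\<Sum>i<nat (- k). x)"

lemma zmul_0 [simp]: "zmul 0 x = 0" by (simp add: zmul_def)

lemma zmul_Suc: "zmul (k + 1) x = zmul k x + x"
proof (cases "k >= 0")
 case True
 then show ?thesis by (simp add: zmul_def nat_add_distrib)
next
 case False
 then have "nat (- k) = Suc (nat (- (k + 1)))" by simp
 with False show ?thesis by (simp add: zmul_def del: minus_add_distrib)
qed

lemma zmul_1 [simp]: "zmul 1 x = x" using zmul_Suc[of 0 x] by simp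

lemma zmul_pred: "zmul (k - 1) x = zmul k x - x" using zmul_Suc[of "k - 1" x] by simp

lemma zmul_add: "zmul (k + l) x = zmul k x + zmul l x"
proof (induction l rule: int_induct[where k = 0])
 case (step1 i)
 have "zmul (k + (i + 1)) x = zmul ((k + i) + 1) x" by (simp add: add.assoc)
 then show ?case using step1 unfolding zmul_Suc by simp
next
 case (step2 i)
 have "zmul (k + (i - 1)) x = zmul ((k + i) - 1) x" by (simp add: algebra_simps)
 then show ?case using step2 unfolding zmul_pred by simp
qed simp

lemma zmul_add_right: "zmul k (x + y) = zmul k x + zmul k y" by (simp add: zmul_def sum.distrib)

lemma zmul_mult: "zmul (k * l) x = zmul k (zmul l x)"
proof (induction k rule: int_induct[where k = 0])
 case (step1 i)
 then show ?case by (simp add: zmul_Suc zmul_add distrib_right)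
next
 case (step2 i)
 have "(i - 1) * l + l = i * l" by (simp add: algebra_simps)
 then have "zmul ((i - 1) * l) x + zmul l x = zmul (i * l) x" by (metis zmul_add)
 then show ?case using step2 by (simp add: zmul_pred algebra_simps)
qed simp

lemma zmul_minus: "zmul (- k) x = - zmul k x" using zmul_add[of k "- k" x] by (metis add.right_inverse add_eq_0_iff zmul_0)

lemma zmul_in: "subgrp A ==> x : A ==> zmul k x : A" unfolding zmul_def by (intro subgrp_diff subgrp_sum) auto

lemma zmul_additive:
 assumes "additive_on A f" "subgrp A" "x : A" shows "f (zmul k x) = zmul k (f x)"
proof -
 have "(\<Sum>i<n. x) : A" "f (\<Sum>i<n. x) = (\<Sum>i<n. f x)" for n :: nat using assms by (auto intro: subgrp_sum simp: additive_on_sum)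
 then show ?thesis using assms unfolding zmul_def by (simp add: additive_on_diff)
qed

lemma additive_fst: "additive_on A fst" and additive_snd: "additive_on A snd" by (auto simp: additive_on_def)

lemma fst_zmul [simp]: "fst (zmul k p) = zmul k (fst p)" and snd_zmul [simp]: "snd (zmul k p) = zmul k (snd p)" using zmul_additive[of UNIV fst p k] zmul_additive[of UNIV snd p k] by (auto simp: additive_fst additive_snd)

subsection \<open>The circle group and characters\<close>

text \<open>The circle group is divisible, hence injective, and so its powers contain every abelian group:
 this is what allows us to compute in the type class of abelian groups.\<close>

lemma frac_add_frac: "frac (frac x + y) = frac (x + y)" for x y :: real
proof -
 have "frac x + y = (x + y) - of_int \<lfloor>x\<rfloor>" by (simp add: frac_def)
 moreover have "frac (z - of_int n) = frac z" for z :: real and n by (simp add: frac_def)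
 ultimately show ?thesis by presburger
qed

text \<open>The group \<open>R/Z\<close>, each class given by its representative in
  \<open>[0,1)\<close>; the operations reduce modulo 1 by \<open>frac\<close>.\<close>

typedef circle = "{0..<1::real}" by (intro exI[of _ 0]) simp

setup_lifting type_definition_circle

instantiation circle :: ab_group_add
begin
lift_definition zero_circle :: circle is 0 by simp
lift_definition plus_circle :: "circle => circle => circle" is "%x y. frac (x + y)" by (simp add: frac_lt_1)
lift_definition uminus_circle :: "circle => circle" is "%x. frac (- x)" by (simp add: frac_lt_1)
lift_definition minus_circle :: "circle => circle => circle" is "%x y. frac (x - y)" by (simp add: frac_lt_1)
instance
proof
 fix a b c :: circle
 show "a + b + c = a + (b + c)" by transfer (metis add.commute add.left_commute frac_add_frac)
 show "a + b = b + a" by transfer (simp add: add.commute)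
 show "0 + a = a" by transfer (simp add: frac_eq)
 show "- a + a = 0" by transfer (simp add: frac_add_frac)
 show "a - b = a + - b" by transfer (metis add.commute diff_conv_add_uminus frac_add_frac)
qed
end

lift_definition to_circle :: "real => circle" is frac by (simp add: frac_lt_1)

lemma to_circle_add: "to_circle (x + y) = to_circle x + to_circle y"
proof transfer
 fix x y :: real
 show "frac (x + y) = frac (frac x + frac y)" unfolding frac_add_frac by (metis add.commute frac_add_frac)
qed

lemma to_circle_surj: "EX x. to_circle x = c" by (transfer) (metis atLeastLessThan_iff frac_eq)

lemma circle_divisible:
 assumes "n > 0" shows "EX c. zmul n c = (z::circle)"
proof -
 obtain x where x: "to_circle x = z" using to_circle_surj by blast
 have "additive_on UNIV to_circle" by (simp add: additive_on_def to_circle_add)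
 then have "zmul n (to_circle (x / of_int n)) = to_circle (zmul n (x / of_int n))" using zmul_additive[of UNIV to_circle "x / of_int n" n] by simp
 also have "zmul n (x / of_int n) = x" using assms by (simp add: zmul_def)
 finally show ?thesis using x by blast
qed

text \<open>The class of \<open>1/n\<close> is killed by \<open>n\<close>. It supplies non-zero
  character values on elements of finite order.\<close>

lemma circle_torsion:
 assumes "n > 1" shows "EX c::circle. c ~= 0 & zmul n c = 0"
proof -
 have "additive_on UNIV to_circle" by (simp add: additive_on_def to_circle_add)
 then have "zmul n (to_circle (1 / of_int n)) = to_circle (zmul n (1 / of_int n))" using zmul_additive[of UNIV to_circle "1 / of_int n" n] by simp
 also have "zmul n (1 / of_int n) = (1::real)" using assms by (simp add: zmul_def)
 also have "to_circle 1 = 0" by transfer simp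
 finally have "zmul n (to_circle (1 / of_int n)) = 0" .
 moreover have "to_circle (1 / of_int n) ~= 0" using assms by transfer (simp add: frac_eq)
 ultimately show ?thesis by blast
qed

text \<open>Partial characters are represented by their graphs, which are subgroups of a product.\<close>

definition char_graph :: "('a::ab_group_add \<times> circle) set => bool" where
 "char_graph G <-> subgrp G & (ALL c. (0, c) : G --> c = 0)"

lemma char_graph_unique: "char_graph G ==> (x, c) : G ==> (x, c') : G ==> c = c'" using subgrp_diff[of G "(x, c)" "(x, c')"] by (fastforce simp: char_graph_def)

text \<open>The new graph is \<open>G\<close> plus the multiples of \<open>(y, c)\<close>. It stays
  single-valued because \<open>c\<close> is compatible with the values that \<open>G\<close> already
  gives to multiples of \<open>y\<close>.\<close>

lemma char_graph_extend:
 assumes G: "char_graph G" and c: "!!k z. (zmul k y, z) : G ==> z = zmul k c"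
 shows "EX G'. char_graph G' & G <= G' & (y, c) : G'"
proof (intro exI conjI)
 let ?G = "{g + zmul k (y, c) | g k. g : G}"
 have sG: "subgrp G" using G by (simp add: char_graph_def)
 have "subgrp ?G" unfolding subgrp_def
 proof (intro conjI ballI)
  have "0 = 0 + zmul 0 (y, c)" "0 : G" using sG by (simp_all add: subgrp_0)
  then show "0 : ?G" by blast
  fix u v assume "u : ?G" "v : ?G"
  then obtain g k h l where "u = g + zmul k (y, c)" "v = h + zmul l (y, c)" "g : G" "h : G" by blast
  then have "u - v = (g - h) + zmul (k - l) (y, c)" "g - h : G" using sG zmul_add[of "k - l" l "(y, c)"] by (auto simp: subgrp_diff algebra_simps)
  then show "u - v : ?G" by blast
 qed
 moreover have "z = 0" if "(0, z) : ?G" for z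
 proof -
  from that obtain a b k where ab: "(0, z) = (a, b) + zmul k (y, c)" "(a, b) : G" by force
  then have a: "a = zmul (- k) y" and z: "z = b + zmul k c" by (auto simp: prod_eq_iff zmul_minus eq_neg_iff_add_eq_0)
  have "b = zmul (- k) c" using c[of "- k" b] ab(2) a by simp
  then show "z = 0" using z by (simp add: zmul_minus)
 qed
 ultimately show "char_graph ?G" by (simp add: char_graph_def)
 show "G <= ?G"
 proof
  fix g assume "g : G"
  moreover have "g = g + zmul 0 (y, c)" by simp
  ultimately show "g : ?G" by blast
 qed
 have "(y, c) = 0 + zmul 1 (y, c)" by simp
 then show "(y, c) : ?G" using sG subgrp_0 by blast
qed

text \<open>The multiples of \<open>y\<close> in the domain of \<open>G\<close> are those of a least
  positive one \<open>n\<close>, if there is any, and \<open>c\<close> is an \<open>n\<close>-th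
  part of the value there. The flag \<open>nz\<close> asks for \<open>c ~= 0\<close>; then
  \<open>G\<close> takes only the value zero and \<open>y\<close> lies outside its domain, so
  \<open>n > 1\<close> and torsion of the circle gives \<open>c\<close>.\<close>

lemma char_graph_value:
 assumes G: "char_graph G" and D: "!!x z. (x, z) : G ==> z = 0 \<or> \<not> nz" and y: "nz ==> (y, 0) \<notin> G"
 shows "EX c. (nz --> c ~= 0) & (ALL k z. (zmul k y, z) : G --> z = zmul k c)"
proof (cases "EX k>0. EX z. (zmul k y, z) : G")
 case False
 have sG: "subgrp G" using G by (simp add: char_graph_def)
 have k0: "k = 0" if "(zmul k y, z) : G" for k z
 proof (rule ccontr)
  assume "k ~= 0"
  moreover have "(zmul (- k) y, - z) : G" using subgrp_uminus[OF sG that] by (simp add: zmul_minus)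
  ultimately show False using False that by (metis neg_0_less_iff_less linorder_neqE_linordered_idom)
 qed
 obtain c :: circle where "c ~= 0" using circle_torsion[of 2] by auto
 moreover have "z = zmul k c" if "(zmul k y, z) : G" for k z using k0[OF that] that G by (auto simp: char_graph_def)
 ultimately show ?thesis by blast
next
 case True
 have sG: "subgrp G" using G by (simp add: char_graph_def)
 define P where "P n <-> n > 0 & (EX z. (zmul (int n) y, z) : G)" for n
 have "EX n. P n"
 proof -
  from True obtain k z where "k > 0" "(zmul k y, z) : G" by blast
  then have "P (nat k)" by (auto simp: P_def)
  then show ?thesis by blast
 qed
 then obtain n where Pn: "P n" and least: "!!m. P m ==> n <= m" by (metis LeastI_ex Least_le)
 from Pn obtain z0 where z0: "(zmul (int n) y, z0) : G" and n: "n > 0" by (auto simp: P_def)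
 have "EX c. (nz --> c ~= 0) & zmul (int n) c = z0"
 proof (cases nz)
  case True
  then have "z0 = 0" using D[OF z0] by blast
  moreover have "n ~= 1" using True y z0 \<open>z0 = 0\<close> by auto
  ultimately show ?thesis using circle_torsion[of "int n"] n by auto
 next
  case False then show ?thesis using circle_divisible[of "int n"] n by auto
 qed
 then obtain c where c: "nz --> c ~= 0" "zmul (int n) c = z0" by blast
 have "z = zmul k c" if kz: "(zmul k y, z) : G" for k z
 proof -
  define q r where "q = k div int n" and "r = k mod int n"
  have k: "k = q * int n + r" by (simp add: q_def r_def)
  have qz: "(zmul (q * int n) y, zmul q z0) : G" using zmul_in[OF sG z0, of q] by (simp add: zmul_mult prod_eq_iff)
    (metis fst_conv fst_zmul prod.collapse snd_conv snd_zmul)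
  have "(zmul r y, z - zmul q z0) : G" using subgrp_diff[OF sG kz qz] by (simp add: k zmul_add)
  moreover have "0 <= r" "r < int n" using n by (simp_all add: r_def)
  ultimately have "r = 0" using least[of "nat r"] n by (cases "r = 0") (auto simp: P_def nat_le_iff le_nat_iff)
  then have "z = zmul q z0" using qz kz k char_graph_unique[OF G] by auto
  then show ?thesis using c(2) k \<open>r = 0\<close> by (simp add: zmul_mult)
 qed
 then show ?thesis using c(1) by blast
qed

text \<open>Start from the zero character on \<open>D\<close>, give \<open>x\<close> a non-zero
  value and extend by Zorn's lemma; a maximal graph has full domain since one more element could
  always be added.\<close>

lemma character_exists:
 fixes D :: "'a::ab_group_add set"
 assumes D: "subgrp D" and x: "x \<notin> D"
 shows "EX \<chi>::'a => circle. additive_on UNIV \<chi> & (ALL d:D. \<chi> d = 0) & \<chi> x ~= 0"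
proof -
 let ?G0 = "D \<times> {0::circle}"
 have G0: "char_graph ?G0" using D by (auto simp: char_graph_def subgrp_Times)
 obtain c where c: "c ~= 0" "!!k z. (zmul k x, z) : ?G0 ==> z = zmul k c" using char_graph_value[OF G0, of True x] x by auto
 obtain G1 where G1: "char_graph G1" "?G0 <= G1" "(x, c) : G1" using char_graph_extend[OF G0 c(2)] by blast
 let ?\<A> = "{G. char_graph G & G1 <= G}"
 have "EX G:?\<A>. ALL H:?\<A>. G <= H --> H = G"
 proof (rule subset_Zorn_nonempty)
  show "?\<A> ~= {}" using G1 by blast
  fix \<C> assume \<C>: "\<C> ~= {}" "subset.chain ?\<A> \<C>"
  have sub: "subgrp H" "G1 <= H" "!!d. (0, d) : H ==> d = 0" if "H : \<C>" for H using that \<C>(2) by (auto simp: subset_chain_def char_graph_def)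
  have "subgrp (\<Union>\<C>)" unfolding subgrp_def
  proof (intro conjI ballI)
   show "0 : \<Union>\<C>" using \<C>(1) sub(1) subgrp_0 by blast
   fix u v assume "u : \<Union>\<C>" "v : \<Union>\<C>"
   then obtain H1 H2 where H: "H1 : \<C>" "H2 : \<C>" "u : H1" "v : H2" by blast
   then have "H1 <= H2 \<or> H2 <= H1" using \<C>(2) H(1,2) unfolding subset_chain_def by blast
   then show "u - v : \<Union>\<C>" using H subgrp_diff[OF sub(1)[OF H(1)], of u v] subgrp_diff[OF sub(1)[OF H(2)], of u v] by blast
  qed
  then show "\<Union>\<C> : ?\<A>" using \<C>(1) sub by (fastforce simp: char_graph_def)
 qed
 then obtain G where "G : ?\<A>" and G_max: "ALL H:?\<A>. G <= H --> H = G" by (rule bexE)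
 then have G: "char_graph G" "G1 <= G" by simp_all
 have max: "H = G" if "char_graph H" "G <= H" for H using G_max that G(2) by simp
 have dom: "EX c. (y, c) : G" for y
 proof -
  obtain c where "!!k z. (zmul k y, z) : G ==> z = zmul k c" using char_graph_value[OF G(1), of False y] by auto
  then obtain G' where "char_graph G'" "G <= G'" "(y, c) : G'" using char_graph_extend[OF G(1)] by blast
  then show ?thesis using max by blast
 qed
 define \<chi> where "\<chi> y = (SOME c. (y, c) : G)" for y
 have \<chi>: "(y, \<chi> y) : G" for y unfolding \<chi>_def by (rule someI_ex) (rule dom)
 have \<chi>_eq: "\<chi> y = c" if "(y, c) : G" for y c using char_graph_unique[OF G(1) \<chi> that] .
 have "additive_on UNIV \<chi>" using subgrp_add[of G] G(1) \<chi> by (fastforce simp: additive_on_def char_graph_def intro!: \<chi>_eq)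
 moreover have "\<chi> d = 0" if "d : D" for d using that G G1 by (auto intro!: \<chi>_eq)
 moreover have "\<chi> x ~= 0" using \<chi>_eq[of x c] G(2) G1(3) c(1) by auto
 ultimately show ?thesis by blast
qed

text \<open>Evaluation at all characters that vanish on \<open>D\<close>; they separate the points
  outside \<open>D\<close> from 0. Functions that are no such characters get the dummy value 0,
  which keeps \<open>q\<close> additive. The image is a copy of the quotient by \<open>D\<close> in
  a type of class \<open>ab_group_add\<close>.\<close>

lemma quotient_embedding:
 fixes D :: "'a::ab_group_add set"
 assumes "subgrp D"
 shows "EX q::'a => ('a => circle) => circle. additive_on UNIV q & (ALL x. q x = 0 <-> x : D)"
proof (intro exI conjI allI)
 define q where "q x \<chi> = (if additive_on UNIV \<chi> & (ALL d:D. \<chi> d = 0) then \<chi> x else 0)" for x :: 'a and \<chi> :: "'a => circle"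
 show "additive_on UNIV q" by (auto simp: additive_on_def q_def fun_eq_iff)
 show "q x = 0 <-> x : D" for x using character_exists[OF assms, of x] by (auto simp: q_def fun_eq_iff)
qed

subsection \<open>Embedding an abstract abelian group into a type\<close>

type_synonym 'a bidual = "(('a \<Rightarrow>\<^sub>0 int) => circle) => circle"

definition add_embedding :: "('x, 's) ring_scheme => ('x => 'a::ab_group_add) => bool" where
 "add_embedding G j <-> inj_on j (carrier G) &
  (ALL x:carrier G. ALL y:carrier G. j (x \<oplus>\<^bsub>G\<^esub> y) = j x + j y)"

text \<open>A group is the quotient of the free abelian group on its carrier by the formal sums
  \<open>D\<close> of value zero; \<open>j\<close> sends an element to the image of its generator
  under the embedding of that quotient.\<close>

lemma add_embedding_exists:
 fixes G :: "('x, 's) ring_scheme"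
 assumes "abelian_group G"
 shows "EX j::'x => 'x bidual. add_embedding G j"
proof -
 interpret G: abelian_group G by fact
 let ?F = "free_Abelian_group (carrier G)"
 obtain h where h: "h : hom ?F (add_monoid G)" "!!x. x : carrier G ==> h (frag_of x) = x" using comm_group.free_Abelian_group_universal[OF G.a_comm_group, of "%x. x" "carrier G"] by auto
 interpret h: group_hom ?F "add_monoid G" h by (simp add: group_hom_def group_hom_axioms_def h(1) G.a_group)
 define D where "D = {c. fkeys c <= carrier G & h c = \<zero>\<^bsub>G\<^esub>}"
 have D_kernel: "D = kernel ?F (add_monoid G) h" by (auto simp: D_def kernel_def)
 have sub: "subgroup D ?F" unfolding D_kernel by (rule h.subgroup_kernel)
 have "subgrp D"
 proof (rule subgrpI)
  show "0 : D" using subgroup.one_closed[OF sub] by simp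
  show "x + y : D" if "x : D" "y : D" for x y using subgroup.m_closed[OF sub that] by simp
  show "- x : D" if "x : D" for x using subgroup.m_inv_closed[OF sub that] that by (simp add: D_def)
 qed
 from quotient_embedding[OF this] obtain q :: "('x \<Rightarrow>\<^sub>0 int) => (('x \<Rightarrow>\<^sub>0 int) => circle) => circle" where q: "additive_on UNIV q" "!!c. q c = 0 <-> c : D" by blast
 have q_diff: "q (a - b) = q a - q b" for a b using additive_on_diff[OF q(1)] by simp
 have q_eq: "q a = q b <-> a - b : D" for a b by (metis q(2) q_diff eq_iff_diff_eq_0)
 have h_add: "h (a + b) = h a \<oplus>\<^bsub>G\<^esub> h b" if "fkeys a <= carrier G" "fkeys b <= carrier G" for a b using h.hom_mult[of a b] that by simp
 have h_minus: "h (- a) = \<ominus>\<^bsub>G\<^esub> h a" if "fkeys a <= carrier G" for a using h.hom_inv[of a] that by (simp add: a_inv_def)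
 have h_diff: "h (frag_of x - frag_of y) = x \<ominus>\<^bsub>G\<^esub> y" if "x : carrier G" "y : carrier G" for x y using h_add[of "frag_of x" "- frag_of y"] h_minus[of "frag_of y"] that h(2) by (simp add: a_minus_def)
 have key_diff: "fkeys (a - b) <= carrier G" if "fkeys a <= carrier G" "fkeys b <= carrier G" for a b :: "'x \<Rightarrow>\<^sub>0 int" using that keys_diff[of a b] by blast
 define j where "j x = q (frag_of x)" for x
 have "inj_on j (carrier G)"
 proof (rule inj_onI)
  fix x y assume "x : carrier G" "y : carrier G" "j x = j y"
  then have "h (frag_of x - frag_of y) = \<zero>\<^bsub>G\<^esub>" by (simp add: j_def q_eq D_def)
  moreover have "x = (x \<ominus>\<^bsub>G\<^esub> y) \<oplus>\<^bsub>G\<^esub> y" using \<open>x : carrier G\<close> \<open>y : carrier G\<close> by (simp add: G.minus_eq G.a_assoc G.l_neg)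
  ultimately show "x = y" using h_diff \<open>x : carrier G\<close> \<open>y : carrier G\<close> by simp
 qed
 moreover have "j (x \<oplus>\<^bsub>G\<^esub> y) = j x + j y" if "x : carrier G" "y : carrier G" for x y
 proof -
  have k: "fkeys (frag_of x + frag_of y) <= carrier G" using that keys_add[of "frag_of x" "frag_of y"] by auto
  have "h (frag_of (x \<oplus>\<^bsub>G\<^esub> y) - (frag_of x + frag_of y)) = (x \<oplus>\<^bsub>G\<^esub> y) \<oplus>\<^bsub>G\<^esub> \<ominus>\<^bsub>G\<^esub> (x \<oplus>\<^bsub>G\<^esub> y)" unfolding diff_conv_add_uminus using h_add[of "frag_of (x \<oplus>\<^bsub>G\<^esub> y)" "- (frag_of x + frag_of y)", unfolded keys_minus] h_minus[OF k]
    h_add[of "frag_of x" "frag_of y"] that h(2) k by (simp del: minus_add_distrib)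
  then have "frag_of (x \<oplus>\<^bsub>G\<^esub> y) - (frag_of x + frag_of y) : D" using key_diff[OF _ k, of "frag_of (x \<oplus>\<^bsub>G\<^esub> y)"] that by (simp add: D_def G.r_neg)
  then have "q (frag_of (x \<oplus>\<^bsub>G\<^esub> y)) = q (frag_of x + frag_of y)" by (simp add: q_eq)
  then show ?thesis using q(1) by (simp add: j_def additive_on_def)
 qed
 ultimately show ?thesis by (auto simp: add_embedding_def)
qed

section \<open>Rings and modules on subgroups\<close>

text \<open>Only the carrier, the unit and the product come from the record; zero and addition are
  those of the type, so that finite sums are plain \<open>sum\<close>.\<close>

definition ring_on :: "('a::ab_group_add, 's) ring_scheme => bool" where
 "ring_on A <-> subgrp (carrier A) & (one A) : carrier A & biadd (carrier A) (carrier A) (mult A) &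
  (ALL x:carrier A. ALL y:carrier A. x \<otimes>\<^bsub>A\<^esub> y : carrier A) &
  (ALL x:carrier A. ALL y:carrier A. ALL z:carrier A. x \<otimes>\<^bsub>A\<^esub> y \<otimes>\<^bsub>A\<^esub> z = x \<otimes>\<^bsub>A\<^esub> (y \<otimes>\<^bsub>A\<^esub> z)) &
  (ALL x:carrier A. (one A) \<otimes>\<^bsub>A\<^esub> x = x & x \<otimes>\<^bsub>A\<^esub> (one A) = x)"

lemma opp_simps [simp]:
 "carrier (opp A) = carrier A" "\<one>\<^bsub>opp A\<^esub> = (one A)" "x \<otimes>\<^bsub>opp A\<^esub> y = y \<otimes>\<^bsub>A\<^esub> x"
 "zero (opp A) = zero A" "add (opp A) = add A" "opp (opp A) = A" by (simp_all add: opp_def)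

lemma ring_onD:
 assumes "ring_on A"
 shows "subgrp (carrier A)" "(one A) : carrier A" "biadd (carrier A) (carrier A) (mult A)"
  "x : carrier A ==> y : carrier A ==> x \<otimes>\<^bsub>A\<^esub> y : carrier A"
  "x : carrier A ==> y : carrier A ==> z : carrier A ==> x \<otimes>\<^bsub>A\<^esub> y \<otimes>\<^bsub>A\<^esub> z = x \<otimes>\<^bsub>A\<^esub> (y \<otimes>\<^bsub>A\<^esub> z)"
  "x : carrier A ==> (one A) \<otimes>\<^bsub>A\<^esub> x = x" "x : carrier A ==> x \<otimes>\<^bsub>A\<^esub> (one A) = x" using assms by (auto simp: ring_on_def)

lemma ring_on_opp [simp]: "ring_on (opp A) = ring_on A"
proof -
 have "ring_on (opp B)" if "ring_on B" for B :: "('a, 's) ring_scheme" using that biadd_flip[of "carrier B" "carrier B" "mult B"] by (auto simp: ring_on_def biadd_def additive_on_def)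
 from this[of A] this[of "opp A"] show ?thesis by auto
qed

definition mod_on :: "('a::ab_group_add, 's) ring_scheme => 'x::ab_group_add set => ('a => 'x => 'x) => bool" where
 "mod_on A X s <-> ring_on A & subgrp X & biadd (carrier A) X s &
  (ALL a:carrier A. ALL x:X. s a x : X) &
  (ALL a:carrier A. ALL b:carrier A. ALL x:X. s (a \<otimes>\<^bsub>A\<^esub> b) x = s a (s b x)) &
  (ALL x:X. s (one A) x = x)"

lemma mod_onD:
 assumes "mod_on A X s"
 shows "ring_on A" "subgrp X" "biadd (carrier A) X s"
  "a : carrier A ==> x : X ==> s a x : X"
  "a : carrier A ==> b : carrier A ==> x : X ==> s (a \<otimes>\<^bsub>A\<^esub> b) x = s a (s b x)"
  "x : X ==> s (one A) x = x" using assms by (auto simp: mod_on_def)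

lemma mod_on_ring: "mod_on A X s ==> subgrp (carrier A)" using mod_onD(1) ring_onD(1) by blast

lemma mod_on_self: "ring_on A ==> mod_on A (carrier A) (mult A)" by (auto simp: mod_on_def ring_on_def)

lemma mod_on_self_opp: "ring_on A ==> mod_on (opp A) (carrier A) (mult (opp A))" using mod_on_self[of "opp A"] by simp

definition submod :: "('a::ab_group_add, 's) ring_scheme => 'x::ab_group_add set => ('a => 'x => 'x) => 'x set => bool" where
 "submod A X s D <-> subgrp D & D <= X & (ALL a:carrier A. ALL x:D. s a x : D)"

lemma submodD:
 assumes "submod A X s D"
 shows "subgrp D" "x : D ==> x : X" "a : carrier A ==> x : D ==> s a x : D" using assms by (auto simp: submod_def)

lemma submod_self: "mod_on A X s ==> submod A X s X" by (auto simp: submod_def mod_on_def)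

lemma biadd_0:
 "biadd A B f ==> subgrp A ==> b : B ==> f 0 b = 0"
 "biadd A B f ==> subgrp B ==> a : A ==> f a 0 = 0" using additive_on_0[OF biadd_left[of A B f b]] additive_on_0[OF biadd_right[of A B f a]] by auto

lemma biadd_subset: "biadd A B f ==> A' <= A ==> B' <= B ==> biadd A' B' f" unfolding biadd_def additive_on_def by blast

lemma mod_on_0:
 assumes "mod_on A X s"
 shows "x : X ==> s 0 x = 0" "a : carrier A ==> s a 0 = 0" using biadd_0[OF mod_onD(3)[OF assms]] mod_onD(2)[OF assms] mod_on_ring[OF assms] by auto

lemma mod_on_distrib:
 assumes "mod_on A X s"
 shows "a : carrier A ==> x : X ==> y : X ==> s a (x + y) = s a x + s a y"
  "a : carrier A ==> x : X ==> y : X ==> s a (x - y) = s a x - s a y"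
  "a : carrier A ==> x : X ==> s a (- x) = - s a x"
  "a : carrier A ==> b : carrier A ==> x : X ==> s (a + b) x = s a x + s b x" using biadd_add[OF mod_onD(3)[OF assms]] additive_on_diff[OF biadd_right[OF mod_onD(3)[OF assms]]]
  additive_on_uminus[OF biadd_right[OF mod_onD(3)[OF assms]]] mod_onD(2)[OF assms] by auto

lemma submod_0: "mod_on A X s ==> submod A X s {0}" by (auto simp: submod_def mod_on_0 intro: subgrp_0 mod_onD)

lemma submod_mod_on:
 assumes "mod_on A X s" "submod A X s D" shows "mod_on A D s"
proof -
 have "D <= X" using assms(2) by (simp add: submod_def)
 then have "biadd (carrier A) D s" using mod_onD(3)[OF assms(1)] biadd_subset by blast
 then show ?thesis unfolding mod_on_def using mod_onD[OF assms(1)] submodD[OF assms(2)] by auto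
qed

definition lin_map :: "('a::ab_group_add, 's) ring_scheme => 'x::ab_group_add set => ('a => 'x => 'x) =>
  'y::ab_group_add set => ('a => 'y => 'y) => ('x => 'y) => bool" where
 "lin_map A X s Y t f <-> additive_on X f & (ALL x:X. f x : Y) & (ALL a:carrier A. ALL x:X. f (s a x) = t a (f x))"

lemma lin_mapD:
 assumes "lin_map A X s Y t f"
 shows "additive_on X f" "x : X ==> f x : Y" "a : carrier A ==> x : X ==> f (s a x) = t a (f x)"
  "x : X ==> y : X ==> f (x + y) = f x + f y" using assms by (auto simp: lin_map_def additive_on_def)

lemma lin_map_diff: "lin_map A X s Y t f ==> subgrp X ==> x : X ==> y : X ==> f (x - y) = f x - f y" using additive_on_diff lin_mapD(1) by blast

lemma lin_map_0: "lin_map A X s Y t f ==> subgrp X ==> f 0 = 0" using additive_on_0 lin_mapD(1) by blast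

lemma lin_map_uminus: "lin_map A X s Y t f ==> subgrp X ==> x : X ==> f (- x) = - f x" using additive_on_uminus lin_mapD(1) by blast

lemma lin_map_id: "lin_map A X s X s (%x. x)" by (auto simp: lin_map_def additive_on_def)

lemma lin_map_incl: "X <= Y ==> lin_map A X s Y s (%x. x)" by (auto simp: lin_map_def additive_on_def)

lemma lin_map_zero: "mod_on A Y t ==> lin_map A X s Y t (%x. 0)" by (auto simp: lin_map_def additive_on_def mod_on_0 mod_onD subgrp_0)

lemma lin_map_comp:
 "lin_map A X s Y t f ==> lin_map A Y t Z u g ==> lin_map A X s Z u (%x. g (f x))" by (auto simp: lin_map_def additive_on_def)

lemma lin_map_subset: "lin_map A X s Y t f ==> X' <= X ==> (!!x. x : X' ==> f x : Y') ==> lin_map A X' s Y' t f" unfolding lin_map_def additive_on_def by blast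

lemma lin_map_add_fun:
 assumes Y: "mod_on A Y t" and f: "lin_map A X s Y t f" and g: "lin_map A X s Y t g"
 shows "lin_map A X s Y t (%x. f x + g x)" using lin_mapD[OF f] lin_mapD[OF g] mod_on_distrib(1)[OF Y] mod_onD(2)[OF Y] by (auto simp: lin_map_def additive_on_def algebra_simps subgrp_add)

lemma lin_map_diff_fun:
 assumes Y: "mod_on A Y t" and f: "lin_map A X s Y t f" and g: "lin_map A X s Y t g"
 shows "lin_map A X s Y t (%x. f x - g x)" using lin_mapD[OF f] lin_mapD[OF g] mod_on_distrib(2)[OF Y] mod_onD(2)[OF Y] by (auto simp: lin_map_def additive_on_def algebra_simps subgrp_diff)

lemma submod_image:
 assumes X: "mod_on A X s" and f: "lin_map A X s Y t f" shows "submod A Y t (f ` X)"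
proof -
 have "t a y : f ` X" if a: "a : carrier A" and y: "y : f ` X" for a y
 proof -
  obtain x where x: "x : X" "y = f x" using y by blast
  have "t a y = f (s a x)" using lin_mapD(3)[OF f a x(1)] x by simp
  then show ?thesis using mod_onD(4)[OF X a x(1)] by blast
 qed
 then show ?thesis using subgrp_image[OF mod_onD(2)[OF X] lin_mapD(1)[OF f]] lin_mapD(2)[OF f] by (auto simp: submod_def)
qed

lemma submod_preimage:
 assumes X: "mod_on A X s" and f: "lin_map A X s Y t f" and D: "submod A Y t D"
 shows "submod A X s {x\<in>X. f x : D}" using subgrp_preimage[OF mod_onD(2)[OF X] lin_mapD(1)[OF f] submodD(1)[OF D]]
  mod_onD(4)[OF X] lin_mapD(3)[OF f] submodD(3)[OF D] by (auto simp: submod_def)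

subsection \<open>Finitely supported functions\<close>

definition fs :: "'n::zero set => 'b set => ('b => 'n) set" where
 "fs N B = {v. finite {b. v b ~= 0} & (ALL b. v b : N) & (ALL b. b \<notin> B --> v b = 0)}"

definition single :: "'b => 'n::zero => 'b => 'n" where
 "single b x = (%j. if j = b then x else 0)"

text \<open>The product \<open>f\<close> may be any pairing, a scalar action, a ring multiplication
  or a tensor product, so that one set of lemmas serves all of them.\<close>

definition lincomb :: "('n::zero => 'x => 'y::ab_group_add) => ('b => 'n) => ('b => 'x) => 'y" where
 "lincomb f v e = (\<Sum>b | v b ~= 0. f (v b) (e b))"

text \<open>The product of a row vector \<open>v\<close> with entries in a right module and a matrix \<open>d\<close> over the ring;
 right modules are modules over the opposite ring.\<close>

definition ap :: "('a => 'n::ab_group_add => 'n) => ('b => 'n) => ('b => 'j => 'a) => 'j => 'n" where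
 "ap s v d = (%j. lincomb (%x r. s r x) v (%b. d b j))"

definition pws :: "('a => 'n => 'n) => 'a => ('b => 'n) => 'b => 'n" where
 "pws s a v = (%b. s a (v b))"

lemma fsD:
 assumes "v : fs N B"
 shows "finite {b. v b ~= 0}" "v b : N" "b \<notin> B ==> v b = 0" using assms by (auto simp: fs_def)

lemma fs_supp: "v : fs N B ==> v b ~= 0 ==> b : B" by (auto simp: fs_def)

lemma fs_mono: "B <= B' ==> N <= N' ==> fs N B <= fs N' B'" by (auto simp: fs_def)

lemma subgrp_fs: assumes "subgrp N" shows "subgrp (fs N B)" unfolding subgrp_def
proof (intro conjI ballI)
 show "0 : fs N B" using assms by (simp add: fs_def subgrp_0)
 fix v w assume v: "v : fs N B" and w: "w : fs N B"
 have "{b. (v - w) b ~= 0} <= {b. v b ~= 0} \<union> {b. w b ~= 0}" by auto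
 then have "finite {b. (v - w) b ~= 0}" using fsD(1)[OF v] fsD(1)[OF w] by (meson finite_UnI finite_subset)
 then show "v - w : fs N B" using v w assms by (auto simp: fs_def subgrp_diff)
qed

lemma fs_single: "b : B ==> x : N ==> 0 : N ==> single b x : fs N B" by (auto simp: fs_def single_def)

lemma fs_empty: "subgrp N ==> fs N {} = {0}" by (auto simp: fs_def subgrp_0 fun_eq_iff)

lemma sum_fun_apply: "(\<Sum>i\<in>I. f i) b = (\<Sum>i\<in>I. f i b)" for f :: "'i => 'b => 'n::comm_monoid_add" by (induction I rule: infinite_finite_induct) auto

lemma fs_expand: assumes "v : fs N B" shows "v = (\<Sum>b | v b ~= 0. single b (v b))"
proof
 fix j
 have "(\<Sum>b | v b ~= 0. single b (v b) j) = (\<Sum>b | v b ~= 0. if b = j then v b else 0)" by (intro sum.cong) (auto simp: single_def)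
 then show "v j = (\<Sum>b | v b ~= 0. single b (v b)) j" using fsD(1)[OF assms] by (simp add: sum_fun_apply)
qed

lemma fs_mod:
 assumes X: "mod_on A X s" shows "mod_on A (fs X B) (pws s)"
proof -
 have sub: "subgrp (fs X B)" using X by (intro subgrp_fs mod_onD)
 have cl: "pws s a v : fs X B" if a: "a : carrier A" and v: "v : fs X B" for a v
 proof -
  have "{b. pws s a v b ~= 0} <= {b. v b ~= 0}" using mod_on_0(2)[OF X a] by (auto simp: pws_def)
  then have "finite {b. pws s a v b ~= 0}" using fsD(1)[OF v] finite_subset by blast
  then show ?thesis using fsD[OF v] a mod_on_0(2)[OF X a] mod_onD(4)[OF X a] by (auto simp: fs_def pws_def)
 qed
 have "biadd (carrier A) (fs X B) (pws s)" by (rule biaddI) (simp_all add: pws_def fun_eq_iff mod_on_distrib(1,4)[OF X] fsD(2)[of _ X B])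
 moreover have "pws s (a \<otimes>\<^bsub>A\<^esub> b) v = pws s a (pws s b v)" "pws s (one A) v = v" if "a : carrier A" "b : carrier A" "v : fs X B" for a b v using mod_onD(5,6)[OF X] fsD(2)[OF that(3)] that(1,2) by (simp_all add: pws_def)
 ultimately show ?thesis using sub cl mod_onD(1)[OF X] ring_onD(2)[OF mod_onD(1)[OF X]] by (auto simp: mod_on_def)
qed

lemma free_mod: "ring_on A ==> mod_on A (fs (carrier A) B) (pws (mult A))" by (intro fs_mod mod_on_self)

lemma lincomb_superset:
 assumes "finite S" "{b. v b ~= 0} <= S" "!!b. b : S ==> f 0 (e b) = 0"
 shows "lincomb f v e = (\<Sum>b\<in>S. f (v b) (e b))" unfolding lincomb_def by (rule sum.mono_neutral_left) (use assms in auto)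

lemma lincomb_cong:
 "v : fs N B ==> (!!b. b : B ==> f (v b) (e b) = g (v b) (e' b)) ==> lincomb f v e = lincomb g v e'" unfolding lincomb_def by (rule sum.cong) (auto dest: fsD)

lemma lincomb_0 [simp]: "lincomb f 0 e = 0" "lincomb f (%b. 0) e = 0" by (simp_all add: lincomb_def)

lemma lincomb_single: "f 0 (e b) = 0 ==> lincomb f (single b x) e = f x (e b)" by (subst lincomb_superset[of "{b}"]) (auto simp: single_def)

lemma lincomb_in:
 assumes "subgrp Y" "v : fs N B" "!!b. b : B ==> f (v b) (e b) : Y" shows "lincomb f v e : Y" unfolding lincomb_def using assms(1) by (rule subgrp_sum) (use assms fs_supp[OF assms(2)] in auto)

lemma lincomb_additive:
 assumes f: "biadd N X f" "subgrp N" and e: "!!b. b : B ==> e b : X"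
 shows "additive_on (fs N B) (%v. lincomb f v e)" unfolding additive_on_def
proof (intro ballI)
 fix v w assume v: "v : fs N B" and w: "w : fs N B"
 let ?S = "{b. v b ~= 0} \<union> {b. w b ~= 0}"
 have S: "finite ?S" "?S <= B" using fsD(1)[OF v] fsD(1)[OF w] fs_supp[OF v] fs_supp[OF w] by auto
 have z: "f 0 (e b) = 0" if "b : ?S" for b using biadd_0(1)[OF f] e that S(2) by blast
 have "lincomb f (v + w) e = (\<Sum>b\<in>?S. f ((v + w) b) (e b))" using S z by (intro lincomb_superset) auto
 also have "... = (\<Sum>b\<in>?S. f (v b) (e b) + f (w b) (e b))" using S(2) e fsD(2)[OF v] fsD(2)[OF w] biadd_add(1)[OF f(1)] by (intro sum.cong) auto
 also have "... = lincomb f v e + lincomb f w e" using S z by (subst (1 2) lincomb_superset[of ?S]) (auto simp: sum.distrib)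
 finally show "lincomb f (v + w) e = lincomb f v e + lincomb f w e" .
qed

lemma lincomb_map:
 assumes "additive_on Y g" "subgrp Y" "v : fs N B" "!!b. b : B ==> f (v b) (e b) : Y"
 shows "g (lincomb f v e) = lincomb (%n x. g (f n x)) v e" unfolding lincomb_def using additive_on_sum[OF assms(1,2), of "{b. v b ~= 0}" "%b. f (v b) (e b)"]
  assms(4) fs_supp[OF assms(3)] by auto

lemma lincomb_diff_right:
 assumes "biadd N X f" "subgrp X" "v : fs N B" "!!b. b : B ==> e b : X" "!!b. b : B ==> e' b : X"
 shows "lincomb f v (%b. e b - e' b) = lincomb f v e - lincomb f v e'"
proof -
 have "f (v b) (e b - e' b) = f (v b) (e b) - f (v b) (e' b)" if "v b ~= 0" for b using additive_on_diff[OF biadd_right[OF assms(1)] assms(2)] fsD[OF assms(3)] assms(4,5) that by blast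
 then show ?thesis unfolding lincomb_def by (simp add: sum_subtractf)
qed

text \<open>Both sides are the same double sum over the support of \<open>v\<close> and the union of
  the supports of the rows \<open>d i\<close>. The four products are independent of each other, so
  composition of matrices, evaluation of vectors and balanced pairings are all instances.\<close>

lemma lincomb_assoc:
 assumes v: "v : fs N I" and d: "!!i. i : I ==> d i : fs R J" and e: "!!j. j : J ==> e j : X"
  and g: "!!n r. n : N ==> r : R ==> g n r : L" "!!n. n : N ==> g n 0 = 0"
  and f1: "biadd L X f1" "subgrp L" and f2: "biadd N Y f2" "subgrp Y"
  and f3: "!!r x. r : R ==> x : X ==> f3 r x : Y" "!!x. x : X ==> f3 0 x = 0"
  and assoc: "!!n r x. n : N ==> r : R ==> x : X ==> f1 (g n r) x = f2 n (f3 r x)"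
 shows "lincomb f1 (%j. lincomb g v (%i. d i j)) e = lincomb f2 v (%i. lincomb f3 (d i) e)"
proof -
 let ?S = "{i. v i ~= 0}" and ?T = "\<Union>i\<in>{i. v i ~= 0}. {j. d i j ~= 0}"
 have S: "finite ?S" "?S <= I" using fsD(1)[OF v] fs_supp[OF v] by auto
 have SI: "i : I" if "i : ?S" for i using S(2) that by blast
 have fin: "finite {j. d i j ~= 0}" if "i : ?S" for i using fsD(1)[OF d[OF SI[OF that]]] .
 have sub: "{j. d i j ~= 0} <= J" if "i : ?S" for i using fs_supp[OF d[OF SI[OF that]]] by blast
 have T: "finite ?T" "?T <= J" by (rule finite_UN_I[OF S(1) fin], assumption, rule UN_least[OF sub])
 have dR: "d i j : R" if "i : ?S" for i j using fsD(2)[OF d[OF SI[OF that]]] .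
 have gs: "lincomb g v (%i. d i j) = (\<Sum>i\<in>?S. g (v i) (d i j))" for j by (simp add: lincomb_def)
 have supp: "{j. lincomb g v (%i. d i j) ~= 0} <= ?T"
 proof
  fix j assume "j : {j. lincomb g v (%i. d i j) ~= 0}"
  then have "(\<Sum>i\<in>?S. g (v i) (d i j)) ~= 0" by (simp add: gs)
  then obtain i where i: "i : ?S" "g (v i) (d i j) ~= 0" using sum.not_neutral_contains_not_neutral by blast
  then have "d i j ~= 0" using g(2)[OF fsD(2)[OF v]] by auto
  then show "j : ?T" using i(1) by blast
 qed
 have "lincomb f1 (%j. lincomb g v (%i. d i j)) e = (\<Sum>j\<in>?T. f1 (lincomb g v (%i. d i j)) (e j))"
 proof (rule lincomb_superset[OF T(1) supp])
  fix j assume "j : ?T"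
  then have "e j : X" using T(2) e by blast
  then show "f1 0 (e j) = 0" using biadd_0(1)[OF f1] by blast
 qed
 also have "... = (\<Sum>j\<in>?T. \<Sum>i\<in>?S. f1 (g (v i) (d i j)) (e j))"
 proof (rule sum.cong[OF refl])
  fix j assume "j : ?T"
  then have "e j : X" using T(2) e by blast
  then show "f1 (lincomb g v (%i. d i j)) (e j) = (\<Sum>i\<in>?S. f1 (g (v i) (d i j)) (e j))" unfolding gs using g(1) fsD(2)[OF v] dR by (intro additive_on_sum[OF biadd_left[OF f1(1)] f1(2)]) auto
 qed
 also have "... = (\<Sum>i\<in>?S. \<Sum>j\<in>?T. f1 (g (v i) (d i j)) (e j))" by (rule sum.swap)
 also have "... = (\<Sum>i\<in>?S. f2 (v i) (\<Sum>j\<in>?T. f3 (d i j) (e j)))"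
 proof (rule sum.cong[OF refl])
  fix i assume i: "i : ?S"
  have "(\<Sum>j\<in>?T. f1 (g (v i) (d i j)) (e j)) = (\<Sum>j\<in>?T. f2 (v i) (f3 (d i j) (e j)))" by (intro sum.cong refl assoc fsD(2)[OF v] dR[OF i] e) (use T(2) in blast)
  also have "... = f2 (v i) (\<Sum>j\<in>?T. f3 (d i j) (e j))" by (intro additive_on_sum[OF biadd_right[OF f2(1)] f2(2), symmetric] fsD(2)[OF v] f3(1) dR[OF i] e)
    (use T(2) in blast)
  finally show "(\<Sum>j\<in>?T. f1 (g (v i) (d i j)) (e j)) = f2 (v i) (\<Sum>j\<in>?T. f3 (d i j) (e j))" .
 qed
 also have "... = lincomb f2 v (%i. lincomb f3 (d i) e)" unfolding lincomb_def[of f2]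
 proof (rule sum.cong[OF refl])
  fix i assume i: "i : ?S"
  have "lincomb f3 (d i) e = (\<Sum>j\<in>?T. f3 (d i j) (e j))" by (intro lincomb_superset T(1) f3(2) e) (use i T(2) in blast)+
  then show "f2 (v i) (\<Sum>j\<in>?T. f3 (d i j) (e j)) = f2 (v i) (lincomb f3 (d i) e)" by simp
 qed
 finally show ?thesis .
qed

subsection \<open>Linear combinations in modules\<close>

lemma mod_lincomb_in:
 assumes "mod_on A X s" "v : fs (carrier A) B" "!!b. b : B ==> e b : X"
 shows "lincomb s v e : X" by (rule lincomb_in[OF mod_onD(2)[OF assms(1)] assms(2)])
  (use mod_onD(4)[OF assms(1)] fsD(2)[OF assms(2)] assms(3) in blast)

lemma submod_lincomb_in:
 assumes "mod_on A X s" "submod A X s D" "v : fs (carrier A) B" "!!b. b : B ==> e b : D"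
 shows "lincomb s v e : D" by (rule mod_lincomb_in[OF submod_mod_on]) (use assms in auto)

lemma lincomb_lin_map:
 assumes X: "mod_on A X s" and e: "!!b. b : B ==> e b : X"
 shows "lin_map A (fs (carrier A) B) (pws (mult A)) X s (%v. lincomb s v e)" unfolding lin_map_def
proof (intro conjI ballI)
 show "additive_on (fs (carrier A) B) (%v. lincomb s v e)" by (rule lincomb_additive[OF mod_onD(3)[OF X] mod_on_ring[OF X] e])
 show "lincomb s v e : X" if "v : fs (carrier A) B" for v by (rule mod_lincomb_in[OF X that e])
 fix a v assume a: "a : carrier A" and v: "v : fs (carrier A) B"
 have A: "ring_on A" using X mod_onD(1) by blast
 have "lincomb s (pws (mult A) a v) e = (\<Sum>b | v b ~= 0. s (pws (mult A) a v b) (e b))" using fsD(1)[OF v] fs_supp[OF v] e mod_on_0(1)[OF X] mod_on_0(2)[OF mod_on_self[OF A] a] by (intro lincomb_superset) (auto simp: pws_def)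
 also have "... = (\<Sum>b | v b ~= 0. s a (s (v b) (e b)))" using fsD(2)[OF v] fs_supp[OF v] e a mod_onD(5)[OF X] by (intro sum.cong) (auto simp: pws_def)
 also have "... = s a (lincomb s v e)" unfolding lincomb_def using fsD(2)[OF v] fs_supp[OF v] e a mod_onD(4)[OF X] by (intro additive_on_sum[OF biadd_right[OF mod_onD(3)[OF X]] mod_onD(2)[OF X], symmetric]) auto
 finally show "lincomb s (pws (mult A) a v) e = s a (lincomb s v e)" .
qed

lemma lin_map_lincomb:
 assumes X: "mod_on A X s" and f: "lin_map A X s Y t f" and v: "v : fs (carrier A) B" and e: "!!b. b : B ==> e b : X"
 shows "f (lincomb s v e) = lincomb t v (%b. f (e b))"
proof -
 have "f (lincomb s v e) = lincomb (%n x. f (s n x)) v e" using mod_onD(4)[OF X] fsD(2)[OF v] e by (intro lincomb_map[OF lin_mapD(1)[OF f] mod_onD(2)[OF X] v]) auto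
 also have "... = lincomb t v (%b. f (e b))" using lin_mapD(3)[OF f] fsD(2)[OF v] e by (intro lincomb_cong[OF v]) auto
 finally show ?thesis .
qed

lemma fs_basis: "ring_on A ==> b : B ==> single b (one A) : fs (carrier A) B" by (simp add: fs_single ring_onD(2) subgrp_0[OF ring_onD(1)])

lemma lincomb_basis:
 fixes B :: "'b set"
 assumes A: "ring_on A" and v: "v : fs (carrier A) B"
 shows "lincomb (pws (mult A)) v (%b. single b (one A)) = v"
proof -
 have "pws (mult A) a (single b (one A)) = single b a" if "a : carrier A" for a and b :: 'b using that ring_onD[OF A] mod_on_0(2)[OF mod_on_self[OF A]] by (auto simp: pws_def single_def fun_eq_iff)
 then have "lincomb (pws (mult A)) v (%b. single b (one A)) = (\<Sum>b | v b ~= 0. single b (v b))" using fsD(2)[OF v] by (simp add: lincomb_def)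
 then show ?thesis using fs_expand[OF v] by simp
qed

lemma lin_map_free_eq:
 assumes A: "ring_on A" and f: "lin_map A (fs (carrier A) B) (pws (mult A)) Y t f" and v: "v : fs (carrier A) B"
 shows "f v = lincomb t v (%b. f (single b (one A)))" using lin_map_lincomb[OF free_mod[OF A] f v, of "%b. single b (one A)", OF fs_basis[OF A]]
  lincomb_basis[OF A v] by simp

lemma lincomb_one:
 assumes X: "mod_on A X s" and e: "e b : X" shows "lincomb s (single b (one A)) e = e b" using mod_on_0(1)[OF X e] mod_onD(6)[OF X e] by (simp add: lincomb_single)

lemma ap_in:
 assumes N: "mod_on (opp A) N s" and v: "v : fs N B" and d: "!!b. b : B ==> d b : fs (carrier A) J"
 shows "ap s v d : fs N J"
proof -
 let ?T = "\<Union>i\<in>{i. v i ~= 0}. {j. d i j ~= 0}"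
 have fin: "finite ?T" using fsD(1)[OF v] fsD(1)[OF d] fs_supp[OF v] by auto
 have in_N: "ap s v d j : N" for j unfolding ap_def using mod_onD(4)[OF N] fsD(2)[OF v] fsD(2)[OF d] by (intro lincomb_in[OF mod_onD(2)[OF N] v]) auto
 have z: "ap s v d j = 0" if "j \<notin> ?T" for j unfolding ap_def lincomb_def using that mod_on_0(1)[OF N] fsD(2)[OF v] by (intro sum.neutral) auto
 have "{j. ap s v d j ~= 0} <= ?T" using z by blast
 then have "finite {j. ap s v d j ~= 0}" using fin finite_subset by blast
 moreover have "ap s v d j = 0" if "j \<notin> J" for j using fsD(3)[OF d that] fs_supp[OF v] by (intro z) auto
 ultimately show ?thesis using in_N by (simp add: fs_def)
qed

lemma ap_additive:
 assumes N: "mod_on (opp A) N s" and d: "!!b. b : B ==> d b : fs (carrier A) J"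
 shows "additive_on (fs N B) (%v. ap s v d)"
proof -
 have "additive_on (fs N B) (%v. lincomb (%x r. s r x) v (%b. d b j))" for j using mod_onD(3)[OF N] fsD(2)[OF d] by (intro lincomb_additive[OF biadd_flip mod_onD(2)[OF N]]) auto
 then show ?thesis by (simp add: additive_on_def ap_def fun_eq_iff)
qed

lemma ap_ap:
 assumes N: "mod_on (opp A) N s" and v: "v : fs N I" and d: "!!i. i : I ==> d i : fs (carrier A) J"
  and d': "!!j. j : J ==> d' j : fs (carrier A) K"
 shows "ap s (ap s v d) d' = ap s v (%i. ap (mult (opp A)) (d i) d')"
proof
 fix k
 have A: "ring_on A" using mod_onD(1)[OF N] by simp
 have "lincomb (%x r. s r x) (%j. lincomb (%x r. s r x) v (%i. d i j)) (%j. d' j k)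
  = lincomb (%x r. s r x) v (%i. lincomb (%x r. r \<otimes>\<^bsub>opp A\<^esub> x) (d i) (%j. d' j k))" using v d mod_onD[OF N] fsD(2)[OF d'] biadd_flip[OF mod_onD(3)[OF N]] mod_on_0[OF N] ring_onD[OF A]
   mod_on_0[OF mod_on_self[OF A]] by (intro lincomb_assoc[where N = N and L = N and X = "carrier A" and Y = "carrier A" and J = J and I = I
     and R = "carrier A"]) auto
 then show "ap s (ap s v d) d' k = ap s v (%i. ap (mult (opp A)) (d i) d') k" by (simp add: ap_def)
qed

lemma lincomb_ap:
 assumes X: "mod_on A X s" and v: "v : fs (carrier A) I" and d: "!!i. i : I ==> d i : fs (carrier A) J"
  and e: "!!j. j : J ==> e j : X"
 shows "lincomb s (ap (mult (opp A)) v d) e = lincomb s v (%i. lincomb s (d i) e)"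
proof -
 have A: "ring_on A" using mod_onD(1)[OF X] by simp
 show ?thesis using v d e mod_onD[OF X] ring_onD[OF A] mod_on_0[OF X] mod_on_0[OF mod_on_self[OF A]] unfolding ap_def by (intro lincomb_assoc[where N = "carrier A" and L = "carrier A" and X = X and Y = X and J = J and I = I
     and R = "carrier A"]) auto
qed

lemma ap_lincomb: "ap (mult (opp A)) v d = lincomb (pws (mult A)) v d" by (auto simp: ap_def lincomb_def sum_fun_apply pws_def fun_eq_iff)

lemma ap_lin_map:
 assumes A: "ring_on A" and d: "!!b. b : B ==> d b : fs (carrier A) J"
 shows "lin_map A (fs (carrier A) B) (pws (mult A)) (fs (carrier A) J) (pws (mult A)) (%v. ap (mult (opp A)) v d)" unfolding ap_lincomb by (rule lincomb_lin_map[OF free_mod[OF A] d])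

section \<open>Projective modules and resolutions\<close>

text \<open>The canonical map from the free module on the set \<open>X\<close> itself splits. Unlike
  a lifting property this needs no quantification over modules.\<close>

definition proj :: "('a::ab_group_add, 's) ring_scheme => 'x::ab_group_add set => ('a => 'x => 'x) => bool" where
 "proj A X s <-> mod_on A X s &
  (EX \<sigma>. lin_map A X s (fs (carrier A) X) (pws (mult A)) \<sigma> & (ALL x:X. lincomb s (\<sigma> x) (%y. y) = x))"

text \<open>A dual basis with any index set suffices: replacing the index \<open>i\<close> by
  \<open>y i\<close> moves it to the index set \<open>X\<close> required in
  \<open>proj\<close>.\<close>

lemma projI:
 assumes X: "mod_on A X s" and \<phi>: "lin_map A X s (fs (carrier A) I) (pws (mult A)) \<phi>"
  and y: "!!i. i : I ==> y i : X" and eq: "!!x. x : X ==> lincomb s (\<phi> x) y = x"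
 shows "proj A X s" unfolding proj_def
proof (intro conjI X exI ballI)
 have A: "ring_on A" using mod_onD(1)[OF X] .
 let ?d = "%i. single (y i) (one A)"
 have d: "?d i : fs (carrier A) X" if "i : I" for i using y[OF that] ring_onD[OF A] by (simp add: fs_single subgrp_0)
 show "lin_map A X s (fs (carrier A) X) (pws (mult A)) (%x. ap (mult (opp A)) (\<phi> x) ?d)" by (rule lin_map_comp[OF \<phi> ap_lin_map[OF A d]])
 fix x assume x: "x : X"
 have "lincomb s (ap (mult (opp A)) (\<phi> x) ?d) (%y. y) = lincomb s (\<phi> x) (%i. lincomb s (?d i) (%y. y))" by (rule lincomb_ap[OF X lin_mapD(2)[OF \<phi> x] d]) auto
 also have "... = lincomb s (\<phi> x) y" using y lincomb_one[OF X, where e = "%y. y"] by (intro lincomb_cong[OF lin_mapD(2)[OF \<phi> x]]) auto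
 finally show "lincomb s (ap (mult (opp A)) (\<phi> x) ?d) (%y. y) = x" using eq x by simp
qed

lemma proj_mod: "proj A X s ==> mod_on A X s" by (simp add: proj_def)

lemma proj_free: "ring_on A ==> proj A (fs (carrier A) B) (pws (mult A))" by (intro projI[OF free_mod lin_map_id, of A B "%b. single b (one A)"])
  (simp_all add: lincomb_basis fs_basis)

lemma proj_retract:
 assumes P: "proj A P t" and Q: "mod_on A Q u" and i: "lin_map A Q u P t i" and r: "lin_map A P t Q u r"
  and ri: "!!q. q : Q ==> r (i q) = q"
 shows "proj A Q u"
proof -
 from P obtain \<sigma> where \<sigma>: "lin_map A P t (fs (carrier A) P) (pws (mult A)) \<sigma>"
  "!!x. x : P ==> lincomb t (\<sigma> x) (%y. y) = x" by (auto simp: proj_def)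
 show ?thesis
 proof (rule projI[OF Q lin_map_comp[OF i \<sigma>(1)], of r])
  show "r p : Q" if "p : P" for p using lin_mapD(2)[OF r that] .
  fix q assume q: "q : Q"
  then have iq: "i q : P" using lin_mapD(2)[OF i] by simp
  have "lincomb u (\<sigma> (i q)) r = r (lincomb t (\<sigma> (i q)) (%y. y))" using lin_map_lincomb[OF proj_mod[OF P] r lin_mapD(2)[OF \<sigma>(1) iq], of "%y. y"] by simp
  then show "lincomb u (\<sigma> (i q)) r = q" using \<sigma>(2)[OF iq] ri[OF q] by simp
 qed
qed

text \<open>Pick a lift \<open>z p\<close> for each \<open>p\<close> and extend linearly over the
  free module on \<open>P\<close>, reached through the splitting \<open>\<sigma>\<close>. The
  congruence modulo \<open>D\<close> makes this a lifting problem for \<open>Y/D\<close>.\<close>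

lemma proj_lift:
 assumes P: "proj A P t" and f: "lin_map A P t Y u f" and Z: "mod_on A Z w" and g: "lin_map A Z w Y u g"
  and Y: "mod_on A Y u" and D: "submod A Y u D" and ex: "!!p. p : P ==> EX z:Z. f p - g z : D"
 shows "EX h. lin_map A P t Z w h & (ALL p:P. f p - g (h p) : D)"
proof -
 from P obtain \<sigma> where \<sigma>: "lin_map A P t (fs (carrier A) P) (pws (mult A)) \<sigma>"
  "!!x. x : P ==> lincomb t (\<sigma> x) (%y. y) = x" by (auto simp: proj_def)
 obtain z where z: "!!p. p : P ==> z p : Z" "!!p. p : P ==> f p - g (z p) : D" using ex by metis
 let ?h = "%p. lincomb w (\<sigma> p) z"
 have "lin_map A P t Z w ?h" by (rule lin_map_comp[OF \<sigma>(1) lincomb_lin_map[OF Z z(1)]])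
 moreover have "f p - g (?h p) : D" if p: "p : P" for p
 proof -
  have \<sigma>p: "\<sigma> p : fs (carrier A) P" using lin_mapD(2)[OF \<sigma>(1) p] .
  have "f p = lincomb u (\<sigma> p) f" using lin_map_lincomb[OF proj_mod[OF P] f \<sigma>p, of "%y. y"] \<sigma>(2)[OF p] by simp
  moreover have "g (?h p) = lincomb u (\<sigma> p) (%p. g (z p))" by (rule lin_map_lincomb[OF Z g \<sigma>p z(1)])
  moreover have "lincomb u (\<sigma> p) (%p. f p - g (z p)) = lincomb u (\<sigma> p) f - lincomb u (\<sigma> p) (%p. g (z p))" using lin_mapD(2)[OF f] lin_mapD(2)[OF g] z(1) by (intro lincomb_diff_right[OF mod_onD(3)[OF Y] mod_onD(2)[OF Y] \<sigma>p]) auto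
  moreover have "lincomb u (\<sigma> p) (%p. f p - g (z p)) : D" by (rule submod_lincomb_in[OF Y D \<sigma>p z(2)])
  ultimately show ?thesis by simp
 qed
 ultimately show ?thesis by blast
qed

text \<open>A projective resolution of \<open>X/D\<close> in which the quotient is never formed:
  surjectivity and kernel of the augmentation are read modulo \<open>D\<close>.\<close>

definition pres :: "('a::ab_group_add, 's) ring_scheme => 'x::ab_group_add set => ('a => 'x => 'x) => 'x set =>
  (nat => 'p::ab_group_add set) => (nat => 'a => 'p => 'p) => (nat => 'p => 'p) => ('p => 'x) => bool" where
 "pres A X s D P t d e <-> mod_on A X s & submod A X s D & (ALL n. proj A (P n) (t n)) &
  (ALL n. lin_map A (P (Suc n)) (t (Suc n)) (P n) (t n) (d n)) & lin_map A (P 0) (t 0) X s e &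
  (ALL x:X. EX p:P 0. x - e p : D) & (ALL p:P 0. e p : D <-> p : d 0 ` P 1) &
  (ALL n. ALL p:P (Suc n). d n p = 0 <-> p : d (Suc n) ` P (Suc (Suc n)))"

text \<open>The image of \<open>d n\<close> is a projective module, so the resolution can be cut off there.\<close>

definition preg :: "('a::ab_group_add, 's) ring_scheme => (nat => 'p::ab_group_add set) =>
  (nat => 'a => 'p => 'p) => (nat => 'p => 'p) => nat => bool" where
 "preg A P t d n <-> (EX \<sigma>. lin_map A (P n) (t n) (P (Suc n)) (t (Suc n)) \<sigma> &
  (ALL p:P (Suc n). d n (\<sigma> (d n p)) = d n p))"

lemma presD:
 assumes "pres A X s D P t d e"
 shows "mod_on A X s" "submod A X s D" "proj A (P n) (t n)" "mod_on A (P n) (t n)"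
  "lin_map A (P (Suc n)) (t (Suc n)) (P n) (t n) (d n)" "lin_map A (P 0) (t 0) X s e"
  "x : X ==> EX p:P 0. x - e p : D" "p : P 0 ==> e p : D ==> EX q:P 1. p = d 0 q"
  "p : P 1 ==> e (d 0 p) : D" "p : P (Suc n) ==> d n p = 0 ==> EX q:P (Suc (Suc n)). p = d (Suc n) q"
  "p : P (Suc (Suc n)) ==> d n (d (Suc n) p) = 0"
proof -
 show "mod_on A X s" "submod A X s D" "proj A (P n) (t n)" and d: "!!n. lin_map A (P (Suc n)) (t (Suc n)) (P n) (t n) (d n)"
  "lin_map A (P 0) (t 0) X s e" "x : X ==> EX p:P 0. x - e p : D" using assms by (auto simp: pres_def)
 then show "mod_on A (P n) (t n)" using proj_mod by blast
 show "p : P 0 ==> e p : D ==> EX q:P 1. p = d 0 q" "p : P (Suc n) ==> d n p = 0 ==> EX q:P (Suc (Suc n)). p = d (Suc n) q" using assms unfolding pres_def by blast+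
 show "e (d 0 p) : D" if "p : P 1" using assms lin_mapD(2)[OF d(1)[of 0]] that unfolding pres_def by auto
 show "d n (d (Suc n) p) = 0" if "p : P (Suc (Suc n))" using assms lin_mapD(2)[OF d(1)[of "Suc n"]] that unfolding pres_def by auto
qed

section \<open>Comparison of projective resolutions\<close>

lemma proj_lift0:
 assumes P: "proj A P t" and f: "lin_map A P t Y u f" and Z: "mod_on A Z w" and g: "lin_map A Z w Y u g"
  and Y: "mod_on A Y u" and ex: "!!p. p : P ==> EX z:Z. f p = g z"
 shows "EX h. lin_map A P t Z w h & (ALL p:P. g (h p) = f p)"
proof -
 have "EX z:Z. f p - g z : {0}" if "p : P" for p using ex[OF that] by auto
 from proj_lift[OF P f Z g Y submod_0[OF Y] this] show ?thesis by auto
qed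

text \<open>Each component is a lift over the previous one. The invariant \<open>I\<close> records
  that \<open>F\<close> carries boundaries to boundaries, which is what the next lift requires; it
  passes on because the new composite is a cycle and \<open>P'\<close> is exact.\<close>

lemma chain_map_exists:
 assumes P: "pres A X s D P t d e" and P': "pres A X' s' D' P' t' d' e'"
  and f: "lin_map A X s X' s' f" and fD: "!!x. x : D ==> f x : D'"
 shows "EX F. (ALL n. lin_map A (P n) (t n) (P' n) (t' n) (F n)) & (ALL p:P 0. f (e p) - e' (F 0 p) : D') &
  (ALL n. ALL p:P (Suc n). d' n (F (Suc n) p) = F n (d n p))"
proof -
 note P = presD[OF P] and P' = presD[OF P']
 have sub: "subgrp D'" using submodD(1)[OF P'(2)] .
 define I where "I n F <-> lin_map A (P n) (t n) (P' n) (t' n) F & (n = 0 --> (ALL p:P 0. f (e p) - e' (F p) : D')) &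
  (ALL p:P (Suc n). EX q:P' (Suc n). F (d n p) = d' n q)" for n F
 define Q where "Q n F F' <-> (ALL p:P (Suc n). d' n (F' p) = F (d n p))" for n F F'
 have "EX F. I 0 F"
 proof -
  have "EX z:P' 0. f (e p) - e' z : D'" if "p : P 0" for p using P'(7) lin_mapD(2)[OF f] lin_mapD(2)[OF P(6)] that by blast
  then obtain F where F: "lin_map A (P 0) (t 0) (P' 0) (t' 0) F" "!!p. p : P 0 ==> f (e p) - e' (F p) : D'" using proj_lift[OF P(3) lin_map_comp[OF P(6) f] P'(4) P'(6) P'(1,2)] by blast
  have "EX q:P' 1. F (d 0 p) = d' 0 q" if p: "p : P 1" for p
  proof -
   have dp: "d 0 p : P 0" using lin_mapD(2)[OF P(5)[of 0]] p by simp
   have "f (e (d 0 p)) - (f (e (d 0 p)) - e' (F (d 0 p))) : D'" using subgrp_diff[OF sub] fD P(9)[OF p] F(2)[OF dp] by blast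
   then show ?thesis using P'(8) lin_mapD(2)[OF F(1) dp] by auto
  qed
  then show ?thesis using F by (auto simp: I_def)
 qed
 moreover have "EX F'. I (Suc n) F' & Q n F F'" if I: "I n F" for F n
 proof -
  have F: "lin_map A (P n) (t n) (P' n) (t' n) F" "!!p. p : P (Suc n) ==> EX q:P' (Suc n). F (d n p) = d' n q" using I by (auto simp: I_def)
  obtain F' where F': "lin_map A (P (Suc n)) (t (Suc n)) (P' (Suc n)) (t' (Suc n)) F'"
   "!!p. p : P (Suc n) ==> d' n (F' p) = F (d n p)" using proj_lift0[OF P(3) lin_map_comp[OF P(5) F(1)] P'(4) P'(5) P'(4) F(2)] by blast
  have "EX q:P' (Suc (Suc n)). F' (d (Suc n) p) = d' (Suc n) q" if p: "p : P (Suc (Suc n))" for p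
  proof -
   have dp: "d (Suc n) p : P (Suc n)" using lin_mapD(2)[OF P(5)[of "Suc n"]] p by simp
   have "d' n (F' (d (Suc n) p)) = 0" using F'(2)[OF dp] P(11)[OF p] lin_map_0[OF F(1) mod_onD(2)[OF P(4)]] by simp
   then show ?thesis using P'(10) lin_mapD(2)[OF F'(1) dp] by blast
  qed
  then show ?thesis using F' by (auto simp: I_def Q_def)
 qed
 ultimately obtain F where "ALL n. I n (F n) & Q n (F n) (F (Suc n))" using dependent_nat_choice[of I Q] by blast
 then show ?thesis by (intro exI[of _ F]) (auto simp: I_def Q_def)
qed

text \<open>\<open>X/D\<close> is a direct summand of \<open>X'/D'\<close>, and the comparison maps
  \<open>F\<close> and \<open>G\<close> transport the splitting. With identities for
  \<open>f\<close> and \<open>g\<close> this yields independence of the resolution.\<close>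

lemma preg_retract:
 assumes P: "pres A X s D P t d e" and P': "pres A X' s' D' P' t' d' e'"
  and f: "lin_map A X s X' s' f" and fD: "!!x. x : D ==> f x : D'"
  and g: "lin_map A X' s' X s g" and gD: "!!x. x : D' ==> g x : D"
  and gf: "!!x. x : X ==> g (f x) - x : D" and reg: "preg A P' t' d' n"
 shows "preg A P t d n"
proof -
 from chain_map_exists[OF P P' f fD] obtain F where F: "!!n. lin_map A (P n) (t n) (P' n) (t' n) (F n)"
  "!!p. p : P 0 ==> f (e p) - e' (F 0 p) : D'" "!!n p. p : P (Suc n) ==> d' n (F (Suc n) p) = F n (d n p)" by blast
 from chain_map_exists[OF P' P g gD] obtain G where G: "!!n. lin_map A (P' n) (t' n) (P n) (t n) (G n)"
  "!!p. p : P' 0 ==> g (e' p) - e (G 0 p) : D" "!!n p. p : P' (Suc n) ==> d n (G (Suc n) p) = G n (d' n p)" by blast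
 note P = presD[OF P] and P' = presD[OF P']
 have sD: "subgrp D" using submodD(1)[OF P(2)] .
 define \<phi> where "\<phi> n p = G n (F n p) - p" for n p
 have \<phi>: "lin_map A (P n) (t n) (P n) (t n) (\<phi> n)" for n unfolding \<phi>_def by (rule lin_map_diff_fun[OF P(4) lin_map_comp[OF F(1) G(1)] lin_map_id])
 have d_in: "d n p : P n" if "p : P (Suc n)" for n p using lin_mapD(2)[OF P(5)] that .
 have \<phi>d: "d n (\<phi> (Suc n) p) = \<phi> n (d n p)" if p: "p : P (Suc n)" for n p using lin_map_diff[OF P(5) mod_onD(2)[OF P(4)]] G(3) F(3)[OF p] lin_mapD(2)[OF F(1) p]
   lin_mapD(2)[OF G(1)] p by (simp add: \<phi>_def)
 have \<phi>0: "EX q:P 1. \<phi> 0 p = d 0 q" if p: "p : P 0" for p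
 proof (rule P(8))
  show "\<phi> 0 p : P 0" using lin_mapD(2)[OF \<phi> p] .
  let ?q = "F 0 p"
  have q: "?q : P' 0" using lin_mapD(2)[OF F(1) p] .
  have ep: "e p : X" using lin_mapD(2)[OF P(6) p] .
  have e'q: "e' ?q : X'" using lin_mapD(2)[OF P'(6) q] .
  have "e (\<phi> 0 p) = e (G 0 ?q) - e p" using lin_map_diff[OF P(6) mod_onD(2)[OF P(4)]] lin_mapD(2)[OF G(1) q] p by (simp add: \<phi>_def)
  also have "... = (g (f (e p)) - e p) - g (f (e p) - e' ?q) - (g (e' ?q) - e (G 0 ?q))" using lin_map_diff[OF g mod_onD(2)[OF P'(1)] lin_mapD(2)[OF f ep] e'q] by simp
  also have "... : D" by (intro subgrp_diff[OF sD] gf[OF ep] gD F(2)[OF p] G(2)[OF q])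
  finally show "e (\<phi> 0 p) : D" .
 qed
 \<comment> \<open>A null homotopy of \<open>G F - 1\<close>, recorded only on boundaries: there the
   second term of the homotopy formula disappears because \<open>d d = 0\<close>.\<close>
 have "EX H. lin_map A (P n) (t n) (P (Suc n)) (t (Suc n)) H & (ALL p:P (Suc n). d n (H (d n p)) = \<phi> n (d n p))"
 proof (induction n)
  case 0
  have "EX q:P (Suc 0). \<phi> 0 p = d 0 q" if "p : P 0" for p using \<phi>0[OF that] by simp
  from proj_lift0[OF P(3) \<phi> P(4) P(5) P(4) this] show ?case using d_in by blast
 next
  case (Suc n)
  then obtain H where H: "lin_map A (P n) (t n) (P (Suc n)) (t (Suc n)) H"
   "!!p. p : P (Suc n) ==> d n (H (d n p)) = \<phi> n (d n p)" by blast
  let ?\<psi> = "%p. \<phi> (Suc n) p - H (d n p)"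
  have \<psi>: "lin_map A (P (Suc n)) (t (Suc n)) (P (Suc n)) (t (Suc n)) ?\<psi>" by (rule lin_map_diff_fun[OF P(4) \<phi> lin_map_comp[OF P(5) H(1)]])
  have "EX q:P (Suc (Suc n)). ?\<psi> p = d (Suc n) q" if p: "p : P (Suc n)" for p
  proof (rule P(10))
   show "?\<psi> p : P (Suc n)" using lin_mapD(2)[OF \<psi> p] .
   show "d n (?\<psi> p) = 0" using lin_map_diff[OF P(5) mod_onD(2)[OF P(4)] lin_mapD(2)[OF \<phi> p] lin_mapD(2)[OF H(1) d_in[OF p]]]
     H(2)[OF p] \<phi>d[OF p] by simp
  qed
  from proj_lift0[OF P(3) \<psi> P(4) P(5) P(4) this] obtain H' where
   H': "lin_map A (P (Suc n)) (t (Suc n)) (P (Suc (Suc n))) (t (Suc (Suc n))) H'"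
   "!!p. p : P (Suc n) ==> d (Suc n) (H' p) = ?\<psi> p" by blast
  have "d (Suc n) (H' (d (Suc n) p)) = \<phi> (Suc n) (d (Suc n) p)" if p: "p : P (Suc (Suc n))" for p using H'(2)[OF d_in[OF p]] P(11)[OF p] lin_map_0[OF H(1) mod_onD(2)[OF P(4)]] by simp
  then show ?case using H'(1) by blast
 qed
 then obtain H where H: "lin_map A (P n) (t n) (P (Suc n)) (t (Suc n)) H"
   "!!p. p : P (Suc n) ==> d n (H (d n p)) = \<phi> n (d n p)" by blast
 from reg obtain \<sigma> where \<sigma>: "lin_map A (P' n) (t' n) (P' (Suc n)) (t' (Suc n)) \<sigma>"
  "!!p. p : P' (Suc n) ==> d' n (\<sigma> (d' n p)) = d' n p" by (auto simp: preg_def)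
 have \<tau>0: "lin_map A (P n) (t n) (P (Suc n)) (t (Suc n)) (%p. G (Suc n) (\<sigma> (F n p)))" by (rule lin_map_comp[OF lin_map_comp[OF F(1) \<sigma>(1)] G(1)])
 \<comment> \<open>The splitting \<open>\<sigma>\<close> carried over by \<open>F\<close> and
   \<open>G\<close>, corrected by \<open>H\<close> since \<open>G F\<close> is the identity only up
   to homotopy.\<close>
 let ?\<tau> = "%p. G (Suc n) (\<sigma> (F n p)) - H p"
 have \<tau>: "lin_map A (P n) (t n) (P (Suc n)) (t (Suc n)) ?\<tau>" by (rule lin_map_diff_fun[OF P(4) \<tau>0 H(1)])
 have "d n (?\<tau> (d n p)) = d n p" if p: "p : P (Suc n)" for p
 proof -
  have Fp: "F (Suc n) p : P' (Suc n)" and Fdp: "F n (d n p) : P' n" using lin_mapD(2)[OF F(1)] p d_in by auto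
  have "d n (?\<tau> (d n p)) = d n (G (Suc n) (\<sigma> (F n (d n p)))) - d n (H (d n p))" by (rule lin_map_diff[OF P(5) mod_onD(2)[OF P(4)] lin_mapD(2)[OF \<tau>0 d_in[OF p]] lin_mapD(2)[OF H(1) d_in[OF p]]])
  also have "d n (G (Suc n) (\<sigma> (F n (d n p)))) = G n (d' n (\<sigma> (F n (d n p))))" by (rule G(3)[OF lin_mapD(2)[OF \<sigma>(1) Fdp]])
  also have "... = G n (F n (d n p))" using \<sigma>(2)[OF Fp] F(3)[OF p] by simp
  also have "G n (F n (d n p)) - d n (H (d n p)) = d n p" using H(2)[OF p] by (simp add: \<phi>_def)
  finally show ?thesis .
 qed
 then show ?thesis using \<tau> by (auto simp: preg_def)
qed

lemma preg_transfer:
 assumes "pres A X s D P t d e" "pres A X s D P' t' d' e'" "preg A P' t' d' n"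
 shows "preg A P t d n" using assms presD(1,2)[OF assms(1)] by (intro preg_retract[OF assms(1,2) lin_map_id _ lin_map_id]) (auto dest: submodD intro: subgrp_0)

text \<open>\<open>p - \<sigma> (d p)\<close> is a cycle, so it has the form \<open>d (h p)\<close>;
  on boundaries the correction vanishes and \<open>h\<close> is a splitting one step
  further.\<close>

lemma preg_Suc:
 assumes P: "pres A X s D P t d e" and reg: "preg A P t d n" shows "preg A P t d (Suc n)"
proof -
 note P = presD[OF P]
 from reg obtain \<sigma> where \<sigma>: "lin_map A (P n) (t n) (P (Suc n)) (t (Suc n)) \<sigma>"
  "!!p. p : P (Suc n) ==> d n (\<sigma> (d n p)) = d n p" by (auto simp: preg_def)
 let ?\<psi> = "%p. p - \<sigma> (d n p)"
 have \<psi>: "lin_map A (P (Suc n)) (t (Suc n)) (P (Suc n)) (t (Suc n)) ?\<psi>" by (rule lin_map_diff_fun[OF P(4) lin_map_id lin_map_comp[OF P(5) \<sigma>(1)]])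
 have "EX q:P (Suc (Suc n)). ?\<psi> p = d (Suc n) q" if p: "p : P (Suc n)" for p
 proof (rule P(10))
  show "?\<psi> p : P (Suc n)" using lin_mapD(2)[OF \<psi> p] .
  show "d n (?\<psi> p) = 0" using lin_map_diff[OF P(5) mod_onD(2)[OF P(4)] p lin_mapD(2)[OF \<sigma>(1) lin_mapD(2)[OF P(5) p]]] \<sigma>(2)[OF p] by simp
 qed
 from proj_lift0[OF P(3) \<psi> P(4) P(5) P(4) this] obtain h where
  h: "lin_map A (P (Suc n)) (t (Suc n)) (P (Suc (Suc n))) (t (Suc (Suc n))) h"
  "!!p. p : P (Suc n) ==> d (Suc n) (h p) = ?\<psi> p" by blast
 have "d (Suc n) (h (d (Suc n) p)) = d (Suc n) p" if p: "p : P (Suc (Suc n))" for p using h(2)[OF lin_mapD(2)[OF P(5) p]] P(11)[OF p] lin_map_0[OF \<sigma>(1) mod_onD(2)[OF P(4)]] by simp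
 then show ?thesis using h(1) by (auto simp: preg_def)
qed

lemma preg_mono:
 assumes P: "pres A X s D P t d e" and reg: "preg A P t d n" and le: "n <= m" shows "preg A P t d m" using le by (induction rule: dec_induct) (auto intro: reg preg_Suc[OF P])

subsection \<open>Mapping cones\<close>

definition prod_smult :: "('a => 'x => 'x) => ('a => 'y => 'y) => 'a => 'x * 'y => 'x * 'y" where
 "prod_smult s t a p = (s a (fst p), t a (snd p))"

lemma mod_on_prod: "mod_on A X s ==> mod_on A Y t ==> mod_on A (X \<times> Y) (prod_smult s t)" unfolding mod_on_def[of A "X \<times> Y"] by (intro conjI biaddI ballI) (auto simp: mod_onD mod_on_distrib subgrp_Times prod_smult_def)

lemma proj_zero: "ring_on A ==> proj A {0} (%a x. 0)" by (rule projI[where I = "{}" and \<phi> = "%x. 0"])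
  (auto simp: mod_on_def biadd_def additive_on_def lin_map_def fs_empty ring_onD pws_def fun_eq_iff
   dest: mod_on_0[OF mod_on_self])

lemma lin_map_fst: "lin_map A (X \<times> Y) (prod_smult s t) X s fst"
 and lin_map_snd: "lin_map A (X \<times> Y) (prod_smult s t) Y t snd" by (auto simp: lin_map_def additive_on_def prod_smult_def)

lemma lin_map_Pair: "lin_map A Z u X s f ==> lin_map A Z u Y t g ==> lin_map A Z u (X \<times> Y) (prod_smult s t) (%z. (f z, g z))" by (auto simp: lin_map_def additive_on_def prod_smult_def)

lemma proj_prod:
 assumes P: "proj A P s" and Q: "proj A Q t" shows "proj A (P \<times> Q) (prod_smult s t)"
proof -
 have mP: "mod_on A P s" and mQ: "mod_on A Q t" using P Q proj_mod by blast+
 have A: "ring_on A" using mod_onD(1)[OF mP] .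
 have mPQ: "mod_on A (P \<times> Q) (prod_smult s t)" by (rule mod_on_prod[OF mP mQ])
 let ?fr = "%I. fs (carrier A) I" and ?m = "pws (mult A)"
 from P obtain \<sigma> where \<sigma>: "lin_map A P s (?fr P) ?m \<sigma>" "!!x. x : P ==> lincomb s (\<sigma> x) (%y. y) = x" by (auto simp: proj_def)
 from Q obtain \<tau> where \<tau>: "lin_map A Q t (?fr Q) ?m \<tau>" "!!x. x : Q ==> lincomb t (\<tau> x) (%y. y) = x" by (auto simp: proj_def)
 \<comment> \<open>Generators of both factors in one index set. The index \<open>(0, 0)\<close>
   belongs to both parts, which does no harm as it is evaluated at the zero element.\<close>
 let ?I = "P \<times> {0} \<union> {0} \<times> Q"
 have i1: "lin_map A P s (P \<times> Q) (prod_smult s t) (%x. (x, 0))" and i2: "lin_map A Q t (P \<times> Q) (prod_smult s t) (%y. (0, y))" by (intro lin_map_Pair lin_map_id lin_map_zero mP mQ)+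
 have d1: "single (x, 0) (one A) : ?fr ?I" if "x : P" for x using that by (intro fs_basis[OF A]) auto
 have d2: "single (0, y) (one A) : ?fr ?I" if "y : Q" for y using that by (intro fs_basis[OF A]) auto
 let ?f = "%p. ap (mult (opp A)) (\<sigma> (fst p)) (%x. single (x, 0) (one A))"
 let ?g = "%p. ap (mult (opp A)) (\<tau> (snd p)) (%y. single (0, y) (one A))"
 have f: "lin_map A (P \<times> Q) (prod_smult s t) (?fr ?I) ?m ?f" by (rule lin_map_comp[OF lin_map_comp[OF lin_map_fst \<sigma>(1)] ap_lin_map[OF A d1]])
 have g: "lin_map A (P \<times> Q) (prod_smult s t) (?fr ?I) ?m ?g" by (rule lin_map_comp[OF lin_map_comp[OF lin_map_snd \<tau>(1)] ap_lin_map[OF A d2]])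
 show ?thesis
 proof (rule projI[OF mPQ lin_map_add_fun[OF free_mod[OF A] f g], of "%i. i"])
  have sub: "?I <= P \<times> Q" using subgrp_0[OF mod_onD(2)[OF mP]] subgrp_0[OF mod_onD(2)[OF mQ]] by auto
  then show "i : ?I ==> i : P \<times> Q" for i by auto
  fix p assume p: "p : P \<times> Q"
  then have sp: "\<sigma> (fst p) : ?fr P" and tp: "\<tau> (snd p) : ?fr Q" using lin_mapD(2)[OF \<sigma>(1)] lin_mapD(2)[OF \<tau>(1)] by auto
  have L: "lin_map A (?fr ?I) ?m (P \<times> Q) (prod_smult s t) (%v. lincomb (prod_smult s t) v (%i. i))" by (rule lincomb_lin_map[OF mPQ]) (use sub in auto)
  have "lincomb (prod_smult s t) (?f p) (%i. i) = lincomb (prod_smult s t) (\<sigma> (fst p)) (%x. lincomb (prod_smult s t) (single (x, 0) (one A)) (%i. i))" by (rule lincomb_ap[OF mPQ sp d1]) (use sub in auto)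
  also have "... = lincomb (prod_smult s t) (\<sigma> (fst p)) (%x. (x, 0))" using lincomb_one[OF mPQ, where e = "%i. i"] subgrp_0[OF mod_onD(2)[OF mQ]] by (intro lincomb_cong[OF sp]) auto
  also have "... = (fst p, 0)" using lin_map_lincomb[OF mP i1 sp, of "%x. x"] \<sigma>(2) p by auto
  finally have 1: "lincomb (prod_smult s t) (?f p) (%i. i) = (fst p, 0)" .
  have "lincomb (prod_smult s t) (?g p) (%i. i) = lincomb (prod_smult s t) (\<tau> (snd p)) (%x. lincomb (prod_smult s t) (single (0, x) (one A)) (%i. i))" by (rule lincomb_ap[OF mPQ tp d2]) (use sub in auto)
  also have "... = lincomb (prod_smult s t) (\<tau> (snd p)) (%x. (0, x))" using lincomb_one[OF mPQ, where e = "%i. i"] subgrp_0[OF mod_onD(2)[OF mP]] by (intro lincomb_cong[OF tp]) auto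
  also have "... = (0, snd p)" using lin_map_lincomb[OF mQ i2 tp, of "%x. x"] \<tau>(2) p by auto
  finally have 2: "lincomb (prod_smult s t) (?g p) (%i. i) = (0, snd p)" .
  show "lincomb (prod_smult s t) (?f p + ?g p) (%i. i) = p" using lin_mapD(4)[OF L lin_mapD(2)[OF f p] lin_mapD(2)[OF g p]] 1 2 by simp
 qed
qed

subsection \<open>Existence of free resolutions\<close>

lemma inj_pairs_infinite:
 assumes "infinite (UNIV :: 'u set)" shows "EX p::'u * 'u => 'u. inj p"
proof -
 have "|(UNIV :: 'u set) \<times> (UNIV :: 'u set)| <=o |UNIV :: 'u set|" using card_of_Times_same_infinite[OF assms] ordIso_imp_ordLeq by blast
 then show ?thesis unfolding card_of_ordLeq[symmetric] by (auto simp: UNIV_Times_UNIV)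
qed

lemma inj_list_infinite:
 assumes inf: "infinite (UNIV :: 'u set)" shows "EX c::'u list => 'u. inj c"
proof -
 obtain p :: "'u * 'u => 'u" where p: "inj p" using inj_pairs_infinite[OF inf] by blast
 obtain h :: "nat => 'u" where h: "inj h" using infinite_countable_subset[OF inf] by blast
 define g where "g xs = foldr (%x y. p (x, y)) xs undefined" for xs
 have g: "xs = ys" if "length xs = length ys" "g xs = g ys" for xs ys using that by (induction rule: list_induct2) (auto simp: g_def dest: injD[OF p])
 have "inj (%xs. p (h (length xs), g xs))" by (rule injI) (use g in "auto dest!: injD[OF p] injD[OF h]")
 then show ?thesis by blast
qed

text \<open>A finitely supported function is coded by a list of its non-zero values with their
  indices. So free modules with basis in an infinite type that can hold the ring have a copy in that
  same type, and a whole resolution can be built inside it.\<close>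

lemma fs_inj:
 fixes j :: "'a::zero => 'u" and k :: "'b => 'u"
 assumes inf: "infinite (UNIV :: 'u set)" and j: "inj_on j N" and k: "inj_on k B"
 shows "EX i::('b => 'a) => 'u. inj_on i (fs N B)"
proof -
 obtain p :: "'u * 'u => 'u" where p: "inj p" using inj_pairs_infinite[OF inf] by blast
 obtain c :: "'u list => 'u" where c: "inj c" using inj_list_infinite[OF inf] by blast
 define l where "l v = (SOME l. set l = (%b. (v b, b)) ` {b. v b ~= 0})" for v :: "'b => 'a"
 have l: "set (l v) = (%b. (v b, b)) ` {b. v b ~= 0}" if "v : fs N B" for v unfolding l_def by (rule someI_ex) (use fsD(1)[OF that] finite_list in blast)
 define f where "f = (%(x, b). p (j x, k b))"
 have "inj_on (%v. c (map f (l v))) (fs N B)"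
 proof (rule inj_onI)
  fix v w assume v: "v : fs N B" and w: "w : fs N B" and "c (map f (l v)) = c (map f (l w))"
  then have eq: "map f (l v) = map f (l w)" using c by (simp add: inj_eq)
  have "inj_on f (set (l v) \<union> set (l w))"
  proof (rule inj_onI)
   fix a b assume ab: "a : set (l v) \<union> set (l w)" "b : set (l v) \<union> set (l w)" "f a = f b"
   then have "fst a : N" "fst b : N" "snd a : B" "snd b : B" using l[OF v] l[OF w] fsD(2)[OF v] fsD(2)[OF w] fs_supp[OF v] fs_supp[OF w] by auto
   moreover have "j (fst a) = j (fst b)" "k (snd a) = k (snd b)" using ab(3) p by (auto simp: f_def split_beta inj_eq)
   ultimately show "a = b" using j k by (auto simp: prod_eq_iff dest: inj_onD)
  qed
  then have "l v = l w" using eq map_inj_on by blast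
  then have graph: "(%b. (v b, b)) ` {b. v b ~= 0} = (%b. (w b, b)) ` {b. w b ~= 0}" using l[OF v] l[OF w] by simp
  show "v = w"
  proof
   fix b
   have "v b = w b" if "v b ~= 0 \<or> w b ~= 0" using that graph by (auto simp: set_eq_iff image_iff)
   then show "v b = w b" by metis
  qed
 qed
 then show ?thesis by blast
qed

abbreviation free_on :: "('a::zero, 's) ring_scheme => 'b set => ('b => 'a) set" where
 "free_on A B \<equiv> fs (carrier A) B"

abbreviation free_smult :: "('a, 's) ring_scheme => 'a => ('b => 'a) => 'b => 'a" where
 "free_smult A \<equiv> pws (mult A)"

abbreviation rmul :: "('a::ab_group_add, 's) ring_scheme => ('b => 'a) => ('b => 'j => 'a) => 'j => 'a" where
 "rmul A v d \<equiv> ap (mult (opp A)) v d"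

text \<open>A complex of free modules given by matrices: the row \<open>d n b\<close> is the image
  of the basis element \<open>b\<close> of degree \<open>Suc n\<close>.\<close>

definition fcx :: "('a::ab_group_add, 's) ring_scheme => (nat => 'b set) => (nat => 'b => 'b => 'a) => bool" where
 "fcx A B d <-> ring_on A & (ALL n. ALL b:B (Suc n). d n b : free_on A (B n)) &
  (ALL n. ALL b:B (Suc (Suc n)). rmul A (d (Suc n) b) (d n) = 0)"

text \<open>The tensor product of \<open>N\<close> with the free module on \<open>B\<close> is the
  group of finitely supported families in \<open>N\<close>. So this is exactness of the tensored
  complex in degree \<open>Suc n\<close>, with no tensor product formed.\<close>

definition ex_at :: "('a => 'n::ab_group_add => 'n) => 'n set => (nat => 'b set) => (nat => 'b => 'b => 'a) => nat => bool" where
 "ex_at s N B d n <-> (ALL v:fs N (B (Suc n)). ap s v (d n) = 0 --> (EX w:fs N (B (Suc (Suc n))). v = ap s w (d (Suc n))))"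

text \<open>The equation \<open>d a d = d\<close> for matrices: the form of \<open>preg\<close> that
  an entrywise ring homomorphism respects.\<close>

definition freg :: "('a::ab_group_add, 's) ring_scheme => (nat => 'b set) => (nat => 'b => 'b => 'a) => nat => bool" where
 "freg A B d n <-> (EX a. (ALL b:B n. a b : free_on A (B (Suc n))) &
  (ALL b:B (Suc n). rmul A (rmul A (d n b) a) (d n) = d n b))"

definition fres :: "('a::ab_group_add, 's) ring_scheme => 'x::ab_group_add set => ('a => 'x => 'x) => 'x set =>
  (nat => 'b set) => (nat => 'b => 'b => 'a) => ('b => 'x) => bool" where
 "fres A X s D B d e <-> mod_on A X s & submod A X s D & fcx A B d & (ALL n. ex_at (mult (opp A)) (carrier A) B d n) &
  (ALL b:B 0. e b : X) & (ALL x:X. EX v:free_on A (B 0). x - lincomb s v e : D) &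
  (ALL v:free_on A (B 0). lincomb s v e : D <-> (EX w:free_on A (B 1). v = rmul A w (d 0)))"

lemma rmul_single:
 assumes "ring_on A" "f b : free_on A J" shows "rmul A (single b (one A)) f = f b" unfolding ap_lincomb by (rule lincomb_one[where e = f, OF free_mod[OF assms(1)] assms(2)])

lemma fcxD:
 assumes "fcx A B d"
 shows "ring_on A" "b : B (Suc n) ==> d n b : free_on A (B n)"
  "b : B (Suc (Suc n)) ==> rmul A (d (Suc n) b) (d n) = 0" using assms by (auto simp: fcx_def)

lemma ap_zero:
 assumes "!!n. n : N ==> s 0 n = 0" "v : fs N B" "!!b. b : B ==> d b = 0" shows "ap s v d = 0"
proof
 fix j
 have "s (d b j) (v b) = 0" if "v b ~= 0" for b using assms(1)[OF fsD(2)[OF assms(2)]] assms(3)[OF fs_supp[OF assms(2) that]] by simp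
 then show "ap s v d j = 0 j" by (simp add: ap_def lincomb_def)
qed

lemma ap_cong:
 assumes "v : fs N B" "!!b. b : B ==> d b = d' b" shows "ap s v d = ap s v d'" unfolding ap_def using assms(2) by (intro ext lincomb_cong[OF assms(1)]) simp

lemma fcx_dd:
 assumes c: "fcx A B d" and N: "mod_on (opp A) N s" and v: "v : fs N (B (Suc (Suc n)))"
 shows "ap s (ap s v (d (Suc n))) (d n) = 0"
proof -
 have "ap s (ap s v (d (Suc n))) (d n) = ap s v (%i. rmul A (d (Suc n) i) (d n))" by (rule ap_ap[OF N v fcxD(2)[OF c] fcxD(2)[OF c]])
 also have "... = 0" by (rule ap_zero[OF _ v fcxD(3)[OF c]]) (use mod_on_0(1)[OF N] in auto)
 finally show ?thesis .
qed

lemma fresD: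
 assumes "fres A X s D B d e"
 shows "mod_on A X s" "submod A X s D" "fcx A B d" "ex_at (mult (opp A)) (carrier A) B d n"
  "b : B 0 ==> e b : X" "x : X ==> EX v:free_on A (B 0). x - lincomb s v e : D"
  "v : free_on A (B 0) ==> lincomb s v e : D ==> EX w:free_on A (B 1). v = rmul A w (d 0)"
  "b : B 1 ==> lincomb s (d 0 b) e : D" "w : free_on A (B 1) ==> lincomb s (rmul A w (d 0)) e : D"
proof -
 show A: "mod_on A X s" "submod A X s D" and c: "fcx A B d" and "ex_at (mult (opp A)) (carrier A) B d n"
  "b : B 0 ==> e b : X" "x : X ==> EX v:free_on A (B 0). x - lincomb s v e : D"
  "v : free_on A (B 0) ==> lincomb s v e : D ==> EX w:free_on A (B 1). v = rmul A w (d 0)" using assms by (auto simp: fres_def)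
 have R: "ring_on A" using fcxD(1)[OF c] .
 show *: "lincomb s (rmul A w (d 0)) e : D" if "w : free_on A (B 1)" for w
 proof -
  have "rmul A w (d 0) : free_on A (B 0)" using fcxD(2)[OF c, of _ 0] that by (intro ap_in[OF mod_on_self_opp[OF R]]) auto
  then show ?thesis using assms that by (auto simp: fres_def)
 qed
 have "lincomb s (d 0 b) e : D" if "b : B 1"
 proof -
  have db: "d 0 b : free_on A (B 0)" using fcxD(2)[OF c, of b 0] that by simp
  have "rmul A (single b (one A)) (d 0) = d 0 b" by (rule rmul_single[where f = "d 0" and b = b, OF R db])
  then show ?thesis using *[OF fs_basis[OF R that]] by simp
 qed
 then show "b : B 1 ==> lincomb s (d 0 b) e : D" by blast
qed

lemma fres_pres:
 assumes "fres A X s D B d e"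
 shows "pres A X s D (%n. free_on A (B n)) (%n. free_smult A) (%n v. rmul A v (d n)) (%v. lincomb s v e)"
proof -
 note F = fresD[OF assms]
 have R: "ring_on A" using fcxD(1)[OF F(3)] .
 have "rmul A p (d n) = 0 <-> p : (%v. rmul A v (d (Suc n))) ` free_on A (B (Suc (Suc n)))" if "p : free_on A (B (Suc n))" for n p using F(4)[of n] that fcx_dd[OF F(3) mod_on_self_opp[OF R]] by (auto simp: ex_at_def)
 moreover have "lincomb s p e : D <-> p : (%v. rmul A v (d 0)) ` free_on A (B 1)" if "p : free_on A (B 0)" for p using F(7)[OF that] F(9) by blast
 ultimately show ?thesis unfolding pres_def by (intro conjI allI ballI F(1,2) proj_free[OF R] ap_lin_map[OF R fcxD(2)[OF F(3)]] lincomb_lin_map[OF F(1) F(5)] F(6))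
qed

lemma freg_preg:
 assumes c: "fcx A B d"
 shows "freg A B d n <-> preg A (%n. free_on A (B n)) (%n. free_smult A) (%n v. rmul A v (d n)) n"
proof
 have R: "ring_on A" using fcxD(1)[OF c] .
 have N: "mod_on (opp A) (carrier A) (mult (opp A))" by (rule mod_on_self_opp[OF R])
 have dn: "rmul A v (d n) : free_on A (B n)" if "v : free_on A (B (Suc n))" for v by (rule ap_in[OF N that fcxD(2)[OF c]])
 {
  assume "freg A B d n"
  then obtain a where a: "!!b. b : B n ==> a b : free_on A (B (Suc n))"
   "!!b. b : B (Suc n) ==> rmul A (rmul A (d n b) a) (d n) = d n b" by (auto simp: freg_def)
  have "rmul A (rmul A (rmul A p (d n)) a) (d n) = rmul A p (d n)" if p: "p : free_on A (B (Suc n))" for p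
  proof -
   have "rmul A (rmul A (rmul A p (d n)) a) (d n) = rmul A (rmul A p (%i. rmul A (d n i) a)) (d n)" by (subst ap_ap[OF N p fcxD(2)[OF c] a(1)]) auto
   also have "... = rmul A p (%i. rmul A (rmul A (d n i) a) (d n))" by (rule ap_ap[OF N p ap_in[OF N fcxD(2)[OF c] a(1)] fcxD(2)[OF c]])
   also have "... = rmul A p (d n)" by (rule ap_cong[OF p a(2)])
   finally show ?thesis .
  qed
  then show "preg A (%n. free_on A (B n)) (%n. free_smult A) (%n v. rmul A v (d n)) n" unfolding preg_def by (intro exI[of _ "%v. rmul A v a"] conjI ap_lin_map[OF R a(1)] ballI)
 }
 {
  assume "preg A (%n. free_on A (B n)) (%n. free_smult A) (%n v. rmul A v (d n)) n"
  then obtain \<sigma> where \<sigma>: "lin_map A (free_on A (B n)) (free_smult A) (free_on A (B (Suc n))) (free_smult A) \<sigma>"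
   "!!p. p : free_on A (B (Suc n)) ==> rmul A (\<sigma> (rmul A p (d n))) (d n) = rmul A p (d n)" by (auto simp: preg_def)
  let ?a = "%b. \<sigma> (single b (one A))"
  have a: "\<sigma> v = rmul A v ?a" if "v : free_on A (B n)" for v unfolding ap_lincomb by (rule lin_map_free_eq[OF R \<sigma>(1) that])
  have "rmul A (rmul A (d n b) ?a) (d n) = d n b" if b: "b : B (Suc n)" for b using \<sigma>(2)[OF fs_basis[OF R b]] rmul_single[where f = "d n" and b = b, OF R fcxD(2)[OF c b]] a[OF fcxD(2)[OF c b]] by simp
  then show "freg A B d n" using lin_mapD(2)[OF \<sigma>(1) fs_basis[OF R]] unfolding freg_def by (intro exI[of _ ?a]) blast
 }
qed

text \<open>Each kernel is covered by the free module on all its elements, and \<open>i\<close>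
  codes vectors as elements of the index type. Hence the differential is just decoding, and the same
  function \<open>?ii\<close> serves in every degree.\<close>

lemma fres_exists:
 fixes i :: "('b => 'a::ab_group_add) => 'b" and k :: "'x::ab_group_add => 'b"
 assumes X: "mod_on A X s" and D: "submod A X s D" and i: "inj_on i (free_on A UNIV)" and k: "inj_on k X"
 shows "EX (B :: nat => 'b set) d e. fres A X s D B d e"
proof -
 have R: "ring_on A" using mod_onD(1)[OF X] .
 let ?ii = "tinv (free_on A UNIV) i" and ?e = "tinv X k"
 define K where "K = rec_nat {v : free_on A (k ` X). lincomb s v ?e : D}
  (%_ K. {v : free_on A (i ` K). rmul A v ?ii = 0})"
 define B where "B n = (case n of 0 => k ` X | Suc m => i ` K m)" for n
 have K0: "K 0 = {v : free_on A (B 0). lincomb s v ?e : D}" and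
  KS: "K (Suc n) = {v : free_on A (B (Suc n)). rmul A v ?ii = 0}" and
  B0: "B 0 = k ` X" and BS: "B (Suc n) = i ` K n" for n by (simp_all add: K_def B_def)
 have KB: "K n <= free_on A (B n)" for n by (cases n) (auto simp: K0 KS)
 have ii: "?ii (i v) = v" if "v : K n" for v n using that KB[of n] fs_mono[of "B n" UNIV "carrier A"] by (intro the_inv_into_f_f[OF i]) auto
 have d: "?ii b : K n" if "b : B (Suc n)" for b n using that ii unfolding BS by auto
 have d': "?ii b : free_on A (B n)" if "b : B (Suc n)" for b n using d[OF that] KB by blast
 have e: "?e b : X" "b : B 0 ==> k (?e b) = b" if "b : B 0" for b using that the_inv_into_f_f[OF k] unfolding B0 by auto
 have e_lin: "lin_map A (free_on A (B 0)) (free_smult A) X s (%v. lincomb s v ?e)" by (rule lincomb_lin_map[OF X e(1)])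
 have subK: "submod A (free_on A (B n)) (free_smult A) (K n)" for n
 proof (cases n)
  case 0
  then show ?thesis using submod_preimage[OF free_mod[OF R] e_lin D] by (simp add: K0)
 next
  case (Suc m)
  have "submod A (free_on A (B (Suc m))) (free_smult A) {v : free_on A (B (Suc m)). rmul A v ?ii : {0}}" by (rule submod_preimage[OF free_mod[OF R] ap_lin_map[OF R d'] submod_0[OF free_mod[OF R]]])
  then show ?thesis by (simp add: Suc KS)
 qed
 have img: "rmul A w ?ii : K n" if "w : free_on A (B (Suc n))" for w n unfolding ap_lincomb by (rule submod_lincomb_in[OF free_mod[OF R] subK that d])
 have surj: "EX w:free_on A (B (Suc n)). v = rmul A w ?ii" if v: "v : K n" for v n
 proof
  show "single (i v) (one A) : free_on A (B (Suc n))" using v by (intro fs_basis[OF R]) (auto simp: BS)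
  have "?ii (i v) : free_on A (B n)" using v ii KB by auto
  then show "v = rmul A (single (i v) (one A)) ?ii" unfolding ap_lincomb using lincomb_one[OF free_mod[OF R], of ?ii "i v"] ii[OF v] by simp
 qed
 have "EX v:free_on A (B 0). x - lincomb s v ?e : D" if x: "x : X" for x
 proof
  show "single (k x) (one A) : free_on A (B 0)" using x by (intro fs_basis[OF R]) (auto simp: B0)
  show "x - lincomb s (single (k x) (one A)) ?e : D" using lincomb_one[OF X, of ?e "k x"] the_inv_into_f_f[OF k x] x subgrp_0[OF submodD(1)[OF D]] by simp
 qed
 moreover have "lincomb s v ?e : D <-> (EX w:free_on A (B 1). v = rmul A w ?ii)" if "v : free_on A (B 0)" for v using that surj[of v 0] img[of _ 0] by (auto simp: K0)
 moreover have "fcx A B (%n. ?ii)" unfolding fcx_def using R d' d KS by blast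
 moreover have "ex_at (mult (opp A)) (carrier A) B (%n. ?ii) n" for n unfolding ex_at_def using surj[of _ "Suc n"] by (auto simp: KS)
 ultimately have "fres A X s D B (%n. ?ii) ?e" using X D e(1) by (simp add: fres_def)
 then show ?thesis by blast
qed

section \<open>Bounds on projective dimension through splittings\<close>

lemma infinite_lists [simp]: "infinite (UNIV :: 'u list set)" by (rule infinite_UNIV_listI)

text \<open>The bound expressed is \<open>n + 1\<close>: a splitting at \<open>n\<close> makes the
  image of \<open>d n\<close> projective, and this image is the term of degree \<open>n + 1\<close>
  of a finite resolution. Only the existence of some bound matters in the end. The index type is
  large enough for a free resolution of \<open>X/D\<close>.\<close>

definition pdle :: "('a::ab_group_add, 's) ring_scheme => 'x::ab_group_add set => ('a => 'x => 'x) => 'x set => nat => bool" where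
 "pdle A X s D n <-> (EX (B :: nat => ('a * 'x) list set) d e. fres A X s D B d e & freg A B d n)"

lemma fres_exists_list:
 fixes A :: "('a::ab_group_add, 's) ring_scheme" and X :: "'x::ab_group_add set"
 assumes X: "mod_on A X s" and D: "submod A X s D"
 shows "EX (B :: nat => ('a * 'x) list set) d e. fres A X s D B d e"
proof -
 have "inj_on (%a::'a. [(a, undefined::'x)]) (carrier A)" "inj_on (%x::'x. [(undefined::'a, x)]) X" by (auto intro: inj_onI)
 then show ?thesis using fs_inj[OF infinite_lists, of "%a::'a. [(a, undefined::'x)]" "carrier A" "%b::('a * 'x) list. b" UNIV]
   fres_exists[OF X D] by auto
qed

lemma pdleI:
 fixes A :: "('a::ab_group_add, 's) ring_scheme" and X :: "'x::ab_group_add set"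
 assumes "pres A X s D P t d e" "preg A P t d n" shows "pdle A X s D n"
proof -
 obtain B :: "nat => ('a * 'x) list set" and d' e' where F: "fres A X s D B d' e'" using fres_exists_list[OF presD(1,2)[OF assms(1)]] by blast
 have "freg A B d' n" unfolding freg_preg[OF fresD(3)[OF F]] by (rule preg_transfer[OF fres_pres[OF F] assms])
 then show ?thesis using F by (auto simp: pdle_def)
qed

lemma pdle_preg:
 fixes A :: "('a::ab_group_add, 's) ring_scheme" and X :: "'x::ab_group_add set"
 assumes "pdle A X s D n" "pres A X s D P t d e" shows "preg A P t d n"
proof -
 from assms(1) obtain B :: "nat => ('a * 'x) list set" and d' e' where
  F: "fres A X s D B d' e'" "freg A B d' n" by (auto simp: pdle_def)
 show ?thesis using F(2) unfolding freg_preg[OF fresD(3)[OF F(1)]] by (rule preg_transfer[OF assms(2) fres_pres[OF F(1)]])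
qed

lemma pdle_freg:
 assumes "pdle A X s D n" and F: "fres A X s D B d e" shows "freg A B d n" unfolding freg_preg[OF fresD(3)[OF F]] by (rule pdle_preg[OF assms(1) fres_pres[OF F]])

lemma pdle_fresI:
 assumes F: "fres A X s D B d e" and "freg A B d n" shows "pdle A X s D n" using assms(2) unfolding freg_preg[OF fresD(3)[OF F]] by (rule pdleI[OF fres_pres[OF F]])

lemma pdle_mono:
 fixes A :: "('a::ab_group_add, 's) ring_scheme" and X :: "'x::ab_group_add set"
 assumes "pdle A X s D n" "n <= m" shows "pdle A X s D m"
proof -
 from assms(1) obtain B :: "nat => ('a * 'x) list set" and d' e' where
  F: "fres A X s D B d' e'" by (auto simp: pdle_def)
 show ?thesis by (rule pdleI[OF fres_pres[OF F] preg_mono[OF fres_pres[OF F] pdle_preg[OF assms(1) fres_pres[OF F]] assms(2)]])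
qed

lemma pdle_mod: "pdle A X s D n ==> mod_on A X s" "pdle A X s D n ==> submod A X s D" unfolding pdle_def using fresD by blast+

lemma pdle_retract:
 fixes A :: "('a::ab_group_add, 's) ring_scheme" and X :: "'x::ab_group_add set" and X' :: "'y::ab_group_add set"
 assumes "pdle A X' s' D' n" "mod_on A X s" "submod A X s D"
  and f: "lin_map A X s X' s' f" and fD: "!!x. x : D ==> f x : D'"
  and g: "lin_map A X' s' X s g" and gD: "!!x. x : D' ==> g x : D"
  and gf: "!!x. x : X ==> g (f x) - x : D"
 shows "pdle A X s D n"
proof -
 obtain B :: "nat => ('a * 'x) list set" and d e where F: "fres A X s D B d e" using fres_exists_list[OF assms(2,3)] by blast
 obtain B' :: "nat => ('a * 'y) list set" and d' e' where F': "fres A X' s' D' B' d' e'" "freg A B' d' n" using assms(1) by (auto simp: pdle_def)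
 show ?thesis by (rule pdleI[OF fres_pres[OF F] preg_retract[OF fres_pres[OF F] fres_pres[OF F'(1)] f fD g gD gf
      pdle_preg[OF assms(1) fres_pres[OF F'(1)]]]])
qed

text \<open>\<open>f\<close> induces an isomorphism from \<open>X/D\<close> to \<open>X'/D'\<close>,
  so only the augmentation changes.\<close>

lemma pres_push:
 assumes P: "pres A X s D P t d e" and f: "lin_map A X s X' s' f" and X': "mod_on A X' s'" and D': "submod A X' s' D'"
  and iff: "!!x. x : X ==> f x : D' <-> x : D" and surj: "!!y. y : X' ==> EX x:X. y - f x : D'"
 shows "pres A X' s' D' P t d (%p. f (e p))"
proof -
 note Q = presD[OF P]
 have ker: "f (e p) : D' <-> p : d 0 ` P 1" if "p : P 0" for p using P iff lin_mapD(2)[OF Q(6) that] that by (simp add: pres_def)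
 have "EX p:P 0. y - f (e p) : D'" if y: "y : X'" for y
 proof -
  obtain x where x: "x : X" "y - f x : D'" using surj[OF y] by blast
  obtain p where p: "p : P 0" "x - e p : D" using Q(7)[OF x(1)] by blast
  have ep: "e p : X" using lin_mapD(2)[OF Q(6) p(1)] .
  have "f (x - e p) : D'" using iff p(2) submodD(2)[OF Q(2)] by blast
  then have "f x - f (e p) : D'" using lin_map_diff[OF f mod_onD(2)[OF Q(1)] x(1) ep] by simp
  from subgrp_add[OF submodD(1)[OF D'] x(2) this] show ?thesis using p(1) by (intro bexI[of _ p]) simp_all
 qed
 then show ?thesis using P X' D' ker lin_map_comp[OF Q(6) f] by (simp add: pres_def)
qed

lemma pdle_iso:
 fixes A :: "('a::ab_group_add, 's) ring_scheme" and X :: "'x::ab_group_add set" and X' :: "'y::ab_group_add set"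
 assumes X: "mod_on A X s" and D: "submod A X s D"
  and f: "lin_map A X s X' s' f" and X': "mod_on A X' s'" and D': "submod A X' s' D'"
  and iff: "!!x. x : X ==> f x : D' <-> x : D" and surj: "!!y. y : X' ==> EX x:X. y - f x : D'"
 shows "pdle A X s D n <-> pdle A X' s' D' n"
proof -
 obtain B :: "nat => ('a * 'x) list set" and d e where F: "fres A X s D B d e" using fres_exists_list[OF X D] by blast
 note P = fres_pres[OF F]
 note P' = pres_push[OF P f X' D' iff surj]
 show ?thesis using pdle_preg[OF _ P] pdle_preg[OF _ P'] pdleI[OF P] pdleI[OF P'] by blast
qed

text \<open>In the exact sequence of \<open>L/D\<close>, \<open>X/D\<close> and \<open>X/L\<close>
  the first two have finite projective dimension; the cone of a chain map over the inclusion
  resolves the third and inherits a splitting from theirs.\<close>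

lemma pdle_cone:
 fixes A :: "('a::ab_group_add, 's) ring_scheme" and X :: "'x::ab_group_add set"
 assumes D: "submod A X s D" and DL: "D <= L" and L: "submod A X s L"
  and m: "pdle A L s D m" and n: "pdle A X s D n"
 shows "EX k. pdle A X s L k"
proof -
 have X: "mod_on A X s" using pdle_mod[OF n] by blast
 obtain B :: "nat => ('a * 'x) list set" and d e where P: "fres A L s D B d e" using m by (auto simp: pdle_def)
 obtain B' :: "nat => ('a * 'x) list set" and d' e' where Q: "fres A X s D B' d' e'" using n by (auto simp: pdle_def)
 define P where "P n = free_on A (B n)" for n
 define Q where "Q n = free_on A (B' n)" for n
 define t :: "'a => (('a * 'x) list => 'a) => ('a * 'x) list => 'a" where "t = free_smult A"
 define dz where "dz n v = rmul A v (d n)" for n v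
 define dz' where "dz' n v = rmul A v (d' n)" for n v
 define ez where "ez v = lincomb s v e" for v
 define ez' where "ez' v = lincomb s v e'" for v
 have P0: "pres A L s D P (%n. t) dz ez" and Q0: "pres A X s D Q (%n. t) dz' ez'" using fres_pres[OF P] fres_pres[OF Q] by (simp_all add: P_def[abs_def] Q_def[abs_def] t_def dz_def[abs_def] dz'_def[abs_def] ez_def[abs_def] ez'_def[abs_def])
 note P = presD[OF P0] and Q = presD[OF Q0]
 note sX = mod_onD(2)[OF X] and sP = mod_onD(2)[OF P(4)] and sQ = mod_onD(2)[OF Q(4)]
 note sD = submodD(1)[OF D] and sL = submodD(1)[OF L]
 note dP = lin_mapD(2)[OF P(5)] and dQ = lin_mapD(2)[OF Q(5)]
 have LX: "L <= X" using submodD(2)[OF L] by blast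
 \<comment> \<open>In degree \<open>n\<close> the cone consists of \<open>Q n\<close> and
   \<open>P (n - 1)\<close>, so splittings are needed at neighbouring places, \<open>N\<close> for
   \<open>P\<close> and \<open>Suc N\<close> for \<open>Q\<close>.\<close>
 define N where "N = max m n"
 have mN: "m <= N" "n <= Suc N" by (simp_all add: N_def)
 obtain \<sigma> where \<sigma>: "lin_map A (P N) t (P (Suc N)) t \<sigma>" "!!p. p : P (Suc N) ==> dz N (\<sigma> (dz N p)) = dz N p" using pdle_preg[OF pdle_mono[OF m mN(1)] P0] by (auto simp: preg_def)
 obtain \<tau> where \<tau>: "lin_map A (Q (Suc N)) t (Q (Suc (Suc N))) t \<tau>"
  "!!p. p : Q (Suc (Suc N)) ==> dz' (Suc N) (\<tau> (dz' (Suc N) p)) = dz' (Suc N) p" using pdle_preg[OF pdle_mono[OF n mN(2)] Q0] by (auto simp: preg_def)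
 obtain F where F: "!!n. lin_map A (P n) t (Q n) t (F n)" "!!p. p : P 0 ==> ez p - ez' (F 0 p) : D"
  "!!n p. p : P (Suc n) ==> dz' n (F (Suc n) p) = F n (dz n p)" using chain_map_exists[OF P0 Q0 lin_map_incl[OF LX]] by blast
 note Fin = lin_mapD(2)[OF F(1)]
 \<comment> \<open>The second factor is shifted by one; in degree 0 it is the zero group, so that
   all terms have one type.\<close>
 define C where "C n = Q n \<times> (case n of 0 => {0} | Suc m => P m)" for n
 define u where "u n = prod_smult t (case n of 0 => (%a x. 0) | Suc m => t)" for n :: nat
 define \<Delta> where "\<Delta> n x = (dz' n (fst x) + F n (snd x), case n of 0 => 0 | Suc m => - dz m (snd x))" for n x
 have C0: "C 0 = Q 0 \<times> {0}" "u 0 = prod_smult t (%a x. 0)" "!!x. \<Delta> 0 x = (dz' 0 (fst x) + F 0 (snd x), 0)"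
  and CS: "!!n. C (Suc n) = Q (Suc n) \<times> P n" "!!n. u (Suc n) = prod_smult t t"
   "!!n x. \<Delta> (Suc n) x = (dz' (Suc n) (fst x) + F (Suc n) (snd x), - dz n (snd x))" by (simp_all add: C_def u_def \<Delta>_def)
 have lin1: "lin_map A (C (Suc n)) (u (Suc n)) (Q n) t (%x. dz' n (fst x) + F n (snd x))" for n unfolding CS by (intro lin_map_add_fun[OF Q(4)] lin_map_comp[OF lin_map_fst Q(5)] lin_map_comp[OF lin_map_snd F(1)])
 have lin2: "lin_map A (C (Suc (Suc n))) (u (Suc (Suc n))) (P n) t (%x. - dz n (snd x))" for n using lin_map_diff_fun[OF P(4) lin_map_zero[OF P(4)] lin_map_comp[OF lin_map_snd P(5)]] unfolding CS by simp
 have pC: "proj A (C n) (u n)" for n by (cases n) (auto simp: C0 CS intro!: proj_prod P(3) Q(3) proj_zero mod_onD(1)[OF X])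
 have pres: "pres A X s L C u \<Delta> (%x. ez' (fst x))" unfolding pres_def
 proof (intro conjI allI ballI X L pC)
  show "lin_map A (C (Suc n)) (u (Suc n)) (C n) (u n) (\<Delta> n)" for n
  proof (cases n)
   case 0
   have "lin_map A (C (Suc 0)) (u (Suc 0)) {0} (%a x. 0) (%x. 0)" by (auto simp: lin_map_def additive_on_def)
   from lin_map_Pair[OF lin1 this] show ?thesis unfolding 0 C0(1,2) C0(3)[abs_def] .
  next
   case (Suc m)
   show ?thesis using lin_map_Pair[OF lin1[of n] lin2[of m, folded Suc]] unfolding Suc CS(1,2) CS(3)[abs_def] .
  qed
  show "lin_map A (C 0) (u 0) X s (%x. ez' (fst x))" unfolding C0 by (rule lin_map_comp[OF lin_map_fst Q(6)])
  show "EX p:C 0. x - ez' (fst p) : L" if "x : X" for x using Q(7)[OF that] DL by (force simp: C0)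
  fix p assume "p : C 0"
  then obtain q where q: "p = (q, 0)" "q : Q 0" by (auto simp: C0)
  show "ez' (fst p) : L <-> p : \<Delta> 0 ` C 1"
  proof
   assume "ez' (fst p) : L"
   then obtain y where y: "y : P 0" "ez' q - ez y : D" using P(7) q by auto
   have "ez' (q - F 0 y) = (ez' q - ez y) + (ez y - ez' (F 0 y))" using lin_map_diff[OF Q(6) sQ q(2) Fin[OF y(1)]] by simp
   also have "... : D" using subgrp_add[OF sD y(2) F(2)[OF y(1)]] .
   finally obtain z where z: "z : Q 1" "q - F 0 y = dz' 0 z" using Q(8) subgrp_diff[OF sQ q(2) Fin[OF y(1)]] by blast
   then have "p = \<Delta> 0 (z, y)" "(z, y) : C 1" using q y CS[of 0] by (auto simp: C0 algebra_simps)
   then show "p : \<Delta> 0 ` C 1" by blast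
  next
   assume "p : \<Delta> 0 ` C 1"
   then obtain z y where zy: "z : Q 1" "y : P 0" "q = dz' 0 z + F 0 y" using q CS[of 0] by (auto simp: C0)
   have "ez y - ez' (F 0 y) : L" using F(2)[OF zy(2)] DL by blast
   from subgrp_diff[OF sL lin_mapD(2)[OF P(6) zy(2)] this] have Fy: "ez' (F 0 y) : L" by simp
   have "ez' q = ez' (dz' 0 z) + ez' (F 0 y)" using lin_mapD(4)[OF Q(6) dQ Fin[OF zy(2)], of z] zy by simp
   also have "... : L" using Q(9)[OF zy(1)] DL Fy by (intro subgrp_add[OF sL]) auto
   finally show "ez' (fst p) : L" using q by simp
  qed
 next
  fix n p assume "p : C (Suc n)"
  then obtain q y where p: "p = (q, y)" "q : Q (Suc n)" "y : P n" by (auto simp: CS)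
  show "\<Delta> n p = 0 <-> p : \<Delta> (Suc n) ` C (Suc (Suc n))"
  proof
   assume "\<Delta> n p = 0"
   then have e1: "dz' n q + F n y = 0" and e2: "n = Suc m ==> dz m y = 0" for m by (auto simp: \<Delta>_def p prod_eq_iff)
   have "EX z:P (Suc n). y = dz n z"
   proof (cases n)
    case 0
    have y0: "y : P 0" using p 0 by simp
    have "ez y = (ez y - ez' (F 0 y)) + ez' (- dz' 0 q)" using e1 0 eq_neg_iff_add_eq_0[of "F 0 y" "dz' 0 q"] by (simp add: add.commute)
    also have "... = (ez y - ez' (F 0 y)) - ez' (dz' 0 q)" using lin_map_uminus[OF Q(6) sQ dQ, of q] p 0 by simp
    also have "... : D" using subgrp_diff[OF sD F(2)[OF y0] Q(9)] p 0 by simp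
    finally show ?thesis using P(8)[OF y0] 0 by simp
   next
    case (Suc m) then show ?thesis using P(10) e2[OF Suc] p by blast
   qed
   then obtain z where z: "z : P (Suc n)" "y = dz n z" by blast
   let ?q = "q + F (Suc n) z"
   have Fz: "F (Suc n) z : Q (Suc n)" using Fin[OF z(1)] .
   have "dz' n ?q = 0" using lin_mapD(4)[OF Q(5) p(2) Fz] F(3)[OF z(1)] z(2) e1 by simp
   then obtain w where w: "w : Q (Suc (Suc n))" "?q = dz' (Suc n) w" using Q(10) subgrp_add[OF sQ p(2) Fz] by blast
   have "p = \<Delta> (Suc n) (w, - z)" "(w, - z) : C (Suc (Suc n))" using w z p lin_map_uminus[OF F(1) sP z(1)] lin_map_uminus[OF P(5) sP z(1)] subgrp_uminus[OF sP z(1)] by (auto simp: CS algebra_simps)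
   then show "p : \<Delta> (Suc n) ` C (Suc (Suc n))" by blast
  next
   assume "p : \<Delta> (Suc n) ` C (Suc (Suc n))"
   then obtain w z where wz: "w : Q (Suc (Suc n))" "z : P (Suc n)" "q = dz' (Suc n) w + F (Suc n) z" "y = - dz n z" using p by (auto simp: CS)
   have "dz' n q + F n y = 0" using wz lin_mapD(4)[OF Q(5) dQ[OF wz(1)] Fin[OF wz(2)]] Q(11)[OF wz(1)] F(3)[OF wz(2)]
     lin_map_uminus[OF F(1) sP dP[OF wz(2)]] by simp
   moreover have "dz m y = 0" if "n = Suc m" for m using wz that lin_map_uminus[OF P(5) sP dP[OF wz(2)[unfolded that]]] P(11)[of z m] by simp
   ultimately show "\<Delta> n p = 0" by (cases n) (auto simp: \<Delta>_def p prod_eq_iff)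
  qed
 qed
 \<comment> \<open>The splittings \<open>\<tau>\<close> and \<open>- \<sigma>\<close> on the
   diagonal, with an off-diagonal term that compensates for \<open>F\<close> in the differential of
   the cone.\<close>
 let ?S = "%x. (\<tau> (fst x) + \<tau> (F (Suc N) (\<sigma> (snd x))), - \<sigma> (snd x))"
 have S: "lin_map A (C (Suc N)) (u (Suc N)) (C (Suc (Suc N))) (u (Suc (Suc N))) ?S"
 proof -
  have 1: "lin_map A (Q (Suc N) \<times> P N) (prod_smult t t) (Q (Suc (Suc N))) t (%x. \<tau> (fst x) + \<tau> (F (Suc N) (\<sigma> (snd x))))" by (intro lin_map_add_fun[OF Q(4)] lin_map_comp[OF lin_map_fst \<tau>(1)]
     lin_map_comp[OF lin_map_comp[OF lin_map_comp[OF lin_map_snd \<sigma>(1)] F(1)] \<tau>(1)])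
  have 2: "lin_map A (Q (Suc N) \<times> P N) (prod_smult t t) (P (Suc N)) t (%x. - \<sigma> (snd x))" using lin_map_diff_fun[OF P(4) lin_map_zero[OF P(4)] lin_map_comp[OF lin_map_snd \<sigma>(1)]] by simp
  show ?thesis unfolding CS using lin_map_Pair[OF 1 2] .
 qed
 have "\<Delta> (Suc N) (?S (\<Delta> (Suc N) x)) = \<Delta> (Suc N) x" if xC: "x : C (Suc (Suc N))" for x
 proof -
  obtain b a where x: "x = (b, a)" "b : Q (Suc (Suc N))" "a : P (Suc N)" using xC by (auto simp: CS)
  let ?d = "dz' (Suc N)" and ?f = "F (Suc N)" and ?da = "dz N a"
  have da: "?da : P N" using dP[OF x(3)] .
  have sda: "\<sigma> ?da : P (Suc N)" using lin_mapD(2)[OF \<sigma>(1) da] .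
  have fa: "?f a : Q (Suc N)" and fsda: "?f (\<sigma> ?da) : Q (Suc N)" and db: "?d b : Q (Suc N)" using Fin x(3) sda dQ[OF x(2)] by auto
  note \<tau>in = lin_mapD(2)[OF \<tau>(1)]
  have \<sigma>m: "\<sigma> (- ?da) = - \<sigma> ?da" by (rule lin_map_uminus[OF \<sigma>(1) sP da])
  have fm: "?f (- \<sigma> ?da) = - ?f (\<sigma> ?da)" by (rule lin_map_uminus[OF F(1) sP sda])
  have \<tau>m: "\<tau> (- ?f (\<sigma> ?da)) = - \<tau> (?f (\<sigma> ?da))" by (rule lin_map_uminus[OF \<tau>(1) sQ fsda])
  have \<tau>a: "\<tau> (?d b + ?f a) = \<tau> (?d b) + \<tau> (?f a)" by (rule lin_mapD(4)[OF \<tau>(1) db fa])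
  have d3: "?d (\<tau> (?d b) + \<tau> (?f a) - \<tau> (?f (\<sigma> ?da))) = ?d (\<tau> (?d b)) + ?d (\<tau> (?f a)) - ?d (\<tau> (?f (\<sigma> ?da)))" using lin_map_diff[OF Q(5) sQ subgrp_add[OF sQ \<tau>in[OF db] \<tau>in[OF fa]] \<tau>in[OF fsda]]
    lin_mapD(4)[OF Q(5) \<tau>in[OF db] \<tau>in[OF fa]] by simp
  text \<open>\<open>f (a - \<sigma> d a)\<close> is a cycle, hence a boundary, and \<open>d \<tau>\<close> is the identity on boundaries.\<close>
  have "dz N (a - \<sigma> ?da) = 0" using lin_map_diff[OF P(5) sP x(3) sda] \<sigma>(2)[OF x(3)] by simp
  then have "dz' N (?f (a - \<sigma> ?da)) = 0" using F(3)[OF subgrp_diff[OF sP x(3) sda]] lin_map_0[OF F(1) sP] by simp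
  then obtain z where z: "z : Q (Suc (Suc N))" "?f (a - \<sigma> ?da) = ?d z" using Q(10) Fin[OF subgrp_diff[OF sP x(3) sda]] by blast
  have "?d (\<tau> (?f (a - \<sigma> ?da))) = ?f (a - \<sigma> ?da)" using \<tau>(2)[OF z(1)] z(2) by simp
  then have key: "?d (\<tau> (?f a)) - ?d (\<tau> (?f (\<sigma> ?da))) = ?f a - ?f (\<sigma> ?da)" using lin_map_diff[OF F(1) sP x(3) sda] lin_map_diff[OF \<tau>(1) sQ fa fsda]
    lin_map_diff[OF Q(5) sQ \<tau>in[OF fa] \<tau>in[OF fsda]] by simp
  have "?d (\<tau> (?d b) + \<tau> (?f a) - \<tau> (?f (\<sigma> ?da))) + ?f (\<sigma> ?da)
   = ?d b + (?d (\<tau> (?f a)) - ?d (\<tau> (?f (\<sigma> ?da)))) + ?f (\<sigma> ?da)" unfolding d3 \<tau>(2)[OF x(2)] by simp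
  also have "... = ?d b + ?f a" unfolding key by simp
  finally show ?thesis using \<sigma>(2)[OF x(3)] lin_map_uminus[OF P(5) sP sda] by (simp add: CS x \<sigma>m fm \<tau>m \<tau>a)
 qed
 then have "preg A C u \<Delta> (Suc N)" using S by (auto simp: preg_def)
 then show ?thesis using pdleI[OF pres] by blast
qed

section \<open>Tensor products with free modules and Tor\<close>

subsection \<open>Base change\<close>

lemma fs_map:
 assumes "v : fs N B" "\<rho> 0 = 0" "!!n. n : N ==> \<rho> n : N'"
 shows "(%b. \<rho> (v b)) : fs N' B"
proof -
 have "{b. \<rho> (v b) ~= 0} <= {b. v b ~= 0}" using assms(2) by auto
 then have "finite {b. \<rho> (v b) ~= 0}" using fsD(1)[OF assms(1)] finite_subset by blast
 then show ?thesis using assms fsD(2,3)[OF assms(1)] by (auto simp: fs_def)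
qed

text \<open>Additivity of \<open>\<rho>\<close> and compatibility with scalars along
  \<open>\<kappa>\<close> carry the argument. It therefore covers ring homomorphisms, the
  projections of a split extension to its two components, and the action of one scalar on a
  bimodule.\<close>

lemma map_ap:
 assumes N: "mod_on (opp A) N s" and N': "mod_on (opp A') N' s'" and \<rho>: "additive_on N \<rho>" "!!n. n : N ==> \<rho> n : N'"
  and \<kappa>: "!!r. r : carrier A ==> \<kappa> r : carrier A'" and eq: "!!r n. r : carrier A ==> n : N ==> \<rho> (s r n) = s' (\<kappa> r) (\<rho> n)"
  and v: "v : fs N B" and d: "!!b. b : B ==> d b : free_on A J"
 shows "\<rho> (ap s v d j) = ap s' (%b. \<rho> (v b)) (%b j. \<kappa> (d b j)) j"
proof -
 have \<rho>0: "\<rho> 0 = 0" using additive_on_0[OF \<rho>(1) mod_onD(2)[OF N]] .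
 have "\<rho> (ap s v d j) = (\<Sum>b | v b ~= 0. \<rho> (s (d b j) (v b)))" unfolding ap_def lincomb_def using mod_onD(4)[OF N] fsD(2)[OF v] fsD(2)[OF d] fs_supp[OF v] by (intro additive_on_sum[OF \<rho>(1) mod_onD(2)[OF N]]) auto
 also have "... = (\<Sum>b | v b ~= 0. s' (\<kappa> (d b j)) (\<rho> (v b)))" using eq fsD(2)[OF v] fsD(2)[OF d] fs_supp[OF v] by (intro sum.cong) auto
 also have "... = ap s' (%b. \<rho> (v b)) (%b j. \<kappa> (d b j)) j" unfolding ap_def using fsD(1)[OF v] fsD(2)[OF d] fs_supp[OF v] \<rho>0 mod_on_0(2)[OF N'] \<kappa> by (intro lincomb_superset[symmetric]) auto
 finally show ?thesis .
qed

definition ring_map :: "('a::ab_group_add, 's) ring_scheme => ('c::ab_group_add, 't) ring_scheme => ('a => 'c) => bool" where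
 "ring_map A A' \<rho> <-> additive_on (carrier A) \<rho> & (ALL x:carrier A. \<rho> x : carrier A') &
  (ALL x:carrier A. ALL y:carrier A. \<rho> (x \<otimes>\<^bsub>A\<^esub> y) = \<rho> x \<otimes>\<^bsub>A'\<^esub> \<rho> y)"

lemma ring_mapD:
 assumes "ring_map A A' \<rho>"
 shows "additive_on (carrier A) \<rho>" "x : carrier A ==> \<rho> x : carrier A'"
  "x : carrier A ==> y : carrier A ==> \<rho> (x \<otimes>\<^bsub>A\<^esub> y) = \<rho> x \<otimes>\<^bsub>A'\<^esub> \<rho> y" using assms by (auto simp: ring_map_def)

lemma rmul_map:
 assumes A: "ring_on A" and A': "ring_on A'" and \<rho>: "ring_map A A' \<rho>"
  and v: "v : free_on A B" and d: "!!b. b : B ==> d b : free_on A J"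
 shows "rmul A' (%b. \<rho> (v b)) (%b j. \<rho> (d b j)) = (%j. \<rho> (rmul A v d j))" by (rule ext, rule map_ap[OF mod_on_self_opp[OF A] mod_on_self_opp[OF A'] ring_mapD(1)[OF \<rho>], symmetric])
  (use v d ring_mapD[OF \<rho>] in auto)

lemma fs_ring_map:
 assumes A: "ring_on A" and \<rho>: "ring_map A A' \<rho>" and v: "v : free_on A B"
 shows "(%b. \<rho> (v b)) : free_on A' B" using fs_map[OF v, of \<rho>] additive_on_0[OF ring_mapD(1)[OF \<rho>] ring_onD(1)[OF A]] ring_mapD(2)[OF \<rho>] by blast

lemma freg_base_change:
 assumes c: "fcx A B d" and A': "ring_on A'" and \<rho>: "ring_map A A' \<rho>" and reg: "freg A B d n"
 shows "freg A' B (%n b j. \<rho> (d n b j)) n"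
proof -
 have A: "ring_on A" using fcxD(1)[OF c] .
 note map = rmul_map[OF A A' \<rho>] and fsm = fs_ring_map[OF A \<rho>] and N = mod_on_self_opp[OF A]
 from reg obtain a where a: "!!b. b : B n ==> a b : free_on A (B (Suc n))"
  "!!b. b : B (Suc n) ==> rmul A (rmul A (d n b) a) (d n) = d n b" by (auto simp: freg_def)
 have "rmul A' (rmul A' (%j. \<rho> (d n b j)) (%b j. \<rho> (a b j))) (%b j. \<rho> (d n b j)) = (%j. \<rho> (d n b j))" if b: "b : B (Suc n)" for b using map[OF fcxD(2)[OF c b] a(1)] map[OF ap_in[OF N fcxD(2)[OF c b] a(1)] fcxD(2)[OF c]] a(2)[OF b] by simp
 then show ?thesis unfolding freg_def using fsm[OF a(1)] by (intro exI[of _ "%b j. \<rho> (a b j)"]) auto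
qed

lemma fcx_base_change:
 assumes c: "fcx A B d" and A': "ring_on A'" and \<rho>: "ring_map A A' \<rho>"
 shows "fcx A' B (%n b j. \<rho> (d n b j))"
proof -
 have A: "ring_on A" using fcxD(1)[OF c] .
 have "rmul A' (%j. \<rho> (d (Suc n) b j)) (%b j. \<rho> (d n b j)) = 0" if "b : B (Suc (Suc n))" for n b using rmul_map[OF A A' \<rho> fcxD(2)[OF c that] fcxD(2)[OF c]]
   fcxD(3)[OF c that] additive_on_0[OF ring_mapD(1)[OF \<rho>] ring_onD(1)[OF A]] by (simp add: zero_fun_def)
 then show ?thesis unfolding fcx_def using A' fs_ring_map[OF A \<rho> fcxD(2)[OF c]] by blast
qed

subsection \<open>Double complexes\<close>

text \<open>The statement \<open>S p q\<close> moves along the antidiagonal, from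
  \<open>(p, q + 1)\<close> to \<open>(p + 1, q)\<close>, by a diagram chase with exact rows and
  columns. It starts at \<open>(0, i + 1)\<close> with hypothesis \<open>A\<close> and ends at
  \<open>(i + 1, 0)\<close>, which exchanges the roles of the two directions.\<close>

lemma double_complex_staircase:
 fixes K :: "nat => nat => 'k::ab_group_add set"
 assumes sub: "!!p q. subgrp (K p q)"
  and dh: "!!p q. additive_on (K (Suc p) q) (dh p)" "!!p q x. x : K (Suc p) q ==> dh p x : K p q"
  and dv: "!!p q. additive_on (K p (Suc q)) (dv q)" "!!p q x. x : K p (Suc q) ==> dv q x : K p q"
  and dhdh: "!!p q x. x : K (Suc (Suc p)) q ==> dh p (dh (Suc p) x) = 0"
  and dvdv: "!!p q x. x : K p (Suc (Suc q)) ==> dv q (dv (Suc q) x) = 0"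
  and comm: "!!p q x. x : K (Suc p) (Suc q) ==> dh p (dv q x) = dv q (dh p x)"
  and rows: "!!p q x. x : K (Suc p) q ==> dh p x = 0 ==> EX w:K (Suc (Suc p)) q. x = dh (Suc p) w"
  and cols: "!!p q x. x : K p (Suc q) ==> dv q x = 0 ==> EX w:K p (Suc (Suc q)). x = dv (Suc q) w"
  and A: "!!x z. x : K 0 (Suc i) ==> z : K 1 i ==> dv i x = dh 0 z ==>
   EX y:K 0 (Suc (Suc i)). EX z:K 1 (Suc i). x = dv (Suc i) y + dh 0 z"
  and x: "x : K (Suc i) 0" and z: "z : K i 1" and eq: "dh i x = dv 0 z"
 shows "EX y:K (Suc (Suc i)) 0. EX z:K (Suc i) 1. x = dh (Suc i) y + dv 0 z"
proof -
 \<comment> \<open>Off the edges each boundary of \<open>x\<close> has to come from the other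
   direction; on an edge the corresponding condition is void.\<close>
 define S where "S p q <-> (ALL x:K p q. (ALL p'. p = Suc p' --> (EX y:K p' (Suc q). dh p' x = dv q y)) -->
  (ALL q'. q = Suc q' --> (EX w:K (Suc p) q'. dv q' x = dh p w)) -->
  (EX y:K p (Suc q). EX z:K (Suc p) q. x = dv q y + dh p z))" for p q
 have S0: "S 0 (Suc i)" unfolding S_def using A by auto
 have step: "S (Suc p) q" if S: "S p (Suc q)" for p q unfolding S_def
 proof (intro ballI impI)
  fix x assume x: "x : K (Suc p) q" and "ALL p'. Suc p = Suc p' --> (EX y:K p' (Suc q). dh p' x = dv q y)"
  then obtain y where y: "y : K p (Suc q)" "dh p x = dv q y" by auto
  have "EX y':K p' (Suc (Suc q)). dh p' y = dv (Suc q) y'" if p': "p = Suc p'" for p'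
  proof (rule cols)
   show "dh p' y : K p' (Suc q)" using dh(2) y p' by blast
   show "dv q (dh p' y) = 0" using comm[of y p' q] y p' dhdh[of x p' q] x by simp
  qed
  moreover have "EX w:K (Suc p) q'. dv q' y = dh p w" if "Suc q = Suc q'" for q' using that x y by (intro bexI[of _ x]) auto
  \<comment> \<open>The statement at \<open>(p, q + 1)\<close> is applied to \<open>y\<close>
    instead of \<open>x\<close>; then \<open>x - dv q s\<close> is a cycle of its row.\<close>
  ultimately obtain t s where ts: "t : K p (Suc (Suc q))" "s : K (Suc p) (Suc q)" "y = dv (Suc q) t + dh p s" using S[unfolded S_def, rule_format, OF y(1)] by blast
  have dvs: "dv q s : K (Suc p) q" using dv(2) ts(2) .
  have "dh p (x - dv q s) = dv q y - dv q (dh p s)" using additive_on_diff[OF dh(1) sub x dvs] y(2) comm[OF ts(2)] by simp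
  also have "dv q y = dv q (dv (Suc q) t) + dv q (dh p s)" unfolding ts(3) by (rule additive_on_add[OF dv(1) dv(2)[OF ts(1)] dh(2)[OF ts(2)]])
  finally have "dh p (x - dv q s) = 0" using dvdv[OF ts(1)] by simp
  then obtain r where "r : K (Suc (Suc p)) q" "x - dv q s = dh (Suc p) r" using rows subgrp_diff[OF sub x dvs] by blast
  then show "EX y:K (Suc p) (Suc q). EX z:K (Suc (Suc p)) q. x = dv q y + dh (Suc p) z" using ts(2) by (metis add.commute diff_add_cancel)
 qed
 have "S p (Suc i - p)" if "p <= Suc i" for p using that
 proof (induction p)
  case (Suc p)
  then have "Suc (Suc i - Suc p) = Suc i - p" by simp
  then show ?case using step[of p "Suc i - Suc p"] Suc by simp
 qed (use S0 in simp)
 from this[of "Suc i"] have "S (Suc i) 0" by simp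
 then obtain y w where "y : K (Suc i) 1" "w : K (Suc (Suc i)) 0" "x = dv 0 y + dh (Suc i) w" unfolding S_def using x z eq by fastforce
 then show ?thesis by (metis add.commute)
qed

text \<open>The double complex of two free complexes has the matrices with index set
  \<open>C p \<times> B q\<close> as its terms. One differential multiplies from the right by
  \<open>d\<close>; the other one, \<open>rowm\<close>, acts on the row index and is the same
  operation over the opposite ring.\<close>

definition colm :: "('a::ab_group_add, 's) ring_scheme => ('c * 'b => 'a) => ('b => 'j => 'a) => 'c * 'j => 'a" where
 "colm A u d = (%(c, j). rmul A (%b. u (c, b)) d j)"

definition rowm :: "('a::ab_group_add, 's) ring_scheme => ('c * 'b => 'a) => ('c => 'j => 'a) => 'j * 'b => 'a" where
 "rowm A u d = (%(j, b). rmul (opp A) (%c. u (c, b)) d j)"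

lemma rowm_colm: "rowm A u d = (%x. colm (opp A) (%x. u (prod.swap x)) d (prod.swap x))" by (auto simp: rowm_def colm_def)

lemma fs_slice: assumes "u : fs N (C \<times> B)"
 shows "(%b. u (c, b)) : fs N B" "c \<notin> C ==> (%b. u (c, b)) = 0"
proof -
 have "{b. u (c, b) ~= 0} = snd ` ({x. u x ~= 0} \<inter> {c} \<times> UNIV)" by force
 then have "finite {b. u (c, b) ~= 0}" using fsD(1)[OF assms] by simp
 then show "(%b. u (c, b)) : fs N B" using fsD(2,3)[OF assms] by (auto simp: fs_def)
 show "c \<notin> C ==> (%b. u (c, b)) = 0" using fsD(3)[OF assms] by (auto simp: fun_eq_iff)
qed

lemma fs_swap: "u : fs N (C \<times> B) ==> (%x. u (prod.swap x)) : fs N (B \<times> C)"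
proof -
 assume u: "u : fs N (C \<times> B)"
 have "{x. u (prod.swap x) ~= 0} = prod.swap ` {x. u x ~= 0}" by force
 then have "finite {x. u (prod.swap x) ~= 0}" using fsD(1)[OF u] by simp
 then show ?thesis using fsD(2,3)[OF u] by (auto simp: fs_def)
qed

lemma fs_assemble:
 assumes N: "0 : N" and S: "finite S" "S <= C" and w: "!!c. c : S ==> w c : fs N B" and z: "!!c. c \<notin> S ==> w c = 0"
 shows "(%(c, b). w c b) : fs N (C \<times> B)"
proof -
 have "{x. (%(c, b). w c b) x ~= 0} <= (SIGMA c:S. {b. w c b ~= 0})" using z by force
 moreover have "finite (SIGMA c:S. {b. w c b ~= 0})" using S(1) fsD(1)[OF w] by (intro finite_SigmaI) auto
 ultimately have "finite {x. (%(c, b). w c b) x ~= 0}" using finite_subset by blast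
 moreover have "w c b : N" for c b using fsD(2)[OF w] z N by (cases "c : S") auto
 moreover have "w c b = 0" if "c \<notin> C \<or> b \<notin> B" for c b using that fsD(3)[OF w] z S(2) by (cases "c : S") auto
 ultimately show ?thesis by (auto simp: fs_def)
qed

lemma finite_fst_supp: "u : fs N (C \<times> B) ==> finite {c. (%b. u (c, b)) ~= 0}"
proof -
 assume u: "u : fs N (C \<times> B)"
 have "{c. (%b. u (c, b)) ~= 0} <= fst ` {x. u x ~= 0}" by (force simp: fun_eq_iff)
 then show ?thesis using fsD(1)[OF u] finite_subset by blast
qed

lemma colm_slice: "(%b. colm A u d (c, b)) = rmul A (%b. u (c, b)) d" by (simp add: colm_def)

lemma ap_zero_left [simp]: "ap s 0 d = 0" by (simp add: ap_def fun_eq_iff zero_fun_def)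

lemma colm_in:
 assumes A: "ring_on A" and u: "u : fs (carrier A) (C \<times> B)" and d: "!!b. b : B ==> d b : free_on A J"
 shows "colm A u d : fs (carrier A) (C \<times> J)" unfolding colm_def
proof (rule fs_assemble[of _ "{c. (%b. u (c, b)) ~= 0}"])
 show "0 : carrier A" using A ring_onD(1) subgrp_0 by blast
 show "{c. (%b. u (c, b)) ~= 0} <= C" using fs_slice(2)[OF u] by blast
 show "rmul A (%b. u (c, b)) d : free_on A J" for c by (rule ap_in[OF mod_on_self_opp[OF A] fs_slice(1)[OF u] d])
 show "rmul A (%b. u (c, b)) d = 0" if "c \<notin> {c. (%b. u (c, b)) ~= 0}" for c using that by simp
qed (rule finite_fst_supp[OF u])

lemma colm_additive:
 fixes C :: "'c set" and J :: "'j set"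
 assumes A: "ring_on A" and d: "!!b. b : B ==> d b : free_on A J"
 shows "additive_on (fs (carrier A) (C \<times> B)) (%u. colm A u d)" unfolding additive_on_def
proof (intro ballI ext)
 fix u v and x :: "'c * 'j" assume u: "u : fs (carrier A) (C \<times> B)" and v: "v : fs (carrier A) (C \<times> B)"
 obtain c j where x: "x = (c, j)" by fastforce
 have "(%b. (u + v) (c, b)) = (%b. u (c, b)) + (%b. v (c, b))" by auto
 then show "colm A (u + v) d x = (colm A u d + colm A v d) x" using additive_on_add[OF ap_additive[OF mod_on_self_opp[OF A] d] fs_slice(1)[OF u] fs_slice(1)[OF v]] by (simp add: colm_def x)
qed

lemma colm_colm:
 assumes A: "ring_on A" and u: "u : fs (carrier A) (C \<times> B)" and d: "!!b. b : B ==> d b : free_on A J"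
  and d': "!!b. b : J ==> d' b : free_on A L"
 shows "colm A (colm A u d) d' = colm A u (%i. rmul A (d i) d')" unfolding colm_def[of _ "colm A u d"] colm_slice using ap_ap[OF mod_on_self_opp[OF A] fs_slice(1)[OF u] d d'] by (simp add: colm_def)

lemma colm_cong:
 assumes "u : fs N (C \<times> B)" "!!b. b : B ==> d b = d' b" shows "colm A u d = colm A u d'" unfolding colm_def using ap_cong[OF fs_slice(1)[OF assms(1)] assms(2)] by simp

lemma colm_zero:
 assumes A: "ring_on A" and u: "u : fs (carrier A) (C \<times> B)" and d: "!!b. b : B ==> d b = 0"
 shows "colm A u d = 0" unfolding colm_def using mod_on_0(1)[OF mod_on_self_opp[OF A]] by (subst ap_zero[OF _ fs_slice(1)[OF u] d]) (auto simp: fun_eq_iff)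

lemma colm_exact:
 assumes A: "ring_on A" and ex: "ex_at (mult (opp A)) (carrier A) B d n" and u: "u : fs (carrier A) (C \<times> B (Suc n))"
  and z: "colm A u (d n) = 0"
 shows "EX w:fs (carrier A) (C \<times> B (Suc (Suc n))). u = colm A w (d (Suc n))"
proof -
 let ?S = "{c. (%b. u (c, b)) ~= 0}"
 have "rmul A (%b. u (c, b)) (d n) = 0" for c unfolding colm_slice[symmetric] z by (simp add: fun_eq_iff)
 then have "EX w:free_on A (B (Suc (Suc n))). (%b. u (c, b)) = rmul A w (d (Suc n))" for c using ex fs_slice(1)[OF u] by (auto simp: ex_at_def)
 then obtain w0 where w0: "!!c. w0 c : free_on A (B (Suc (Suc n)))" "!!c. (%b. u (c, b)) = rmul A (w0 c) (d (Suc n))" by metis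
 define w where "w c = (if c : ?S then w0 c else 0)" for c
 have w: "(%b. u (c, b)) = rmul A (w c) (d (Suc n))" for c using w0(2)[of c] by (cases "c : ?S") (auto simp: w_def)
 have "(%(c, b). w c b) : fs (carrier A) (C \<times> B (Suc (Suc n)))" by (rule fs_assemble[OF _ finite_fst_supp[OF u]])
   (use fs_slice(2)[OF u] w0(1) A ring_onD(1) subgrp_0 in "auto simp: w_def")
 moreover have "u = colm A (%(c, b). w c b) (d (Suc n))" using w by (auto simp: colm_def fun_eq_iff)
 ultimately show ?thesis by blast
qed

lemma rowm_in:
 assumes "ring_on A" "u : fs (carrier A) (C \<times> B)" "!!c. c : C ==> d c : free_on A J"
 shows "rowm A u d : fs (carrier A) (J \<times> B)"
proof -
 have "colm (opp A) (%x. u (prod.swap x)) d : fs (carrier (opp A)) (B \<times> J)" by (rule colm_in[where B = C]) (use assms fs_swap[OF assms(2)] in simp_all)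
 from fs_swap[OF this] show ?thesis by (simp add: rowm_colm)
qed

lemma rowm_additive:
 assumes "ring_on A" "!!c. c : C ==> d c : free_on A J"
 shows "additive_on (fs (carrier A) (C \<times> B)) (%u. rowm A u d)" unfolding additive_on_def
proof (intro ballI)
 fix u v assume u: "u : fs (carrier A) (C \<times> B)" and v: "v : fs (carrier A) (C \<times> B)"
 have e: "(%x. (u + v) (prod.swap x)) = (%x. u (prod.swap x)) + (%x. v (prod.swap x))" by auto
 have "additive_on (fs (carrier (opp A)) (B \<times> C)) (%u. colm (opp A) u d)" by (rule colm_additive) (use assms in simp_all)
 from additive_on_add[OF this, of "%x. u (prod.swap x)" "%x. v (prod.swap x)"]
 show "rowm A (u + v) d = rowm A u d + rowm A v d" using fs_swap[OF u] fs_swap[OF v] unfolding rowm_colm e by (auto simp: fun_eq_iff)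
qed

lemma rowm_exact:
 assumes A: "ring_on A" and ex: "ex_at (mult A) (carrier A) C dz n" and u: "u : fs (carrier A) (C (Suc n) \<times> B)"
  and z: "rowm A u (dz n) = 0"
 shows "EX w:fs (carrier A) (C (Suc (Suc n)) \<times> B). u = rowm A w (dz (Suc n))"
proof -
 have "colm (opp A) (%x. u (prod.swap x)) (dz n) x = 0" for x using fun_cong[OF z, of "prod.swap x"] by (simp add: rowm_colm)
 then have "colm (opp A) (%x. u (prod.swap x)) (dz n) = 0" by (simp add: fun_eq_iff)
 then obtain w where w: "w : fs (carrier A) (B \<times> C (Suc (Suc n)))" "(%x. u (prod.swap x)) = colm (opp A) w (dz (Suc n))" using colm_exact[of "opp A" C dz n "%x. u (prod.swap x)" B] fs_swap[OF u] A ex by auto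
 have "u = rowm A (%x. w (prod.swap x)) (dz (Suc n))" unfolding rowm_colm using fun_cong[OF w(2)] by (auto simp: fun_eq_iff)
 then show ?thesis using fs_swap[OF w(1)] by blast
qed

text \<open>Associativity of the product of three matrices; finite supports allow the two sums to be
  exchanged.\<close>

lemma rowm_colm_comm:
 fixes J :: "'j set" and L :: "'l set"
 assumes A: "ring_on A" and u: "u : fs (carrier A) (C \<times> B)" and d: "!!b. b : B ==> d b : free_on A J"
  and dz: "!!c. c : C ==> dz c : free_on A L"
 shows "rowm A (colm A u d) dz = colm A (rowm A u dz) d"
proof
 fix x :: "'l * 'j"
 obtain l j where x: "x = (l, j)" by fastforce
 let ?S = "fst ` {x. u x ~= 0}" and ?T = "snd ` {x. u x ~= 0}"
 have S: "finite ?S" "?S <= C" and T: "finite ?T" "?T <= B" using fsD(1)[OF u] fs_supp[OF u] by (force, force, force, force)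
 note R = ring_onD[OF A] and z = mod_on_0[OF mod_on_self[OF A]]
 have uR: "u y : carrier A" for y using fsD(2)[OF u] .
 have dR: "b : ?T ==> d b j : carrier A" for b using fsD(2)[OF d] T by blast
 have dzR: "c : ?S ==> dz c l : carrier A" for c using fsD(2)[OF dz] S by blast
 have c1: "colm A u d (c, j) = (\<Sum>b\<in>?T. u (c, b) \<otimes>\<^bsub>A\<^esub> d b j)" for c unfolding colm_def ap_def split_conv using T dR z(1) by (subst lincomb_superset[of ?T]) force+
 have c0: "colm A u d (c, j) = 0" if "c \<notin> ?S" for c
 proof -
  have "(%b. u (c, b)) = 0" using that by (force simp: fun_eq_iff)
  then show ?thesis by (simp add: colm_def)
 qed
 have r1: "rowm A u dz (l, b) = (\<Sum>c\<in>?S. dz c l \<otimes>\<^bsub>A\<^esub> u (c, b))" for b unfolding rowm_def ap_def split_conv opp_simps using S dzR z(2) by (subst lincomb_superset[of ?S]) force+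
 have r0: "rowm A u dz (l, b) = 0" if "b \<notin> ?T" for b
 proof -
  have "(%c. u (c, b)) = 0" using that by (force simp: fun_eq_iff)
  then show ?thesis by (simp add: rowm_def)
 qed
 have "rowm A (colm A u d) dz x = (\<Sum>c\<in>?S. dz c l \<otimes>\<^bsub>A\<^esub> colm A u d (c, j))" unfolding x rowm_def ap_def split_conv opp_simps using S dzR z(2) c0 by (subst lincomb_superset[of ?S]) blast+
 also have "... = (\<Sum>c\<in>?S. \<Sum>b\<in>?T. dz c l \<otimes>\<^bsub>A\<^esub> (u (c, b) \<otimes>\<^bsub>A\<^esub> d b j))" unfolding c1 by (intro sum.cong refl additive_on_sum[OF biadd_right[OF R(3)] R(1)] R(4) uR dR dzR)
 also have "... = (\<Sum>b\<in>?T. \<Sum>c\<in>?S. (dz c l \<otimes>\<^bsub>A\<^esub> u (c, b)) \<otimes>\<^bsub>A\<^esub> d b j)" using R(5) uR dR dzR by (subst sum.swap, intro sum.cong refl) auto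
 also have "... = (\<Sum>b\<in>?T. rowm A u dz (l, b) \<otimes>\<^bsub>A\<^esub> d b j)" unfolding r1 by (intro sum.cong refl additive_on_sum[OF biadd_left[OF R(3)] R(1), symmetric] R(4) uR dR dzR)
 also have "... = colm A (rowm A u dz) d x" unfolding x colm_def ap_def split_conv opp_simps using T dR z(1) r0 by (subst lincomb_superset[of ?T]) blast+
 finally show "rowm A (colm A u d) dz x = colm A (rowm A u dz) d x" .
qed

text \<open>Hypothesis \<open>A\<close> of the staircase for the double complex of \<open>C\<close>
  and \<open>B\<close>, that is, exactness at its corner \<open>(0, i + 1)\<close>.\<close>

definition dc_ex :: "('a::ab_group_add, 's) ring_scheme => (nat => 'c set) => (nat => 'c => 'c => 'a) =>
  (nat => 'b set) => (nat => 'b => 'b => 'a) => nat => bool" where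
 "dc_ex A C dz B d i <-> (ALL x:fs (carrier A) (C 0 \<times> B (Suc i)). ALL z:fs (carrier A) (C 1 \<times> B i).
  colm A x (d i) = rowm A z (dz 0) -->
  (EX y:fs (carrier A) (C 0 \<times> B (Suc (Suc i))). EX z:fs (carrier A) (C 1 \<times> B (Suc i)).
    x = colm A y (d (Suc i)) + rowm A z (dz 0)))"

lemma colm_dd:
 assumes c: "fcx A B d" and u: "u : fs (carrier A) (C \<times> B (Suc (Suc n)))"
 shows "colm A (colm A u (d (Suc n))) (d n) = 0"
proof -
 have A: "ring_on A" using fcxD(1)[OF c] .
 have "colm A (colm A u (d (Suc n))) (d n) = colm A u (%i. rmul A (d (Suc n) i) (d n))" by (rule colm_colm[OF A u fcxD(2)[OF c] fcxD(2)[OF c]])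
 also have "... = 0" by (rule colm_zero[OF A u fcxD(3)[OF c]])
 finally show ?thesis .
qed

lemma rowm_dd:
 assumes c: "fcx (opp A) C dz" and u: "u : fs (carrier A) (C (Suc (Suc n)) \<times> B)"
 shows "rowm A (rowm A u (dz (Suc n))) (dz n) = 0"
proof -
 have "(%x. u (prod.swap x)) : fs (carrier (opp A)) (B \<times> C (Suc (Suc n)))" using fs_swap[OF u] by simp
 from colm_dd[OF c this] show ?thesis by (simp add: rowm_colm fun_eq_iff)
qed

text \<open>The conclusion of the staircase, read after transposing all matrices, is the corner
  condition for the two complexes in the other order.\<close>

lemma dc_swap:
 assumes B: "fcx A B d" "!!n. ex_at (mult (opp A)) (carrier A) B d n"
  and C: "fcx (opp A) C dz" "!!n. ex_at (mult A) (carrier A) C dz n"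
  and ex: "dc_ex A C dz B d i"
 shows "dc_ex (opp A) B d C dz i" unfolding dc_ex_def
proof (intro ballI impI)
 fix x z assume x: "x : fs (carrier (opp A)) (B 0 \<times> C (Suc i))" and z: "z : fs (carrier (opp A)) (B 1 \<times> C i)"
  and eq: "colm (opp A) x (dz i) = rowm (opp A) z (d 0)"
 have A: "ring_on A" using fcxD(1)[OF B(1)] .
 note db = fcxD(2)[OF B(1)] and dzc = fcxD(2)[OF C(1), simplified]
 let ?s = "%u x. u (prod.swap x)"
 let ?K = "%p q. fs (carrier A) (C p \<times> B q)"
 have x': "?s x : ?K (Suc i) 0" and z': "?s z : ?K i 1" using fs_swap[OF x] fs_swap[OF z] by simp_all
 have eq': "rowm A (?s x) (dz i) = colm A (?s z) (d 0)" using fun_cong[OF eq] by (auto simp: rowm_colm[of A] rowm_colm[of "opp A"] fun_eq_iff)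
 have "EX y:?K (Suc (Suc i)) 0. EX z:?K (Suc i) 1. ?s x = rowm A y (dz (Suc i)) + colm A z (d 0)"
 proof (rule double_complex_staircase[where K = ?K and dh = "%p x. rowm A x (dz p)" and dv = "%q x. colm A x (d q)"
    and i = i and x = "?s x" and z = "?s z"])
  show "subgrp (?K p q)" for p q by (rule subgrp_fs[OF ring_onD(1)[OF A]])
  show "additive_on (?K (Suc p) q) (%x. rowm A x (dz p))" for p q by (rule rowm_additive[OF A dzc])
  show "x : ?K (Suc p) q ==> rowm A x (dz p) : ?K p q" for p q x by (rule rowm_in[OF A _ dzc])
  show "additive_on (?K p (Suc q)) (%x. colm A x (d q))" for p q by (rule colm_additive[OF A db])
  show "x : ?K p (Suc q) ==> colm A x (d q) : ?K p q" for p q x by (rule colm_in[OF A _ db])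
  show "x : ?K (Suc (Suc p)) q ==> rowm A (rowm A x (dz (Suc p))) (dz p) = 0" for p q x by (rule rowm_dd[OF C(1)])
  show "x : ?K p (Suc (Suc q)) ==> colm A (colm A x (d (Suc q))) (d q) = 0" for p q x by (rule colm_dd[OF B(1)])
  show "x : ?K (Suc p) (Suc q) ==> rowm A (colm A x (d q)) (dz p) = colm A (rowm A x (dz p)) (d q)" for p q x by (rule rowm_colm_comm[OF A _ db dzc])
  show "x : ?K (Suc p) q ==> rowm A x (dz p) = 0 ==> EX w:?K (Suc (Suc p)) q. x = rowm A w (dz (Suc p))" for p q x by (rule rowm_exact[OF A C(2)])
  show "x : ?K p (Suc q) ==> colm A x (d q) = 0 ==> EX w:?K p (Suc (Suc q)). x = colm A w (d (Suc q))" for p q x by (rule colm_exact[OF A B(2)])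
  show "x : ?K 0 (Suc i) ==> z : ?K 1 i ==> colm A x (d i) = rowm A z (dz 0) ==>
   EX y:?K 0 (Suc (Suc i)). EX z:?K 1 (Suc i). x = colm A y (d (Suc i)) + rowm A z (dz 0)" for x z using ex unfolding dc_ex_def by blast
 qed (fact x' z' eq')+
 then obtain y w where yw: "y : ?K (Suc (Suc i)) 0" "w : ?K (Suc i) 1"
  "?s x = rowm A y (dz (Suc i)) + colm A w (d 0)" by blast
 have "x = colm (opp A) (?s y) (dz (Suc i)) + rowm (opp A) (?s w) (d 0)"
 proof
  fix a show "x a = (colm (opp A) (?s y) (dz (Suc i)) + rowm (opp A) (?s w) (d 0)) a" using fun_cong[OF yw(3), of "prod.swap a"] by (simp add: rowm_colm[of A] rowm_colm[of "opp A"])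
 qed
 then show "EX y:fs (carrier (opp A)) (B 0 \<times> C (Suc (Suc i))). EX z:fs (carrier (opp A)) (B 1 \<times> C (Suc i)).
   x = colm (opp A) y (dz (Suc i)) + rowm (opp A) z (d 0)" using fs_swap[OF yw(1)] fs_swap[OF yw(2)] by auto
qed

text \<open>The augmentation \<open>ez\<close> applied in every column. It maps the matrices on
  \<open>C 0 \<times> B\<close> onto the families in \<open>N\<close>, and its kernel is the image
  of the first row differential.\<close>

definition row_eval :: "('a => 'n => 'n::ab_group_add) => ('c => 'n) => ('c * 'b => 'a::zero) => 'b => 'n" where
 "row_eval s ez u = (%b. lincomb s (%c. u (c, b)) ez)"

lemma fs_slice': assumes "u : fs N (C \<times> B)"
 shows "(%c. u (c, b)) : fs N C" "b \<notin> B ==> (%c. u (c, b)) = 0" using fs_slice[OF fs_swap[OF assms], of b] by simp_all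

lemma finite_snd_supp: "u : fs N (C \<times> B) ==> finite {b. (%c. u (c, b)) ~= 0}" using finite_fst_supp[OF fs_swap] by fastforce

lemma fs_choose_slices:
 assumes A: "ring_on A" and S: "finite S" "S <= B'" and ex: "!!b. b : S ==> EX w:fs (carrier A) J. P b w"
 shows "EX u:fs (carrier A) (J \<times> B'). (ALL b:S. P b (%j. u (j, b))) & (ALL b. b \<notin> S --> (%j. u (j, b)) = 0)"
proof -
 obtain w0 where w0: "!!b. b : S ==> w0 b : fs (carrier A) J" "!!b. b : S ==> P b (w0 b)" using ex by metis
 define w where "w b = (if b : S then w0 b else 0)" for b
 have R: "0 : carrier A" using subgrp_0[OF ring_onD(1)[OF A]] .
 have "(%(b, j). w b j) : fs (carrier A) (B' \<times> J)" by (rule fs_assemble[where w = w, OF R S]) (simp_all add: w_def w0(1))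
 from fs_swap[OF this] have "(%x. (%(b, j). w b j) (prod.swap x)) : fs (carrier A) (J \<times> B')" .
 moreover have eq: "(%j. (%(b, j). w b j) (prod.swap (j, b))) = w b" for b by (rule ext) simp
 moreover have "ALL b:S. P b (w b)" "ALL b. b \<notin> S --> w b = 0" by (simp_all add: w_def w0(2))
 ultimately show ?thesis by (intro bexI[of _ "%x. (%(b, j). w b j) (prod.swap x)"]) (simp_all only: eq)
qed

context
 fixes A :: "('a::ab_group_add, 's) ring_scheme" and N :: "'n::ab_group_add set" and s ez
  and C :: "nat => 'c set" and dz B and d :: "nat => 'b => 'b => 'a"
 assumes F: "fres (opp A) N s {0} C dz ez" and Bd: "fcx A B d"
begin

lemma row_eval_in: assumes u: "u : fs (carrier A) (C 0 \<times> B')" shows "row_eval s ez u : fs N B'"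
proof -
 have z: "row_eval s ez u b = 0" if "(%c. u (c, b)) = 0" for b using that by (simp add: row_eval_def)
 have "row_eval s ez u b : N" for b unfolding row_eval_def using fs_slice'(1)[OF u] by (intro mod_lincomb_in[OF fresD(1)[OF F] _ fresD(5)[OF F]]) auto
 moreover have "{b. row_eval s ez u b ~= 0} <= {b. (%c. u (c, b)) ~= 0}" using z by auto
 then have "finite {b. row_eval s ez u b ~= 0}" using finite_snd_supp[OF u] finite_subset by blast
 ultimately show ?thesis using z fs_slice'(2)[OF u] by (auto simp: fs_def)
qed

lemma row_eval_additive: "additive_on (fs (carrier A) (C 0 \<times> B')) (row_eval s ez)" unfolding additive_on_def
proof (intro ballI ext)
 fix u v b assume u: "u : fs (carrier A) (C 0 \<times> B')" and v: "v : fs (carrier A) (C 0 \<times> B')"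
 have "additive_on (fs (carrier (opp A)) (C 0)) (%v. lincomb s v ez)" using lin_mapD(1)[OF lincomb_lin_map[OF fresD(1)[OF F] fresD(5)[OF F]]] by simp
 from additive_on_add[OF this, of "%c. u (c, b)" "%c. v (c, b)"]
 show "row_eval s ez (u + v) b = (row_eval s ez u + row_eval s ez v) b" using fs_slice'(1)[OF u] fs_slice'(1)[OF v] by (simp add: row_eval_def plus_fun_def)
qed

lemma row_eval_surj: assumes v: "v : fs N B'" shows "EX u:fs (carrier A) (C 0 \<times> B'). v = row_eval s ez u"
proof -
 have "EX w:fs (carrier A) (C 0). v b = lincomb s w ez" for b using fresD(6)[OF F fsD(2)[OF v]] by simp
 then obtain u where u: "u : fs (carrier A) (C 0 \<times> B')" "!!b. v b ~= 0 ==> v b = lincomb s (%j. u (j, b)) ez"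
  "!!b. v b = 0 ==> (%j. u (j, b)) = 0" using fs_choose_slices[OF fcxD(1)[OF Bd] fsD(1)[OF v], of B' "C 0" "%b w. v b = lincomb s w ez"] fs_supp[OF v] by blast
 have "v b = row_eval s ez u b" for b using u(2,3)[of b] by (cases "v b = 0") (simp_all add: row_eval_def)
 then show ?thesis using u(1) by blast
qed

lemma row_eval_kernel:
 assumes u: "u : fs (carrier A) (C 0 \<times> B')" and z: "row_eval s ez u = 0"
 shows "EX w:fs (carrier A) (C 1 \<times> B'). u = rowm A w (dz 0)"
proof -
 have "EX w:fs (carrier A) (C 1). (%c. u (c, b)) = rmul (opp A) w (dz 0)" for b
 proof -
  have "lincomb s (%c. u (c, b)) ez : {0}" using fun_cong[OF z, of b] by (simp add: row_eval_def)
  then show ?thesis using fresD(7)[OF F, of "%c. u (c, b)"] fs_slice'(1)[OF u] by simp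
 qed
 then obtain w where w: "w : fs (carrier A) (C 1 \<times> B')"
  "!!b. (%c. u (c, b)) ~= 0 ==> (%c. u (c, b)) = rmul (opp A) (%j. w (j, b)) (dz 0)"
  "!!b. (%c. u (c, b)) = 0 ==> (%j. w (j, b)) = 0" using fs_choose_slices[OF fcxD(1)[OF Bd] finite_snd_supp[OF u], of B' "C 1" "%b w. (%c. u (c, b)) = rmul (opp A) w (dz 0)"]
   fs_slice'(2)[OF u] by blast
 have "(%c. u (c, b)) = rmul (opp A) (%j. w (j, b)) (dz 0)" for b using w(2,3)[of b] by (cases "(%c. u (c, b)) = 0") simp_all
 then have "u = rowm A w (dz 0)" unfolding rowm_def by (auto simp: fun_eq_iff)
 then show ?thesis using w(1) by blast
qed

lemma row_eval_rowm: assumes w: "w : fs (carrier A) (C 1 \<times> B')" shows "row_eval s ez (rowm A w (dz 0)) = 0"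
proof
 fix b
 have "lincomb s (rmul (opp A) (%c. w (c, b)) (dz 0)) ez : {0}" by (rule fresD(9)[OF F]) (use fs_slice'(1)[OF w] in simp)
 then show "row_eval s ez (rowm A w (dz 0)) b = 0 b" by (simp add: row_eval_def rowm_def)
qed

lemma row_eval_colm:
 assumes u: "u : fs (carrier A) (C 0 \<times> B')" and d': "!!b. b : B' ==> d' b : free_on A J"
 shows "row_eval s ez (colm A u d') = ap s (row_eval s ez u) d'"
proof
 fix j
 have A: "ring_on A" using fcxD(1)[OF Bd] .
 have N: "mod_on (opp A) N s" using fresD(1)[OF F] .
 let ?S = "fst ` {x. u x ~= 0}" and ?T = "snd ` {x. u x ~= 0}"
 have S: "finite ?S" "?S <= C 0" and T: "finite ?T" "?T <= B'" using fsD(1)[OF u] fs_supp[OF u] by (force, force, force, force)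
 note R = ring_onD[OF A] and z = mod_on_0[OF mod_on_self[OF A]] and zN = mod_on_0[OF N]
 note M = mod_onD[OF N, simplified]
 have uR: "u y : carrier A" for y using fsD(2)[OF u] .
 have dR: "b : ?T ==> d' b j : carrier A" for b using fsD(2)[OF d'] T by blast
 have ezN: "c : ?S ==> ez c : N" for c using fresD(5)[OF F] S by blast
 have c1: "colm A u d' (c, j) = (\<Sum>b\<in>?T. u (c, b) \<otimes>\<^bsub>A\<^esub> d' b j)" for c unfolding colm_def ap_def split_conv using T dR z(1) by (subst lincomb_superset[of ?T]) force+
 have c0: "colm A u d' (c, j) = 0" if "c \<notin> ?S" for c
 proof -
  have "(%b. u (c, b)) = 0" using that by (force simp: fun_eq_iff)
  then show ?thesis by (simp add: colm_def)
 qed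
 have r1: "row_eval s ez u b = (\<Sum>c\<in>?S. s (u (c, b)) (ez c))" for b unfolding row_eval_def using S ezN zN(1) by (subst lincomb_superset[of ?S]) force+
 have r0: "row_eval s ez u b = 0" if "b \<notin> ?T" for b
 proof -
  have "(%c. u (c, b)) = 0" using that by (force simp: fun_eq_iff)
  then show ?thesis by (simp add: row_eval_def)
 qed
 have "row_eval s ez (colm A u d') j = (\<Sum>c\<in>?S. s (colm A u d' (c, j)) (ez c))" unfolding row_eval_def using S ezN zN(1) c0 by (subst lincomb_superset[of ?S]) blast+
 also have "... = (\<Sum>c\<in>?S. \<Sum>b\<in>?T. s (u (c, b) \<otimes>\<^bsub>A\<^esub> d' b j) (ez c))" unfolding c1 by (intro sum.cong refl additive_on_sum[OF biadd_left[OF M(3)] R(1)] R(4) uR dR ezN)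
 also have "... = (\<Sum>b\<in>?T. \<Sum>c\<in>?S. s (d' b j) (s (u (c, b)) (ez c)))" using M(5) uR dR ezN by (subst sum.swap, intro sum.cong refl) auto
 also have "... = (\<Sum>b\<in>?T. s (d' b j) (row_eval s ez u b))" unfolding r1 by (intro sum.cong refl additive_on_sum[OF biadd_right[OF M(3)] M(2), symmetric] M(4) uR dR ezN)
 also have "... = ap s (row_eval s ez u) d' j" unfolding ap_def
 proof (rule lincomb_superset[OF T(1), symmetric])
  show "{b. row_eval s ez u b ~= 0} <= ?T" using r0 by blast
  show "s (d' b j) 0 = 0" if "b : ?T" for b using zN(2) dR[OF that] by simp
 qed
 finally show "row_eval s ez (colm A u d') j = ap s (row_eval s ez u) d' j" .
qed

text \<open>The families in \<open>N\<close> are the cokernel of the first row differential, so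
  exactness of the tensored complex is exactness at the corner modulo the image of that
  differential.\<close>

lemma dc_ex_iff: "dc_ex A C dz B d i <-> ex_at s N B d i"
proof
 have A: "ring_on A" using fcxD(1)[OF Bd] .
 note dzc = fcxD(2)[OF fresD(3)[OF F], of _ 0, simplified]
 note db = fcxD(2)[OF Bd]
 have sub: "subgrp (fs (carrier A) X)" for X :: "('c * 'b) set" by (rule subgrp_fs[OF ring_onD(1)[OF A]])
 have ri: "rowm A z (dz 0) : fs (carrier A) (C 0 \<times> B')" if "z : fs (carrier A) (C 1 \<times> B')" for z and B' :: "'b set" using that by (intro rowm_in[OF A _ dzc]) auto
 {
  assume dc: "dc_ex A C dz B d i"
  show "ex_at s N B d i" unfolding ex_at_def
  proof (intro ballI impI)
   fix v assume v: "v : fs N (B (Suc i))" and v0: "ap s v (d i) = 0"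
   obtain x where x: "x : fs (carrier A) (C 0 \<times> B (Suc i))" "v = row_eval s ez x" using row_eval_surj[OF v] by blast
   have cx: "colm A x (d i) : fs (carrier A) (C 0 \<times> B i)" by (rule colm_in[OF A x(1) db])
   have "row_eval s ez (colm A x (d i)) = ap s (row_eval s ez x) (d i)" by (rule row_eval_colm[OF x(1) db])
   then have "row_eval s ez (colm A x (d i)) = 0" using v0 x(2) by simp
   then obtain z where "z : fs (carrier A) (C 1 \<times> B i)" "colm A x (d i) = rowm A z (dz 0)" using row_eval_kernel[OF cx] by blast
   then obtain y w where yw: "y : fs (carrier A) (C 0 \<times> B (Suc (Suc i)))" "w : fs (carrier A) (C 1 \<times> B (Suc i))"
    "x = colm A y (d (Suc i)) + rowm A w (dz 0)" using dc x(1) by (auto simp: dc_ex_def)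
   have "v = row_eval s ez (colm A y (d (Suc i))) + row_eval s ez (rowm A w (dz 0))" unfolding x(2) yw(3) by (rule additive_on_add[OF row_eval_additive colm_in[OF A yw(1) db] ri[OF yw(2)]])
   also have "... = ap s (row_eval s ez y) (d (Suc i))" unfolding row_eval_rowm[OF yw(2)] using row_eval_colm[OF yw(1), of "d (Suc i)", OF db] by simp
   finally show "EX w:fs N (B (Suc (Suc i))). v = ap s w (d (Suc i))" using row_eval_in[OF yw(1)] by blast
  qed
 }
 {
  assume ex: "ex_at s N B d i"
  show "dc_ex A C dz B d i" unfolding dc_ex_def
  proof (intro ballI impI)
   fix x z assume x: "x : fs (carrier A) (C 0 \<times> B (Suc i))" and z: "z : fs (carrier A) (C 1 \<times> B i)"
    and eq: "colm A x (d i) = rowm A z (dz 0)"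
   have "row_eval s ez (colm A x (d i)) = ap s (row_eval s ez x) (d i)" by (rule row_eval_colm[OF x db])
   then have "ap s (row_eval s ez x) (d i) = 0" using row_eval_rowm[OF z] eq by simp
   then obtain v where v: "v : fs N (B (Suc (Suc i)))" "row_eval s ez x = ap s v (d (Suc i))" using ex row_eval_in[OF x] by (auto simp: ex_at_def)
   obtain y where y: "y : fs (carrier A) (C 0 \<times> B (Suc (Suc i)))" "v = row_eval s ez y" using row_eval_surj[OF v(1)] by blast
   have dy: "colm A y (d (Suc i)) : fs (carrier A) (C 0 \<times> B (Suc i))" by (rule colm_in[OF A y(1) db])
   have "row_eval s ez (x - colm A y (d (Suc i))) = row_eval s ez x - row_eval s ez (colm A y (d (Suc i)))" by (rule additive_on_diff[OF row_eval_additive sub x dy])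
   also have "... = 0" using row_eval_colm[OF y(1), of "d (Suc i)", OF db] v(2) y(2) by simp
   finally obtain w where w: "w : fs (carrier A) (C 1 \<times> B (Suc i))" "x - colm A y (d (Suc i)) = rowm A w (dz 0)" using row_eval_kernel[OF subgrp_diff[OF sub x dy]] by blast
   have "x = colm A y (d (Suc i)) + rowm A w (dz 0)" unfolding w(2)[symmetric] by simp
   then show "EX y:fs (carrier A) (C 0 \<times> B (Suc (Suc i))). EX z:fs (carrier A) (C 1 \<times> B (Suc i)).
     x = colm A y (d (Suc i)) + rowm A z (dz 0)" using y(1) w(1) by blast
  qed
 }
qed

end

text \<open>Vanishing of Tor in degree \<open>Suc i\<close>, computed from a resolution of
  \<open>Y\<close>, is translated to the double complex, transposed there, and translated back to a
  resolution of \<open>N\<close>.\<close>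

theorem tor_balance:
 assumes N: "fres (opp A) N s {0} C dz ez" and Y: "fres A Y t {0} B d \<eta>" and ex: "ex_at s N B d i"
 shows "ex_at t Y C dz i"
proof -
 have "dc_ex A C dz B d i" using dc_ex_iff[OF N fresD(3)[OF Y]] ex by simp
 then have "dc_ex (opp A) B d C dz i" using dc_swap[OF fresD(3)[OF Y] fresD(4)[OF Y] fresD(3)[OF N]] fresD(4)[OF N] by simp
 then show ?thesis using dc_ex_iff[of "opp A" Y t B d \<eta> C dz i] Y fresD(3)[OF N] by simp
qed

text \<open>A splitting at \<open>m\<close> solves the corner condition of the transposed double
  complex directly. The exact complex \<open>B\<close> is arbitrary and the place \<open>m\<close>
  depends on \<open>N\<close> alone; this is the source of the uniform bounds.\<close>

theorem tor_bound:
 assumes N: "fres (opp A) N s {0} C dz ez" and reg: "freg (opp A) C dz m"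
  and B: "fcx A B d" "!!n. ex_at (mult (opp A)) (carrier A) B d n"
 shows "ex_at s N B d m"
proof -
 have A: "ring_on A" using fcxD(1)[OF B(1)] .
 have A': "ring_on (opp A)" using A by simp
 note F = fresD[OF N]
 obtain a where a: "!!c. c : C m ==> a c : free_on (opp A) (C (Suc m))"
  "!!c. c : C (Suc m) ==> rmul (opp A) (rmul (opp A) (dz m c) a) (dz m) = dz m c" using reg by (auto simp: freg_def)
 note dzc = fcxD(2)[OF F(3)]
 have db0: "d 0 b : free_on (opp A) (B 0)" if "b : B 1" for b using fcxD(2)[OF B(1), of b 0] that by simp
 have "dc_ex (opp A) B d C dz m" unfolding dc_ex_def
 proof (intro ballI impI)
  fix x z assume x: "x : fs (carrier (opp A)) (B 0 \<times> C (Suc m))" and z: "z : fs (carrier (opp A)) (B 1 \<times> C m)"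
   and eq: "colm (opp A) x (dz m) = rowm (opp A) z (d 0)"
  have xdz: "colm (opp A) x (dz m) : fs (carrier (opp A)) (B 0 \<times> C m)" by (rule colm_in[OF A' x dzc])
  \<comment> \<open>The part of \<open>x\<close> seen by the splitting: \<open>x - ?xa\<close> is a
    cycle for \<open>dz\<close>, and \<open>?xa\<close> is a boundary for \<open>d\<close> because
    \<open>colm (opp A) x (dz m)\<close> is one.\<close>
  let ?xa = "colm (opp A) (colm (opp A) x (dz m)) a"
  have xa: "?xa : fs (carrier (opp A)) (B 0 \<times> C (Suc m))" by (rule colm_in[OF A' xdz a(1)])
  have sub: "subgrp (fs (carrier (opp A)) (B 0 \<times> C (Suc m)))" by (rule subgrp_fs[OF ring_onD(1)[OF A']])
  have "colm (opp A) ?xa (dz m) = colm (opp A) (colm (opp A) x (%c. rmul (opp A) (dz m c) a)) (dz m)"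
  proof -
   have "?xa = colm (opp A) x (%c. rmul (opp A) (dz m c) a)" by (rule colm_colm[OF A' x dzc a(1)])
   then show ?thesis by simp
  qed
  also have "... = colm (opp A) x (%c. rmul (opp A) (rmul (opp A) (dz m c) a) (dz m))" by (rule colm_colm[OF A' x _ dzc]) (rule ap_in[OF mod_on_self_opp[OF A'] dzc a(1)])
  also have "... = colm (opp A) x (dz m)" by (rule colm_cong[OF x a(2)])
  finally have "colm (opp A) (x - ?xa) (dz m) = 0" using additive_on_diff[OF colm_additive[OF A' dzc] sub x xa] by simp
  then obtain y where y: "y : fs (carrier (opp A)) (B 0 \<times> C (Suc (Suc m)))" "x - ?xa = colm (opp A) y (dz (Suc m))" using colm_exact[OF A' F(4) subgrp_diff[OF sub x xa]] by blast
  have "?xa = rowm (opp A) (colm (opp A) z a) (d 0)" unfolding eq by (rule rowm_colm_comm[OF A' z a(1) db0, symmetric])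
  then have "x = colm (opp A) y (dz (Suc m)) + rowm (opp A) (colm (opp A) z a) (d 0)" using y(2) by (simp add: diff_eq_eq)
  moreover have "colm (opp A) z a : fs (carrier (opp A)) (B 1 \<times> C (Suc m))" by (rule colm_in[OF A' z a(1)])
  ultimately show "EX y:fs (carrier (opp A)) (B 0 \<times> C (Suc (Suc m))). EX z:fs (carrier (opp A)) (B 1 \<times> C (Suc m)).
    x = colm (opp A) y (dz (Suc m)) + rowm (opp A) z (d 0)" using y(1) by blast
 qed
 then have "dc_ex (opp (opp A)) C dz B d m" using dc_swap[of "opp A" C dz B d m] F(3,4) B by simp
 then show ?thesis using dc_ex_iff[OF N B(1)] by simp
qed

subsection \<open>Direct sums of copies\<close>

definition blk :: "('b => 'j => 'a::zero) => 'i * 'b => 'i * 'j => 'a" where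
 "blk d x = (%(i, j). if i = fst x then d (snd x) j else 0)"

lemma blk_in: assumes "subgrp N" "x : I \<times> B" "!!b. b : B ==> d b : fs N J" shows "blk d x : fs N (I \<times> J)"
proof -
 have "(%(i, j). (if i = fst x then d (snd x) else 0) j) : fs N (I \<times> J)" by (rule fs_assemble[of _ "{fst x}"]) (use assms in "auto simp: subgrp_0")
 moreover have "(%(i, j). (if i = fst x then d (snd x) else 0) j) = blk d x" by (auto simp: blk_def fun_eq_iff)
 ultimately show ?thesis by simp
qed

lemma rmul_blk:
 fixes u :: "'i * 'b => 'a::ab_group_add" and J :: "'j set"
 assumes A: "ring_on A" and u: "u : fs (carrier A) (I \<times> B)" and d: "!!b. b : B ==> d b : free_on A J"
 shows "rmul A u (blk d) = colm A u d"
proof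
 fix y :: "'i * 'j"
 obtain i j where y: "y = (i, j)" by fastforce
 note z = mod_on_0[OF mod_on_self[OF A]]
 have uR: "u x : carrier A" for x using fsD(2)[OF u] .
 have fin: "finite {b. u (i, b) ~= 0}" using fsD(1)[OF fs_slice(1)[OF u]] .
 have "rmul A u (blk d) y = (\<Sum>x | u x ~= 0. u x \<otimes>\<^bsub>A\<^esub> blk d x y)" by (simp add: ap_def lincomb_def)
 also have "... = (\<Sum>x\<in>Pair i ` {b. u (i, b) ~= 0}. u x \<otimes>\<^bsub>A\<^esub> blk d x y)" by (rule sum.mono_neutral_right) (use fsD(1)[OF u] z(2) uR in "auto simp: blk_def y image_iff")
 also have "... = (\<Sum>b | u (i, b) ~= 0. u (i, b) \<otimes>\<^bsub>A\<^esub> d b j)" by (subst sum.reindex) (auto simp: inj_on_def blk_def y)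
 also have "... = colm A u d y" by (simp add: colm_def ap_def lincomb_def y)
 finally show "rmul A u (blk d) y = colm A u d y" .
qed

lemma colm_blk:
 fixes x :: "'i * 'b" and d' :: "'j => 'l => 'a::ab_group_add"
 shows "colm A (blk d x) d' = blk (%b. rmul A (d b) d') x"
proof
 fix y :: "'i * 'l"
 have "(%b. if fst y = fst x then d (snd x) b else 0) = (if fst y = fst x then d (snd x) else 0)" by auto
 then show "colm A (blk d x) d' y = blk (%b. rmul A (d b) d') x y" by (auto simp: colm_def blk_def split_beta)
qed

lemma lincomb_single_pairs:
 assumes X: "mod_on A X s" and u: "u : fs (carrier A) (I \<times> B)" and e: "!!b. b : B ==> e b : X"
 shows "lincomb (pws s) u (%x. single (fst x) (e (snd x))) = row_eval s e (%x. u (prod.swap x))"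
proof
 fix i
 have uR: "u x : carrier A" for x using fsD(2)[OF u] .
 have "lincomb (pws s) u (%x. single (fst x) (e (snd x))) i = (\<Sum>x | u x ~= 0. s (u x) (single (fst x) (e (snd x)) i))" by (simp add: lincomb_def sum_fun_apply pws_def)
 also have "... = (\<Sum>x\<in>Pair i ` {b. u (i, b) ~= 0}. s (u x) (single (fst x) (e (snd x)) i))" by (rule sum.mono_neutral_right)
   (use fsD(1)[OF u] mod_on_0(2)[OF X] uR in "auto simp: single_def image_iff")
 also have "... = (\<Sum>b | u (i, b) ~= 0. s (u (i, b)) (e b))" by (subst sum.reindex) (auto simp: inj_on_def single_def)
 also have "... = row_eval s e (%x. u (prod.swap x)) i" by (simp add: row_eval_def lincomb_def)
 finally show "lincomb (pws s) u (%x. single (fst x) (e (snd x))) i = row_eval s e (%x. u (prod.swap x)) i" .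
qed

text \<open>Block diagonal matrices resolve the direct sum of copies, and the blocks of a splitting
  form a splitting. An infinite \<open>I\<close> costs nothing since the place \<open>n\<close> is
  the same in all blocks.\<close>

lemma pdle_fs:
 fixes A :: "('a::ab_group_add, 's) ring_scheme" and X :: "'x::ab_group_add set" and I :: "'i set"
 assumes p: "pdle A X s {0} n"
 shows "pdle A (fs X I) (pws s) {0} n"
proof -
 obtain B :: "nat => ('a * 'x) list set" and d e where F: "fres A X s {0} B d e" and reg: "freg A B d n" using p by (auto simp: pdle_def)
 note f = fresD[OF F]
 note X = f(1) and db = fcxD(2)[OF f(3)]
 have A: "ring_on A" using fcxD(1)[OF f(3)] .
 have sA: "subgrp (carrier A)" using ring_onD(1)[OF A] .
 let ?B = "%n. I \<times> B n" and ?d = "%n. blk (d n)" and ?e = "%x::'i * ('a * 'x) list. single (fst x) (e (snd x))"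
 have dummy: "fcx (opp A) (%n. {}::'i set) (%n b. 0)" using A by (simp add: fcx_def)
 have F': "fres (opp (opp A)) X s {0} B d e" using F by simp
 note re_surj = row_eval_surj[OF F' dummy] and re_ker = row_eval_kernel[OF F' dummy] and re_row = row_eval_rowm[OF F' dummy]
 have swap2: "(%x. (%y. u (prod.swap y)) (prod.swap x)) = u" for u :: "'i * ('a * 'x) list => 'a" by auto
 have din: "blk (d n) b : free_on A (I \<times> B n)" if "b : I \<times> B (Suc n)" for n b by (rule blk_in[OF sA that db])
 have rm: "rmul A u (blk (d n)) = colm A u (d n)" if "u : free_on A (I \<times> B (Suc n))" for n u by (rule rmul_blk[OF A that db])
 have cx: "fcx A ?B ?d" unfolding fcx_def
 proof (intro conjI A allI ballI din)
  fix n and b :: "'i * ('a * 'x) list" assume b: "b : I \<times> B (Suc (Suc n))"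
  have "rmul A (blk (d (Suc n)) b) (blk (d n)) = colm A (blk (d (Suc n)) b) (d n)" by (rule rm[OF din[OF b]])
  also have "... = blk (%b. rmul A (d (Suc n) b) (d n)) b" by (rule colm_blk)
  also have "... = 0" using fcxD(3)[OF f(3), of "snd b" n] b by (auto simp: blk_def fun_eq_iff)
  finally show "rmul A (blk (d (Suc n)) b) (blk (d n)) = 0" .
 qed
 have ex: "ex_at (mult (opp A)) (carrier A) ?B ?d n" for n unfolding ex_at_def
 proof (intro ballI impI)
  fix v assume v: "v : free_on A (I \<times> B (Suc n))" and "rmul A v (blk (d n)) = 0"
  then have "colm A v (d n) = 0" using rm[OF v] by simp
  from colm_exact[OF A f(4) v this] obtain w where "w : free_on A (I \<times> B (Suc (Suc n)))" "v = colm A w (d (Suc n))" by blast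
  then show "EX w:free_on A (I \<times> B (Suc (Suc n))). v = rmul A w (blk (d (Suc n)))" using rm by metis
 qed
 have "fres A (fs X I) (pws s) {0} ?B ?d ?e" unfolding fres_def
 proof (intro conjI fs_mod[OF X] submod_0 cx allI ex ballI)
  show "?e x : fs X I" if "x : I \<times> B 0" for x using that f(5) mod_onD(2)[OF X] by (auto intro: fs_single subgrp_0)
  fix x assume "x : fs X I"
  from re_surj[OF this] obtain u where u: "u : free_on (opp A) (B 0 \<times> I)" "x = row_eval s e u" by blast
  let ?u = "%x. u (prod.swap x)"
  have u': "?u : free_on A (I \<times> B 0)" using fs_swap[OF u(1)] by simp
  have "lincomb (pws s) ?u ?e = x" using lincomb_single_pairs[where e = e, OF X u' f(5)] u(2) by simp
  then show "EX v:free_on A (I \<times> B 0). x - lincomb (pws s) v ?e : {0}" using u' by (intro bexI[of _ ?u]) simp_all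
 next
  fix v assume v: "v : free_on A (I \<times> B 0)"
  have v': "(%x. v (prod.swap x)) : free_on (opp A) (B 0 \<times> I)" using fs_swap[OF v] by simp
  note lv = lincomb_single_pairs[where e = e, OF X v f(5)]
  show "lincomb (pws s) v ?e : {0} <-> (EX w:free_on A (I \<times> B 1). v = rmul A w (blk (d 0)))"
  proof
   assume "lincomb (pws s) v ?e : {0}"
   then obtain w where w: "w : free_on (opp A) (B 1 \<times> I)" "(%x. v (prod.swap x)) = rowm (opp A) w (d 0)" using re_ker[OF v'] lv by auto
   have w': "(%x. w (prod.swap x)) : free_on A (I \<times> B (Suc 0))" using fs_swap[OF w(1)] by simp
   have "v = colm A (%x. w (prod.swap x)) (d 0)"
   proof
    fix x show "v x = colm A (%x. w (prod.swap x)) (d 0) x" using fun_cong[OF w(2), of "prod.swap x"] by (simp add: rowm_colm)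
   qed
   then show "EX w:free_on A (I \<times> B 1). v = rmul A w (blk (d 0))" using rm[OF w'] w' by (intro bexI[of _ "%x. w (prod.swap x)"]) simp_all
  next
   assume "EX w:free_on A (I \<times> B 1). v = rmul A w (blk (d 0))"
   then obtain w where w: "w : free_on A (I \<times> B (Suc 0))" "v = colm A w (d 0)" using rm[of _ 0] by auto
   have w': "(%x. w (prod.swap x)) : free_on (opp A) (B 1 \<times> I)" using fs_swap[OF w(1)] by simp
   have "(%x. v (prod.swap x)) = rowm (opp A) (%x. w (prod.swap x)) (d 0)" using w(2) by (simp add: rowm_colm)
   then show "lincomb (pws s) v ?e : {0}" using re_row[OF w'] lv by simp
  qed
 qed
 moreover have "freg A ?B ?d n"
 proof -
  obtain a where a: "!!b. b : B n ==> a b : free_on A (B (Suc n))"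
   "!!b. b : B (Suc n) ==> rmul A (rmul A (d n b) a) (d n) = d n b" using reg by (auto simp: freg_def)
  have ain: "blk a b : free_on A (I \<times> B (Suc n))" if "b : I \<times> B n" for b by (rule blk_in[OF sA that a(1)])
  have "rmul A (rmul A (blk (d n) b) (blk a)) (blk (d n)) = blk (d n) b" if b: "b : I \<times> B (Suc n)" for b
  proof -
   have 1: "rmul A (blk (d n) b) (blk a) = blk (%b. rmul A (d n b) a) b" using rmul_blk[where d = a, OF A din[OF b] a(1)] colm_blk[of A "d n" b a] by simp
   have "blk (%b. rmul A (d n b) a) b : free_on A (I \<times> B (Suc n))" unfolding 1[symmetric] by (rule ap_in[OF mod_on_self_opp[OF A] din[OF b] ain])
   from rm[OF this] have "rmul A (blk (%b. rmul A (d n b) a) b) (blk (d n))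
    = blk (%b. rmul A (rmul A (d n b) a) (d n)) b" unfolding colm_blk .
   then show ?thesis unfolding 1 using a(2) b by (auto simp: blk_def fun_eq_iff)
  qed
  then show ?thesis unfolding freg_def using ain by (intro exI[of _ "blk a"]) blast
 qed
 ultimately show ?thesis by (rule pdle_fresI)
qed

text \<open>Every exact free complex resolves its own cokernel, kept as the pair of the free module
  on \<open>B 0\<close> and the image of \<open>d 0\<close>. So results on modules apply to a
  complex that comes without one.\<close>

lemma fres_coker:
 assumes c: "fcx A B d" and ex: "!!n. ex_at (mult (opp A)) (carrier A) B d n"
 shows "fres A (free_on A (B 0)) (free_smult A) ((%v. rmul A v (d 0)) ` free_on A (B 1)) B d (%b. single b (one A))"
proof -
 have A: "ring_on A" using fcxD(1)[OF c] .
 have D: "submod A (free_on A (B 0)) (free_smult A) ((%v. rmul A v (d 0)) ` free_on A (B 1))" by (rule submod_image[OF free_mod[OF A] ap_lin_map[OF A]]) (use fcxD(2)[OF c, of _ 0] in simp)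
 show ?thesis unfolding fres_def
 proof (intro conjI free_mod[OF A] D c allI ex ballI fs_basis[OF A])
  fix x assume x: "x : free_on A (B 0)"
  show "EX v:free_on A (B 0). x - lincomb (free_smult A) v (%b. single b (one A)) : (%v. rmul A v (d 0)) ` free_on A (B 1)" using lincomb_basis[OF A x] subgrp_0[OF submodD(1)[OF D]] x by (intro bexI[of _ x]) simp_all
  show "lincomb (free_smult A) x (%b. single b (one A)) : (%v. rmul A v (d 0)) ` free_on A (B 1) <->
    (EX w:free_on A (B 1). x = rmul A w (d 0))" unfolding lincomb_basis[OF A x] by blast
 qed
qed

lemma pdle_trivial:
 fixes A :: "('a::ab_group_add, 's) ring_scheme" and X :: "'x::ab_group_add set"
 assumes X: "mod_on A X s" shows "pdle A X s X 0"
proof -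
 have A: "ring_on A" using mod_onD(1)[OF X] .
 have e: "free_on A {} = {0}" by (rule fs_empty[OF ring_onD(1)[OF A]])
 have "fres A X s X (%n. {}::('a * 'x) list set) (%n b. 0) (%b. 0)" using A X submod_self[OF X] subgrp_0[OF mod_onD(2)[OF X]] by (auto simp: fres_def fcx_def ex_at_def e)
 moreover have "freg A (%n. {}::('a * 'x) list set) (%n b. 0) 0" by (simp add: freg_def)
 ultimately show ?thesis unfolding pdle_def by blast
qed

section \<open>Split extensions\<close>

text \<open>The map \<open>\<theta>\<close> appears as a product \<open>mm\<close> on
  \<open>M\<close>; linearity on both sides and balancedness are stated for \<open>mm\<close>
  directly, in place of a map on a tensor product.\<close>

definition bimod_on :: "('a::ab_group_add, 's) ring_scheme => 'm::ab_group_add set => ('a => 'm => 'm) => ('a => 'm => 'm) =>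
  ('m => 'm => 'm) => bool" where
 "bimod_on A M la ra mm <-> mod_on A M la & mod_on (opp A) M ra &
  (ALL a:carrier A. ALL b:carrier A. ALL x:M. ra b (la a x) = la a (ra b x)) & biadd M M mm &
  (ALL x:M. ALL y:M. mm x y : M) & (ALL x:M. ALL y:M. ALL z:M. mm (mm x y) z = mm x (mm y z)) &
  (ALL a:carrier A. ALL x:M. ALL y:M. mm (la a x) y = la a (mm x y) & mm x (ra a y) = ra a (mm x y) & mm (ra a x) y = mm x (la a y))"

definition sext :: "('a::ab_group_add) ring => 'm::ab_group_add set => ('a => 'm => 'm) => ('a => 'm => 'm) =>
  ('m => 'm => 'm) => ('a * 'm) ring" where
 "sext A M la ra mm = \<lparr>carrier = carrier A \<times> M,
  mult = (%p q. (fst p \<otimes>\<^bsub>A\<^esub> fst q, la (fst p) (snd q) + ra (fst q) (snd p) + mm (snd p) (snd q))),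
  one = ((one A), 0), zero = 0, add = (+)\<rparr>"

lemma sext_simps [simp]:
 "carrier (sext A M la ra mm) = carrier A \<times> M" "\<one>\<^bsub>sext A M la ra mm\<^esub> = ((one A), 0)"
 "p \<otimes>\<^bsub>sext A M la ra mm\<^esub> q = (fst p \<otimes>\<^bsub>A\<^esub> fst q, la (fst p) (snd q) + ra (fst q) (snd p) + mm (snd p) (snd q))" by (simp_all add: sext_def)

lemma opp_sext: "opp (sext A M la ra mm) = sext (opp A) M ra la (%x y. mm y x)" by (simp add: sext_def opp_def add.commute)

lemma bimod_on_opp: "bimod_on A M la ra mm ==> bimod_on (opp A) M ra la (%x y. mm y x)" using biadd_flip[of M M mm] by (simp add: bimod_on_def)

lemma bimod_onD:
 assumes "bimod_on A M la ra mm"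
 shows "mod_on A M la" "mod_on (opp A) M ra"
  "a : carrier A ==> b : carrier A ==> x : M ==> ra b (la a x) = la a (ra b x)"
  "biadd M M mm" "x : M ==> y : M ==> mm x y : M"
  "x : M ==> y : M ==> z : M ==> mm (mm x y) z = mm x (mm y z)"
  "a : carrier A ==> x : M ==> y : M ==> mm (la a x) y = la a (mm x y)"
  "a : carrier A ==> x : M ==> y : M ==> mm x (ra a y) = ra a (mm x y)"
  "a : carrier A ==> x : M ==> y : M ==> mm (ra a x) y = mm x (la a y)" using assms by (auto simp: bimod_on_def)

locale split_extension =
 fixes A :: "('a::ab_group_add) ring" and M :: "'m::ab_group_add set" and la ra mm
 assumes bi: "bimod_on A M la ra mm"
begin

abbreviation "E \<equiv> sext A M la ra mm"

lemma bi_ring: "ring_on A" using mod_onD(1)[OF bimod_onD(1)[OF bi]] .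

lemma bi_zero: "x : M ==> mm 0 x = 0" "x : M ==> mm x 0 = 0"
 "x : M ==> la 0 x = 0" "a : carrier A ==> la a 0 = 0" "x : M ==> ra 0 x = 0" "a : carrier A ==> ra a 0 = 0"
 "0 : M" "0 : carrier A" "mm 0 0 = 0" "la 0 0 = 0" "ra 0 0 = 0" using biadd_0[OF bimod_onD(4)[OF bi]] mod_on_0[OF bimod_onD(1)[OF bi]] mod_on_0[OF bimod_onD(2)[OF bi]]
  mod_onD(2)[OF bimod_onD(1)[OF bi]] ring_onD(1)[OF bi_ring] by (auto simp: subgrp_0)

lemma sext_ring_on: "ring_on E"
proof -
 note b = bimod_onD[OF bi]
 note L = mod_onD[OF b(1)] and R = mod_onD[OF b(2), simplified] and A = ring_onD[OF bi_ring]
 note Ld = mod_on_distrib[OF b(1)] and Rd = mod_on_distrib[OF b(2), simplified]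
 have M: "subgrp M" using L(2) .
 have biadd: "biadd (carrier E) (carrier E) (mult E)" by (rule biaddI) (auto simp: biadd_add[OF A(3)] Ld Rd biadd_add[OF b(4)] algebra_simps)
 have assoc: "p \<otimes>\<^bsub>E\<^esub> q \<otimes>\<^bsub>E\<^esub> r = p \<otimes>\<^bsub>E\<^esub> (q \<otimes>\<^bsub>E\<^esub> r)" if "p : carrier E" "q : carrier E" "r : carrier E" for p q r using that by (cases p; cases q; cases r)
   (simp add: A(4,5) L(4,5) R(4,5) b(3,5,6,7,8,9) Ld(1) Rd(1) biadd_add[OF b(4)] subgrp_add[OF M] algebra_simps)
 show ?thesis unfolding ring_on_def using biadd assoc by (auto simp: subgrp_Times[OF A(1) M] A(2,4,6,7) subgrp_0[OF M] L(4,6) R(4,6) b(5) subgrp_add[OF M] bi_zero)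
qed

lemma ring_map_iota: "ring_map A E (%a. (a, 0))" by (auto simp: ring_map_def additive_on_def bi_zero)

lemma ring_map_fst: "ring_map E A fst" by (auto simp: ring_map_def additive_on_def)

lemma fs_sext: "v : fs (carrier A \<times> M) B <-> (%b. fst (v b)) : free_on A B & (%b. snd (v b)) : fs M B"
proof -
 have "{b. v b ~= 0} = {b. fst (v b) ~= 0} \<union> {b. snd (v b) ~= 0}" by (auto simp: prod_eq_iff)
 then show ?thesis by (auto simp: fs_def prod_eq_iff mem_Times_iff)
qed

text \<open>As a right \<open>A\<close>-module \<open>E\<close> is \<open>A \<oplus> M\<close>,
  hence a matrix over \<open>A\<close> acts separately on the two components of a vector over
  \<open>E\<close>. Base change to \<open>E\<close> is therefore exact where both the complex and
  its tensor product with \<open>M\<close> are.\<close>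

lemma rmul_iota:
 assumes v: "v : free_on E B" and d: "!!b. b : B ==> d b : free_on A J"
 shows "rmul E v (%b j. (d b j, 0)) = (%j. (rmul A (%b. fst (v b)) d j, ap ra (%b. snd (v b)) d j))"
proof
 fix j
 note b = bimod_onD[OF bi]
 let ?s = "%r n. n \<otimes>\<^bsub>E\<^esub> (r, 0)"
 have E: "ring_on E" by (rule sext_ring_on)
 have i: "(r, 0) : carrier E" if "r : carrier A" for r using that bi_zero by simp
 have im: "(r, 0) \<otimes>\<^bsub>E\<^esub> (r', 0) = (r \<otimes>\<^bsub>A\<^esub> r', 0)" if "r : carrier A" "r' : carrier A" for r r' using that bi_zero by simp
 have N: "mod_on (opp A) (carrier E) ?s" unfolding mod_on_def
 proof (intro conjI ballI)
  show "ring_on (opp A)" using bi_ring by simp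
  show "subgrp (carrier E)" using ring_onD(1)[OF E] .
  show "biadd (carrier (opp A)) (carrier E) ?s"
  proof (rule biaddI)
   fix a a' n assume "a : carrier (opp A)" "a' : carrier (opp A)" "n : carrier E"
   then show "?s (a + a') n = ?s a n + ?s a' n" using biadd_add(2)[OF ring_onD(3)[OF E], of n "(a, 0)" "(a', 0)"] i by simp
  next
   fix a n n' assume "a : carrier (opp A)" "n : carrier E" "n' : carrier E"
   then show "?s a (n + n') = ?s a n + ?s a n'" using biadd_add(1)[OF ring_onD(3)[OF E], of n n' "(a, 0)"] i by simp
  qed
  show "?s a n : carrier E" if "a : carrier (opp A)" "n : carrier E" for a n using ring_onD(4)[OF E that(2) i] that by simp
  show "?s (a \<otimes>\<^bsub>opp A\<^esub> a') n = ?s a (?s a' n)" if "a : carrier (opp A)" "a' : carrier (opp A)" "n : carrier E" for a a' n using ring_onD(5)[OF E that(3) i i, of a' a] im that by simp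
  show "?s \<one>\<^bsub>opp A\<^esub> n = n" if "n : carrier E" for n using ring_onD(7)[OF E that] by simp
 qed
 have "rmul E v (%b j. (d b j, 0)) j = ap ?s v d j" by (simp add: ap_def lincomb_def)
 moreover have "fst (ap ?s v d j) = rmul A (%b. fst (v b)) d j" by (rule map_ap[OF N mod_on_self_opp[OF bi_ring], where \<kappa> = "%r. r"]) (use v d in "auto simp: additive_fst")
 moreover have "snd (ap ?s v d j) = ap ra (%b. snd (v b)) d j" by (rule map_ap[OF N b(2), where \<kappa> = "%r. r"]) (use v d in "auto simp: additive_snd bi_zero")
 ultimately show "rmul E v (%b j. (d b j, 0)) j = (rmul A (%b. fst (v b)) d j, ap ra (%b. snd (v b)) d j)" by (simp add: prod_eq_iff)
qed

lemma fcx_iota: "fcx A B d ==> fcx E B (%n b j. (d n b j, 0))" by (rule fcx_base_change[OF _ sext_ring_on ring_map_iota])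

lemma ex_at_iota:
 assumes c: "fcx A B d" and 1: "ex_at (mult (opp A)) (carrier A) B d n" and 2: "ex_at ra M B d n"
 shows "ex_at (mult (opp E)) (carrier E) B (%n b j. (d n b j, 0)) n" unfolding ex_at_def
proof (intro ballI impI)
 fix v assume v: "v : free_on E (B (Suc n))" and z: "rmul E v (%b j. (d n b j, 0)) = 0"
 have "rmul A (%b. fst (v b)) (d n) j = 0 & ap ra (%b. snd (v b)) (d n) j = 0" for j using fun_cong[OF z, of j] fun_cong[OF rmul_iota[where d = "d n", OF v fcxD(2)[OF c]], of j] by (simp add: prod_eq_iff)
 then have "rmul A (%b. fst (v b)) (d n) = 0" "ap ra (%b. snd (v b)) (d n) = 0" by (simp_all add: fun_eq_iff)
 moreover have "(%b. fst (v b)) : free_on A (B (Suc n))" "(%b. snd (v b)) : fs M (B (Suc n))" using v by (simp_all add: fs_sext)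
 ultimately obtain w1 w2 where w: "w1 : free_on A (B (Suc (Suc n)))" "(%b. fst (v b)) = rmul A w1 (d (Suc n))"
  "w2 : fs M (B (Suc (Suc n)))" "(%b. snd (v b)) = ap ra w2 (d (Suc n))" using 1 2 unfolding ex_at_def by blast
 let ?w = "%b. (w1 b, w2 b)"
 have w': "?w : free_on E (B (Suc (Suc n)))" using w by (simp add: fs_sext)
 have "v j = rmul E ?w (%b j. (d (Suc n) b j, 0)) j" for j using fun_cong[OF rmul_iota[where d = "d (Suc n)", OF w' fcxD(2)[OF c]], of j]
   fun_cong[OF w(2), of j] fun_cong[OF w(4), of j] by (simp add: prod_eq_iff)
 then show "EX w:free_on E (B (Suc (Suc n))). v = rmul E w (%b j. (d (Suc n) b j, 0))" using w' by blast
qed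

lemma kernel_ideal_right: "mod_on (opp E) ({0} \<times> M) (mult (opp E))"
 and kernel_ideal_left: "mod_on E ({0} \<times> M) (mult E)"
proof -
 have "submod E (carrier E) (mult E) ({0} \<times> M)" "submod (opp E) (carrier (opp E)) (mult (opp E)) ({0} \<times> M)" using mod_onD[OF bimod_onD(1)[OF bi]] mod_onD(4)[OF bimod_onD(2)[OF bi]] bimod_onD(5)[OF bi]
   mod_on_0[OF mod_on_self[OF bi_ring]] bi_zero by (auto simp: submod_def subgrp_Times intro!: subgrp_add)
 then show "mod_on (opp E) ({0} \<times> M) (mult (opp E))" "mod_on E ({0} \<times> M) (mult E)" using submod_mod_on mod_on_self[of "opp E"] mod_on_self[of E] sext_ring_on by auto
qed

text \<open>If the kernel ideal has bounded flat dimension on the right, then reduction modulo that ideal preserves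
 exactness in high degrees.\<close>

lemma ex_at_fst:
 assumes c: "fcx E B d" and ex: "ex_at (mult (opp E)) (carrier E) B d (Suc n)"
  and exM: "ex_at (mult (opp E)) ({0} \<times> M) B d n"
 shows "ex_at (mult (opp A)) (carrier A) B (%n b j. fst (d n b j)) (Suc n)" unfolding ex_at_def
proof (intro ballI impI)
 fix v assume v: "v : free_on A (B (Suc (Suc n)))" and z: "rmul A v (%b j. fst (d (Suc n) b j)) = 0"
 note E = sext_ring_on and N = mod_on_self_opp[OF sext_ring_on]
 let ?v = "%b. (v b, 0::'m)"
 have v': "?v : free_on E (B (Suc (Suc n)))" using v fs_ring_map[OF bi_ring ring_map_iota v] by simp
 have vd: "rmul E ?v (d (Suc n)) : free_on E (B (Suc n))" by (rule ap_in[OF N v' fcxD(2)[OF c]])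
 have "fst (rmul E ?v (d (Suc n)) j) = 0" for j using fun_cong[OF rmul_map[where d = "d (Suc n)", OF E bi_ring ring_map_fst v' fcxD(2)[OF c]], of j] fun_cong[OF z, of j] by simp
 then have vd': "rmul E ?v (d (Suc n)) : fs ({0} \<times> M) (B (Suc n))" using vd by (auto simp: fs_def mem_Times_iff)
 \<comment> \<open>The boundary of the lifted cycle \<open>?v\<close> has entries in the ideal.
   Exactness with coefficients in the ideal corrects \<open>?v\<close> by a vector \<open>w\<close>
   over the ideal, which becomes zero over \<open>A\<close>.\<close>
 obtain w where w: "w : fs ({0} \<times> M) (B (Suc (Suc n)))" "rmul E ?v (d (Suc n)) = rmul E w (d (Suc n))" using exM vd' fcx_dd[OF c N v'] unfolding ex_at_def by blast
 have wE: "w : free_on E (B (Suc (Suc n)))" using w(1) bi_zero by (auto simp: fs_def mem_Times_iff)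
 have sub: "subgrp (free_on E (B (Suc (Suc n))))" by (rule subgrp_fs[OF ring_onD(1)[OF E]])
 have "rmul E (?v - w) (d (Suc n)) = 0" using additive_on_diff[OF ap_additive[OF N fcxD(2)[OF c]] sub v' wE] w(2) by simp
 then obtain u where u: "u : free_on E (B (Suc (Suc (Suc n))))" "?v - w = rmul E u (d (Suc (Suc n)))" using ex subgrp_diff[OF sub v' wE] unfolding ex_at_def by blast
 have "v b = rmul A (%b. fst (u b)) (%b j. fst (d (Suc (Suc n)) b j)) b" for b using fun_cong[OF rmul_map[where d = "d (Suc (Suc n))", OF E bi_ring ring_map_fst u(1) fcxD(2)[OF c]], of b] fun_cong[OF u(2), of b] fsD(2)[OF w(1), of b] by (simp add: prod_eq_iff mem_Times_iff)
 moreover have "(%b. fst (u b)) : free_on A (B (Suc (Suc (Suc n))))" by (rule fs_ring_map[OF E ring_map_fst u(1)])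
 ultimately show "EX w:free_on A (B (Suc (Suc (Suc n)))). v = rmul A w (%b j. fst (d (Suc (Suc n)) b j))" by blast
qed

end

section \<open>Nilpotent ideals and the lifting of splittings\<close>

definition zspan :: "'a::ab_group_add set => 'a set" where
 "zspan S = \<Inter>{H. subgrp H & S <= H}"

lemma subgrp_zspan: "subgrp (zspan S)" unfolding zspan_def subgrp_def by blast

lemma zspan_superset: "x : S ==> x : zspan S" by (auto simp: zspan_def)

lemma zspan_least: "subgrp H ==> S <= H ==> x : zspan S ==> x : H" by (auto simp: zspan_def)

text \<open>Products of \<open>i + 1\<close> factors, so \<open>mpow mm M N <= {0}\<close> says that
  all products of \<open>N + 1\<close> elements vanish. Only the products are collected; sums are
  taken later by \<open>zspan\<close>.\<close>

primrec mpow :: "('m => 'm => 'm) => 'm set => nat => 'm set" where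
 "mpow mm M 0 = M"
| "mpow mm M (Suc i) = {mm x y | x y. x : M & y : mpow mm M i}"

context split_extension
begin

lemma mpow_sub: "mpow mm M i <= M" by (induction i) (auto simp: bimod_onD(5)[OF bi])

text \<open>Substituting the hypothesis into itself puts \<open>K\<close> into \<open>S\<close> plus
  products of more and more elements of \<open>M\<close> with \<open>K\<close>, and these vanish in
  the end. Nilpotency takes the place of finite generation, and \<open>K\<close> may be any
  subset.\<close>

lemma nakayama:
 assumes X: "mod_on E X s" and S: "submod E X s S" and K: "K <= X" and nil: "mpow mm M N <= {0}"
  and ex: "!!k. k : K ==> EX h:zspan {s (0, y) k' | y k'. y : M & k' : K}. k - h : S"
 shows "K <= S"
proof -
 define H where "H i = zspan {s (0, y) k' | y k'. y : mpow mm M i & k' : K}" for i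
 have sS: "subgrp S" and SX: "x : X" if "x : S" for x using submodD[OF S] that by auto
 have sS: "subgrp S" using submodD(1)[OF S] .
 have cE: "(0, y) : carrier E" if "y : M" for y using that bi_zero by simp
 have HX: "h : X" if "h : H i" for h i by (rule zspan_least[OF mod_onD(2)[OF X] _ that[unfolded H_def]]) (use mpow_sub[of i] K mod_onD(4)[OF X cE] in auto)
 have step: "s (0, y) h : H (Suc i)" if y: "y : M" and h: "h : H i" for y h i
 proof -
  have "subgrp {x\<in>X. s (0, y) x : H (Suc i)}" by (rule subgrp_preimage[OF mod_onD(2)[OF X] biadd_right[OF mod_onD(3)[OF X] cE[OF y]]])
    (simp add: H_def subgrp_zspan)
  moreover have "{s (0, y) k' | y k'. y : mpow mm M i & k' : K} <= {x\<in>X. s (0, y) x : H (Suc i)}"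
  proof (clarify, intro conjI)
   fix z k assume z: "z : mpow mm M i" and k: "k : K"
   have zM: "z : M" and kX: "k : X" using z k mpow_sub K by auto
   show "s (0, z) k : X" using mod_onD(4)[OF X cE[OF zM] kX] .
   have "s (0, y) (s (0, z) k) = s (0, mm y z) k" using mod_onD(5)[OF X cE[OF y] cE[OF zM] kX] mod_on_0[OF mod_on_self[OF bi_ring]] bi_zero y zM by simp
   also have "... : H (Suc i)" unfolding H_def by (rule zspan_superset) (use y z k in auto)
   finally show "s (0, y) (s (0, z) k) : H (Suc i)" .
  qed
  ultimately show ?thesis using zspan_least h unfolding H_def by blast
 qed
 have claim: "ALL k:K. EX h:H i. k - h : S" for i
 proof (induction i)
  case 0 then show ?case using ex by (simp add: H_def)
 next
  case (Suc i)
  let ?T = "{x\<in>X. EX h:H (Suc i). x - h : S}"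
  have sH: "subgrp (H (Suc i))" by (simp add: H_def subgrp_zspan)
  have T: "subgrp ?T" unfolding subgrp_def
  proof (intro conjI ballI)
   show "0 : ?T" using subgrp_0[OF mod_onD(2)[OF X]] subgrp_0[OF sS] subgrp_0[OF sH] by (auto intro!: bexI[of _ 0])
   fix x y assume "x : ?T" "y : ?T"
   then obtain h h' where h: "x : X" "y : X" "h : H (Suc i)" "h' : H (Suc i)" "x - h : S" "y - h' : S" by blast
   have "(x - y) - (h - h') : S" using subgrp_diff[OF sS h(5,6)] by (simp add: algebra_simps)
   then show "x - y : ?T" using subgrp_diff[OF mod_onD(2)[OF X] h(1,2)] subgrp_diff[OF sH h(3,4)] by blast
  qed
  have gens: "{s (0, y) k' | y k'. y : M & k' : K} <= ?T"
  proof (clarify, intro conjI)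
   fix y k assume y: "y : M" and k: "k : K"
   have kX: "k : X" using k K by auto
   show "s (0, y) k : X" using mod_onD(4)[OF X cE[OF y] kX] .
   obtain h where h: "h : H i" "k - h : S" using Suc k by blast
   have "s (0, y) k - s (0, y) h : S" using mod_on_distrib(2)[OF X cE[OF y] kX HX[OF h(1)]] submodD(3)[OF S cE[OF y] h(2)] by simp
   then show "EX h:H (Suc i). s (0, y) k - h : S" using step[OF y h(1)] by blast
  qed
  show ?case
  proof
   fix k assume "k : K"
   then obtain h where h: "h : zspan {s (0, y) k' | y k'. y : M & k' : K}" "k - h : S" using ex by blast
   obtain h' where h': "h' : H (Suc i)" "h - h' : S" using zspan_least[OF T gens h(1)] by blast
   have "k - h' : S" using subgrp_add[OF sS h(2) h'(2)] by simp
   then show "EX h:H (Suc i). k - h : S" using h'(1) by blast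
  qed
 qed
 have "H N <= {0}"
 proof
  fix h assume "h : H N"
  moreover have "{s (0, y) k' | y k'. y : mpow mm M N & k' : K} <= {0}" using nil K mod_on_0(1)[OF X] by (auto simp: zero_prod_def)
  ultimately show "h : {0}" using zspan_least[of "{0}"] unfolding H_def by auto
 qed
 then show ?thesis using claim[of N] by (metis diff_zero singletonD subset_iff)
qed

text \<open>A finitely presented projective module over \<open>A\<close> is lifted to \<open>E\<close> through an idempotent matrix
 over \<open>A\<close>; by Nakayama's lemma the lift is isomorphic to the cokernel over \<open>E\<close>.\<close>

lemma freg_lift:
 assumes c: "fcx E B d" and exA: "ex_at (mult (opp A)) (carrier A) B (%n b j. fst (d n b j)) n"
  and reg: "freg A B (%n b j. fst (d n b j)) n" and nil: "mpow mm M N <= {0}"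
 shows "freg E B d n"
proof -
 note E = sext_ring_on
 note A = bi_ring
 note NE = mod_on_self_opp[OF E] and NA = mod_on_self_opp[OF A]
 let ?F = "free_on E (B n)" and ?G = "free_on E (B (Suc n))" and ?m = "free_smult E"
 let ?dA = "%b j. fst (d n b j)"
 have FE: "mod_on E ?F ?m" and GE: "mod_on E ?G ?m" by (rule free_mod[OF E])+
 have cA: "fcx A B (%n b j. fst (d n b j))" by (rule fcx_base_change[OF c A ring_map_fst])
 note dE = fcxD(2)[OF c, of _ n] and dA = fcxD(2)[OF cA, of _ n]
 have sF: "subgrp ?F" and sG: "subgrp ?G" using mod_onD(2)[OF FE] mod_onD(2)[OF GE] by auto
 have sFA: "subgrp (free_on A (B n))" by (rule subgrp_fs[OF ring_onD(1)[OF A]])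
 obtain a where a: "!!b. b : B n ==> a b : free_on A (B (Suc n))"
  "!!b. b : B (Suc n) ==> rmul A (rmul A (?dA b) a) ?dA = ?dA b" using reg by (auto simp: freg_def)
 \<comment> \<open>Since \<open>d a d = d\<close> over \<open>A\<close>, this is the projection of
   the free module on \<open>B n\<close> along the image of the differential onto a complement, a
   copy of the cokernel.\<close>
 define f where "f v = v - rmul A (rmul A v a) ?dA" for v
 have lin_d: "lin_map A (free_on A (B (Suc n))) (free_smult A) (free_on A (B n)) (free_smult A) (%v. rmul A v ?dA)" by (rule ap_lin_map[OF A dA])
 have lin_a: "lin_map A (free_on A (B n)) (free_smult A) (free_on A (B (Suc n))) (free_smult A) (%v. rmul A v a)" by (rule ap_lin_map[OF A a(1)])
 have lin_f: "lin_map A (free_on A (B n)) (free_smult A) (free_on A (B n)) (free_smult A) f" unfolding f_def by (rule lin_map_diff_fun[OF free_mod[OF A] lin_map_id lin_map_comp[OF lin_a lin_d]])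
 have dad: "rmul A (rmul A (rmul A w ?dA) a) ?dA = rmul A w ?dA" if w: "w : free_on A (B (Suc n))" for w
 proof -
  have "rmul A (rmul A w ?dA) a = rmul A w (%b. rmul A (?dA b) a)" by (rule ap_ap[OF NA w dA a(1)])
  moreover have "rmul A (rmul A w (%b. rmul A (?dA b) a)) ?dA = rmul A w (%b. rmul A (rmul A (?dA b) a) ?dA)" by (rule ap_ap[OF NA w ap_in[OF NA dA a(1)] dA])
  moreover have "... = rmul A w ?dA" by (rule ap_cong[OF w a(2)])
  ultimately show ?thesis by simp
 qed
 have fd: "f (rmul A w ?dA) = 0" if "w : free_on A (B (Suc n))" for w unfolding f_def dad[OF that] by simp
 have ff: "f (f v) = f v" if v: "v : free_on A (B n)" for v
 proof -
  have "f (v - rmul A (rmul A v a) ?dA) = f v - f (rmul A (rmul A v a) ?dA)" by (rule lin_map_diff[OF lin_f sFA v]) (use lin_mapD(2)[OF lin_map_comp[OF lin_a lin_d] v] in simp)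
  then show ?thesis using fd[OF lin_mapD(2)[OF lin_a v]] f_def[of v] by simp
 qed
 define e0 where "e0 b = f (single b (one A))" for b
 have e0: "e0 b : free_on A (B n)" if "b : B n" for b unfolding e0_def by (rule lin_mapD(2)[OF lin_f fs_basis[OF A that]])
 have fe: "f v = rmul A v e0" if "v : free_on A (B n)" for v unfolding ap_lincomb e0_def by (rule lin_map_free_eq[OF A lin_f that])
 \<comment> \<open>The matrix of \<open>f\<close> with its entries viewed in \<open>E\<close> is
   still idempotent; its image \<open>P\<close> is a direct summand of \<open>?F\<close> that lifts
   the cokernel over \<open>A\<close>.\<close>
 define e where "e b = (%j. (e0 b j, 0::'m))" for b
 define \<iota> where "\<iota> v = (%j. (v j, 0::'m))" for v :: "'b => 'a"
 have \<iota>: "\<iota> v : free_on E I" if "v : free_on A I" for v I unfolding \<iota>_def by (rule fs_ring_map[OF A ring_map_iota that])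
 have e: "e b : ?F" if "b : B n" for b using \<iota>[OF e0[OF that]] by (simp add: e_def \<iota>_def)
 have \<iota>e: "rmul E (\<iota> v) e = \<iota> (f v)" if "v : free_on A (B n)" for v unfolding fe[OF that] \<iota>_def e_def by (rule rmul_map[OF A E ring_map_iota that e0])
 have lin_e: "lin_map E ?F ?m ?F ?m (%v. rmul E v e)" by (rule ap_lin_map[OF E e])
 have ee: "rmul E (e b) e = e b" if b: "b : B n" for b
 proof -
  have "e b = \<iota> (e0 b)" by (simp add: e_def \<iota>_def)
  then show ?thesis using \<iota>e[OF e0[OF b]] ff[OF fs_basis[OF A b]] by (simp add: e0_def)
 qed
 have fst_e: "(%j. fst (rmul E v e j)) = f (%j. fst (v j))" if v: "v : ?F" for v
 proof -
  have "rmul A (%b. fst (v b)) (%b j. fst (e b j)) = (%j. fst (rmul E v e j))" by (rule rmul_map[OF E A ring_map_fst v e])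
  then show ?thesis using fe[OF fs_ring_map[OF E ring_map_fst v]] by (simp add: e_def)
 qed
 define P where "P = (%v. rmul E v e) ` ?F"
 define D where "D = (%v. rmul E v (d n)) ` ?G"
 have lin_dE: "lin_map E ?G ?m ?F ?m (%v. rmul E v (d n))" by (rule ap_lin_map[OF E dE])
 have P: "submod E ?F ?m P" unfolding P_def by (rule submod_image[OF FE lin_e])
 have D: "submod E ?F ?m D" unfolding D_def by (rule submod_image[OF GE lin_dE])
 have sP: "subgrp P" and sD: "subgrp D" using submodD(1)[OF P] submodD(1)[OF D] by auto
 have Pe: "rmul E p e = p" if p: "p : P" for p
 proof -
  obtain v where v: "v : ?F" "p = rmul E v e" using p by (auto simp: P_def)
  have "rmul E (rmul E v e) e = rmul E v (%b. rmul E (e b) e)" by (rule ap_ap[OF NE v(1) e e])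
  also have "... = rmul E v e" by (rule ap_cong[OF v(1) ee])
  finally show ?thesis using v(2) by simp
 qed
 have eP: "e b : P" if b: "b : B n" for b unfolding P_def by (rule image_eqI[of _ _ "single b (one E)"]) (use fs_basis[OF E b] rmul_single[where f = e and b = b, OF E e[OF b]] in simp_all)
 have span_M: "lincomb ?m v y : zspan {?m (0, x) k | x k. x : M & k : K}" if vM: "v : fs ({0} \<times> M) I" and yK: "!!b. b : I ==> y b : K" for v :: "'b => 'a * 'm" and y :: "'b => 'b => 'a * 'm" and I K
 proof (rule lincomb_in[OF subgrp_zspan vM])
  fix b assume "b : I"
  moreover obtain x where "v b = (0, x)" "x : M" using fsD(2)[OF vM, of b] by auto
  ultimately show "?m (v b) (y b) : zspan {?m (0, x) k | x k. x : M & k : K}" using yK by (intro zspan_superset) auto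
 qed
 have MF: "v : fs ({0} \<times> M) I" if "v : free_on E I" "!!j. fst (v j) = 0" for v :: "'b => 'a * 'm" and I using that by (auto simp: fs_def mem_Times_iff)
 let ?S = "{p + x | p x. p : P & x : D}"
 have S: "submod E ?F ?m ?S" unfolding submod_def subgrp_def
 proof (intro conjI ballI subsetI)
  have "(0::'b => 'a * 'm) = 0 + 0" by simp
  then show "0 : ?S" using subgrp_0[OF sP] subgrp_0[OF sD] by blast
  fix u v assume "u : ?S" "v : ?S"
  then obtain p x q y where "u = p + x" "v = q + y" "p : P" "x : D" "q : P" "y : D" by blast
  then have "u - v = (p - q) + (x - y)" "p - q : P" "x - y : D" using sP sD by (auto simp: subgrp_diff)
  then show "u - v : ?S" by blast
 next
  fix u assume "u : ?S"
  then show "u : ?F" using subgrp_add[OF sF] submodD(2)[OF P] submodD(2)[OF D] by blast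
 next
  fix r u assume r: "r : carrier E" and "u : ?S"
  then obtain p x where u: "u = p + x" "p : P" "x : D" by blast
  then have "?m r u = ?m r p + ?m r x" using mod_on_distrib(1)[OF FE r] submodD(2)[OF P] submodD(2)[OF D] by blast
  then show "?m r u : ?S" using submodD(3)[OF P r u(2)] submodD(3)[OF D r u(3)] by blast
 qed
 \<comment> \<open>Modulo the ideal a vector is its \<open>f\<close>-part plus a boundary, so
   Nakayama's lemma makes \<open>P\<close> and \<open>D\<close> span the whole free module.\<close>
 have "?F <= ?S"
 proof (rule nakayama[OF FE S order_refl nil])
  fix v assume v: "v : ?F"
  let ?w = "rmul E v (%b. \<iota> (a b))"
  have w: "?w : ?G" by (rule ap_in[OF NE v \<iota>[OF a(1)]])
  let ?h = "v - rmul E v e - rmul E ?w (d n)"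
  have ve: "rmul E v e : ?F" and wd: "rmul E ?w (d n) : ?F" using lin_mapD(2)[OF lin_e v] lin_mapD(2)[OF lin_dE w] by auto
  have h: "?h : ?F" by (intro subgrp_diff[OF sF] v ve wd)
  let ?v0 = "%b. fst (v b)"
  have v0: "?v0 : free_on A (B n)" by (rule fs_ring_map[OF E ring_map_fst v])
  have "rmul A ?v0 (%b j. fst (\<iota> (a b) j)) = (%j. fst (?w j))" by (rule rmul_map[OF E A ring_map_fst v \<iota>[OF a(1)]])
  moreover have "rmul A (%j. fst (?w j)) ?dA = (%j. fst (rmul E ?w (d n) j))" by (rule rmul_map[OF E A ring_map_fst w dE])
  ultimately have wq: "(%j. fst (rmul E ?w (d n) j)) = rmul A (rmul A ?v0 a) ?dA" by (simp add: \<iota>_def)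
  have "fst (?h j) = 0" for j using fun_cong[OF fst_e[OF v], of j] fun_cong[OF wq, of j] by (simp add: f_def)
  then have hM: "?h : fs ({0} \<times> M) (B n)" using MF[OF h] by blast
  have "lincomb ?m ?h (%b. single b (one E)) : zspan {?m (0, x) k | x k. x : M & k : ?F}" by (rule span_M[OF hM, of "%b. single b (one E)", OF fs_basis[OF E]])
  then have "?h : zspan {?m (0, x) k | x k. x : M & k : ?F}" unfolding lincomb_basis[OF E h] .
  moreover have "v - ?h : ?S"
  proof -
   have "v - ?h = rmul E v e + rmul E ?w (d n)" by simp
   moreover have "rmul E v e : P" "rmul E ?w (d n) : D" using v w unfolding P_def D_def by blast+
   ultimately show ?thesis by blast
  qed
  ultimately show "EX h:zspan {?m (0, x) k | x k. x : M & k : ?F}. v - h : ?S" by blast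
 qed
 \<comment> \<open>The decomposition of the basis vectors provides the candidate \<open>a'\<close>
   and a linear map \<open>g\<close> into \<open>P\<close> that is the identity modulo
   \<open>D\<close>.\<close>
 then have "EX p x. single b (one E) = p + rmul E x (d n) & p : P & x : ?G" if "b : B n" for b using fs_basis[OF E that] unfolding D_def by blast
 then obtain p a' where pa: "!!b. b : B n ==> single b (one E) = p b + rmul E (a' b) (d n)"
  "!!b. b : B n ==> p b : P" "!!b. b : B n ==> a' b : ?G" by metis
 have sp: "single b (one E) - p b = rmul E (a' b) (d n)" if "b : B n" for b unfolding pa(1)[OF that] by (rule add_diff_cancel_left')
 have pF: "p b : ?F" if "b : B n" for b using submodD(2)[OF P pa(2)[OF that]] .
 define g where "g v = lincomb ?m v p" for v
 have lin_g: "lin_map E ?F ?m ?F ?m g" unfolding g_def by (rule lincomb_lin_map[OF FE pF])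
 have gP: "g v : P" if "v : ?F" for v unfolding g_def by (rule submod_lincomb_in[OF FE P that pa(2)])
 have gD: "v - g v = rmul E (rmul E v a') (d n)" if v: "v : ?F" for v
 proof -
  have "rmul E (rmul E v a') (d n) = rmul E v (%b. rmul E (a' b) (d n))" by (rule ap_ap[OF NE v pa(3) dE])
  also have "... = lincomb ?m v (%b. single b (one E) - p b)" unfolding ap_lincomb[of E v] by (rule lincomb_cong[OF v]) (simp only: sp)
  also have "... = lincomb ?m v (%b. single b (one E)) - g v" unfolding g_def by (rule lincomb_diff_right[OF mod_onD(3)[OF FE] sF v fs_basis[OF E] pF])
  also have "... = v - g v" unfolding lincomb_basis[OF E v] ..
  finally show ?thesis by simp
 qed
 have gD': "v - g v : D" if v: "v : ?F" for v unfolding gD[OF v] D_def by (intro imageI lin_mapD(2)[OF ap_lin_map[OF E pa(3)] v])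
 let ?K = "P \<inter> D"
 have gK: "g v : ?K" if v: "v : D" for v
 proof -
  have vF: "v : ?F" using submodD(2)[OF D v] .
  have "v - (v - g v) : D" using subgrp_diff[OF sD v gD'[OF vF]] .
  then show ?thesis using gP[OF vF] by simp
 qed
 \<comment> \<open>An element \<open>k\<close> of \<open>P\<close> and \<open>D\<close> reduces to
   zero over \<open>A\<close>. By exactness there it is a combination of rows of \<open>d n\<close>
   with coefficients in the ideal, and it is also such a combination of rows of \<open>e\<close>.
   The first puts \<open>g k\<close>, the second \<open>k - g k\<close> into the span of products of
   \<open>M\<close> with \<open>?K\<close>, so Nakayama's lemma applies again.\<close>
 have K0: "?K <= {0}"
 proof (rule nakayama[OF FE submod_0[OF FE] _ nil])
  show "?K <= ?F" using submodD(2)[OF D] by blast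
  fix k assume k: "k : ?K"
  let ?Z = "zspan {?m (0, x) k | x k. x : M & k : ?K}"
  have kF: "k : ?F" using k submodD(2)[OF D] by blast
  obtain w where w: "w : ?G" "k = rmul E w (d n)" using k by (auto simp: D_def)
  let ?w0 = "%b. fst (w b)"
  have w0: "?w0 : free_on A (B (Suc n))" by (rule fs_ring_map[OF E ring_map_fst w(1)])
  have wd: "rmul A ?w0 ?dA = (%j. fst (k j))" unfolding w(2) by (rule rmul_map[OF E A ring_map_fst w(1) dE])
  have "(%j. fst (k j)) = f (%j. fst (k j))" using fst_e[OF kF] Pe k by simp
  also have "... = 0" using fd[OF w0] wd by simp
  finally have k0: "(%j. fst (k j)) = 0" .
  then obtain u where u: "u : free_on A (B (Suc (Suc n)))" "?w0 = rmul A u (%b j. fst (d (Suc n) b j))" using exA w0 wd unfolding ex_at_def by auto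
  let ?u = "rmul E (\<iota> u) (d (Suc n))"
  have uG: "?u : ?G" by (rule ap_in[OF NE \<iota>[OF u(1)] fcxD(2)[OF c]])
  have "rmul A (%b. fst (\<iota> u b)) (%b j. fst (d (Suc n) b j)) = (%j. fst (?u j))" by (rule rmul_map[OF E A ring_map_fst \<iota>[OF u(1)] fcxD(2)[OF c]])
  then have "fst ((w - ?u) b) = 0" for b using fun_cong[OF u(2), of b] by (simp add: \<iota>_def fun_eq_iff)
  then have w': "w - ?u : fs ({0} \<times> M) (B (Suc n))" using MF[OF subgrp_diff[OF sG w(1) uG]] by blast
  have kw: "k = rmul E (w - ?u) (d n)" using lin_map_diff[OF lin_dE sG w(1) uG] fcx_dd[OF c NE \<iota>[OF u(1)]] w(2) by simp
  have dbF: "d n b : D" if b: "b : B (Suc n)" for b unfolding D_def by (rule image_eqI[of _ _ "single b (one E)"])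
    (use fs_basis[OF E b] rmul_single[where f = "d n" and b = b, OF E dE[OF b]] in simp_all)
  have "g k = lincomb ?m (w - ?u) (%b. g (d n b))" unfolding kw ap_lincomb[of E "w - ?u" "d n"] by (rule lin_map_lincomb[OF FE lin_g subgrp_diff[OF sG w(1) uG] dE])
  then have 1: "g k : ?Z" using span_M[OF w' gK[OF dbF]] by simp
  have kM: "k : fs ({0} \<times> M) (B n)" using MF[OF kF] fun_cong[OF k0] by simp
  have ke: "k = lincomb ?m k e" using Pe[of k] k unfolding ap_lincomb by simp
  have "g k = lincomb ?m k (%b. g (e b))" by (subst ke) (rule lin_map_lincomb[OF FE lin_g kF e])
  moreover have "lincomb ?m k (%b. e b - g (e b)) = lincomb ?m k e - lincomb ?m k (%b. g (e b))" by (rule lincomb_diff_right[OF mod_onD(3)[OF FE] sF kF e lin_mapD(2)[OF lin_g e]])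
  ultimately have "k - g k = lincomb ?m k (%b. e b - g (e b))" using ke by simp
  moreover have "e b - g (e b) : ?K" if b: "b : B n" for b using subgrp_diff[OF sP eP[OF b] gP[OF e[OF b]]] gD'[OF e[OF b]] by simp
  ultimately have 2: "k - g k : ?Z" using span_M[OF kM, of "%b. e b - g (e b)" ?K] by simp
  have "g k + (k - g k) : ?Z" by (rule subgrp_add[OF subgrp_zspan 1 2])
  then show "EX h:?Z. k - h : {0}" by (intro bexI[of _ k]) simp_all
 qed
 \<comment> \<open>\<open>g\<close> sends the rows of \<open>d n\<close> into
   \<open>P \<inter> D\<close>, which is zero, so such a row equals its own boundary part.\<close>
 have "rmul E (rmul E (d n b) a') (d n) = d n b" if b: "b : B (Suc n)" for b
 proof -
  have "d n b : D" unfolding D_def by (rule image_eqI[of _ _ "single b (one E)"])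
    (use fs_basis[OF E b] rmul_single[where f = "d n" and b = b, OF E dE[OF b]] in simp_all)
  then have "g (d n b) = 0" using gK K0 by blast
  then show ?thesis using gD[OF dE[OF b]] by simp
 qed
 then show ?thesis unfolding freg_def using pa(3) by (intro exI[of _ a']) blast
qed

end

section \<open>Projective dimension of the ideal over the split extension\<close>

context split_extension
begin

lemma ap_bimod_lin_map:
 assumes d: "!!i. i : I ==> d i : free_on A J"
 shows "lin_map A (fs M I) (pws la) (fs M J) (pws la) (%v. ap ra v d)" unfolding lin_map_def
proof (intro conjI ballI)
 note b = bimod_onD[OF bi]
 show "additive_on (fs M I) (%v. ap ra v d)" by (rule ap_additive[OF b(2) d])
 show "ap ra v d : fs M J" if "v : fs M I" for v by (rule ap_in[OF b(2) that d])
 fix a v assume a: "a : carrier A" and v: "v : fs M I"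
 have "la a (ap ra v d j) = ap ra (%i. la a (v i)) (%i j. d i j) j" for j by (rule map_ap[OF b(2) b(2) biadd_right[OF mod_onD(3)[OF b(1)] a], where \<kappa> = "%r. r"])
   (use a v d b(3) mod_onD(4)[OF b(1)] in auto)
 then show "ap ra (pws la a v) d = pws la a (ap ra v d)" by (simp add: pws_def fun_eq_iff)
qed

text \<open>\<open>T'\<close> is the tensor product of \<open>M\<close> and \<open>T\<close>, and the higher Tor groups of \<open>M\<close> and \<open>T\<close> vanish;
 both are computed from a free resolution of \<open>T\<close>.\<close>

definition tens :: "'t::ab_group_add set => ('a => 't => 't) => 't set => ('a => 't => 't) => bool" where
 "tens T ta T' ta' <-> (ALL (C :: nat => ('a * 't) list set) dz ez. fres A T ta {0} C dz ez -->
  (EX \<psi>. lin_map A (fs M (C 0)) (pws la) T' ta' \<psi> & (ALL t:T'. EX m:fs M (C 0). \<psi> m = t) &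
    (ALL m:fs M (C 0). \<psi> m = 0 <-> (EX m':fs M (C 1). m = ap ra m' (dz 0)))) &
  (ALL n. ex_at ra M C dz n))"

lemma tensD:
 fixes T :: "'t::ab_group_add set" and C :: "nat => ('a * 't) list set"
 assumes t: "tens T ta T' ta'" and F: "fres A T ta {0} C dz ez"
 shows "EX \<psi>. lin_map A (fs M (C 0)) (pws la) T' ta' \<psi> & (ALL t:T'. EX m:fs M (C 0). \<psi> m = t) &
    (ALL m:fs M (C 0). \<psi> m = 0 <-> (EX m':fs M (C 1). m = ap ra m' (dz 0)))"
  "ex_at ra M C dz n" using t[unfolded tens_def, THEN spec, THEN spec, THEN spec, THEN mp, OF F, THEN conjunct1]
  t[unfolded tens_def, THEN spec, THEN spec, THEN spec, THEN mp, OF F, THEN conjunct2, THEN spec] .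

text \<open>The modules \<open>fs M (C i)\<close> form a complex that is exact by the vanishing of
  Tor and resolves the tensor product. Where the resolution of \<open>T\<close> splits, the cokernel
  is a summand of \<open>fs M (C n)\<close>; from there repeated cones lead down to degree
  0.\<close>

lemma pdle_tens:
 fixes T :: "'t::ab_group_add set"
 assumes M: "pdle A M la {0} c" and T: "pdle A T ta {0} n" and tens: "tens T ta T' ta'" and T': "mod_on A T' ta'"
 shows "EX k. pdle A T' ta' {0} k"
proof -
 note b = bimod_onD[OF bi]
 have A: "ring_on A" by (rule bi_ring)
 obtain C :: "nat => ('a * 't) list set" and dz ez where F: "fres A T ta {0} C dz ez" and reg: "freg A C dz n" using T by (auto simp: pdle_def)
 obtain \<psi> where \<psi>: "lin_map A (fs M (C 0)) (pws la) T' ta' \<psi>" "!!t. t : T' ==> EX m:fs M (C 0). \<psi> m = t"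
  "!!m. m : fs M (C 0) ==> \<psi> m = 0 <-> (EX m':fs M (C 1). m = ap ra m' (dz 0))" using tensD(1)[OF tens F] by (elim exE conjE) simp
 note ex = tensD(2)[OF tens F]
 note dz = fcxD(2)[OF fresD(3)[OF F]]
 have mod: "mod_on A (fs M I) (pws la)" for I :: "('a * 't) list set" by (rule fs_mod[OF b(1)])
 define \<mu> where "\<mu> i v = ap ra v (dz i)" for i v
 define I where "I i = \<mu> i ` fs M (C (Suc i))" for i
 have \<mu>: "lin_map A (fs M (C (Suc i))) (pws la) (fs M (C i)) (pws la) (\<mu> i)" for i unfolding \<mu>_def by (rule ap_bimod_lin_map[OF dz])
 have subI: "submod A (fs M (C i)) (pws la) (I i)" for i unfolding I_def by (rule submod_image[OF mod \<mu>])
 have ker: "\<mu> i x = 0 <-> x : I (Suc i)" if "x : fs M (C (Suc i))" for i x using ex[of i] that fcx_dd[OF fresD(3)[OF F] b(2)] by (auto simp: ex_at_def I_def \<mu>_def)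
 have sum: "pdle A (fs M (C i)) (pws la) {0} c" for i by (rule pdle_fs[OF M])
 have "EX k. pdle A (fs M (C i)) (pws la) (I i) k" if "i <= n" for i using that
 proof (induction i rule: inc_induct)
  case base
  obtain a where a: "!!b. b : C n ==> a b : free_on A (C (Suc n))"
   "!!b. b : C (Suc n) ==> rmul A (rmul A (dz n b) a) (dz n) = dz n b" using reg by (auto simp: freg_def)
  have la: "lin_map A (fs M (C n)) (pws la) (fs M (C (Suc n))) (pws la) (%v. ap ra v a)" by (rule ap_bimod_lin_map[OF a(1)])
  \<comment> \<open>It kills \<open>I n\<close> and is the identity modulo \<open>I n\<close>, which
    makes \<open>fs M (C n)\<close> modulo \<open>I n\<close> a retract of
    \<open>fs M (C n)\<close>.\<close>
  let ?f = "%v. v - \<mu> n (ap ra v a)"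
  have f: "lin_map A (fs M (C n)) (pws la) (fs M (C n)) (pws la) ?f" by (rule lin_map_diff_fun[OF mod lin_map_id lin_map_comp[OF la \<mu>]])
  have "?f x : {0}" if xI: "x : I n" for x
  proof -
   obtain w where w: "w : fs M (C (Suc n))" "x = ap ra w (dz n)" using xI by (auto simp: I_def \<mu>_def)
   have "ap ra x a = ap ra w (%i. rmul A (dz n i) a)" unfolding w(2) by (rule ap_ap[OF b(2) w(1) dz a(1)])
   then have "\<mu> n (ap ra x a) = ap ra (ap ra w (%i. rmul A (dz n i) a)) (dz n)" by (simp add: \<mu>_def)
   also have "... = ap ra w (%i. rmul A (rmul A (dz n i) a) (dz n))" by (rule ap_ap[OF b(2) w(1) ap_in[OF mod_on_self_opp[OF A] dz a(1)] dz])
   also have "... = x" unfolding w(2) by (rule ap_cong[OF w(1) a(2)])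
   finally show ?thesis by simp
  qed
  moreover have "?f x - x : I n" if x: "x : fs M (C n)" for x
  proof -
   have "\<mu> n (ap ra x a) : I n" unfolding I_def using lin_mapD(2)[OF la x] by blast
   then show ?thesis using subgrp_uminus[OF submodD(1)[OF subI]] by simp
  qed
  ultimately have "pdle A (fs M (C n)) (pws la) (I n) c" by (intro pdle_retract[OF sum mod subI f _ lin_map_id]) (auto intro: subgrp_0[OF submodD(1)[OF subI]])
  then show ?case by blast
 next
  case (step i)
  then obtain k where k: "pdle A (fs M (C (Suc i))) (pws la) (I (Suc i)) k" by blast
  have Im: "mod_on A (I i) (pws la)" by (rule submod_mod_on[OF mod subI])
  have "pdle A (fs M (C (Suc i))) (pws la) (I (Suc i)) k <-> pdle A (I i) (pws la) {0} k"
  proof (rule pdle_iso[where f = "\<mu> i", OF mod subI _ Im submod_0[OF Im]])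
   show "lin_map A (fs M (C (Suc i))) (pws la) (I i) (pws la) (\<mu> i)" by (rule lin_map_subset[OF \<mu> order_refl]) (simp add: I_def)
   show "\<mu> i x : {0} <-> x : I (Suc i)" if "x : fs M (C (Suc i))" for x using ker[OF that] by simp
   show "EX x:fs M (C (Suc i)). y - \<mu> i x : {0}" if "y : I i" for y using that by (auto simp: I_def)
  qed
  then have "pdle A (I i) (pws la) {0} k" using k by simp
  then show ?case using pdle_cone[OF submod_0[OF mod] _ subI _ sum] subgrp_0[OF submodD(1)[OF subI]] by blast
 qed
 from this[of 0] obtain k where k: "pdle A (fs M (C 0)) (pws la) (I 0) k" by auto
 have "pdle A (fs M (C 0)) (pws la) (I 0) k <-> pdle A T' ta' {0} k"
 proof (rule pdle_iso[OF mod subI \<psi>(1) T' submod_0[OF T']])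
  show "\<psi> x : {0} <-> x : I 0" if "x : fs M (C 0)" for x using \<psi>(3)[OF that] by (auto simp: I_def \<mu>_def)
  show "EX x:fs M (C 0). y - \<psi> x : {0}" if "y : T'" for y using \<psi>(2)[OF that] by auto
 qed
 then show ?thesis using k by blast
qed

text \<open>An isomorphism of \<open>X/D\<close>, restricted to \<open>A\<close>, with
  \<open>T\<close>. The restriction alone decides what the next kernel restricts to, so the
  \<open>E\<close>-structure need not be recorded along the way.\<close>

definition giso :: "'x::ab_group_add set => ('a * 'm => 'x => 'x) => 'x set => 't::ab_group_add set => ('a => 't => 't) => ('x => 't) => bool" where
 "giso X s D T ta \<kappa> <-> mod_on E X s & submod E X s D & additive_on X \<kappa> & (ALL x:X. \<kappa> x : T) &
  (ALL a:carrier A. ALL x:X. \<kappa> (s (a, 0) x) = ta a (\<kappa> x)) & (ALL t:T. EX x:X. \<kappa> x = t) & (ALL x:X. \<kappa> x = 0 <-> x : D)"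

lemma gisoD:
 assumes "giso X s D T ta \<kappa>"
 shows "mod_on E X s" "submod E X s D" "additive_on X \<kappa>" "x : X ==> \<kappa> x : T"
  "a : carrier A ==> x : X ==> \<kappa> (s (a, 0) x) = ta a (\<kappa> x)" "t : T ==> EX x:X. \<kappa> x = t"
  "x : X ==> \<kappa> x = 0 <-> x : D" using assms by (auto simp: giso_def)

text \<open>If \<open>K = X/D\<close> restricts to the \<open>A\<close>-module \<open>T\<close>, the kernel of \<open>E \<otimes>\<^sub>A K \<rightarrow> K\<close> restricts to \<open>M \<otimes>\<^sub>A T\<close>.
 With \<open>W = E\<^sup>C/D'\<close> a presentation of \<open>E \<otimes>\<^sub>A K\<close>, that kernel is \<open>L/D'\<close>.\<close>

lemma giso_step:
 fixes T :: "'t::ab_group_add set" and X :: "'x::ab_group_add set"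
 assumes tens: "tens T ta T' ta'" and T: "pdle A T ta {0} n" and X: "giso X s D T ta \<kappa>"
  and IH: "!!(X' :: (('a * 't) list => 'a * 'm) set) D' \<kappa>'. giso X' (free_smult E) D' T' ta' \<kappa>' ==>
   EX k. pdle E X' (free_smult E) D' k"
 shows "EX k. pdle E X s D k"
proof -
 note b = bimod_onD[OF bi] and g = gisoD[OF X]
 note A = bi_ring and E = sext_ring_on
 obtain C :: "nat => ('a * 't) list set" and dz ez where F: "fres A T ta {0} C dz ez" and reg: "freg A C dz n" using T by (auto simp: pdle_def)
 note f = fresD[OF F] and dz = fcxD(2)[OF fresD(3)[OF F]]
 obtain \<psi> where \<psi>: "lin_map A (fs M (C 0)) (pws la) T' ta' \<psi>" "!!t. t : T' ==> EX m:fs M (C 0). \<psi> m = t"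
  "!!m. m : fs M (C 0) ==> \<psi> m = 0 <-> (EX m':fs M (C 1). m = ap ra m' (dz 0))" using tensD(1)[OF tens F] by (elim exE conjE) simp
 note ex = tensD(2)[OF tens F]
 define \<iota> where "\<iota> v = (%j. (v j, 0::'m))" for v :: "('a * 't) list => 'a"
 define \<Delta> where "\<Delta> n b = \<iota> (dz n b)" for n b
 have \<Delta>_eq: "\<Delta> = (%n b j. (dz n b j, 0))" by (simp add: \<Delta>_def \<iota>_def fun_eq_iff)
 have \<iota>: "\<iota> v : free_on E I" if "v : free_on A I" for v I unfolding \<iota>_def by (rule fs_ring_map[OF A ring_map_iota that])
 have cE: "fcx E C \<Delta>" unfolding \<Delta>_eq by (rule fcx_iota[OF f(3)])
 have exE: "ex_at (mult (opp E)) (carrier E) C \<Delta> n" for n unfolding \<Delta>_eq by (rule ex_at_iota[OF f(3) f(4) ex])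
 have regE: "freg E C \<Delta> n" unfolding \<Delta>_eq by (rule freg_base_change[OF f(3) E ring_map_iota reg])
 note \<Delta> = fcxD(2)[OF cE]
 let ?F = "free_on E (C 0)" and ?m = "free_smult E"
 define D' where "D' = (%v. rmul E v (\<Delta> 0)) ` free_on E (C 1)"
 have W: "fres E ?F ?m D' C \<Delta> (%b. single b (one E))" unfolding D'_def by (rule fres_coker[OF cE exE])
 have pW: "pdle E ?F ?m D' n" by (rule pdle_fresI[OF W regE])
 note w = fresD[OF W]
 have sF: "subgrp ?F" using mod_onD(2)[OF w(1)] .
 have rm: "rmul E v (\<Delta> i) = (%j. (rmul A (%b. fst (v b)) (dz i) j, ap ra (%b. snd (v b)) (dz i) j))" if "v : free_on E (C (Suc i))" for v i unfolding \<Delta>_eq by (rule rmul_iota[OF that dz])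
 have "EX x:X. \<kappa> x = ez c" if "c : C 0" for c using g(6)[OF f(5)[OF that]] .
 then obtain y where y: "!!c. c : C 0 ==> y c : X" "!!c. c : C 0 ==> \<kappa> (y c) = ez c" by metis
 \<comment> \<open>The multiplication map from \<open>E \<otimes> K\<close> to \<open>K\<close>,
   lifted to the free cover; its kernel is \<open>L/D'\<close>.\<close>
 define Y where "Y u = lincomb s u y" for u
 have Y: "lin_map E ?F ?m X s Y" unfolding Y_def by (rule lincomb_lin_map[OF g(1) y(1)])
 have \<kappa>\<iota>: "\<kappa> (Y (\<iota> v)) = lincomb ta v ez" if v: "v : free_on A (C 0)" for v
 proof -
  have "\<kappa> (Y (\<iota> v)) = lincomb (%n x. \<kappa> (s n x)) (\<iota> v) y" unfolding Y_def using mod_onD(4)[OF g(1)] fsD(2)[OF \<iota>[OF v]] y(1) by (intro lincomb_map[OF g(3) mod_onD(2)[OF g(1)] \<iota>[OF v]]) auto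
  also have "... = (\<Sum>c | v c ~= 0. \<kappa> (s (v c, 0) (y c)))" unfolding lincomb_def \<iota>_def by (simp add: zero_prod_def)
  also have "... = lincomb ta v ez" unfolding lincomb_def by (intro sum.cong refl) (use g(5) fsD(2)[OF v] fs_supp[OF v] y in auto)
  finally show ?thesis .
 qed
 define L where "L = {u\<in>?F. Y u : D}"
 have L: "submod E ?F ?m L" unfolding L_def by (rule submod_preimage[OF w(1) Y g(2)])
 have L_iff: "u : L <-> u : ?F & \<kappa> (Y u) = 0" for u unfolding L_def using g(7) lin_mapD(2)[OF Y] by blast
 have D'L: "D' <= L"
 proof
  fix u assume "u : D'"
  then obtain v where v: "v : free_on E (C 1)" "u = rmul E v (\<Delta> 0)" by (auto simp: D'_def)
  have uF: "u : ?F" unfolding v(2) by (rule ap_in[OF mod_on_self_opp[OF E] v(1)]) (use \<Delta>[of _ 0] in simp)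
  have "Y u = lincomb s v (%i. lincomb s (\<Delta> 0 i) y)" unfolding v(2) Y_def by (rule lincomb_ap[OF g(1) v(1) _ y(1)]) (use \<Delta>[of _ 0] in simp)
  also have "... : D"
  proof (rule submod_lincomb_in[OF g(1,2) v(1)])
   fix c assume c: "c : C 1"
   have dc: "dz 0 c : free_on A (C 0)" using dz[of c 0] c by simp
   have "\<kappa> (Y (\<Delta> 0 c)) = 0" using \<kappa>\<iota>[OF dc] f(8)[OF c] by (simp add: \<Delta>_def)
   then show "lincomb s (\<Delta> 0 c) y : D" using g(7)[OF lin_mapD(2)[OF Y \<iota>[OF dc]]] by (simp add: Y_def \<Delta>_def)
  qed
  finally show "u : L" using uF by (simp add: L_def)
 qed
 have sD': "submod E L ?m D'" using submodD(1,3)[OF w(2)] D'L by (auto simp: submod_def)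
 \<comment> \<open>Over \<open>A\<close> the module \<open>E \<otimes> K\<close> is the sum of
   \<open>T\<close> and \<open>M \<otimes> T\<close>. An element of the kernel is determined by its
   second component, which \<open>\<psi>\<close> identifies.\<close>
 define \<kappa>' where "\<kappa>' u = \<psi> (%b. snd (u b))" for u :: "('a * 't) list => 'a * 'm"
 have LF: "u : ?F" if "u : L" for u using that by (simp add: L_def)
 have sndM: "(%b. snd (u b)) : fs M (C 0)" "(%b. fst (u b)) : free_on A (C 0)" if "u : ?F" for u using that fs_sext[of u] by auto
 have "giso L ?m D' T' ta' \<kappa>'" unfolding giso_def
 proof (intro conjI ballI)
  show "mod_on E L ?m" by (rule submod_mod_on[OF w(1) L])
  show "submod E L ?m D'" by (rule sD')
  show "additive_on L \<kappa>'" unfolding additive_on_def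
  proof (intro ballI)
   fix u v assume u: "u : L" and v: "v : L"
   have "(%b. snd ((u + v) b)) = (%b. snd (u b)) + (%b. snd (v b))" by auto
   then show "\<kappa>' (u + v) = \<kappa>' u + \<kappa>' v" using lin_mapD(4)[OF \<psi>(1) sndM(1)[OF LF[OF u]] sndM(1)[OF LF[OF v]]] by (simp add: \<kappa>'_def)
  qed
  show "\<kappa>' u : T'" if "u : L" for u unfolding \<kappa>'_def by (rule lin_mapD(2)[OF \<psi>(1) sndM(1)[OF LF[OF that]]])
  show "\<kappa>' (?m (a, 0) u) = ta' a (\<kappa>' u)" if a: "a : carrier A" and u: "u : L" for a u
  proof -
   have "snd (?m (a, 0) u b) = la a (snd (u b))" for b using fsD(2)[OF LF[OF u], of b] bi_zero by (simp add: pws_def mem_Times_iff)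
   then have "(%b. snd (?m (a, 0) u b)) = pws la a (%b. snd (u b))" unfolding pws_def by (intro ext)
   then show ?thesis using lin_mapD(3)[OF \<psi>(1) a sndM(1)[OF LF[OF u]]] by (simp add: \<kappa>'_def)
  qed
  show "EX u:L. \<kappa>' u = t" if t: "t : T'" for t
  proof -
   obtain m where m: "m : fs M (C 0)" "\<psi> m = t" using \<psi>(2)[OF t] by blast
   let ?u = "%b. (0::'a, m b)"
   have u: "?u : ?F" using fs_sext[of ?u] m(1) subgrp_0[OF subgrp_fs[OF ring_onD(1)[OF A]]] by (simp add: zero_fun_def)
   \<comment> \<open>The first component is chosen to cancel the value of the second one, so that
     their sum lies in the kernel.\<close>
   have "- \<kappa> (Y ?u) : T" using subgrp_uminus[OF mod_onD(2)[OF f(1)] g(4)[OF lin_mapD(2)[OF Y u]]] .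
   then obtain v where v: "v : free_on A (C 0)" "lincomb ta v ez = - \<kappa> (Y ?u)" using f(6) by force
   let ?w = "\<iota> v + ?u"
   have wF: "?w : ?F" by (rule subgrp_add[OF sF \<iota>[OF v(1)] u])
   have "\<kappa> (Y ?w) = \<kappa> (Y (\<iota> v)) + \<kappa> (Y ?u)" using lin_mapD(4)[OF Y \<iota>[OF v(1)] u] additive_on_add[OF g(3)] lin_mapD(2)[OF Y] \<iota>[OF v(1)] u by simp
   then have "\<kappa> (Y ?w) = 0" using \<kappa>\<iota>[OF v(1)] v(2) by simp
   then have "?w : L" using wF L_iff by simp
   moreover have "\<kappa>' ?w = t" using m(2) by (simp add: \<kappa>'_def \<iota>_def)
   ultimately show ?thesis by blast
  qed
  fix u assume u: "u : L"
  have uF: "u : ?F" using LF[OF u] .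
  show "\<kappa>' u = 0 <-> u : D'"
  proof
   assume "\<kappa>' u = 0"
   then obtain m' where m': "m' : fs M (C 1)" "(%b. snd (u b)) = ap ra m' (dz 0)" using \<psi>(3)[OF sndM(1)[OF uF]] by (auto simp: \<kappa>'_def)
   let ?w = "%b. (0::'a, m' b)"
   have wE: "?w : free_on E (C (Suc 0))" using fs_sext[of ?w] m'(1) subgrp_0[OF subgrp_fs[OF ring_onD(1)[OF A]]] by (simp add: zero_fun_def)
   have wD: "rmul E ?w (\<Delta> 0) : D'" using wE by (auto simp: D'_def)
   let ?v = "u - rmul E ?w (\<Delta> 0)"
   have vL: "?v : L" using subgrp_diff[OF submodD(1)[OF L] u] wD D'L by blast
   have rmw: "rmul E ?w (\<Delta> 0) j = (0, snd (u j))" for j using fun_cong[OF rm[OF wE], of j] fun_cong[OF m'(2), of j] ap_zero_left[of "mult (opp A)" "dz 0"] by (simp add: zero_fun_def fun_eq_iff)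
   have v: "?v = \<iota> (%b. fst (u b))" by (rule ext) (simp add: rmw \<iota>_def prod_eq_iff)
   have "lincomb ta (%b. fst (u b)) ez = 0" using vL \<kappa>\<iota>[OF sndM(2)[OF uF]] unfolding L_iff v by simp
   then obtain v' where v': "v' : free_on A (C 1)" "(%b. fst (u b)) = rmul A v' (dz 0)" using f(7)[OF sndM(2)[OF uF]] by auto
   have v'E: "\<iota> v' : free_on E (C (Suc 0))" using \<iota>[OF v'(1)] by simp
   have "ap ra (%b. 0) (dz 0) = 0" using ap_zero_left[of ra "dz 0"] by (simp add: zero_fun_def)
   then have "rmul E (\<iota> v') (\<Delta> 0) j = (fst (u j), 0)" for j using fun_cong[OF rm[OF v'E], of j] fun_cong[OF v'(2), of j] by (simp add: \<iota>_def fun_eq_iff)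
   then have "?v = rmul E (\<iota> v') (\<Delta> 0)" unfolding v by (simp add: \<iota>_def fun_eq_iff)
   then have "?v : D'" using v'E by (auto simp: D'_def)
   from subgrp_add[OF submodD(1)[OF w(2)] this wD] show "u : D'" by simp
  next
   assume "u : D'"
   then obtain v where v: "v : free_on E (C (Suc 0))" "u = rmul E v (\<Delta> 0)" by (auto simp: D'_def)
   have vM: "(%b. snd (v b)) : fs M (C 1)" using fs_sext[of v] v(1) by simp
   have "(%b. snd (u b)) = ap ra (%b. snd (v b)) (dz 0)" unfolding v(2) rm[OF v(1)] by simp
   then show "\<kappa>' u = 0" using \<psi>(3)[OF sndM(1)[OF uF]] vM by (auto simp: \<kappa>'_def)
  qed
 qed
 from IH[OF this] obtain k where k: "pdle E L ?m D' k" by blast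
 \<comment> \<open>The inclusion of \<open>L/D'\<close> into the free cover modulo \<open>D'\<close>
   has cokernel \<open>X/D\<close>, so a cone gives the bound.\<close>
 obtain k' where k': "pdle E ?F ?m L k'" using pdle_cone[OF w(2) D'L L k pW] by blast
 have "pdle E ?F ?m L k' <-> pdle E X s D k'"
 proof (rule pdle_iso[OF w(1) L Y g(1,2)])
  show "Y u : D <-> u : L" if "u : ?F" for u using that by (simp add: L_def)
  fix x assume x: "x : X"
  obtain v where v: "v : free_on A (C 0)" "\<kappa> x = lincomb ta v ez" using f(6)[OF g(4)[OF x]] by auto
  have Yv: "Y (\<iota> v) : X" using lin_mapD(2)[OF Y \<iota>[OF v(1)]] .
  have "\<kappa> (x - Y (\<iota> v)) = 0" using additive_on_diff[OF g(3) mod_onD(2)[OF g(1)] x Yv] \<kappa>\<iota>[OF v(1)] v(2) by simp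
  then show "EX u:?F. x - Y u : D" using g(7) subgrp_diff[OF mod_onD(2)[OF g(1)] x Yv] \<iota>[OF v(1)] by blast
 qed
 then show ?thesis using k' by blast
qed

text \<open>\<open>T j\<close> stands for the \<open>j\<close>-th tensor power. Upwards in
  \<open>j\<close> each has finite projective dimension over \<open>A\<close>; downwards from
  \<open>T N = {0}\<close>, where \<open>X = D\<close>, every \<open>E\<close>-module met that
  restricts to \<open>T j\<close> has finite projective dimension over \<open>E\<close>. The ideal
  restricts to \<open>T 1\<close>.\<close>

theorem pdle_kernel_ideal:
 fixes T :: "nat => 't::ab_group_add set"
 assumes M: "pdle A M la {0} c" and T: "!!j. j >= 1 ==> mod_on A (T j) (ta j)"
  and tens: "!!j. j >= 1 ==> tens (T j) (ta j) (T (Suc j)) (ta (Suc j))"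
  and N: "N >= 1" "T N = {0}"
  and h: "lin_map A M la (T 1) (ta 1) h" "inj_on h M" "h ` M = T 1"
 shows "EX k. pdle E ({0} \<times> M) (mult E) {0} k"
proof -
 note b = bimod_onD[OF bi]
 have h0: "h x = 0 <-> x = 0" if "x : M" for x using lin_map_0[OF h(1) mod_onD(2)[OF b(1)]] inj_onD[OF h(2), of x 0] that bi_zero(7) by auto
 have fin: "EX k. pdle A (T j) (ta j) {0} k" if "j >= 1" for j using that
 proof (induction j rule: dec_induct)
  case base
  have "pdle A M la {0} c <-> pdle A (T 1) (ta 1) {0} c" by (rule pdle_iso[OF b(1) submod_0[OF b(1)] h(1) T submod_0[OF T]]) (use h0 h(3) in force)+
  then show ?case using M by blast
 next
  case (step j)
  then show ?case using pdle_tens[OF M _ tens T[of "Suc j"]] by auto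
 qed
 have Q: "EX k. pdle E X (free_smult E) D k" if "j <= N" "j >= 1" "giso X (free_smult E) D (T j) (ta j) \<kappa>" for j and X D :: "(('a * 't) list => 'a * 'm) set" and \<kappa> using that
 proof (induction j arbitrary: X D \<kappa> rule: inc_induct)
  case base
  note g = gisoD[OF base(2)]
  have "X = D" using g(4,7) N(2) submodD(2)[OF g(2)] by blast
  then show ?case using pdle_trivial[OF g(1)] by blast
 next
  case (step j)
  obtain n where n: "pdle A (T j) (ta j) {0} n" using fin step by blast
  have "1 <= Suc j" by simp
  from giso_step[OF tens[OF step.prems(1)] n step.prems(2) step.IH[OF this]] show ?case .
 qed
 obtain n where n: "pdle A (T 1) (ta 1) {0} n" using fin by blast
 have "giso ({0} \<times> M) (mult E) {0} (T 1) (ta 1) (%p. h (snd p))" unfolding giso_def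
 proof (intro conjI ballI)
  show "mod_on E ({0} \<times> M) (mult E)" by (rule kernel_ideal_left)
  then show "submod E ({0} \<times> M) (mult E) {0}" by (rule submod_0)
  show "additive_on ({0} \<times> M) (%p. h (snd p))" using lin_mapD(4)[OF h(1)] by (auto simp: additive_on_def)
  show "h (snd p) : T 1" if "p : {0} \<times> M" for p using that lin_mapD(2)[OF h(1)] by auto
  show "h (snd ((a, 0) \<otimes>\<^bsub>E\<^esub> p)) = ta 1 a (h (snd p))" if "a : carrier A" "p : {0} \<times> M" for a p using that lin_mapD(3)[OF h(1)] bi_zero by auto
  show "EX p:{0} \<times> M. h (snd p) = t" if "t : T 1" for t using that h(3) by force
  show "h (snd p) = 0 <-> p : {0}" if "p : {0} \<times> M" for p using that h0 by (auto simp: zero_prod_def)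
 qed
 \<comment> \<open>The ideal lives in another type than the kernels met afterwards, so the first
   step is made outside the induction.\<close>
 then show ?thesis
 proof (rule giso_step[OF tens n, rotated])
  fix X' D' :: "(('a * 't) list => 'a * 'm) set" and \<kappa>'
  assume g: "giso X' (free_smult E) D' (T (Suc 1)) (ta (Suc 1)) \<kappa>'"
  show "EX k. pdle E X' (free_smult E) D' k"
  proof (cases "N = 1")
   \<comment> \<open>Here \<open>M\<close> itself is zero, and so is the next tensor power, being an
     image of \<open>\<psi>\<close>.\<close>
   case True
   note g' = gisoD[OF g]
   have t2: "t = 0" if tT: "t : T (Suc 1)" for t
   proof -
    obtain C :: "nat => ('a * 't) list set" and dz ez where F: "fres A (T 1) (ta 1) {0} C dz ez" using n by (auto simp: pdle_def)
    have M0: "M = {0}" using h(3) h0 N(2) True bi_zero(7) by auto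
    obtain \<psi> where \<psi>: "lin_map A (fs M (C 0)) (pws la) (T (Suc 1)) (ta (Suc 1)) \<psi>" "EX m:fs M (C 0). \<psi> m = t" using tensD(1)[OF tens[OF order_refl] F] tT by blast
    have "fs M (C 0) = {0}" unfolding M0 by (auto simp: fs_def fun_eq_iff)
    then show ?thesis using \<psi> lin_map_0[OF \<psi>(1)] by simp
   qed
   have "X' = D'" using g'(4,7) t2 submodD(2)[OF g'(2)] by blast
   then show ?thesis using pdle_trivial[OF g'(1)] by blast
  next
   case False
   then show ?thesis using Q[OF _ _ g] N(1) by simp
  qed
 qed simp
qed

end

section \<open>Abstract rings and modules\<close>

lemma add_embeddingD:
 assumes "add_embedding G j"
 shows "inj_on j (carrier G)" "x : carrier G ==> y : carrier G ==> j (x \<oplus>\<^bsub>G\<^esub> y) = j x + j y"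
  "x : carrier G ==> tinv (carrier G) j (j x) = x"
  "z : j ` carrier G ==> tinv (carrier G) j z : carrier G"
  "z : j ` carrier G ==> j (tinv (carrier G) j z) = z" using assms by (auto simp: add_embedding_def the_inv_into_f_f f_the_inv_into_f intro: the_inv_into_into)

lemma add_embedding_group:
 assumes "abelian_group G" "add_embedding G j"
 shows "j \<zero>\<^bsub>G\<^esub> = 0" "subgrp (j ` carrier G)" "x : carrier G ==> j x = 0 <-> x = \<zero>\<^bsub>G\<^esub>"
  "x : carrier G ==> j (\<ominus>\<^bsub>G\<^esub> x) = - j x"
proof -
 interpret G: abelian_group G by fact
 note j = add_embeddingD[OF assms(2)]
 show 0: "j \<zero>\<^bsub>G\<^esub> = 0" using j(2)[of "\<zero>\<^bsub>G\<^esub>" "\<zero>\<^bsub>G\<^esub>"] by simp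
 show m: "j (\<ominus>\<^bsub>G\<^esub> x) = - j x" if "x : carrier G" for x using j(2)[of "\<ominus>\<^bsub>G\<^esub> x" x] 0 that by (simp add: G.l_neg eq_neg_iff_add_eq_0)
 show "subgrp (j ` carrier G)"
 proof (rule subgrpI)
  show "0 : j ` carrier G" using 0 by (metis G.zero_closed imageI)
  show "x + y : j ` carrier G" if "x : j ` carrier G" "y : j ` carrier G" for x y using that j(2) by (metis (no_types, lifting) G.a_closed image_iff)
  show "- x : j ` carrier G" if "x : j ` carrier G" for x using that m by (metis (no_types, lifting) G.a_inv_closed image_iff)
 qed
 show "j x = 0 <-> x = \<zero>\<^bsub>G\<^esub>" if "x : carrier G" using inj_onD[OF j(1), of x "\<zero>\<^bsub>G\<^esub>"] that 0 by auto
qed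

text \<open>The copy \<open>A\<close> comes with its coding \<open>j\<close>, since statements have
  to be carried in both directions; \<open>mlink\<close> plays the same role for a module, with
  scalars read through the same \<open>j\<close>.\<close>

definition rlink :: "('r, 's) ring_scheme => ('r => 'a::ab_group_add) => 'a ring => bool" where
 "rlink R j A <-> ring R & add_embedding R j & carrier A = j ` carrier R & (one A) = j (one R) &
  (ALL x:carrier R. ALL y:carrier R. j x \<otimes>\<^bsub>A\<^esub> j y = j (x \<otimes>\<^bsub>R\<^esub> y))"

definition mlink :: "('r, 's) ring_scheme => ('r => 'a) => ('r, 'x) module => ('x => 'y::ab_group_add) => ('a => 'y => 'y) => bool" where
 "mlink R j X k s <-> left_module R X & add_embedding X k &
  (ALL r:carrier R. ALL x:carrier X. s (j r) (k x) = k (r \<odot>\<^bsub>X\<^esub> x))"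

lemma rlinkD:
 assumes "rlink R j A"
 shows "ring R" "add_embedding R j" "carrier A = j ` carrier R" "(one A) = j (one R)"
  "x : carrier R ==> y : carrier R ==> j x \<otimes>\<^bsub>A\<^esub> j y = j (x \<otimes>\<^bsub>R\<^esub> y)" using assms by (auto simp: rlink_def)

lemma ring_opp: assumes "ring R" shows "ring (opp R)"
proof -
 interpret R: ring R by fact
 show ?thesis
 proof (rule ringI)
  show "abelian_group (opp R)" by (rule abelian_groupI) (auto simp: R.a_ac intro: R.add.r_inv_ex R.add.l_inv_ex)
  show "monoid (opp R)" by (rule monoidI) (auto simp: R.m_assoc)
 qed (auto simp: R.l_distr R.r_distr)
qed

lemma rlink_opp: "rlink R j A ==> rlink (opp R) j (opp A)" by (auto simp: rlink_def ring_opp add_embedding_def)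

lemma rlink_ring_on: assumes "rlink R j A" shows "ring_on A"
proof -
 note r = rlinkD[OF assms] and j = add_embeddingD[OF rlinkD(2)[OF assms]]
 interpret R: ring R by (rule r(1))
 have "biadd (carrier A) (carrier A) (mult A)" by (rule biaddI) (auto simp: r(3,5) j(2)[symmetric] R.l_distr R.r_distr)
 then show ?thesis unfolding ring_on_def using add_embedding_group(2)[OF R.is_abelian_group r(2)] by (auto simp: r(3-5) R.m_assoc)
qed

lemma mlinkD:
 assumes "mlink R j X k s"
 shows "left_module R X" "add_embedding X k" "r : carrier R ==> x : carrier X ==> s (j r) (k x) = k (r \<odot>\<^bsub>X\<^esub> x)"
  "abelian_group X" "k \<zero>\<^bsub>X\<^esub> = 0" "x : carrier X ==> k x = 0 <-> x = \<zero>\<^bsub>X\<^esub>" using assms add_embedding_group[of X k] by (auto simp: mlink_def left_module_def)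

lemma mlink_mod_on:
 assumes R: "rlink R j A" and X: "mlink R j X k s" shows "mod_on A (k ` carrier X) s"
proof -
 note r = rlinkD[OF R] and j = add_embeddingD[OF rlinkD(2)[OF R]] and x = mlinkD[OF X] and k = add_embeddingD[OF mlinkD(2)[OF X]]
 interpret X: left_module R X by (rule x(1))
 have "biadd (carrier A) (k ` carrier X) s" by (rule biaddI) (auto simp: r(3) x(3) j(2)[symmetric] k(2)[symmetric] X.smult_l_distr X.smult_r_distr X.smult_closed)
 then show ?thesis unfolding mod_on_def using rlink_ring_on[OF R] add_embedding_group(2)[OF x(4,2)] by (auto simp: r(3-5) x(3) X.smult_closed X.smult_assoc X.smult_one)
qed

lemma rlink_exists: assumes "ring (R :: ('r, 's) ring_scheme)" shows "EX (j :: 'r => 'r bidual) A. rlink R j A"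
proof -
 interpret R: ring R by fact
 obtain j :: "'r => 'r bidual" where j: "add_embedding R j" using add_embedding_exists[OF R.is_abelian_group] by blast
 let ?i = "tinv (carrier R) j"
 have "rlink R j \<lparr>carrier = j ` carrier R, mult = (%x y. j (?i x \<otimes>\<^bsub>R\<^esub> ?i y)), one = j (one R), zero = 0, add = (+)\<rparr>" using j assms by (auto simp: rlink_def add_embeddingD(3)[OF j])
 then show ?thesis by blast
qed

lemma mlink_exists:
 assumes R: "rlink R j A" and X: "left_module R (X :: ('r, 'x) module)"
 shows "EX (k :: 'x => 'x bidual) s. mlink R j X k s"
proof -
 interpret X: left_module R X by fact
 obtain k :: "'x => 'x bidual" where k: "add_embedding X k" using add_embedding_exists[OF X.X.abelian_group_axioms] by blast
 let ?i = "tinv (carrier R) j" and ?k = "tinv (carrier X) k"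
 have "mlink R j X k (%a y. k (?i a \<odot>\<^bsub>X\<^esub> ?k y))" using X k by (auto simp: mlink_def add_embeddingD(3)[OF k] add_embeddingD(3)[OF rlinkD(2)[OF R]])
 then show ?thesis by blast
qed

lemma module_hom_lin_map:
 assumes R: "rlink R j A" and X: "mlink R j X k s" and Y: "mlink R j Y l t" and f: "f : module_hom R X Y"
 shows "lin_map A (k ` carrier X) s (l ` carrier Y) t (%y. l (f (tinv (carrier X) k y)))"
proof -
 note x = mlinkD[OF X] and y = mlinkD[OF Y] and k = add_embeddingD[OF mlinkD(2)[OF X]] and l = add_embeddingD[OF mlinkD(2)[OF Y]]
 interpret X: left_module R X by (rule x(1))
 have fc: "f x : carrier Y" if "x : carrier X" for x using f that by (auto simp: module_hom_def hom_def)
 have fa: "f (x \<oplus>\<^bsub>X\<^esub> x') = f x \<oplus>\<^bsub>Y\<^esub> f x'" if "x : carrier X" "x' : carrier X" for x x' using f that by (auto simp: module_hom_def hom_def)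
 have fs: "f (r \<odot>\<^bsub>X\<^esub> x) = r \<odot>\<^bsub>Y\<^esub> f x" if "r : carrier R" "x : carrier X" for r x using f that by (auto simp: module_hom_def)
 show ?thesis unfolding lin_map_def additive_on_def by (auto simp: k(3) k(2)[symmetric] l(2) fc fa fs x(3) y(3) rlinkD(3)[OF R] X.smult_closed)
qed

lemma lin_map_module_hom:
 assumes R: "rlink R j A" and X: "mlink R j X k s" and Y: "mlink R j Y l t"
  and g: "lin_map A (k ` carrier X) s (l ` carrier Y) t g"
 shows "(%x. tinv (carrier Y) l (g (k x))) : module_hom R X Y"
proof -
 note x = mlinkD[OF X] and y = mlinkD[OF Y] and k = add_embeddingD[OF mlinkD(2)[OF X]] and l = add_embeddingD[OF mlinkD(2)[OF Y]]
 interpret X: left_module R X by (rule x(1))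
 interpret Y: left_module R Y by (rule y(1))
 let ?h = "%x. tinv (carrier Y) l (g (k x))"
 have gl: "g (k x) : l ` carrier Y" if "x : carrier X" for x using lin_mapD(2)[OF g] that by blast
 have h: "?h x : carrier Y" "l (?h x) = g (k x)" if "x : carrier X" for x using l(4,5) gl[OF that] by auto
 have eq: "a = b" if "l a = l b" "a : carrier Y" "b : carrier Y" for a b using inj_onD[OF l(1) that] .
 have "?h (x \<oplus>\<^bsub>X\<^esub> x') = ?h x \<oplus>\<^bsub>Y\<^esub> ?h x'" if "x : carrier X" "x' : carrier X" for x x'
 proof (rule eq)
  show "l (?h (x \<oplus>\<^bsub>X\<^esub> x')) = l (?h x \<oplus>\<^bsub>Y\<^esub> ?h x')" using h that lin_mapD(4)[OF g, of "k x" "k x'"] k(2) l(2)[of "?h x" "?h x'"] h(2)[OF X.X.a_closed[OF that]] by simp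
 qed (use h(1) that X.X.a_closed Y.X.a_closed in auto)
 moreover have "?h (r \<odot>\<^bsub>X\<^esub> x) = r \<odot>\<^bsub>Y\<^esub> ?h x" if r: "r : carrier R" and x: "x : carrier X" for r x
 proof (rule eq)
  have "l (?h (r \<odot>\<^bsub>X\<^esub> x)) = g (k (r \<odot>\<^bsub>X\<^esub> x))" by (rule h(2)[OF X.smult_closed[OF r x]])
  also have "... = g (s (j r) (k x))" using mlinkD(3)[OF X r x] by simp
  also have "... = t (j r) (g (k x))" by (rule lin_mapD(3)[OF g]) (use r x rlinkD(3)[OF R] in auto)
  also have "... = l (r \<odot>\<^bsub>Y\<^esub> ?h x)" using mlinkD(3)[OF Y r h(1)[OF x]] h(2)[OF x] by simp
  finally show "l (?h (r \<odot>\<^bsub>X\<^esub> x)) = l (r \<odot>\<^bsub>Y\<^esub> ?h x)" .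
 qed (use h(1) r x X.smult_closed Y.smult_closed in auto)
 ultimately show ?thesis using h(1) by (auto simp: module_hom_def hom_def)
qed

lemma module_hom_cong:
 assumes f: "f : module_hom R X Y" and eq: "!!x. x : carrier X ==> f x = g x" and X: "left_module R X"
 shows "g : module_hom R X Y"
proof -
 interpret X: left_module R X by (rule X)
 have "g x : carrier Y" if "x : carrier X" for x using f eq[OF that, symmetric] that by (auto simp: module_hom_def hom_def)
 then show ?thesis using f eq X.X.a_closed X.smult_closed by (auto simp: module_hom_def hom_def)
qed

subsection \<open>Copies of modules\<close>

text \<open>The way back from subgroups of types to records, with elements coded in a prescribed
  type: projectivity and resolutions of records are defined by quantifying over one such
  type.\<close>

definition mrec :: "('r => 'a) => 'x::ab_group_add set => ('a => 'x => 'x) => ('x => 'q) => ('r, 'q) module" where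
 "mrec j X s enc = \<lparr>carrier = enc ` X, mult = undefined, one = undefined, zero = enc 0,
  add = (%a b. enc (tinv X enc a + tinv X enc b)),
  smult = (%r a. enc (s (j r) (tinv X enc a)))\<rparr>"

lemma mlink_intro:
 assumes R: "rlink R j A" and X: "mod_on A (k ` carrier X) s" and inj: "inj_on k (carrier X)"
  and add: "!!x y. x : carrier X ==> y : carrier X ==> x \<oplus>\<^bsub>X\<^esub> y : carrier X & k (x \<oplus>\<^bsub>X\<^esub> y) = k x + k y"
  and zero: "\<zero>\<^bsub>X\<^esub> : carrier X" "k \<zero>\<^bsub>X\<^esub> = 0"
  and sm: "!!r x. r : carrier R ==> x : carrier X ==> r \<odot>\<^bsub>X\<^esub> x : carrier X & k (r \<odot>\<^bsub>X\<^esub> x) = s (j r) (k x)"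
 shows "mlink R j X k s"
proof -
 note m = mod_onD[OF X] and d = mod_on_distrib[OF X] and r = rlinkD[OF R]
 interpret R: ring R by (rule r(1))
 have eq: "x = y" if "k x = k y" "x : carrier X" "y : carrier X" for x y using inj_onD[OF inj that] .
 have jA: "j a : carrier A" if "a : carrier R" for a using that r(3) by auto
 have j: "j (a \<oplus>\<^bsub>R\<^esub> b) = j a + j b" "j (a \<otimes>\<^bsub>R\<^esub> b) = j a \<otimes>\<^bsub>A\<^esub> j b" if "a : carrier R" "b : carrier R" for a b using add_embeddingD(2)[OF r(2)] r(5) that by auto
 have "abelian_group X"
 proof (rule abelian_groupI)
  fix x assume x: "x : carrier X"
  obtain y where y: "y : carrier X" "k y = - k x" using subgrp_uminus[OF m(2), of "k x"] x by auto
  then show "EX y:carrier X. y \<oplus>\<^bsub>X\<^esub> x = \<zero>\<^bsub>X\<^esub>" using eq[of "y \<oplus>\<^bsub>X\<^esub> x" "\<zero>\<^bsub>X\<^esub>"] add zero x by auto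
 qed (use add zero in "auto intro!: eq simp: add_ac")
 then have "left_module R X" unfolding left_module_def left_module_axioms_def using R.ring_axioms by (auto intro!: eq simp: add sm j jA d m(4,5,6) r(4)[symmetric])
 then show ?thesis using inj add sm by (auto simp: mlink_def add_embedding_def)
qed

lemma mrec_link:
 assumes R: "rlink R j A" and X: "mod_on A X s" and enc: "inj_on enc X"
 shows "mlink R j (mrec j X s enc) (tinv X enc) s" "tinv X enc ` carrier (mrec j X s enc) = X"
  "carrier (mrec j X s enc) = enc ` X" "x : X ==> tinv X enc (enc x) = x"
  "x : X ==> tinv (carrier (mrec j X s enc)) (tinv X enc) x = enc x"
proof -
 note m = mod_onD[OF X]
 show dec: "tinv X enc (enc x) = x" if "x : X" for x by (rule the_inv_into_f_f[OF enc that])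
 show car: "carrier (mrec j X s enc) = enc ` X" by (simp add: mrec_def)
 show img: "tinv X enc ` carrier (mrec j X s enc) = X" using dec by (force simp: mrec_def)
 have jA: "j a : carrier A" if "a : carrier R" for a using that rlinkD(3)[OF R] by auto
 show "mlink R j (mrec j X s enc) (tinv X enc) s"
 proof (rule mlink_intro[OF R])
  show "mod_on A (tinv X enc ` carrier (mrec j X s enc)) s" unfolding img by (rule X)
  show "inj_on (tinv X enc) (carrier (mrec j X s enc))" by (auto intro!: inj_onI simp: dec car)
 qed (auto simp: mrec_def dec subgrp_add[OF m(2)] m(4) jA subgrp_0[OF m(2)])
 then show "tinv (carrier (mrec j X s enc)) (tinv X enc) x = enc x" if "x : X" using add_embeddingD(3)[OF mlinkD(2), of R j "mrec j X s enc" "tinv X enc" s "enc x"] that dec by (simp add: car)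
qed

subsection \<open>Projectivity\<close>

lemma projective_imp_proj:
 fixes R :: "('r, 's) ring_scheme" and P :: "('r, 'p) module"
 assumes R: "rlink R j A" and P: "mlink R j P k t" and proj: "projective R P"
 shows "proj A (k ` carrier P) t"
proof -
 let ?P = "k ` carrier P"
 have mP: "mod_on A ?P t" by (rule mlink_mod_on[OF R P])
 have A: "ring_on A" by (rule rlink_ring_on[OF R])
 note kk = add_embeddingD[OF mlinkD(2)[OF P]] and jj = add_embeddingD[OF rlinkD(2)[OF R]]
 let ?ij = "tinv (carrier R) j" and ?ik = "tinv (carrier P) k"
 have "inj_on (%a. [(?ij a, undefined :: 'p)]) (carrier A)" by (rule inj_onI) (metis jj(5) list.inject prod.inject rlinkD(3)[OF R])
 moreover have enc2: "inj_on (%p. [(undefined :: 'r, ?ik p)]) ?P" by (rule inj_onI) (metis kk(5) list.inject prod.inject)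
 ultimately obtain enc :: "_ => ('r, 'p) big" where enc: "inj_on enc (free_on A ?P)" using fs_inj[OF infinite_lists] by blast
 let ?enc2 = "%p. [(undefined :: 'r, ?ik p)]"
 define F where "F = mrec j (free_on A ?P) (free_smult A) enc"
 define B where "B = mrec j ?P t ?enc2"
 note LF = mrec_link[OF R free_mod[OF A] enc, folded F_def] and LB = mrec_link[OF R mP enc2, folded B_def]
 let ?g = "%v. lincomb t v (%y. y)"
 have g: "lin_map A (free_on A ?P) (free_smult A) ?P t ?g" by (rule lincomb_lin_map[OF mP]) auto
 define g' where "g' x = ?enc2 (?g (tinv (free_on A ?P) enc x))" for x
 have dF: "tinv (free_on A ?P) enc x : free_on A ?P" if "x : carrier F" for x using that LF(3,4) by auto
 have "(%x. tinv (carrier B) (tinv ?P ?enc2) (?g (tinv (free_on A ?P) enc x))) : module_hom R F B" by (rule lin_map_module_hom[OF R LF(1) LB(1)]) (use g in "simp add: LF(2) LB(2)")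
 moreover have "tinv (carrier B) (tinv ?P ?enc2) (?g (tinv (free_on A ?P) enc x)) = g' x" if "x : carrier F" for x unfolding g'_def by (rule LB(5)[OF lin_mapD(2)[OF g dF[OF that]]])
 moreover have FB: "left_module R F" "left_module R B" using mlinkD(1) LF(1) LB(1) by auto
 ultimately have g'h: "g' : module_hom R F B" using module_hom_cong by blast
 have g'im: "g' ` carrier F = carrier B"
 proof
  show "g' ` carrier F <= carrier B" using g'h by (auto simp: module_hom_def hom_def)
  show "carrier B <= g' ` carrier F"
  proof
   fix b assume "b : carrier B"
   then obtain p where p: "p : ?P" "b = ?enc2 p" by (auto simp: LB(3))
   have s: "single p (one A) : free_on A ?P" by (rule fs_basis[OF A p(1)])
   have "g' (enc (single p (one A))) = b" using LF(4)[OF s] lincomb_one[OF mP, where e = "%y. y", OF p(1)] p(2) by (simp add: g'_def)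
   then show "b : g' ` carrier F" using s LF(3) by blast
  qed
 qed
 have f: "(%x. tinv (carrier B) (tinv ?P ?enc2) (k x)) : module_hom R P B" by (rule lin_map_module_hom[OF R P LB(1)]) (use lin_map_id in "simp add: LB(2)")
 obtain h where h: "h : module_hom R P F"
  "!!x. x : carrier P ==> g' (h x) = tinv (carrier B) (tinv ?P ?enc2) (k x)" using proj f g'h g'im FB unfolding projective_def by blast
 define \<sigma> where "\<sigma> y = tinv (free_on A ?P) enc (h (?ik y))" for y
 have \<sigma>: "lin_map A ?P t (free_on A ?P) (free_smult A) \<sigma>" using module_hom_lin_map[OF R P LF(1) h(1)] unfolding LF(2) \<sigma>_def .
 have "?g (\<sigma> p) = p" if p: "p : ?P" for p
 proof -
  have ik: "?ik p : carrier P" "k (?ik p) = p" using kk(4,5) p by auto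
  have "?enc2 (?g (\<sigma> p)) = ?enc2 p" using h(2)[OF ik(1)] LB(5)[OF p] ik(2) by (simp add: g'_def \<sigma>_def)
  then show ?thesis using inj_onD[OF enc2] lin_mapD(2)[OF lin_map_comp[OF \<sigma> g] p] p by auto
 qed
 then show ?thesis unfolding proj_def using mP \<sigma> by blast
qed

lemma proj_imp_projective:
 fixes R :: "('r, 's) ring_scheme" and P :: "('r, 'p) module"
 assumes R: "rlink R j A" and P: "mlink R j P k t" and proj: "proj A (k ` carrier P) t"
 shows "projective R P" unfolding projective_def
proof (intro conjI mlinkD(1)[OF P] allI impI, elim conjE)
 fix X Y :: "('r, ('r, 'p) big) module" and g f
 assume X: "left_module R X" and Y: "left_module R Y" and g: "g : module_hom R X Y" and surj: "g ` carrier X = carrier Y"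
  and f: "f : module_hom R P Y"
 obtain kX :: "('r, 'p) big => ('r, 'p) big bidual" and sX where LX: "mlink R j X kX sX" using mlink_exists[OF R X] by blast
 obtain kY :: "('r, 'p) big => ('r, 'p) big bidual" and sY where LY: "mlink R j Y kY sY" using mlink_exists[OF R Y] by blast
 note ax = add_embeddingD[OF mlinkD(2)[OF LX]] and ay = add_embeddingD[OF mlinkD(2)[OF LY]] and ap = add_embeddingD[OF mlinkD(2)[OF P]]
 have gX: "g x : carrier Y" if "x : carrier X" for x using g that by (auto simp: module_hom_def hom_def)
 have fP: "f x : carrier Y" if "x : carrier P" for x using f that by (auto simp: module_hom_def hom_def)
 have "EX z:kX ` carrier X. kY (f (tinv (carrier P) k p)) = kY (g (tinv (carrier X) kX z))" if p: "p : k ` carrier P" for p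
 proof -
  have "f (tinv (carrier P) k p) : g ` carrier X" unfolding surj using fP ap(4)[OF p] by blast
  then obtain x where "x : carrier X" "f (tinv (carrier P) k p) = g x" by blast
  then show ?thesis by (intro bexI[of _ "kX x"]) (simp_all add: ax(3))
 qed
 from proj_lift0[OF proj module_hom_lin_map[OF R P LY f] mlink_mod_on[OF R LX] module_hom_lin_map[OF R LX LY g] mlink_mod_on[OF R LY] this]
 obtain h where h: "lin_map A (k ` carrier P) t (kX ` carrier X) sX h"
  "!!p. p : k ` carrier P ==> kY (g (tinv (carrier X) kX (h p))) = kY (f (tinv (carrier P) k p))" by blast
 have "g (tinv (carrier X) kX (h (k x))) = f x" if x: "x : carrier P" for x
 proof (rule inj_onD[OF ay(1)])
  show "kY (g (tinv (carrier X) kX (h (k x)))) = kY (f x)" using h(2)[of "k x"] x ap(3)[OF x] by simp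
  have "h (k x) : kX ` carrier X" using lin_mapD(2)[OF h(1)] x by blast
  then show "g (tinv (carrier X) kX (h (k x))) : carrier Y" using gX ax(4) by blast
 qed (rule fP[OF x])
 then show "EX h:module_hom R P X. ALL x:carrier P. g (h x) = f x" by (intro bexI[OF _ lin_map_module_hom[OF R P LX h(1)]] ballI)
qed

subsection \<open>Projective dimension\<close>

lemma pres_proj_resolution:
 fixes R :: "('r, 's) ring_scheme" and X :: "('r, 'x) module" and enc :: "'p::ab_group_add => 'q"
 assumes R: "rlink R j A" and X: "mlink R j X k s" and P: "pres A (k ` carrier X) s {0} P t d e"
  and U: "!!n. P n <= U" and enc: "inj_on enc U"
 shows "proj_resolution R X (%n. mrec j (P n) (t n) enc) (%n x. enc (d n (tinv (P (Suc n)) enc x)))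
  (%x. tinv (carrier X) k (e (tinv (P 0) enc x)))"
proof -
 note p = presD[OF P]
 have encP: "inj_on enc (P n)" for n using enc U inj_on_subset by blast
 note L = mrec_link[OF R p(4) encP]
 note kk = add_embeddingD[OF mlinkD(2)[OF X]]
 have dec: "x : carrier (mrec j (P n) (t n) enc) <-> (EX q:P n. x = enc q)" for n x using L(3) by auto
 have dP: "d n q : P n" if "q : P (Suc n)" for n q using lin_mapD(2)[OF p(5) that] .
 have eP: "e q : k ` carrier X" if "q : P 0" for q using lin_mapD(2)[OF p(6) that] .
 have zero: "\<zero>\<^bsub>mrec j (P n) (t n) enc\<^esub> = enc 0" for n by (simp add: mrec_def)
 have P0: "0 : P n" for n using subgrp_0[OF mod_onD(2)[OF p(4)]] .
 show ?thesis unfolding proj_resolution_def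
 proof (intro conjI allI)
  show "projective R (mrec j (P n) (t n) enc)" for n by (rule proj_imp_projective[OF R L(1)]) (simp add: L(2) p(3))
  show "(%x. enc (d n (tinv (P (Suc n)) enc x))) : module_hom R (mrec j (P (Suc n)) (t (Suc n)) enc) (mrec j (P n) (t n) enc)" for n
  proof (rule module_hom_cong[OF lin_map_module_hom[OF R L(1) L(1)] _ mlinkD(1)[OF L(1)]])
   show "lin_map A (tinv (P (Suc n)) enc ` carrier (mrec j (P (Suc n)) (t (Suc n)) enc)) (t (Suc n))
    (tinv (P n) enc ` carrier (mrec j (P n) (t n) enc)) (t n) (d n)" unfolding L(2) by (rule p(5))
   show "tinv (carrier (mrec j (P n) (t n) enc)) (tinv (P n) enc) (d n (tinv (P (Suc n)) enc x)) =
    enc (d n (tinv (P (Suc n)) enc x))" if "x : carrier (mrec j (P (Suc n)) (t (Suc n)) enc)" for x using that dP by (auto simp: dec L(4) intro!: L(5))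
  qed
  show "(%x. tinv (carrier X) k (e (tinv (P 0) enc x))) : module_hom R (mrec j (P 0) (t 0) enc) X" by (rule lin_map_module_hom[OF R L(1) X]) (unfold L(2), rule p(6))
  show "(%x. tinv (carrier X) k (e (tinv (P 0) enc x))) ` carrier (mrec j (P 0) (t 0) enc) = carrier X"
  proof (intro equalityI subsetI)
   fix x assume "x : carrier X"
   then obtain q where q: "q : P 0" "k x = e q" using p(7)[of "k x"] by auto
   then have "x = tinv (carrier X) k (e (tinv (P 0) enc (enc q)))" using kk(3)[OF \<open>x : carrier X\<close>] by (simp add: L(4))
   then show "x : (%x. tinv (carrier X) k (e (tinv (P 0) enc x))) ` carrier (mrec j (P 0) (t 0) enc)" using q(1) by (auto simp: L(3))
  qed (use kk(4) eP in "auto simp: dec L(4)")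
  show "a_kernel (mrec j (P 0) (t 0) enc) X (%x. tinv (carrier X) k (e (tinv (P 0) enc x))) =
   (%x. enc (d 0 (tinv (P (Suc 0)) enc x))) ` carrier (mrec j (P 1) (t 1) enc)"
  proof -
   have "tinv (carrier X) k (e q) = \<zero>\<^bsub>X\<^esub> <-> q : d 0 ` P 1" if q: "q : P 0" for q
   proof -
    have "tinv (carrier X) k (e q) = \<zero>\<^bsub>X\<^esub> <-> e q = 0" using kk(4,5)[OF eP[OF q]] mlinkD(5,6)[OF X] by metis
    then show ?thesis using p(8)[OF q] p(9) by auto
   qed
   then have eq: "{q : P 0. tinv (carrier X) k (e q) = \<zero>\<^bsub>X\<^esub>} = d 0 ` P (Suc 0)" using dP[of _ 0] by auto
   have "a_kernel (mrec j (P 0) (t 0) enc) X (%x. tinv (carrier X) k (e (tinv (P 0) enc x))) =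
    enc ` {q : P 0. tinv (carrier X) k (e q) = \<zero>\<^bsub>X\<^esub>}" by (auto simp: a_kernel_def' L(3) L(4))
   also have "... = (%x. enc (d 0 (tinv (P (Suc 0)) enc x))) ` carrier (mrec j (P 1) (t 1) enc)" unfolding eq L(3) image_image One_nat_def by (intro image_cong refl) (simp add: L(4))
   finally show ?thesis .
  qed
  show "a_kernel (mrec j (P (Suc n)) (t (Suc n)) enc) (mrec j (P n) (t n) enc) (%x. enc (d n (tinv (P (Suc n)) enc x))) =
   (%x. enc (d (Suc n) (tinv (P (Suc (Suc n))) enc x))) ` carrier (mrec j (P (Suc (Suc n))) (t (Suc (Suc n))) enc)" for n
  proof -
   have "enc (d n q) = enc 0 <-> q : d (Suc n) ` P (Suc (Suc n))" if q: "q : P (Suc n)" for q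
   proof -
    have "enc (d n q) = enc 0 <-> d n q = 0" using inj_on_eq_iff[OF encP dP[OF q] P0] .
    then show ?thesis using p(10)[OF q] p(11) by auto
   qed
   then have eq: "{q : P (Suc n). enc (d n q) = enc 0} = d (Suc n) ` P (Suc (Suc n))" using dP[of _ "Suc n"] by auto
   have "a_kernel (mrec j (P (Suc n)) (t (Suc n)) enc) (mrec j (P n) (t n) enc) (%x. enc (d n (tinv (P (Suc n)) enc x))) =
    enc ` {q : P (Suc n). enc (d n q) = enc 0}" by (auto simp: a_kernel_def' zero L(3) L(4))
   also have "... = (%x. enc (d (Suc n) (tinv (P (Suc (Suc n))) enc x))) ` carrier (mrec j (P (Suc (Suc n))) (t (Suc (Suc n))) enc)" unfolding eq L(3) image_image by (intro image_cong refl) (simp add: L(4))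
   finally show ?thesis .
  qed
 qed
qed

lemma pd_imp_pdle:
 fixes R :: "('r, 's) ring_scheme" and X :: "('r, 'x) module"
 assumes R: "rlink R j A" and X: "mlink R j X k s" and pd: "pd R X <= enat n"
 shows "pdle A (k ` carrier X) s {0} n"
proof -
 let ?S = "{enat n | n. EX (P :: nat => ('r, ('r, 'x) big) module) d e. proj_resolution R X P d e & (ALL i>n. zero_module (P i))}"
 have "?S ~= {}"
 proof
  assume "?S = {}"
  then have "pd R X = Inf {}" unfolding pd_def by (rule arg_cong)
  then show False using pd by (simp add: Inf_enat_def)
 qed
 \<comment> \<open>The infimum of a non-empty set of numbers is attained, so some resolution has the
   minimal length.\<close>
 then have "Inf ?S : ?S" unfolding Inf_enat_def by (simp only: if_False) (metis (no_types, lifting) LeastI all_not_in_conv)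
 then obtain m where m: "pd R X = enat m" "EX (P :: nat => ('r, ('r, 'x) big) module) d e. proj_resolution R X P d e & (ALL i>m. zero_module (P i))" unfolding pd_def by blast
 have mn: "m <= n" using pd m(1) by simp
 obtain P :: "nat => ('r, ('r, 'x) big) module" and d e where P: "proj_resolution R X P d e" "!!i. i > m ==> zero_module (P i)" using m(2) by blast
 have pj: "projective R (P n)" and dh: "d n : module_hom R (P (Suc n)) (P n)" and eh: "e : module_hom R (P 0) X"
  and es: "e ` carrier (P 0) = carrier X" and k0: "a_kernel (P 0) X e = d 0 ` carrier (P 1)"
  and kS: "a_kernel (P (Suc n)) (P n) (d n) = d (Suc n) ` carrier (P (Suc (Suc n)))" for n using P(1) by (auto simp: proj_resolution_def)
 have "left_module R (P n)" for n using pj by (simp add: projective_def)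
 then have "ALL n. EX (l :: ('r, 'x) big => ('r, 'x) big bidual) t. mlink R j (P n) l t" using mlink_exists[OF R] by blast
 then obtain l :: "nat => ('r, 'x) big => ('r, 'x) big bidual" and t where L: "!!n. mlink R j (P n) (l n) (t n)" by metis
 note ll = add_embeddingD[OF mlinkD(2)[OF L]]
 note kk = add_embeddingD[OF mlinkD(2)[OF X]]
 define P' where "P' n = l n ` carrier (P n)" for n
 define d' where "d' n y = l n (d n (tinv (carrier (P (Suc n))) (l (Suc n)) y))" for n y
 define e' where "e' y = k (e (tinv (carrier (P 0)) (l 0) y))" for y
 have X': "mod_on A (k ` carrier X) s" by (rule mlink_mod_on[OF R X])
 have dl: "d' n (l (Suc n) x) = l n (d n x)" if "x : carrier (P (Suc n))" for n x using that by (simp add: d'_def ll(3))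
 have el: "e' (l 0 x) = k (e x)" if "x : carrier (P 0)" for x using that by (simp add: e'_def ll(3))
 have dc: "d n x : carrier (P n)" if "x : carrier (P (Suc n))" for n x using dh[of n] that by (auto simp: module_hom_def hom_def)
 have ec: "e x : carrier X" if "x : carrier (P 0)" for x using eh that by (auto simp: module_hom_def hom_def)
 have li: "l n x = l n y <-> x = y" if "x : carrier (P n)" "y : carrier (P n)" for n x y using inj_on_eq_iff[OF ll(1) that] .
 have img: "d' n ` P' (Suc n) = l n ` d n ` carrier (P (Suc n))" for n unfolding P'_def image_image by (intro image_cong refl dl)
 have mem: "l n x : d' n ` P' (Suc n) <-> x : d n ` carrier (P (Suc n))" if "x : carrier (P n)" for n x unfolding img by (rule inj_on_image_mem_iff[OF ll(1) that image_subsetI[OF dc]])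
 have "pres A (k ` carrier X) s {0} P' t d' e'" unfolding pres_def
 proof (intro conjI allI X' submod_0[OF X'] ballI)
  show "proj A (P' n) (t n)" for n unfolding P'_def by (rule projective_imp_proj[OF R L pj])
  show "lin_map A (P' (Suc n)) (t (Suc n)) (P' n) (t n) (d' n)" for n unfolding P'_def d'_def by (rule module_hom_lin_map[OF R L L dh])
  show "lin_map A (P' 0) (t 0) (k ` carrier X) s e'" unfolding P'_def e'_def by (rule module_hom_lin_map[OF R L X eh])
  show "EX p:P' 0. y - e' p : {0}" if "y : k ` carrier X" for y
  proof -
   from that obtain z where "z : carrier X" "y = k z" by blast
   moreover from this es obtain x where "x : carrier (P 0)" "z = e x" by blast
   ultimately have "x : carrier (P 0)" "y = k (e x)" by simp_all
   then show ?thesis by (intro bexI[of _ "l 0 x"]) (simp_all add: el P'_def)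
  qed
  fix p assume "p : P' 0"
  then obtain x where x: "x : carrier (P 0)" "p = l 0 x" by (auto simp: P'_def)
  have "e' p : {0} <-> x : a_kernel (P 0) X e" using el[OF x(1)] x mlinkD(6)[OF X ec[OF x(1)]] by (simp add: a_kernel_def')
  also have "... <-> p : d' 0 ` P' 1" unfolding k0 using mem[of x 0] x by simp
  finally show "e' p : {0} <-> p : d' 0 ` P' 1" .
 next
  fix n p assume "p : P' (Suc n)"
  then obtain x where x: "x : carrier (P (Suc n))" "p = l (Suc n) x" by (auto simp: P'_def)
  have "d' n p = 0 <-> x : a_kernel (P (Suc n)) (P n) (d n)" using dl[OF x(1)] x mlinkD(6)[OF L dc[OF x(1)]] by (simp add: a_kernel_def')
  also have "... <-> p : d' (Suc n) ` P' (Suc (Suc n))" unfolding kS using mem[of x "Suc n"] x by simp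
  finally show "d' n p = 0 <-> p : d' (Suc n) ` P' (Suc (Suc n))" .
 qed
 note pr = this
 \<comment> \<open>Since the term of degree \<open>m + 1\<close> is zero, the zero map is a
   splitting at \<open>m\<close>.\<close>
 have z: "P' (Suc m) = {0}" using P(2)[of "Suc m"] mlinkD(5)[OF L[of "Suc m"]] by (simp add: P'_def zero_module_def)
 have "lin_map A (P' m) (t m) (P' (Suc m)) (t (Suc m)) (%x. 0)" by (rule lin_map_zero[OF presD(4)[OF pr]])
 moreover have "d' m 0 = 0" by (rule lin_map_0[OF presD(5)[OF pr] mod_onD(2)[OF presD(4)[OF pr]]])
 ultimately have "preg A P' t d' m" unfolding preg_def by (intro exI[of _ "%x. 0"]) (simp add: z)
 then show ?thesis using pdle_mono[OF pdleI[OF pr] mn] by blast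
qed

text \<open>The splitting exhibits the image of \<open>d n\<close> as a direct summand of a free
  module. It replaces the term of degree \<open>n + 1\<close>, with the inclusion as differential,
  and all later terms become zero.\<close>

lemma fres_truncate:
 fixes A :: "('a::ab_group_add, 's) ring_scheme" and B :: "nat => 'b set"
 assumes F: "fres A X s D B d e" and reg: "freg A B d n"
 shows "pres A X s D (%i. if i <= n then free_on A (B i) else if i = Suc n then (%v. rmul A v (d n)) ` free_on A (B (Suc n)) else {0})
  (%i. free_smult A) (%i. if i < n then (%v. rmul A v (d i)) else if i = n then (%v. v) else (%v. 0)) (%v. lincomb s v e)"
  (is "pres A X s D ?P _ ?d _")
proof -
 note p = presD[OF fres_pres[OF F]]
 have A: "ring_on A" using fcxD(1)[OF fresD(3)[OF F]] .
 let ?I = "(%v. rmul A v (d n)) ` free_on A (B (Suc n))"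
 have I: "submod A (free_on A (B n)) (free_smult A) ?I" by (rule submod_image[OF p(4) p(5)])
 have mI: "mod_on A ?I (free_smult A)" by (rule submod_mod_on[OF p(4) I])
 obtain \<sigma> where \<sigma>: "lin_map A (free_on A (B n)) (free_smult A) (free_on A (B (Suc n))) (free_smult A) \<sigma>"
  "!!p. p : free_on A (B (Suc n)) ==> rmul A (\<sigma> (rmul A p (d n))) (d n) = rmul A p (d n)" using reg unfolding freg_preg[OF fresD(3)[OF F]] preg_def by blast
 have "proj A ?I (free_smult A)"
 proof (rule proj_retract[OF p(3)[of "Suc n"] mI])
  show "lin_map A ?I (free_smult A) (free_on A (B (Suc n))) (free_smult A) \<sigma>" by (rule lin_map_subset[OF \<sigma>(1)]) (use submodD(2)[OF I] lin_mapD(2)[OF \<sigma>(1)] in blast)+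
  show "lin_map A (free_on A (B (Suc n))) (free_smult A) ?I (free_smult A) (%v. rmul A v (d n))" by (rule lin_map_subset[OF p(5)]) auto
 qed (use \<sigma>(2) in auto)
 moreover have m0: "mod_on A {0 :: 'b => 'a} (free_smult A)" by (rule submod_mod_on[OF free_mod[OF A] submod_0[OF free_mod[OF A]]])
 moreover have "proj A {0 :: 'b => 'a} (free_smult A)" by (rule proj_retract[OF p(3)[of 0] m0 lin_map_zero[OF p(4)] lin_map_zero[OF m0]]) simp
 ultimately have pj: "proj A (?P i) (free_smult A)" for i using p(3)[of i] by simp
 have "lin_map A (?P (Suc i)) (free_smult A) (?P i) (free_smult A) (?d i)" for i
 proof -
  consider "Suc i <= n" | "i = n" | "i > n" by linarith
  then show ?thesis
  proof cases
   case 1 then show ?thesis using p(5)[of i] by simp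
  next
   case 2 then show ?thesis using lin_map_incl[of ?I "free_on A (B n)"] submodD(2)[OF I] by auto
  next
   case 3 then show ?thesis using lin_map_zero[of A "?P i" "free_smult A" "{0}"] proj_mod[OF pj[of i]] by auto
  qed
 qed
 moreover have "(lincomb s q e : D) = (q : ?d 0 ` ?P 1)" if "q : ?P 0" for q using that p(8,9)[of q] p(9) by (cases n) auto
 moreover have "(?d i q = 0) = (q : ?d (Suc i) ` ?P (Suc (Suc i)))" if q: "q : ?P (Suc i)" for i q
 proof -
  consider "Suc (Suc i) <= n" | "Suc i = n" | "i = n" | "i > n" by linarith
  then show ?thesis
  proof cases
   case 1 then show ?thesis using q p(10)[of q i] p(11)[of _ i] by auto
  next
   case 2 then show ?thesis using q p(10)[of q i] p(11)[of _ i] by auto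
  next
   case 3 then show ?thesis by auto
  next
   case 4 then show ?thesis using q by auto
  qed
 qed
 ultimately show ?thesis unfolding pres_def using p(1,2) pj p(6) p(7) by simp
qed

lemma fres_exists_big:
 fixes R :: "('r, 's) ring_scheme" and X :: "('r, 'x) module"
 assumes R: "rlink R j A" and X: "mlink R j X k s" and inf: "infinite (UNIV :: 'u set)"
  and r: "inj (r :: 'r => 'u)" and x: "inj (x :: 'x => 'u)"
 shows "EX (B :: nat => 'u set) d e. fres A (k ` carrier X) s {0} B d e"
  "EX enc :: ('u => _) => 'u. inj_on enc (free_on A UNIV)"
proof -
 note kk = add_embeddingD[OF mlinkD(2)[OF X]] and jj = add_embeddingD[OF rlinkD(2)[OF R]]
 have i1: "inj_on (%a. r (tinv (carrier R) j a)) (carrier A)" by (rule inj_onI) (metis jj(5) injD[OF r] rlinkD(3)[OF R])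
 have i2: "inj_on (%y. x (tinv (carrier X) k y)) (k ` carrier X)" by (rule inj_onI) (metis kk(5) injD[OF x])
 show enc: "EX enc :: ('u => _) => 'u. inj_on enc (free_on A UNIV)" using fs_inj[OF inf i1, of "%u::'u. u" UNIV] by simp
 have X': "mod_on A (k ` carrier X) s" by (rule mlink_mod_on[OF R X])
 show "EX (B :: nat => 'u set) d e. fres A (k ` carrier X) s {0} B d e" using fres_exists[OF X' submod_0[OF X'] _ i2] enc by blast
qed

lemma pdle_imp_pd:
 fixes R :: "('r, 's) ring_scheme" and X :: "('r, 'x) module" and A :: "'a::ab_group_add ring"
 assumes R: "rlink R j A" and X: "mlink R j X k s" and pd: "pdle A (k ` carrier X) s {0} n"
 shows "pd R X <= enat (Suc n)"
proof -
 have "inj (%r::'r. [(r, undefined :: 'x)])" "inj (%x::'x. [(undefined :: 'r, x)])" by (auto intro: injI)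
 note ex = fres_exists_big[OF R X infinite_lists this]
 obtain B :: "nat => ('r, 'x) big set" and d e where F: "fres A (k ` carrier X) s {0} B d e" using ex(1) by blast
 obtain enc :: "(('r, 'x) big => 'a) => ('r, 'x) big" where enc: "inj_on enc (free_on A UNIV)" using ex(2) by blast
 have reg: "freg A B d n" by (rule pdle_freg[OF pd F])
 define P where "P i = (if i <= n then free_on A (B i) else if i = Suc n then (%v. rmul A v (d n)) ` free_on A (B (Suc n)) else {0})" for i
 have U: "P i <= free_on A UNIV" for i
 proof -
  have A: "ring_on A" by (rule rlink_ring_on[OF R])
  have "rmul A v (d n) : free_on A (B n)" if "v : free_on A (B (Suc n))" for v by (rule ap_in[OF mod_on_self_opp[OF A] that fcxD(2)[OF fresD(3)[OF F]]])
  then show ?thesis unfolding P_def using fs_mono[of _ UNIV "carrier A"] subgrp_0[OF subgrp_fs[OF ring_onD(1)[OF A]]] by (auto split: if_splits)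
 qed
 note res = pres_proj_resolution[OF R X fres_truncate[OF F reg, folded P_def] U enc]
 have "zero_module (mrec j (P i) (free_smult A) enc)" if "i > Suc n" for i using that by (simp add: P_def zero_module_def mrec_def)
 then have "enat (Suc n) : {enat n | n. EX (P :: nat => ('r, ('r, 'x) big) module) d e. proj_resolution R X P d e & (ALL i>n. zero_module (P i))}" using res by blast
 then show ?thesis unfolding pd_def by (rule Inf_lower)
qed

lemma pd_finite_iff:
 assumes "rlink R j A" "mlink R j X k s"
 shows "pd R X < \<infinity> <-> (EX n. pdle A (k ` carrier X) s {0} n)"
proof
 assume "pd R X < \<infinity>"
 then obtain n where "pd R X = enat n" using less_infinityE by blast
 then show "EX n. pdle A (k ` carrier X) s {0} n" using pd_imp_pdle[OF assms, of n] by auto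
next
 assume "EX n. pdle A (k ` carrier X) s {0} n"
 then obtain n where "pd R X <= enat (Suc n)" using pdle_imp_pd[OF assms] by blast
 then show "pd R X < \<infinity>" using enat_ord_simps(4) le_less_trans by blast
qed

subsection \<open>Quotient modules as records\<close>

lemma quotient_module:
 assumes X: "mod_on A X s" and D: "submod A X s D"
 shows "EX (q :: 'x::ab_group_add => ('x => circle) => circle) t. mod_on A (q ` X) t & lin_map A X s (q ` X) t q & (ALL x:X. q x = 0 <-> x : D)"
proof -
 obtain q :: "'x => ('x => circle) => circle" where q: "additive_on UNIV q" "!!x. q x = 0 <-> x : D" using quotient_embedding[OF submodD(1)[OF D]] by blast
 have qa: "q (x + y) = q x + q y" for x y using q(1) by (simp add: additive_on_def)
 have qd: "q (x - y) = q x - q y" for x y using additive_on_diff[OF q(1)] by simp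
 have q_eq: "q x = q y <-> x - y : D" for x y by (simp add: q(2)[symmetric] qd)
 note m = mod_onD[OF X] and md = mod_on_distrib[OF X]
 define c where "c y = (SOME x. x : X & q x = y)" for y
 have c: "c (q x) : X" "q (c (q x)) = q x" if "x : X" for x using someI[of "%x'. x' : X & q x' = q x" x] that by (auto simp: c_def)
 define t where "t a y = q (s a (c y))" for a y
 have t: "t a (q x) = q (s a x)" if "a : carrier A" "x : X" for a x
 proof -
  have "c (q x) - x : D" using q_eq c(2)[OF that(2)] by blast
  then have "s a (c (q x)) - s a x : D" using submodD(3)[OF D that(1)] md(2)[OF that(1) c(1)[OF that(2)] that(2)] by metis
  then show ?thesis unfolding t_def using q_eq by blast
 qed
 have sub: "subgrp (q ` X)" by (rule subgrp_image[OF m(2)]) (simp add: additive_on_def qa)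
 have "biadd (carrier A) (q ` X) t" by (rule biaddI) (auto simp: t m(4) md qa[symmetric] subgrp_add[OF m(2)] subgrp_add[OF ring_onD(1)[OF m(1)]])
 then have "mod_on A (q ` X) t" unfolding mod_on_def using sub m(1) by (auto simp: t m(4,5,6) ring_onD(2,4)[OF m(1)])
 moreover have "lin_map A X s (q ` X) t q" by (auto simp: lin_map_def additive_on_def qa t)
 ultimately show ?thesis using q(2) by blast
qed

definition fgen :: "('a::ab_group_add, 's) ring_scheme => 'x::ab_group_add set => ('a => 'x => 'x) => bool" where
 "fgen A X s <-> (EX S. finite S & S <= X & (ALL x:X. EX v:free_on A S. x = lincomb s v (%y. y)))"

lemma embedding_finsum:
 assumes G: "abelian_group G" and k: "add_embedding G k" and S: "finite S" "f : S \<rightarrow> carrier G"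
 shows "k (\<Oplus>\<^bsub>G\<^esub>x\<in>S. f x) = (\<Sum>x\<in>S. k (f x))"
proof -
 interpret G: abelian_group G by fact
 show ?thesis using S by (induction S rule: finite_induct)
   (auto simp: add_embedding_group(1)[OF G k] add_embeddingD(2)[OF k] Pi_def)
qed

lemma fin_gen_iff_fgen:
 assumes R: "rlink R j A" and X: "mlink R j X k s"
 shows "fin_gen R X <-> fgen A (k ` carrier X) s"
proof -
 note r = rlinkD[OF R] and jj = add_embeddingD[OF rlinkD(2)[OF R]] and kk = add_embeddingD[OF mlinkD(2)[OF X]]
 interpret X: left_module R X by (rule mlinkD(1)[OF X])
 have zA: "0 : carrier A" using subgrp_0[OF ring_onD(1)[OF rlink_ring_on[OF R]]] .
 have m: "mod_on A (k ` carrier X) s" by (rule mlink_mod_on[OF R X])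
 have sum: "k (\<Oplus>\<^bsub>X\<^esub>x\<in>S. c x \<odot>\<^bsub>X\<^esub> x) = (\<Sum>x\<in>S. s (j (c x)) (k x))" if "finite S" "S <= carrier X" "c : S \<rightarrow> carrier R" for S c
 proof -
  have "k (\<Oplus>\<^bsub>X\<^esub>x\<in>S. c x \<odot>\<^bsub>X\<^esub> x) = (\<Sum>x\<in>S. k (c x \<odot>\<^bsub>X\<^esub> x))" by (rule embedding_finsum[OF mlinkD(4)[OF X] mlinkD(2)[OF X] that(1)]) (use that X.smult_closed in auto)
  also have "... = (\<Sum>x\<in>S. s (j (c x)) (k x))" by (rule sum.cong[OF refl], rule mlinkD(3)[OF X, symmetric]) (use that in auto)
  finally show ?thesis .
 qed
 show ?thesis
 proof
  assume "fin_gen R X"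
  then obtain S where S: "finite S" "S <= carrier X" "!!x. x : carrier X ==> EX c:S \<rightarrow> carrier R. x = (\<Oplus>\<^bsub>X\<^esub>s\<in>S. c s \<odot>\<^bsub>X\<^esub> s)" by (auto simp: fin_gen_def)
  have injS: "inj_on k S" using kk(1) S(2) inj_on_subset by blast
  have "EX v:free_on A (k ` S). k x = lincomb s v (%y. y)" if x: "x : carrier X" for x
  proof -
   obtain c where c: "c : S \<rightarrow> carrier R" "x = (\<Oplus>\<^bsub>X\<^esub>s\<in>S. c s \<odot>\<^bsub>X\<^esub> s)" using S(3)[OF x] by blast
   define v where "v y = (if y : k ` S then j (c (tinv S k y)) else 0)" for y
   have vk: "v (k y) = j (c y)" if "y : S" for y using that by (simp add: v_def the_inv_into_f_f[OF injS])
   have "v y : carrier A" for y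
   proof (cases "y : k ` S")
    case True
    then obtain z where z: "z : S" "y = k z" by blast
    then have "c z : carrier R" using c(1) by auto
    then show ?thesis using vk[OF z(1)] z(2) r(3) by simp
   qed (simp add: v_def zA)
   moreover have "{y. v y ~= 0} <= k ` S" by (auto simp: v_def split: if_splits)
   ultimately have v: "v : free_on A (k ` S)" using S(1) finite_subset by (auto simp: fs_def v_def)
   have "lincomb s v (%y. y) = (\<Sum>y\<in>k ` S. s (v y) y)" by (rule lincomb_superset) (use S(1,2) mod_on_0(1)[OF m] in "auto simp: v_def split: if_splits")
   also have "... = (\<Sum>y\<in>S. s (j (c y)) (k y))" by (subst sum.reindex[OF injS]) (simp add: vk)
   finally show ?thesis using v sum[OF S(1,2) c(1)] c(2) by metis
  qed
  then show "fgen A (k ` carrier X) s" unfolding fgen_def using S(1,2) by (intro exI[of _ "k ` S"]) auto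
 next
  assume "fgen A (k ` carrier X) s"
  then obtain S' where S': "finite S'" "S' <= k ` carrier X" "!!x. x : k ` carrier X ==> EX v:free_on A S'. x = lincomb s v (%y. y)" by (auto simp: fgen_def)
  define S where "S = tinv (carrier X) k ` S'"
  have S: "finite S" "S <= carrier X" using S'(1,2) kk(4) by (auto simp: S_def)
  have kS: "k ` S = S'" unfolding S_def using S'(2) kk(5) by (force simp: image_iff)
  have injS: "inj_on k S" using kk(1) S(2) inj_on_subset by blast
  have "EX c:S \<rightarrow> carrier R. x = (\<Oplus>\<^bsub>X\<^esub>s\<in>S. c s \<odot>\<^bsub>X\<^esub> s)" if x: "x : carrier X" for x
  proof -
   obtain v where v: "v : free_on A S'" "k x = lincomb s v (%y. y)" using S'(3) x by blast
   define c where "c y = tinv (carrier R) j (v (k y))" for y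
   have c: "c : S \<rightarrow> carrier R" "j (c y) = v (k y)" for y using jj(4,5) fsD(2)[OF v(1)] r(3) by (auto simp: c_def)
   have "lincomb s v (%y. y) = (\<Sum>y\<in>k ` S. s (v y) y)" by (rule lincomb_superset) (use S'(1,2) fs_supp[OF v(1)] mod_on_0(1)[OF m] kS S(1) in auto)
   also have "... = (\<Sum>y\<in>S. s (j (c y)) (k y))" by (subst sum.reindex[OF injS]) (simp add: c(2))
   also have "... = k (\<Oplus>\<^bsub>X\<^esub>s\<in>S. c s \<odot>\<^bsub>X\<^esub> s)" using sum[OF S c(1)] by simp
   finally have "k x = k (\<Oplus>\<^bsub>X\<^esub>s\<in>S. c s \<odot>\<^bsub>X\<^esub> s)" using v(2) by simp
   moreover have "(\<Oplus>\<^bsub>X\<^esub>s\<in>S. c s \<odot>\<^bsub>X\<^esub> s) : carrier X" by (rule X.X.finsum_closed) (use c(1) S(2) X.smult_closed in auto)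
   ultimately show ?thesis using c(1) inj_onD[OF kk(1)] x by blast
  qed
  then show "fin_gen R X" unfolding fin_gen_def using S by (intro exI[of _ S]) auto
 qed
qed

lemma fgenI:
 assumes X: "mod_on A X s" and B: "finite B" and e: "!!b. b : B ==> e b : X"
  and gen: "!!x. x : X ==> EX v:free_on A B. x = lincomb s v e"
 shows "fgen A X s"
proof -
 have A: "ring_on A" using mod_onD(1)[OF X] .
 have d: "single (e b) (one A) : free_on A (e ` B)" if "b : B" for b by (rule fs_basis[OF A]) (use that in auto)
 have "EX v:free_on A (e ` B). x = lincomb s v (%y. y)" if x: "x : X" for x
 proof -
  obtain v where v: "v : free_on A B" "x = lincomb s v e" using gen[OF x] by blast
  have "lincomb s (rmul A v (%b. single (e b) (one A))) (%y. y) = lincomb s v (%b. lincomb s (single (e b) (one A)) (%y. y))" by (rule lincomb_ap[OF X v(1) d]) (use e in auto)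
  also have "... = x" unfolding v(2) using lincomb_one[OF X, where e = "%y. y"] e by (intro lincomb_cong[OF v(1)]) auto
  finally show ?thesis by (intro bexI[OF _ ap_in[OF mod_on_self_opp[OF A] v(1) d]]) simp_all
 qed
 then show ?thesis unfolding fgen_def using B e by (intro exI[of _ "e ` B"]) auto
qed

lemma fgen_image:
 assumes X: "mod_on A X s" and Y: "mod_on A Y t" and f: "lin_map A X s Y t f" and surj: "f ` X = Y" and fg: "fgen A X s"
 shows "fgen A Y t"
proof -
 obtain S where S: "finite S" "S <= X" "!!x. x : X ==> EX v:free_on A S. x = lincomb s v (%y. y)" using fg by (auto simp: fgen_def)
 show ?thesis
 proof (rule fgenI[OF Y S(1), where e = f])
  show "f b : Y" if "b : S" for b using that S(2) surj by auto
  fix y assume "y : Y"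
  then obtain x where x: "x : X" "y = f x" using surj by auto
  obtain v where v: "v : free_on A S" "x = lincomb s v (%y. y)" using S(3)[OF x(1)] by blast
  show "EX v:free_on A S. y = lincomb t v f" using lin_map_lincomb[OF X f v(1), of "%y. y"] subsetD[OF S(2)] v x(2) by (intro bexI[of _ v]) simp_all
 qed
qed

text \<open>Elements of \<open>X/D\<close> are coded through chosen representatives, so a coding of
  \<open>X\<close> itself is enough. The two bounds match up to one step, which suffices for
  questions of finiteness.\<close>

lemma coker_record:
 fixes R :: "('r, 's) ring_scheme" and enc :: "'x::ab_group_add => 'z"
 assumes R: "rlink R j A" and X: "mod_on A X s" and D: "submod A X s D" and enc: "inj_on enc X"
 shows "EX Z :: ('r, 'z) module. left_module R Z & (fgen A X s --> fin_gen R Z) &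
  (ALL n. pd R Z <= enat n --> pdle A X s D n) & (ALL n. pdle A X s D n --> pd R Z <= enat (Suc n))"
proof -
 obtain q :: "'x => ('x => circle) => circle" and t where q: "mod_on A (q ` X) t" "lin_map A X s (q ` X) t q"
  "!!x. x : X ==> q x = 0 <-> x : D" using quotient_module[OF X D] by blast
 define c where "c y = (SOME x. x : X & q x = y)" for y
 have c: "c (q x) : X" "q (c (q x)) = q x" if "x : X" for x using someI[of "%x'. x' : X & q x' = q x" x] that by (auto simp: c_def)
 have "inj_on (%y. enc (c y)) (q ` X)"
 proof (rule inj_onI)
  fix y z assume "y : q ` X" "z : q ` X" "enc (c y) = enc (c z)"
  then obtain a b where ab: "a : X" "b : X" "y = q a" "z = q b" "enc (c (q a)) = enc (c (q b))" by auto
  have "c (q a) = c (q b)" using inj_onD[OF enc ab(5) c(1)[OF ab(1)] c(1)[OF ab(2)]] .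
  then show "y = z" using c(2)[OF ab(1)] c(2)[OF ab(2)] ab by metis
 qed
 note L = mrec_link[OF R q(1) this]
 have iff: "pdle A X s D n <-> pdle A (q ` X) t {0} n" for n by (rule pdle_iso[OF X D q(2,1) submod_0[OF q(1)]]) (use q(3) in auto)
 have fg: "fgen A X s ==> fgen A (q ` X) t" by (rule fgen_image[OF X q(1,2)]) auto
 show ?thesis using mlinkD(1)[OF L(1)] pd_imp_pdle[OF R L(1)] pdle_imp_pd[OF R L(1)] fin_gen_iff_fgen[OF R L(1)] fg unfolding L(2) iff by blast
qed

subsection \<open>Formal sums\<close>

definition fext :: "('b => 'x::ab_group_add) => ('b \<Rightarrow>\<^sub>0 int) => 'x" where
 "fext f c = (\<Sum>b\<in>fkeys c. zmul (Poly_Mapping.lookup c b) (f b))"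

lemma fext_superset:
 "finite S ==> fkeys c <= S ==> fext f c = (\<Sum>b\<in>S. zmul (Poly_Mapping.lookup c b) (f b))" unfolding fext_def by (rule sum.mono_neutral_left) (auto simp: in_keys_iff)

lemma fext_add: "fext f (c + c') = fext f c + fext f c'"
proof -
 let ?S = "fkeys c \<union> fkeys c'"
 have "fkeys (c + c') <= ?S" by (rule keys_add)
 then have "fext f (c + c') = (\<Sum>b\<in>?S. zmul (Poly_Mapping.lookup (c + c') b) (f b))" by (intro fext_superset) auto
 then show ?thesis by (subst (1 2) fext_superset[of ?S]) (auto simp: lookup_add zmul_add sum.distrib)
qed

lemma fext_additive: "additive_on A (fext f)" by (simp add: additive_on_def fext_add)

lemma fext_diff: "fext f (c - c') = fext f c - fext f c'" using additive_on_diff[OF fext_additive[of UNIV]] by simp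

lemma fext_0 [simp]: "fext f 0 = 0" by (simp add: fext_def)

lemma fext_of [simp]: "fext f (frag_of b) = f b" by (simp add: fext_def)

lemma fext_frag_extend: "fext f (frag_extend g c) = fext (%b. fext f (g b)) c"
proof -
 have cm: "fext f (frag_cmul k x) = zmul k (fext f x)" for k x
 proof -
  have "fext f (frag_cmul k x) = (\<Sum>b\<in>fkeys x. zmul (k * Poly_Mapping.lookup x b) (f b))" using keys_cmul[of k x] by (subst fext_superset[of "fkeys x"]) auto
  also have "... = zmul k (fext f x)" unfolding fext_def zmul_mult by (rule additive_on_sum[of UNIV, symmetric]) (auto simp: additive_on_def zmul_add_right)
  finally show ?thesis .
 qed
 have "fext f (frag_extend g c) = (\<Sum>i\<in>fkeys c. fext f (frag_cmul (Poly_Mapping.lookup c i) (g i)))" unfolding frag_extend_def by (rule additive_on_sum[of UNIV]) (auto simp: fext_additive)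
 then show ?thesis by (simp add: cm fext_def[of _ c])
qed

lemma fext_cong: "(!!b. b : fkeys c ==> f b = g b) ==> fext f c = fext g c" unfolding fext_def by (rule sum.cong) auto

lemma fext_in: "subgrp H ==> (!!b. b : fkeys c ==> f b : H) ==> fext f c : H" unfolding fext_def by (intro subgrp_sum zmul_in) auto

lemma frag_extend_additive: "additive_on A (frag_extend f)" by (simp add: additive_on_def frag_extend_add)

lemma subgrp_keys: "subgrp {c. fkeys c <= S}" unfolding subgrp_def using keys_diff by fastforce

text \<open>Links the subgroup generated inside a free abelian group as a record with the span in
  its type. The keys are restricted to \<open>S\<close> because inverses in the record are known to
  be negatives only there.\<close>

lemma generate_zspan:
 assumes rels: "rels <= {c. fkeys c <= S}"
 shows "generate (free_Abelian_group S) rels = zspan rels"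
proof (intro equalityI subsetI)
 fix c assume "c : generate (free_Abelian_group S) rels"
 then show "c : zspan rels"
 proof induction
  case (inv h)
  then have "inv\<^bsub>free_Abelian_group S\<^esub> h = - h" using rels by auto
  then show ?case using inv zspan_superset subgrp_uminus[OF subgrp_zspan] by metis
 qed (auto intro: subgrp_0[OF subgrp_zspan] subgrp_add[OF subgrp_zspan] zspan_superset)
next
 fix c assume c: "c : zspan rels"
 let ?G = "generate (free_Abelian_group S) rels"
 have sub: "subgroup ?G (free_Abelian_group S)" by (rule group.generate_is_subgroup[OF group_free_Abelian_group]) (use rels in auto)
 have "subgrp ?G"
 proof (rule subgrpI)
  show "0 : ?G" using subgroup.one_closed[OF sub] by simp
  show "x + y : ?G" if "x : ?G" "y : ?G" for x y using subgroup.m_closed[OF sub that] by simp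
  show "- x : ?G" if "x : ?G" for x using subgroup.m_inv_closed[OF sub that] subgroup.subset[OF sub] that by auto
 qed
 then show "c : ?G" by (rule zspan_least[OF _ _ c]) (auto intro: generate.incl)
qed

lemma coset_free: "H #>\<^bsub>free_Abelian_group S\<^esub> c = {h + c | h. h : H}" by (auto simp: r_coset_def)

lemma frag_keys_diff: "(c :: _ \<Rightarrow>\<^sub>0 int) : {c. fkeys c <= T} ==> c' : {c. fkeys c <= T} ==> c - c' : {c. fkeys c <= T}" by (rule subgrp_diff[OF subgrp_keys])

lemma tensor_rels_keys:
 assumes "left_module (opp R) X" "left_module R Y"
 shows "tensor_rels R X Y <= {c. fkeys c <= carrier X \<times> carrier Y}"
proof -
 interpret X: left_module "opp R" X by fact
 interpret Y: left_module R Y by fact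
 have sc: "r \<odot>\<^bsub>X\<^esub> x : carrier X" if "r : carrier R" "x : carrier X" for r x using X.smult_closed[of r x] that by simp
 show ?thesis unfolding tensor_rels_def by (intro Un_least subsetI; elim CollectE exE conjE; hypsubst; intro frag_keys_diff;
    simp add: X.X.a_closed Y.X.a_closed sc Y.smult_closed)
qed

lemma tensor_sub_zspan:
 assumes "left_module (opp R) X" "left_module R Y"
 shows "tensor_sub R X Y = zspan (tensor_rels R X Y)" unfolding tensor_sub_def by (rule generate_zspan[OF tensor_rels_keys[OF assms]])

subsection \<open>Vanishing of Tor\<close>

text \<open>A trivial homology group is translated into exactness of \<open>N\<^sup>(\<^sup>B\<^sup>)\<close>, using that the tensor product of \<open>N\<close>
 with the free module on \<open>B\<close> is \<open>N\<^sup>(\<^sup>B\<^sup>)\<close>.\<close>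

lemma Tor_zero_ex_at:
 fixes R :: "('r, 's) ring_scheme" and N :: "('r, 'n) module" and Y :: "('r, 'y) module" and A :: "'a::ab_group_add ring"
  and kN :: "'n => 'nn::ab_group_add"
 assumes R: "rlink R j A" and N: "mlink (opp R) j N kN sN" and Y: "mlink R j Y kY sY"
  and F: "fres A (kY ` carrier Y) sY {0} (B :: nat => 'b set) d e"
  and tor: "!!i. i >= 1 ==> Tor_zero R i N Y"
 shows "ex_at sN (kN ` carrier N) B d i"
proof -
 let ?N = "kN ` carrier N"
 have A: "ring_on A" by (rule rlink_ring_on[OF R])
 have N': "mod_on (opp A) ?N sN" by (rule mlink_mod_on[OF rlink_opp[OF R] N])
 have Y': "mod_on A (kY ` carrier Y) sY" by (rule mlink_mod_on[OF R Y])
 have lY: "left_module R Y" and lN: "left_module (opp R) N" using mlinkD(1)[OF Y] mlinkD(1)[OF N] by auto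
 \<comment> \<open>\<open>Tor_zero\<close> speaks of resolutions in one type of records, so lists
   are taken as indices here; other index types follow by balancing at the end.\<close>
 have main: "ex_at sN ?N B d i" if F: "fres A (kY ` carrier Y) sY {0} (B :: nat => ('r, 'y) big set) d e" for B d e
 proof -
  have "inj (%r::'r. [(r, undefined :: 'y)])" "inj (%x::'y. [(undefined :: 'r, x)])" by (auto intro: injI)
  from fres_exists_big(2)[OF R Y infinite_lists this]
  obtain enc :: "(('r, 'y) big => 'a) => ('r, 'y) big" where enc: "inj_on enc (free_on A UNIV)" by blast
  have U: "free_on A (B n) <= free_on A UNIV" for n by (rule fs_mono) auto
  define P where "P n = mrec j (free_on A (B n)) (free_smult A) enc" for n
  define D where "D n x = enc (rmul A (tinv (free_on A (B (Suc n))) enc x) (d n))" for n x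
  obtain e' where res: "proj_resolution R Y P D e'" using pres_proj_resolution[OF R Y fres_pres[OF F] U enc] unfolding P_def D_def by blast
  have encB: "inj_on enc (free_on A (B n))" for n using enc U inj_on_subset by blast
  note L = mrec_link[OF R free_mod[OF A] encB, folded P_def]
  have lP: "left_module R (P n)" for n using mlinkD(1)[OF L(1)] .
  have dec: "tinv (free_on A (B n)) enc (enc v) = v" if "v : free_on A (B n)" for n v using L(4) that .
  have db: "d n b : free_on A (B n)" if "b : B (Suc n)" for n b using fcxD(2)[OF fresD(3)[OF F]] that .
  have De: "D n (enc v) = enc (rmul A v (d n))" if "v : free_on A (B (Suc n))" for n v using that by (simp add: D_def dec)
  have dv: "rmul A v (d n) : free_on A (B n)" if "v : free_on A (B (Suc n))" for n v by (rule ap_in[OF mod_on_self_opp[OF A] that db])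
  note kk = add_embeddingD[OF mlinkD(2)[OF N]] and jj = add_embeddingD[OF rlinkD(2)[OF R]]
  define TS where "TS n = tensor_sub R N (P n)" for n
  have TS: "TS n = zspan (tensor_rels R N (P n))" for n unfolding TS_def by (rule tensor_sub_zspan[OF lN lP])
  have sTS: "subgrp (TS n)" for n unfolding TS by (rule subgrp_zspan)
  let ?S = "%n. carrier N \<times> carrier (P n)"
  have Padd: "enc v \<oplus>\<^bsub>P n\<^esub> enc w = enc (v + w)" and Psm: "r \<odot>\<^bsub>P n\<^esub> enc v = enc (free_smult A (j r) v)" if "v : free_on A (B n)" "w : free_on A (B n)" for n v w r using that by (simp_all add: P_def mrec_def dec)
  have Pc: "p : carrier (P n) <-> (EX v:free_on A (B n). p = enc v)" for n p using L(3) by auto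
  have sfr: "subgrp (free_on A I)" for I :: "('r, 'y) big set" by (rule subgrp_fs[OF ring_onD(1)[OF A]])
  have jA: "j r : carrier A" if "r : carrier R" for r using that rlinkD(3)[OF R] by auto
  define fe where "fe n = frag_extend (%(x :: 'n, y). frag_of (x, D n y))" for n
  have fe_TS: "fe n h : TS n" if "h : TS (Suc n)" for n h
  proof -
   have "subgrp {c\<in>UNIV. fe n c : TS n}" by (rule subgrp_preimage[OF subgrp_UNIV _ sTS]) (simp add: fe_def frag_extend_additive)
   moreover have "tensor_rels R N (P (Suc n)) <= {c\<in>UNIV. fe n c : TS n}"
   proof -
    have Dh: "D n : module_hom R (P (Suc n)) (P n)" using res by (simp add: proj_resolution_def)
    then have Dc: "D n y : carrier (P n)" and Da: "y' : carrier (P (Suc n)) ==> D n (y \<oplus>\<^bsub>P (Suc n)\<^esub> y') = D n y \<oplus>\<^bsub>P n\<^esub> D n y'"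
     and Ds: "r : carrier R ==> D n (r \<odot>\<^bsub>P (Suc n)\<^esub> y) = r \<odot>\<^bsub>P n\<^esub> D n y" if "y : carrier (P (Suc n))" for y y' r using that by (auto simp: module_hom_def hom_def)
    have "frag_of (x \<oplus>\<^bsub>N\<^esub> x', y) - frag_of (x, y) - frag_of (x', y) : TS n" if "x : carrier N" "x' : carrier N" "y : carrier (P n)" for x x' y unfolding TS by (rule zspan_superset) (use that in "unfold tensor_rels_def, blast")
    moreover have "frag_of (x, y \<oplus>\<^bsub>P n\<^esub> y') - frag_of (x, y) - frag_of (x, y') : TS n" if "x : carrier N" "y : carrier (P n)" "y' : carrier (P n)" for x y y' unfolding TS by (rule zspan_superset) (use that in "unfold tensor_rels_def, blast")
    moreover have "frag_of (r \<odot>\<^bsub>N\<^esub> x, y) - frag_of (x, r \<odot>\<^bsub>P n\<^esub> y) : TS n" if "r : carrier R" "x : carrier N" "y : carrier (P n)" for r x y unfolding TS by (rule zspan_superset) (use that in "unfold tensor_rels_def, blast")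
    ultimately show ?thesis using Dc Da Ds by (auto simp: tensor_rels_def fe_def frag_extend_diff)
   qed
   ultimately show ?thesis using zspan_least that unfolding TS[of "Suc n"] by blast
  qed
  \<comment> \<open>The isomorphism of the tensor product of \<open>N\<close> and the free module on
    \<open>B n\<close> with the families in \<open>N\<close>: the elementary tensor of
    \<open>x\<close> and \<open>v\<close> goes to the family of products of \<open>x\<close> with
    the entries of \<open>v\<close>.\<close>
  define ev where "ev n = (%(x, p). %b. sN (tinv (free_on A (B n)) enc p b) (kN x))" for n
  have ev: "ev n (x, enc v) = (%b. sN (v b) (kN x))" if "v : free_on A (B n)" for n x v using that by (simp add: ev_def dec)
  note Nd = mod_on_distrib[OF N', simplified] and Nm = mod_onD[OF N', simplified]
  have kc: "kN x : ?N" if "x : carrier N" for x using that by simp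
  have ev_in: "ev n p : fs ?N (B n)" if pS: "p : ?S n" for n p
  proof -
   obtain v where v: "v : free_on A (B n)" "snd p = enc v" using pS Pc[of "snd p" n] by auto
   then have p: "p = (fst p, enc v)" "fst p : carrier N" using pS by (auto simp: prod_eq_iff)
   define x where "x = fst p"
   have "(%b. sN (v b) (kN x)) : fs ?N (B n)" by (rule fs_map[OF v(1)]) (use mod_on_0(1)[OF N'] Nm(4) p(2) in "auto simp: x_def")
   moreover have "p = (x, enc v)" using p(1) by (simp add: x_def)
   ultimately show ?thesis using ev[OF v(1), of x] by simp
  qed
  have ev_TS: "fext (ev n) h = 0" if "h : TS n" for n h
  proof -
   have "subgrp {c\<in>UNIV. fext (ev n) c : {0}}" by (rule subgrp_preimage[OF subgrp_UNIV fext_additive subgrp_single])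
   moreover have "tensor_rels R N (P n) <= {c\<in>UNIV. fext (ev n) c : {0}}"
   proof -
    have "ev n (x \<oplus>\<^bsub>N\<^esub> x', y) = ev n (x, y) + ev n (x', y)" if h: "x : carrier N" "x' : carrier N" "y : carrier (P n)" for x x' y
    proof -
     obtain v where v: "v : free_on A (B n)" "y = enc v" using h(3) Pc by auto
     show ?thesis using h(1,2) Nd(1) fsD(2)[OF v(1)] by (auto simp: v(2) ev[OF v(1)] kk(2) fun_eq_iff)
    qed
    moreover have "ev n (x, y \<oplus>\<^bsub>P n\<^esub> y') = ev n (x, y) + ev n (x, y')" if h: "x : carrier N" "y : carrier (P n)" "y' : carrier (P n)" for x y y'
    proof -
     obtain v where v: "v : free_on A (B n)" "y = enc v" using h(2) Pc by auto
     obtain w where w: "w : free_on A (B n)" "y' = enc w" using h(3) Pc by auto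
     show ?thesis using h(1) Nd(4) fsD(2)[OF v(1)] fsD(2)[OF w(1)] by (auto simp: v(2) w(2) Padd[OF v(1) w(1)] ev[OF v(1)] ev[OF w(1)] ev[OF subgrp_add[OF sfr v(1) w(1)]] fun_eq_iff)
    qed
    moreover have "ev n (r \<odot>\<^bsub>N\<^esub> x, y) = ev n (x, r \<odot>\<^bsub>P n\<^esub> y)" if h: "r : carrier R" "x : carrier N" "y : carrier (P n)" for r x y
    proof -
     obtain v where v: "v : free_on A (B n)" "y = enc v" using h(3) Pc by auto
     have rv: "free_smult A (j r) v : free_on A (B n)" by (rule mod_onD(4)[OF free_mod[OF A] jA[OF h(1)] v(1)])
     have "sN (v b) (sN (j r) (kN x)) = sN (j r \<otimes>\<^bsub>A\<^esub> v b) (kN x)" for b using Nm(5)[OF fsD(2)[OF v(1)] jA[OF h(1)], of "kN x" b] h(2) by simp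
     then show ?thesis using mlinkD(3)[OF N, of r x] h(1,2) by (simp add: v(2) Psm[OF v(1) v(1)] ev[OF v(1)] ev[OF rv, unfolded pws_def] pws_def)
    qed
    ultimately show ?thesis by (auto simp: tensor_rels_def fext_diff)
   qed
   ultimately show ?thesis using zspan_least[of _ _ h] that unfolding TS by blast
  qed
  have ev_fe: "fext (ev n) (fe n c) = ap sN (fext (ev (Suc n)) c) (d n)" if c: "fkeys c <= ?S (Suc n)" for n c
  proof -
   have ev_D: "ev n (x, D n p) = ap sN (ev (Suc n) (x, p)) (d n)" if xp: "(x, p) : ?S (Suc n)" for x p
   proof -
    obtain v where v: "v : free_on A (B (Suc n))" "p = enc v" using xp Pc by auto
    have x: "kN x : ?N" using xp by simp
    have add: "additive_on (carrier A) (%a. sN a (kN x))" using biadd_left[OF Nm(3) x] by simp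
    have "sN (rmul A v (d n) b) (kN x) = ap sN (%b. sN (v b) (kN x)) (%b j. d n b j) b" for b
    proof (rule map_ap[OF mod_on_self_opp[OF A] N' add, where \<kappa> = "%r. r"])
     show "sN (r \<otimes>\<^bsub>opp A\<^esub> a) (kN x) = sN r (sN a (kN x))" if "r : carrier A" "a : carrier A" for r a using Nm(5)[OF that x] by simp
    qed (use v db Nm(4)[OF _ x] in auto)
    then show ?thesis unfolding v(2) De[OF v(1)] ev[OF v(1)] ev[OF dv[OF v(1)]] by (simp add: fun_eq_iff)
   qed
   have "fext (ev n) (fe n c) = fext (%p. fext (ev n) (case p of (x, y) => frag_of (x, D n y))) c" unfolding fe_def by (rule fext_frag_extend)
   also have "... = fext (%p. ap sN (ev (Suc n) p) (d n)) c" using c ev_D by (intro fext_cong) (auto split: prod.split)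
   also have "... = (\<Sum>p\<in>fkeys c. ap sN (zmul (Poly_Mapping.lookup c p) (ev (Suc n) p)) (d n))" unfolding fext_def using ev_in c by (intro sum.cong refl zmul_additive[OF ap_additive[OF N' db] subgrp_fs[OF Nm(2)], symmetric]) auto
   also have "... = ap sN (fext (ev (Suc n)) c) (d n)" unfolding fext_def using ev_in c by (intro additive_on_sum[OF ap_additive[OF N' db] subgrp_fs[OF Nm(2)], symmetric] zmul_in subgrp_fs[OF Nm(2)]) auto
   finally show ?thesis .
  qed
  show ?thesis unfolding ex_at_def
  proof (intro ballI impI)
   fix v assume v: "v : fs ?N (B (Suc i))" and vd: "ap sN v (d i) = 0"
   let ?iN = "tinv (carrier N) kN"
   have iN: "?iN (v b) : carrier N" "kN (?iN (v b)) = v b" for b using kk(4,5) fsD(2)[OF v] by auto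
   \<comment> \<open>The formal sum of the tensors of \<open>v b\<close> with the basis vector
     \<open>b\<close>, a preimage of \<open>v\<close> under \<open>ev\<close>.\<close>
   define c where "c = (\<Sum>b | v b ~= 0. frag_of (?iN (v b), enc (single b (one A))))"
   have bs: "single b (one A) : free_on A (B (Suc i))" if "v b ~= 0" for b by (rule fs_basis[OF A fs_supp[OF v that]])
   have c_keys: "fkeys c <= ?S (Suc i)"
   proof -
    have "c : {c. fkeys c <= ?S (Suc i)}" unfolding c_def by (rule subgrp_sum[OF subgrp_keys]) (use iN bs Pc in auto)
    then show ?thesis by simp
   qed
   have ev_c: "fext (ev (Suc i)) c = v"
   proof -
    have "fext (ev (Suc i)) c = (\<Sum>b | v b ~= 0. fext (ev (Suc i)) (frag_of (?iN (v b), enc (single b (one A)))))" unfolding c_def by (rule additive_on_sum[OF fext_additive[of UNIV]]) auto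
    also have "... = (\<Sum>b | v b ~= 0. single b (v b))"
    proof (rule sum.cong[OF refl])
     fix b assume "b : {b. v b ~= 0}"
     then have b: "v b ~= 0" by simp
     have "(%b'. sN (single b (one A) b') (v b)) = single b (v b)" using Nm(6) mod_on_0(1)[OF N'] fsD(2)[OF v] by (auto simp: single_def fun_eq_iff)
     then show "fext (ev (Suc i)) (frag_of (?iN (v b), enc (single b (one A)))) = single b (v b)" using ev[OF bs[OF b]] iN by simp
    qed
    also have "... = v" using fs_expand[OF v] by simp
    finally show ?thesis .
   qed
   \<comment> \<open>The vanishing of \<open>ap sN v (d i)\<close> must be read back in the tensor
     product. Modulo the relations \<open>\<tau>\<close> is a balanced pairing, so the class of
     \<open>fe i c\<close> is the evaluation of that vanishing vector.\<close>
   have fe_c: "fe i c : TS i"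
   proof -
    obtain q :: "('n * ('r, 'y) big \<Rightarrow>\<^sub>0 int) => (('n * ('r, 'y) big \<Rightarrow>\<^sub>0 int) => circle) => circle" where q: "additive_on UNIV q" "!!c. q c = 0 <-> c : TS i" using quotient_embedding[OF sTS] by blast
    define \<tau> where "\<tau> x w = q (frag_of (?iN x, enc w))" for x w
    have qa: "q (a + b) = q a + q b" for a b using q(1) by (simp add: additive_on_def)
    have qd: "q (a - b) = q a - q b" for a b using additive_on_diff[OF q(1)] by simp
    have qr: "q a = q b + q c'" if "a - b - c' : TS i" for a b c'
    proof -
     have "q a - q b - q c' = 0" using that q(2) by (simp add: qd[symmetric])
     then show ?thesis by (simp add: algebra_simps)
    qed
    have rel: "r : TS i" if "r : tensor_rels R N (P i)" for r unfolding TS by (rule zspan_superset[OF that])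
    have iNa: "?iN (x + x') = ?iN x \<oplus>\<^bsub>N\<^esub> ?iN x'" if "x : ?N" "x' : ?N" for x x'
    proof -
     have "x + x' = kN (?iN x \<oplus>\<^bsub>N\<^esub> ?iN x')" using kk(2,4,5) that by simp
     moreover have "?iN x \<oplus>\<^bsub>N\<^esub> ?iN x' : carrier N" by (rule abelian_monoid.a_closed[OF abelian_group.axioms(1)[OF left_module.axioms(2)[OF lN]]]) (use kk(4) that in auto)
     ultimately show ?thesis using kk(3) by metis
    qed
    have bi\<tau>: "biadd ?N (free_on A (B i)) \<tau>"
    proof (rule biaddI)
     fix x x' w assume h: "x : ?N" "x' : ?N" "w : free_on A (B i)"
     show "\<tau> (x + x') w = \<tau> x w + \<tau> x' w" unfolding \<tau>_def iNa[OF h(1,2)] by (rule qr, rule rel) (use h kk(4) Pc in "unfold tensor_rels_def, blast")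
    next
     fix x w w' assume h: "x : ?N" "w : free_on A (B i)" "w' : free_on A (B i)"
     have hP: "enc w : carrier (P i)" "enc w' : carrier (P i)" using h Pc by auto
     show "\<tau> x (w + w') = \<tau> x w + \<tau> x w'" unfolding \<tau>_def Padd[OF h(2,3), symmetric] by (rule qr, rule rel) (use hP kk(4)[OF h(1)] in "unfold tensor_rels_def, blast")
    qed
    have bal: "\<tau> (sN r x) w = \<tau> x (free_smult A r w)" if r: "r : carrier A" and x: "x : ?N" and w: "w : free_on A (B i)" for r x w
    proof -
     obtain r' where r': "r' : carrier R" "r = j r'" using r rlinkD(3)[OF R] by auto
     have "sN r x = kN (r' \<odot>\<^bsub>N\<^esub> ?iN x)" using mlinkD(3)[OF N, of r' "?iN x"] kk(4,5)[OF x] r' by simp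
     moreover have "r' \<odot>\<^bsub>N\<^esub> ?iN x : carrier N" using left_module.smult_closed[OF lN] r'(1) kk(4)[OF x] by simp
     ultimately have iNs: "?iN (sN r x) = r' \<odot>\<^bsub>N\<^esub> ?iN x" using kk(3) by simp
     have "frag_of (r' \<odot>\<^bsub>N\<^esub> ?iN x, enc w) - frag_of (?iN x, r' \<odot>\<^bsub>P i\<^esub> enc w) : TS i" by (rule rel) (use r'(1) kk(4)[OF x] w Pc in "unfold tensor_rels_def, blast")
     then have "q (frag_of (r' \<odot>\<^bsub>N\<^esub> ?iN x, enc w)) = q (frag_of (?iN x, r' \<odot>\<^bsub>P i\<^esub> enc w))" using q(2) qd by (metis eq_iff_diff_eq_0)
     then show ?thesis unfolding \<tau>_def iNs using Psm[OF w w] r'(2) by simp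
    qed
    have "lincomb \<tau> (%j. lincomb (%x r. sN r x) v (%b. d i b j)) (%j. single j (one A))
     = lincomb \<tau> v (%b. lincomb (free_smult A) (d i b) (%j. single j (one A)))" by (rule lincomb_assoc[OF v db, where X = "free_on A (B i)" and L = ?N and Y = "free_on A (B i)"])
      (use fs_basis[OF A] Nm(2,4) mod_on_0[OF N'] bi\<tau> sfr mod_onD(4)[OF free_mod[OF A]] mod_on_0(1)[OF free_mod[OF A]] bal in auto)
    moreover have "lincomb \<tau> v (%b. lincomb (free_smult A) (d i b) (%j. single j (one A))) = lincomb \<tau> v (d i)" using lincomb_basis[OF A db] by (intro lincomb_cong[OF v]) simp
    ultimately have "lincomb \<tau> v (d i) = lincomb \<tau> (ap sN v (d i)) (%j. single j (one A))" by (simp add: ap_def)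
    then have z: "lincomb \<tau> v (d i) = 0" unfolding vd by simp
    have "fe i c = (\<Sum>b | v b ~= 0. frag_of (?iN (v b), enc (d i b)))"
    proof -
     have "fe i c = (\<Sum>b | v b ~= 0. fe i (frag_of (?iN (v b), enc (single b (one A)))))" unfolding c_def fe_def by (rule additive_on_sum[OF frag_extend_additive[of UNIV]]) auto
     also have "... = (\<Sum>b | v b ~= 0. frag_of (?iN (v b), enc (d i b)))" using De[OF bs] rmul_single[where f = "d i", OF A db] fs_supp[OF v] by (intro sum.cong refl) (simp add: fe_def)
     finally show ?thesis .
    qed
    then have "q (fe i c) = lincomb \<tau> v (d i)" unfolding lincomb_def \<tau>_def using additive_on_sum[OF q(1)] by simp
    then show ?thesis using z q(2) by simp
   qed
   define T where "T n = tensor R N (P n)" for n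
   define DT where "DT n = tensor_map R N (P n) (D n)" for n
   have T: "carrier (T n) = (%c. TS n #>\<^bsub>free_Abelian_group (?S n)\<^esub> c) ` {c. fkeys c <= ?S n}" "\<one>\<^bsub>T n\<^esub> = TS n" for n by (auto simp: T_def tensor_def carrier_FactGroup TS_def)
   have DT: "DT n C = (\<Union>c\<in>C. {h + fe n c | h. h : TS n})" for n C by (simp add: DT_def tensor_map_def coset_free TS_def fe_def)
   let ?Z = "kernel (T (Suc i)) (T i) (DT i)" and ?I = "DT (Suc i) ` carrier (T (Suc (Suc i)))"
   let ?c = "TS (Suc i) #>\<^bsub>free_Abelian_group (?S (Suc i))\<^esub> c"
   have cZ: "?c : ?Z"
   proof -
    have "DT i ?c = TS i"
    proof (intro equalityI subsetI)
     fix y assume "y : DT i ?c"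
     then obtain h h' where y: "h : TS (Suc i)" "h' : TS i" "y = h' + fe i (h + c)" by (auto simp: DT coset_free)
     have "fe i (h + c) = fe i h + fe i c" by (simp add: fe_def frag_extend_add)
     then show "y : TS i" using y fe_TS[OF y(1)] fe_c by (simp add: subgrp_add[OF sTS])
    next
     fix y assume y: "y : TS i"
     have "y - fe i c : TS i" using subgrp_diff[OF sTS y fe_c] .
     moreover have "y = (y - fe i c) + fe i c" by simp
     moreover have "c : ?c" using subgrp_0[OF sTS[of "Suc i"]] by (force simp: coset_free)
     ultimately show "y : DT i ?c" unfolding DT by blast
    qed
    moreover have "?c : carrier (T (Suc i))" using c_keys by (auto simp: T)
    ultimately show ?thesis by (simp add: kernel_def T)
   qed
   have "trivial_group (tensor_homology R N P D (Suc i))"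
   proof -
    have "Tor_zero R (Suc i) N Y" by (rule tor) simp
    then show ?thesis using res unfolding Tor_zero_def by blast
   qed
   then have triv: "carrier ((T (Suc i))\<lparr>carrier := ?Z\<rparr> Mod ?I) = {?I}" by (simp add: trivial_group_def tensor_homology_def T_def DT_def Let_def)
   \<comment> \<open>A trivial quotient identifies the coset of the cycle with the group of
     boundaries; multiplication by the boundary of the zero class then exhibits the cycle as a
     boundary up to relations.\<close>
   have "?I #>\<^bsub>(T (Suc i))\<lparr>carrier := ?Z\<rparr>\<^esub> ?c = ?I" using triv cZ unfolding carrier_FactGroup by auto
   then have I_eq: "?I #>\<^bsub>T (Suc i)\<^esub> ?c = ?I" by simp
   let ?C0 = "TS (Suc (Suc i)) #>\<^bsub>free_Abelian_group (?S (Suc (Suc i)))\<^esub> 0"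
   have C0: "DT (Suc i) ?C0 : ?I" by (rule imageI) (auto simp: T)
   have "DT (Suc i) ?C0 \<otimes>\<^bsub>T (Suc i)\<^esub> ?c : ?I"
   proof -
    have "DT (Suc i) ?C0 \<otimes>\<^bsub>T (Suc i)\<^esub> ?c : ?I #>\<^bsub>T (Suc i)\<^esub> ?c" using C0 unfolding r_coset_def by blast
    then show ?thesis unfolding I_eq .
   qed
   then obtain C1 where C1: "C1 : carrier (T (Suc (Suc i)))" "DT (Suc i) ?C0 <#>\<^bsub>free_Abelian_group (?S (Suc i))\<^esub> ?c = DT (Suc i) C1" by (auto simp: T_def tensor_def)
   obtain c1 where c1: "fkeys c1 <= ?S (Suc (Suc i))" "C1 = TS (Suc (Suc i)) #>\<^bsub>free_Abelian_group (?S (Suc (Suc i)))\<^esub> c1" using C1(1) by (auto simp: T)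
   have "0 : ?C0" using subgrp_0[OF sTS[of "Suc (Suc i)"]] by (force simp: coset_free)
   moreover have "fe (Suc i) 0 = 0" by (simp add: fe_def)
   moreover have "0 : TS (Suc i)" using subgrp_0[OF sTS] .
   ultimately have "0 : DT (Suc i) ?C0" unfolding DT by force
   moreover have "c : ?c" using subgrp_0[OF sTS[of "Suc i"]] by (force simp: coset_free)
   ultimately have "c : DT (Suc i) C1" unfolding C1(2)[symmetric] by (force simp: set_mult_def)
   then obtain h h' where h: "h : TS (Suc i)" "h' : TS (Suc (Suc i))" "c = h + fe (Suc i) (h' + c1)" unfolding DT c1(2) coset_free by blast
   have "v = fext (ev (Suc i)) (fe (Suc i) (h' + c1))" using ev_c h(3) ev_TS[OF h(1)] by (simp add: fext_add)
   also have "... = fext (ev (Suc i)) (fe (Suc i) c1)" using ev_TS[OF fe_TS[OF h(2)]] by (simp add: fe_def frag_extend_add fext_add)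
   also have "... = ap sN (fext (ev (Suc (Suc i))) c1) (d (Suc i))" by (rule ev_fe[OF c1(1)])
   finally show "EX w:fs ?N (B (Suc (Suc i))). v = ap sN w (d (Suc i))" using fext_in[OF subgrp_fs[OF Nm(2)], of c1 "ev (Suc (Suc i))"] ev_in c1(1) by blast
  qed
 qed
 \<comment> \<open>The given resolution of \<open>Y\<close> is compared with one indexed by lists by
   balancing Tor twice, through a resolution of \<open>N\<close>.\<close>
 have "inj (%r::'r. [(r, undefined :: 'y)])" "inj (%x::'y. [(undefined :: 'r, x)])" by (auto intro: injI)
 from fres_exists_big(1)[OF R Y infinite_lists this]
 obtain B' :: "nat => ('r, 'y) big set" and d' e' where F': "fres A (kY ` carrier Y) sY {0} B' d' e'" by blast
 obtain C :: "nat => ('a * 'nn) list set" and dz ez where C: "fres (opp A) ?N sN {0} C dz ez" using fres_exists_list[OF N' submod_0[OF N']] by blast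
 have "ex_at sY (kY ` carrier Y) C dz i" by (rule tor_balance[OF C F' main[OF F']])
 moreover have C': "fres (opp (opp A)) (kY ` carrier Y) sY {0} B d e" using F by simp
 ultimately show ?thesis using tor_balance[OF C' C] by simp
qed

section \<open>Tensor powers\<close>

text \<open>Interchanges the two sides. Together with the reversal of words it turns statements on
  left actions into statements on right actions.\<close>

definition op_bim :: "('r, 'm) bimodule => ('r, 'm) bimodule" where
 "op_bim M = M\<lparr>smult := (%r x. rsmult M x r), rsmult := (%x r. smult M r x)\<rparr>"

lemma op_bim_simps [simp]:
 "carrier (op_bim M) = carrier M" "add (op_bim M) = add M" "smult (op_bim M) r x = rsmult M x r" "rsmult (op_bim M) x r = smult M r x"
 "op_bim (op_bim M) = M" "left_of (op_bim M) = right_of M" "right_of (op_bim M) = left_of M" by (simp_all add: op_bim_def left_of_def right_of_def with_smult_def)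

lemma left_right_of_simps [simp]:
 "carrier (left_of M) = carrier M" "add (left_of M) = add M" "zero (left_of M) = zero M" "smult (left_of M) r x = smult M r x"
 "carrier (right_of M) = carrier M" "add (right_of M) = add M" "zero (right_of M) = zero M" "smult (right_of M) r x = rsmult M x r" by (simp_all add: left_of_def right_of_def with_smult_def)

lemma bimodule_op: "bimodule R M ==> bimodule (opp R) (op_bim M)" by (simp add: bimodule_def)

lemma words_op_bim [simp]: "words (op_bim M) n = words M n" by (simp add: words_def)

lemma fext_map:
 assumes "subgrp T" "additive_on T F" "!!w. w : fkeys c ==> p w : T"
 shows "F (fext p c) = fext (%w. F (p w)) c" unfolding fext_def by (subst additive_on_sum[OF assms(2,1)]) (use assms in "auto intro!: zmul_in sum.cong zmul_additive")

lemma fext_frag_of: "additive_on UNIV F ==> fext (%w. F (frag_of w)) c = F c"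
proof -
 assume F: "additive_on UNIV F"
 have "c : UNIV" "fkeys c <= UNIV" by auto
 from this(2) show "fext (%w. F (frag_of w)) c = F c" by (induction c rule: frag_induction) (simp_all add: additive_on_0[OF F] fext_diff additive_on_diff[OF F])
qed

text \<open>The functions on words that factor through the tensor power: additive in each letter and
  balanced between neighbours, expressed as vanishing on the defining relations.\<close>

definition rel_map :: "('r, 's) ring_scheme => ('r, 'm) bimodule => nat => ('m list => 'x::ab_group_add) => bool" where
 "rel_map R M n f <-> (ALL c:tpow_rels R M n. fext f c = 0)"

lemma rel_mapI:
 assumes "!!u v x y. u @ x # v : words M n ==> y : carrier M ==> f (u @ (x \<oplus>\<^bsub>M\<^esub> y) # v) = f (u @ x # v) + f (u @ y # v)"
  and "!!u v x y r. u @ x # y # v : words M n ==> r : carrier R ==> f (u @ rsmult M x r # y # v) = f (u @ x # (r \<odot>\<^bsub>M\<^esub> y) # v)"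
 shows "rel_map R M n f" unfolding rel_map_def tpow_rels_def using assms by (auto simp: fext_diff)

lemma rel_mapD:
 assumes "rel_map R M n f"
 shows "u @ x # v : words M n ==> y : carrier M ==> f (u @ (x \<oplus>\<^bsub>M\<^esub> y) # v) = f (u @ x # v) + f (u @ y # v)"
  and "u @ x # y # v : words M n ==> r : carrier R ==> f (u @ rsmult M x r # y # v) = f (u @ x # (r \<odot>\<^bsub>M\<^esub> y) # v)"
proof -
 assume h: "u @ x # v : words M n" "y : carrier M"
 have "frag_of (u @ (x \<oplus>\<^bsub>M\<^esub> y) # v) - frag_of (u @ x # v) - frag_of (u @ y # v) : tpow_rels R M n" using h unfolding tpow_rels_def by force
 then have "fext f (frag_of (u @ (x \<oplus>\<^bsub>M\<^esub> y) # v) - frag_of (u @ x # v) - frag_of (u @ y # v)) = 0" using assms unfolding rel_map_def by blast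
 then have "f (u @ (x \<oplus>\<^bsub>M\<^esub> y) # v) - f (u @ x # v) - f (u @ y # v) = 0" by (simp add: fext_diff)
 then show "f (u @ (x \<oplus>\<^bsub>M\<^esub> y) # v) = f (u @ x # v) + f (u @ y # v)" by (simp add: algebra_simps)
next
 assume h: "u @ x # y # v : words M n" "r : carrier R"
 have "frag_of (u @ rsmult M x r # y # v) - frag_of (u @ x # (r \<odot>\<^bsub>M\<^esub> y) # v) : tpow_rels R M n" using h unfolding tpow_rels_def by force
 then have "fext f (frag_of (u @ rsmult M x r # y # v) - frag_of (u @ x # (r \<odot>\<^bsub>M\<^esub> y) # v)) = 0" using assms unfolding rel_map_def by blast
 then show "f (u @ rsmult M x r # y # v) = f (u @ x # (r \<odot>\<^bsub>M\<^esub> y) # v)" by (simp add: fext_diff)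
qed

lemma rel_map_zspan: "rel_map R M n f ==> c : zspan (tpow_rels R M n) ==> fext f c = 0" using zspan_least[of "{c\<in>UNIV. fext f c : {0}}" "tpow_rels R M n" c]
  subgrp_preimage[OF subgrp_UNIV fext_additive[of UNIV f] subgrp_single] by (auto simp: rel_map_def)

text \<open>\<open>tower R M n T p\<close> says that \<open>T\<close> is a copy of the \<open>n\<close>-th tensor power in a type of class \<open>ab_group_add\<close>, with \<open>p\<close> sending words to elementary tensors.\<close>

definition tower :: "('r, 's) ring_scheme => ('r, 'm) bimodule => nat => 'x::ab_group_add set => ('m list => 'x) => bool" where
 "tower R M n T p <-> T = fext p ` {c. fkeys c <= words M n} &
  (ALL c. fkeys c <= words M n --> (fext p c = 0 <-> c : zspan (tpow_rels R M n)))"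

type_synonym 'm tower = "(('m list \<Rightarrow>\<^sub>0 int) => circle) => circle"

locale class_bimodule =
 fixes R :: "('r, 's) ring_scheme" and M :: "('r, 'm) bimodule" and j :: "'r => 'a::ab_group_add" and A :: "'a ring"
  and kM :: "'m => 'y::ab_group_add" and la ra
 assumes R: "rlink R j A" and M: "bimodule R M" and Lm: "mlink R j (left_of M) kM la" and Rm: "mlink (opp R) j (right_of M) kM ra"
begin

lemma A: "ring_on A" by (rule rlink_ring_on[OF R])

lemma op: "class_bimodule (opp R) (op_bim M) j (opp A) kM ra la" by standard (simp_all add: rlink_opp[OF R] bimodule_op[OF M] Lm Rm)

lemma Mmod: "mod_on A (kM ` carrier M) la" "mod_on (opp A) (kM ` carrier M) ra" using mlink_mod_on[OF R Lm] mlink_mod_on[OF rlink_opp[OF R] Rm] by simp_all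

lemma kM_simps:
 "inj_on kM (carrier M)" "x : carrier M ==> y : carrier M ==> kM (x \<oplus>\<^bsub>M\<^esub> y) = kM x + kM y"
 "r : carrier R ==> x : carrier M ==> la (j r) (kM x) = kM (r \<odot>\<^bsub>M\<^esub> x)"
 "r : carrier R ==> x : carrier M ==> ra (j r) (kM x) = kM (rsmult M x r)" using add_embeddingD(1,2)[OF mlinkD(2)[OF Lm]] mlinkD(3)[OF Lm] mlinkD(3)[OF Rm] by simp_all

interpretation L: left_module R "left_of M" by (rule mlinkD(1)[OF Lm])
interpretation Rm: left_module "opp R" "right_of M" by (rule mlinkD(1)[OF Rm])

lemmas closed = L.X.a_closed[simplified] L.X.zero_closed[simplified] L.smult_closed[simplified] Rm.smult_closed[simplified]
lemmas laws = L.smult_r_distr[simplified] L.smult_l_distr[simplified] L.smult_assoc[simplified] L.smult_one[simplified]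

lemma laws_bimodule:
 "r : carrier R ==> t : carrier R ==> x : carrier M ==> rsmult M (r \<odot>\<^bsub>M\<^esub> x) t = r \<odot>\<^bsub>M\<^esub> rsmult M x t" using M by (simp add: bimodule_def)

lemma j_simps:
 "r : carrier R ==> tinv (carrier R) j (j r) = r" "a : carrier A ==> tinv (carrier R) j a : carrier R"
 "a : carrier A ==> j (tinv (carrier R) j a) = a" "r : carrier R ==> j r : carrier A" using add_embeddingD(3-5)[OF rlinkD(2)[OF R]] rlinkD(3)[OF R] by auto

lemma tpow_rels_keys: "tpow_rels R M n <= {c. fkeys c <= words M n}" unfolding tpow_rels_def by (intro Un_least subsetI; elim CollectE exE conjE; hypsubst; intro frag_keys_diff)
  (auto simp: words_def closed)

lemma tpow_sub_zspan: "tpow_sub R M n = zspan (tpow_rels R M n)" unfolding tpow_sub_def by (rule generate_zspan[OF tpow_rels_keys])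

lemma tower_facts:
 assumes "tower R M n T p"
 shows "subgrp T" "w : words M n ==> p w : T" "rel_map R M n p"
  "t : T ==> EX c. fkeys c <= words M n & t = fext p c"
proof -
 have T: "T = fext p ` {c. fkeys c <= words M n}" using assms by (simp add: tower_def)
 show "subgrp T" unfolding T by (rule subgrp_image[OF subgrp_keys fext_additive])
 show "p w : T" if "w : words M n" unfolding T by (rule image_eqI[of _ _ "frag_of w"]) (use that in simp_all)
 show "rel_map R M n p" unfolding rel_map_def using assms tpow_rels_keys[of n] zspan_superset[of _ "tpow_rels R M n"] unfolding tower_def by blast
 show "t : T ==> EX c. fkeys c <= words M n & t = fext p c" unfolding T by blast
qed

lemma tower_eqI:
 assumes T: "tower R M n T p" and F: "additive_on T F" and G: "additive_on T G"
  and eq: "!!w. w : words M n ==> F (p w) = G (p w)" and t: "t : T"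
 shows "F t = G t"
proof -
 note f = tower_facts[OF T]
 obtain c where c: "fkeys c <= words M n" "t = fext p c" using f(4)[OF t] by blast
 have "F t = fext (%w. F (p w)) c" unfolding c(2) by (rule fext_map[OF f(1) F]) (use f(2) c in auto)
 also have "... = fext (%w. G (p w)) c" by (rule fext_cong) (use eq c in auto)
 also have "... = G t" unfolding c(2) by (rule fext_map[OF f(1) G, symmetric]) (use f(2) c in auto)
 finally show ?thesis .
qed

text \<open>The universal property of the tensor power: all formal sums representing
  \<open>t\<close> give the same value, as any two of them differ by relations.\<close>

lemma tower_extend:
 assumes T: "tower R M n T p" and f: "rel_map R M n f"
 shows "EX F. additive_on T F & (ALL w:words M n. F (p w) = f w)"
proof -
 note tf = tower_facts[OF T]
 define ch where "ch t = (SOME c. fkeys c <= words M n & t = fext p c)" for t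
 have ch: "fkeys (ch t) <= words M n" "fext p (ch t) = t" if "t : T" for t using someI_ex[OF tf(4)[OF that]] by (auto simp: ch_def)
 have key: "fext f c = fext f c'" if "fkeys c <= words M n" "fkeys c' <= words M n" "fext p c = fext p c'" for c c'
 proof -
  have "fkeys (c - c') <= words M n" using frag_keys_diff[of c _ c'] that by auto
  moreover have "fext p (c - c') = 0" using that(3) by (simp add: fext_diff)
  ultimately have "c - c' : zspan (tpow_rels R M n)" using T by (simp add: tower_def)
  from rel_map_zspan[OF f this] show ?thesis by (simp add: fext_diff)
 qed
 have "additive_on T (%t. fext f (ch t))" unfolding additive_on_def
 proof (intro ballI)
  fix t t' assume t: "t : T" "t' : T"
  have "fkeys (ch t + ch t') <= words M n" using ch(1)[OF t(1)] ch(1)[OF t(2)] keys_add[of "ch t" "ch t'"] by auto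
  then have "fext f (ch (t + t')) = fext f (ch t + ch t')" using ch(1)[OF subgrp_add[OF tf(1) t]] ch(2)[OF subgrp_add[OF tf(1) t]] ch(2)[OF t(1)] ch(2)[OF t(2)] by (intro key) (simp_all add: fext_add)
  then show "fext f (ch (t + t')) = fext f (ch t) + fext f (ch t')" by (simp add: fext_add)
 qed
 moreover have "fext f (ch (p w)) = f w" if "w : words M n" for w using key[of "ch (p w)" "frag_of w"] ch[OF tf(2)[OF that]] that by simp
 ultimately show ?thesis by blast
qed

text \<open>For each scalar the change of the first letter respects the relations, by the bimodule
  law where that letter takes part in a balancing relation; the module laws are then checked on
  words.\<close>

lemma tower_action:
 assumes T: "tower R M n T p" and n: "n >= 1"
 shows "EX s. mod_on A T s & (ALL r:carrier R. ALL w:words M n. s (j r) (p w) = p ((r \<odot>\<^bsub>M\<^esub> hd w) # tl w))"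
proof -
 note tf = tower_facts[OF T]
 have gw: "(r \<odot>\<^bsub>M\<^esub> hd w) # tl w : words M n" if "r : carrier R" "w : words M n" for r w using that n closed(3) by (cases w) (auto simp: words_def)
 have "EX F. additive_on T F & (ALL w:words M n. F (p w) = p ((r \<odot>\<^bsub>M\<^esub> hd w) # tl w))" if r: "r : carrier R" for r
 proof (rule tower_extend[OF T], rule rel_mapI)
  fix u v x y assume h: "u @ x # v : words M n" "y : carrier M"
  show "p ((r \<odot>\<^bsub>M\<^esub> hd (u @ (x \<oplus>\<^bsub>M\<^esub> y) # v)) # tl (u @ (x \<oplus>\<^bsub>M\<^esub> y) # v)) =
   p ((r \<odot>\<^bsub>M\<^esub> hd (u @ x # v)) # tl (u @ x # v)) + p ((r \<odot>\<^bsub>M\<^esub> hd (u @ y # v)) # tl (u @ y # v))"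
  proof (cases u)
   case Nil
   then show ?thesis using rel_mapD(1)[OF tf(3), of "[]" "r \<odot>\<^bsub>M\<^esub> x" v "r \<odot>\<^bsub>M\<^esub> y"] h r closed laws(1)[of r x y] by (simp add: words_def)
  next
   case (Cons a u')
   then show ?thesis using rel_mapD(1)[OF tf(3), of "(r \<odot>\<^bsub>M\<^esub> a) # u'" x v y] h r closed(3) by (simp add: words_def)
  qed
 next
  fix u v x y t assume h: "u @ x # y # v : words M n" "t : carrier R"
  show "p ((r \<odot>\<^bsub>M\<^esub> hd (u @ rsmult M x t # y # v)) # tl (u @ rsmult M x t # y # v)) =
   p ((r \<odot>\<^bsub>M\<^esub> hd (u @ x # (t \<odot>\<^bsub>M\<^esub> y) # v)) # tl (u @ x # (t \<odot>\<^bsub>M\<^esub> y) # v))"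
  proof (cases u)
   case Nil
   then show ?thesis using rel_mapD(2)[OF tf(3), of "[]" "r \<odot>\<^bsub>M\<^esub> x" y v t] h r closed laws_bimodule[of r t x] by (simp add: words_def)
  next
   case (Cons a u')
   then show ?thesis using rel_mapD(2)[OF tf(3), of "(r \<odot>\<^bsub>M\<^esub> a) # u'" x y v t] h r closed(3) by (simp add: words_def)
  qed
 qed
 then obtain F where F: "!!r. r : carrier R ==> additive_on T (F r)"
  "!!r w. r : carrier R ==> w : words M n ==> F r (p w) = p ((r \<odot>\<^bsub>M\<^esub> hd w) # tl w)" by metis
 have FT: "F r t : T" if r: "r : carrier R" and t: "t : T" for r t
 proof -
  obtain c where c: "fkeys c <= words M n" "t = fext p c" using tf(4)[OF t] by blast
  have "F r t = fext (%w. F r (p w)) c" unfolding c(2) by (rule fext_map[OF tf(1) F(1)[OF r]]) (use tf(2) c in auto)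
  also have "... : T" by (rule fext_in[OF tf(1)]) (use F(2)[OF r] tf(2)[OF gw[OF r]] c(1) in auto)
  finally show ?thesis .
 qed
 interpret R: ring R by (rule rlinkD(1)[OF R])
 have hdM: "hd w : carrier M" if "w : words M n" for w using that n by (cases w) (auto simp: words_def)
 have add: "F (r \<oplus>\<^bsub>R\<^esub> r') t = F r t + F r' t" if r: "r : carrier R" "r' : carrier R" and t: "t : T" for r r' t
 proof (rule tower_eqI[OF T F(1) _ _ t, where G = "%t. F r t + F r' t"])
  show "additive_on T (%t. F r t + F r' t)" using F(1) r by (simp add: additive_on_def algebra_simps)
  fix w assume w: "w : words M n"
  show "F (r \<oplus>\<^bsub>R\<^esub> r') (p w) = F r (p w) + F r' (p w)" using rel_mapD(1)[OF tf(3), of "[]" "r \<odot>\<^bsub>M\<^esub> hd w" "List.tl w" "r' \<odot>\<^bsub>M\<^esub> hd w"] gw[OF r(1) w] closed(3) hdM[OF w] r w by (simp add: F(2) laws(2))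
 qed (use r in simp)
 have mult: "F (r \<otimes>\<^bsub>R\<^esub> r') t = F r (F r' t)" if r: "r : carrier R" "r' : carrier R" and t: "t : T" for r r' t
 proof (rule tower_eqI[OF T F(1) _ _ t, where G = "%t. F r (F r' t)"])
  show "additive_on T (%t. F r (F r' t))" using F(1)[OF r(1)] F(1)[OF r(2)] FT[OF r(2)] by (simp add: additive_on_def)
  fix w assume w: "w : words M n"
  show "F (r \<otimes>\<^bsub>R\<^esub> r') (p w) = F r (F r' (p w))" using gw[OF r(2) w] hdM[OF w] r w by (simp add: F(2) laws(3))
 qed (use r in simp)
 have one: "F (one R) t = t" if t: "t : T" for t
 proof (rule tower_eqI[OF T F(1) _ _ t, where G = "%t. t"])
  fix w assume w: "w : words M n"
  then show "F (one R) (p w) = p w" using hdM[OF w] n by (cases w) (auto simp: F(2) laws(4) words_def)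
 qed (simp_all add: additive_on_def)
 note jj = j_simps and je = add_embeddingD(2)[OF rlinkD(2)[OF R]]
 let ?i = "tinv (carrier R) j"
 have ia: "?i (a + b) = ?i a \<oplus>\<^bsub>R\<^esub> ?i b" if "a : carrier A" "b : carrier A" for a b using jj(1)[of "?i a \<oplus>\<^bsub>R\<^esub> ?i b"] je[of "?i a" "?i b"] jj(2,3) that by simp
 have im: "?i (a \<otimes>\<^bsub>A\<^esub> b) = ?i a \<otimes>\<^bsub>R\<^esub> ?i b" if "a : carrier A" "b : carrier A" for a b using jj(1)[of "?i a \<otimes>\<^bsub>R\<^esub> ?i b"] rlinkD(5)[OF R, of "?i a" "?i b"] jj(2,3) that by simp
 have i1: "?i (one A) = (one R)" using jj(1)[of "(one R)"] by (simp add: rlinkD(4)[OF R])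
 have "mod_on A T (%a. F (?i a))" unfolding mod_on_def using A tf(1) FT jj(2) mult one by (auto simp: im i1 ia add additive_on_add[OF F(1)] intro!: biaddI)
 then show ?thesis using F(2) jj(1) by (intro exI[of _ "%a. F (?i a)"]) simp
qed

text \<open>Reversal carries the relations of \<open>M\<close> to those of the opposite bimodule, up
  to a sign for the balancing ones. In this way a right action becomes a left action on reversed
  words.\<close>

lemma tower_rev:
 assumes T: "tower R M n T p"
 shows "tower (opp R) (op_bim M) n T (%w. p (rev w))"
proof -
 interpret o: class_bimodule "opp R" "op_bim M" j "opp A" kM ra la by (rule op)
 let ?\<rho> = "frag_extend (%w :: 'm list. frag_of (rev w))"
 have \<rho>\<rho>: "?\<rho> (?\<rho> c) = c" for c
 proof -
  have "fkeys c <= UNIV" by simp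
  then show ?thesis by (induction c rule: frag_induction) (simp_all add: frag_extend_diff)
 qed
 have fx: "fext (%w. p (rev w)) c = fext p (?\<rho> c)" for c by (simp add: fext_frag_extend)
 have ks: "fkeys (?\<rho> c) <= words M n" if "fkeys c <= words M n" for c using keys_frag_extend[of "%w. frag_of (rev w)" c] that by (fastforce simp: words_def)
 have rels: "?\<rho> c : zspan (tpow_rels (opp Q) (op_bim N) n)" if "c : zspan (tpow_rels Q N n)" for c Q and N :: "('r, 'm) bimodule"
 proof -
  let ?Z = "zspan (tpow_rels (opp Q) (op_bim N) n)"
  have sub: "subgrp {c\<in>UNIV. ?\<rho> c : ?Z}" by (rule subgrp_preimage[OF subgrp_UNIV frag_extend_additive subgrp_zspan])
  have "tpow_rels Q N n <= {c\<in>UNIV. ?\<rho> c : ?Z}"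
  proof
   fix c assume "c : tpow_rels Q N n"
   then consider u v x y where "c = frag_of (u @ [x \<oplus>\<^bsub>N\<^esub> y] @ v) - frag_of (u @ [x] @ v) - frag_of (u @ [y] @ v)"
     "u @ [x] @ v : words N n" "y : carrier N"
    | u v x y r where "c = frag_of (u @ [rsmult N x r, y] @ v) - frag_of (u @ [x, r \<odot>\<^bsub>N\<^esub> y] @ v)" "u @ [x, y] @ v : words N n" "r : carrier Q" unfolding tpow_rels_def by blast
   then have "?\<rho> c : ?Z"
   proof cases
    case 1
    have "frag_of (rev v @ [x \<oplus>\<^bsub>op_bim N\<^esub> y] @ rev u) - frag_of (rev v @ [x] @ rev u) - frag_of (rev v @ [y] @ rev u) : tpow_rels (opp Q) (op_bim N) n" unfolding tpow_rels_def by (intro UnI1 CollectI exI[of _ "rev v"] exI[of _ "rev u"] exI[of _ x] exI[of _ y]) (use 1(2,3) in "auto simp: words_def")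
    then show ?thesis using 1(1) zspan_superset by (fastforce simp: frag_extend_diff)
   next
    case 2
    have "frag_of (rev v @ [rsmult (op_bim N) y r, x] @ rev u) - frag_of (rev v @ [y, r \<odot>\<^bsub>op_bim N\<^esub> x] @ rev u) : tpow_rels (opp Q) (op_bim N) n" unfolding tpow_rels_def by (intro UnI2 CollectI exI[of _ "rev v"] exI[of _ "rev u"] exI[of _ y] exI[of _ x] exI[of _ r]) (use 2(2,3) in "auto simp: words_def")
    from subgrp_uminus[OF subgrp_zspan zspan_superset[OF this]] show ?thesis using 2(1) by (simp add: frag_extend_diff)
   qed
   then show "c : {c\<in>UNIV. ?\<rho> c : ?Z}" by simp
  qed
  then show ?thesis using zspan_least[OF sub _ that] by simp
 qed
 have "fext p (?\<rho> c) = 0 <-> c : zspan (tpow_rels (opp R) (op_bim M) n)" if "fkeys c <= words M n" for c using T ks[OF that] rels[of "?\<rho> c" R M] rels[of c "opp R" "op_bim M"] unfolding tower_def by (auto simp: \<rho>\<rho>)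
 moreover have "fext p ` {c. fkeys c <= words M n} = fext (%w. p (rev w)) ` {c. fkeys c <= words M n}"
 proof (intro equalityI subsetI)
  fix t assume "t : fext p ` {c. fkeys c <= words M n}"
  then obtain c where "fkeys c <= words M n" "t = fext p c" by blast
  then show "t : fext (%w. p (rev w)) ` {c. fkeys c <= words M n}" using ks[of c] by (intro image_eqI[of _ _ "?\<rho> c"]) (simp_all add: fx \<rho>\<rho>)
 next
  fix t assume "t : fext (%w. p (rev w)) ` {c. fkeys c <= words M n}"
  then show "t : fext p ` {c. fkeys c <= words M n}" using ks by (auto simp: fx)
 qed
 ultimately show ?thesis using T unfolding tower_def by (simp add: fx)
qed

end

lemma rlink_intro:
 assumes A: "ring_on A" "carrier A = j ` carrier R" and inj: "inj_on j (carrier R)"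
  and add: "!!x y. x : carrier R ==> y : carrier R ==> x \<oplus>\<^bsub>R\<^esub> y : carrier R & j (x \<oplus>\<^bsub>R\<^esub> y) = j x + j y"
  and zero: "\<zero>\<^bsub>R\<^esub> : carrier R" "j \<zero>\<^bsub>R\<^esub> = 0" and one: "(one R) : carrier R" "j (one R) = (one A)"
  and mult: "!!x y. x : carrier R ==> y : carrier R ==> x \<otimes>\<^bsub>R\<^esub> y : carrier R & j (x \<otimes>\<^bsub>R\<^esub> y) = j x \<otimes>\<^bsub>A\<^esub> j y"
 shows "rlink R j A"
proof -
 note m = ring_onD[OF A(1)]
 have eq: "x = y" if "j x = j y" "x : carrier R" "y : carrier R" for x y using inj_onD[OF inj that] .
 have jA: "j a : carrier A" if "a : carrier R" for a using that A(2) by auto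
 have d: "(a + b) \<otimes>\<^bsub>A\<^esub> c = a \<otimes>\<^bsub>A\<^esub> c + b \<otimes>\<^bsub>A\<^esub> c" "c \<otimes>\<^bsub>A\<^esub> (a + b) = c \<otimes>\<^bsub>A\<^esub> a + c \<otimes>\<^bsub>A\<^esub> b" if "a : carrier A" "b : carrier A" "c : carrier A" for a b c using biadd_add[OF m(3)] that by auto
 have "abelian_group R"
 proof (rule abelian_groupI)
  fix x assume x: "x : carrier R"
  obtain y where y: "y : carrier R" "j y = - j x" using subgrp_uminus[OF m(1), of "j x"] x A(2) by auto
  then show "EX y:carrier R. y \<oplus>\<^bsub>R\<^esub> x = \<zero>\<^bsub>R\<^esub>" using eq[of "y \<oplus>\<^bsub>R\<^esub> x" "\<zero>\<^bsub>R\<^esub>"] add zero x by auto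
 qed (use add zero in "auto intro!: eq simp: add_ac")
 moreover have "monoid R" by (rule monoidI) (auto intro!: eq simp: mult one jA m)
 ultimately have "ring R" by (rule ringI) (auto intro!: eq simp: mult add jA d)
 then show ?thesis using inj add mult one A(2) by (auto simp: rlink_def add_embedding_def)
qed

context class_bimodule begin

abbreviation "MM \<equiv> kM ` carrier M"

lemma kM_inv:
 "x : carrier M ==> tinv (carrier M) kM (kM x) = x" "y : MM ==> tinv (carrier M) kM y : carrier M"
 "y : MM ==> kM (tinv (carrier M) kM y) = y" using add_embeddingD(3-5)[OF mlinkD(2)[OF Lm]] by simp_all

text \<open>Right exactness of the tensor product. The map \<open>\<psi>\<close> comes from
  prefixing a letter. That its kernel is no larger than required is seen from a map
  \<open>\<Phi>\<close> in the other direction, obtained from the universal property of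
  \<open>T'\<close>: it satisfies \<open>\<Phi> (\<psi> m) = q m\<close>, where \<open>q\<close> is
  the projection to the cokernel.\<close>

lemma tower_tens:
 fixes T T' :: "'t::ab_group_add set" and C :: "nat => 'c set"
 assumes n: "n >= 1" and T: "tower R M n T p" and T': "tower R M (Suc n) T' p'"
  and ta: "mod_on A T ta" "!!r w. r : carrier R ==> w : words M n ==> ta (j r) (p w) = p ((r \<odot>\<^bsub>M\<^esub> hd w) # tl w)"
  and ta': "mod_on A T' ta'" "!!r w. r : carrier R ==> w : words M (Suc n) ==> ta' (j r) (p' w) = p' ((r \<odot>\<^bsub>M\<^esub> hd w) # tl w)"
  and F: "fres A T ta {0} C dz ez"
 shows "EX \<psi>. lin_map A (fs MM (C 0)) (pws la) T' ta' \<psi> & (ALL t:T'. EX m:fs MM (C 0). \<psi> m = t) &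
    (ALL m:fs MM (C 0). \<psi> m = 0 <-> (EX m':fs MM (C 1). m = ap ra m' (dz 0)))"
proof -
 let ?i = "tinv (carrier M) kM"
 note tf = tower_facts[OF T] and tf' = tower_facts[OF T']
 note Mr = mod_onD[OF Mmod(2), simplified] and Ml = mod_onD[OF Mmod(1)]
 note fr = fresD[OF F]
 have dz: "dz 0 b : free_on A (C 0)" if "b : C 1" for b using fcxD(2)[OF fr(3), of b 0] that by simp
 have wS: "m # w : words M (Suc n)" if "m : carrier M" "w : words M n" for m w using that by (auto simp: words_def)
 have wD: "hd w : carrier M" "hd w # tl w = w" "(r \<odot>\<^bsub>M\<^esub> hd w) # tl w : words M n" if "w : words M n" "r : carrier R" for r w using that n closed(3) by (cases w; auto simp: words_def)+
 have "EX F. additive_on T F & (ALL w:words M n. F (p w) = p' (m # w))" if m: "m : carrier M" for m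
 proof (rule tower_extend[OF T], rule rel_mapI)
  fix u v x y assume h: "u @ x # v : words M n" "y : carrier M"
  show "p' (m # u @ (x \<oplus>\<^bsub>M\<^esub> y) # v) = p' (m # u @ x # v) + p' (m # u @ y # v)" using rel_mapD(1)[OF tf'(3), of "m # u" x v y] h wS[OF m h(1)] by simp
 next
  fix u v x y r assume h: "u @ x # y # v : words M n" "r : carrier R"
  show "p' (m # u @ rsmult M x r # y # v) = p' (m # u @ x # (r \<odot>\<^bsub>M\<^esub> y) # v)" using rel_mapD(2)[OF tf'(3), of "m # u" x y v r] h wS[OF m h(1)] by simp
 qed
 then obtain Fb where Fb: "!!m. m : carrier M ==> additive_on T (Fb m)"
  "!!m w. m : carrier M ==> w : words M n ==> Fb m (p w) = p' (m # w)" by metis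
 define \<beta> where "\<beta> x = Fb (?i x)" for x
 have \<beta>a: "additive_on T (\<beta> x)" if "x : MM" for x unfolding \<beta>_def by (rule Fb(1)[OF kM_inv(2)[OF that]])
 have \<beta>: "\<beta> (kM m) (p w) = p' (m # w)" if "m : carrier M" "w : words M n" for m w using that by (simp add: \<beta>_def kM_inv(1) Fb(2))
 have \<beta>T: "\<beta> x t : T'" if x: "x : MM" and t: "t : T" for x t
 proof -
  obtain c where c: "fkeys c <= words M n" "t = fext p c" using tf(4)[OF t] by blast
  have "\<beta> x t = fext (%w. \<beta> x (p w)) c" unfolding c(2) by (rule fext_map[OF tf(1) \<beta>a[OF x]]) (use tf(2) c in auto)
  also have "... : T'"
  proof (rule fext_in[OF tf'(1)])
   fix w assume "w : fkeys c"
   then have w: "w : words M n" using c(1) by blast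
   show "\<beta> x (p w) : T'" using \<beta>[OF kM_inv(2)[OF x] w] tf'(2)[OF wS[OF kM_inv(2)[OF x] w]] kM_inv(3)[OF x] by simp
  qed
  finally show ?thesis .
 qed
 have bi: "biadd MM T \<beta>"
 proof (rule biaddI)
  fix x x' t assume h: "x : MM" "x' : MM" "t : T"
  obtain m m' where m: "m : carrier M" "m' : carrier M" "x = kM m" "x' = kM m'" using h by auto
  show "\<beta> (x + x') t = \<beta> x t + \<beta> x' t"
  proof (rule tower_eqI[OF T _ _ _ h(3), where G = "%t. \<beta> x t + \<beta> x' t"])
   show "additive_on T (\<beta> (x + x'))" by (rule \<beta>a[OF subgrp_add[OF Ml(2) h(1,2)]])
   show "additive_on T (%t. \<beta> x t + \<beta> x' t)" using \<beta>a[OF h(1)] \<beta>a[OF h(2)] by (simp add: additive_on_def algebra_simps)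
   fix w assume w: "w : words M n"
   show "\<beta> (x + x') (p w) = \<beta> x (p w) + \<beta> x' (p w)" using rel_mapD(1)[OF tf'(3), of "[]" m w m'] wS[OF m(1) w] m w by (simp add: \<beta> closed(1) flip: kM_simps(2))
  qed
 next
  fix x t t' assume h: "x : MM" "t : T" "t' : T"
  show "\<beta> x (t + t') = \<beta> x t + \<beta> x t'" by (rule additive_on_add[OF \<beta>a[OF h(1)] h(2,3)])
 qed
 have bal: "\<beta> (ra a x) t = \<beta> x (ta a t)" if a: "a : carrier A" and x: "x : MM" and t: "t : T" for a x t
 proof -
  obtain m where m: "m : carrier M" "x = kM m" using x by auto
  obtain r where r: "r : carrier R" "a = j r" using a rlinkD(3)[OF R] by auto
  show ?thesis
  proof (rule tower_eqI[OF T _ _ _ t, where G = "%t. \<beta> x (ta a t)"])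
   show "additive_on T (\<beta> (ra a x))" by (rule \<beta>a) (use Mr(4)[OF a x] in simp)
   show "additive_on T (%t. \<beta> x (ta a t))" using \<beta>a[OF x] mod_on_distrib(1)[OF ta(1) a] mod_onD(4)[OF ta(1) a] by (simp add: additive_on_def)
   fix w assume w: "w : words M n"
   have "p' (rsmult M m r # hd w # tl w) = p' (m # (r \<odot>\<^bsub>M\<^esub> hd w) # tl w)" using rel_mapD(2)[OF tf'(3), of "[]" m "hd w" "tl w" r] wS[OF m(1) w] wD(2)[OF w r(1)] r(1) by simp
   then show "\<beta> (ra a x) (p w) = \<beta> x (ta a (p w))" using wD[OF w r(1)] m(1) r(1) w by (simp add: r(2) m(2) kM_simps(4) ta(2) \<beta> closed(4))
  qed
 qed
 have lin: "\<beta> (la a x) t = ta' a (\<beta> x t)" if a: "a : carrier A" and x: "x : MM" and t: "t : T" for a x t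
 proof -
  obtain m where m: "m : carrier M" "x = kM m" using x by auto
  obtain r where r: "r : carrier R" "a = j r" using a rlinkD(3)[OF R] by auto
  show ?thesis
  proof (rule tower_eqI[OF T _ _ _ t, where G = "%t. ta' a (\<beta> x t)"])
   show "additive_on T (\<beta> (la a x))" by (rule \<beta>a) (use Ml(4)[OF a x] in simp)
   show "additive_on T (%t. ta' a (\<beta> x t))" using \<beta>a[OF x] mod_on_distrib(1)[OF ta'(1) a] \<beta>T[OF x] by (simp add: additive_on_def)
   fix w assume w: "w : words M n"
   show "\<beta> (la a x) (p w) = ta' a (\<beta> x (p w))" using m(1) r(1) w wS[OF m(1) w] by (simp add: r(2) m(2) kM_simps(3) ta'(2) \<beta> closed(3))
  qed
 qed
 define \<psi> where "\<psi> m = lincomb \<beta> m ez" for m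
 have \<psi>a: "additive_on (fs MM (C 0)) \<psi>" unfolding \<psi>_def by (rule lincomb_additive[OF bi Ml(2) fr(5)])
 have sfs: "subgrp (fs MM B)" for B :: "'c set" by (rule subgrp_fs[OF Ml(2)])
 have \<psi>T: "\<psi> m : T'" if "m : fs MM (C 0)" for m unfolding \<psi>_def by (rule lincomb_in[OF tf'(1) that]) (rule \<beta>T[OF fsD(2)[OF that] fr(5)])
 have \<psi>l: "\<psi> (pws la a m) = ta' a (\<psi> m)" if a: "a : carrier A" and m: "m : fs MM (C 0)" for a m
 proof -
  let ?S = "{c. m c ~= 0}"
  have S: "c : C 0" if "c : ?S" for c using fs_supp[OF m] that by simp
  have "\<psi> (pws la a m) = (\<Sum>c\<in>?S. \<beta> (la a (m c)) (ez c))" unfolding \<psi>_def pws_def by (rule lincomb_superset[OF fsD(1)[OF m]])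
    (use mod_on_0(2)[OF Mmod(1) a] additive_on_0[OF biadd_left[OF bi fr(5)] Ml(2)] S in auto)
  also have "... = (\<Sum>c\<in>?S. ta' a (\<beta> (m c) (ez c)))" using lin[OF a fsD(2)[OF m] fr(5)] S by (intro sum.cong) auto
  also have "... = ta' a (\<psi> m)" unfolding \<psi>_def lincomb_def by (rule additive_on_sum[OF biadd_right[OF mod_onD(3)[OF ta'(1)] a] tf'(1), symmetric]) (use \<beta>T[OF fsD(2)[OF m] fr(5)] S in auto)
  finally show ?thesis .
 qed
 have row: "(%c. ra (v c) x) : fs MM B" if "v : free_on A B" "x : MM" for v x and B :: "'c set" by (rule fs_map[OF that(1)]) (use that(2) mod_on_0(1)[OF Mmod(2)] Mr(4) in auto)
 have surj: "EX m:fs MM (C 0). \<psi> m = t" if t: "t : T'" for t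
 proof -
  have "p' w : \<psi> ` fs MM (C 0)" if w: "w : words M (Suc n)" for w
  proof -
   obtain m w' where w': "w = m # w'" "m : carrier M" "w' : words M n" using w by (cases w) (auto simp: words_def)
   obtain v where v: "v : free_on A (C 0)" "p w' = lincomb ta v ez" using fr(6)[OF tf(2)[OF w'(3)]] by auto
   have m: "kM m : MM" using w'(2) by simp
   have "p' w = \<beta> (kM m) (lincomb ta v ez)" using \<beta>[OF w'(2,3)] w'(1) v(2) by simp
   also have "... = lincomb (%a t. \<beta> (kM m) (ta a t)) v ez" by (rule lincomb_map[OF \<beta>a[OF m] tf(1) v(1)]) (use mod_onD(4)[OF ta(1) fsD(2)[OF v(1)] fr(5)] in auto)
   also have "... = lincomb (%a t. \<beta> (ra a (kM m)) t) v ez" by (rule lincomb_cong[OF v(1)]) (use bal[OF fsD(2)[OF v(1)] m fr(5)] in auto)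
   also have "... = \<psi> (%c. ra (v c) (kM m))" unfolding \<psi>_def by (subst lincomb_superset[where v = "%c. ra (v c) (kM m)", OF fsD(1)[OF v(1)]])
     (use mod_on_0(1)[OF Mmod(2) m] additive_on_0[OF biadd_left[OF bi fr(5)] Ml(2)] fs_supp[OF v(1)] in "auto simp: lincomb_def")
   finally show ?thesis using row[OF v(1) m] by blast
  qed
  note p'\<psi> = this
  obtain c where c: "fkeys c <= words M (Suc n)" "t = fext p' c" using tf'(4)[OF t] by (elim exE conjE)
  have "t : \<psi> ` fs MM (C 0)" unfolding c(2) by (rule fext_in[OF subgrp_image[OF sfs \<psi>a] p'\<psi>[OF subsetD[OF c(1)]]])
  then show ?thesis by (elim imageE) (intro bexI, simp_all)
 qed
 let ?I = "(%m'. ap ra m' (dz 0)) ` fs MM (C 1)"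
 have \<psi>I: "\<psi> (ap ra m' (dz 0)) = 0" if m': "m' : fs MM (C 1)" for m'
 proof -
  have "\<psi> (ap ra m' (dz 0)) = lincomb \<beta> m' (%b. lincomb ta (dz 0 b) ez)" unfolding \<psi>_def ap_def
  proof (rule lincomb_assoc[OF m' dz fr(5), where L = MM and Y = T])
   show "ra r x : MM" if "x : MM" "r : carrier A" for x r by (rule Mr(4)[OF that(2,1)])
   show "ra 0 x = 0" if "x : MM" for x by (rule mod_on_0(1)[OF Mmod(2) that])
   show "ta r x : T" if "r : carrier A" "x : T" for r x by (rule mod_onD(4)[OF ta(1) that])
   show "ta 0 x = 0" if "x : T" for x by (rule mod_on_0(1)[OF ta(1) that])
   show "\<beta> (ra r x) t = \<beta> x (ta r t)" if "x : MM" "r : carrier A" "t : T" for x r t by (rule bal[OF that(2,1,3)])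
  qed (assumption | rule bi Ml(2) tf(1))+
  also have "... = lincomb \<beta> m' (%b. 0)" by (rule lincomb_cong[OF m']) (use fr(8) in auto)
  also have "... = 0" using additive_on_0[OF \<beta>a[OF fsD(2)[OF m']] tf(1)] by (simp add: lincomb_def)
  finally show ?thesis .
 qed
 have sI: "subgrp ?I" by (rule subgrp_image[OF sfs ap_additive[OF Mmod(2) dz]])
 obtain q :: "('c => 'y) => (('c => 'y) => circle) => circle" where q: "additive_on UNIV q" "!!m. q m = 0 <-> m : ?I" using quotient_embedding[OF sI] by blast
 have qa: "q (a + b) = q a + q b" and qd: "q (a - b) = q a - q b" for a b using q(1) additive_on_diff[OF q(1)] by (simp_all add: additive_on_def)
 \<comment> \<open>Two vectors representing the same element of \<open>T\<close> differ by a
   boundary, so the class of \<open>x\<close> times a vector depends on that element only; this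
   makes \<open>\<gamma>\<close> well defined.\<close>
 have key: "q (%c. ra (v c) x) = q (%c. ra (v' c) x)" if v: "v : free_on A (C 0)" "v' : free_on A (C 0)" "lincomb ta v ez = lincomb ta v' ez" and x: "x : MM" for v v' x
 proof -
  have "lincomb ta (v - v') ez = 0" using lin_map_diff[OF lincomb_lin_map[OF ta(1) fr(5)] subgrp_fs[OF ring_onD(1)[OF A]] v(1,2)] v(3) by simp
  then obtain w where w: "w : free_on A (C 1)" "v - v' = rmul A w (dz 0)" using fr(7)[OF subgrp_diff[OF subgrp_fs[OF ring_onD(1)[OF A]] v(1,2)]] by auto
  have add: "additive_on (carrier A) (%a. ra a x)" using biadd_left[OF Mr(3) x] by simp
  have "ra (rmul A w (dz 0) c) x = ap ra (%b. ra (w b) x) (%b j. dz 0 b j) c" for c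
  proof (rule map_ap[OF mod_on_self_opp[OF A] Mmod(2) add, where \<kappa> = "%r. r"])
   show "ra (r \<otimes>\<^bsub>opp A\<^esub> a) x = ra r (ra a x)" if "r : carrier A" "a : carrier A" for r a using Mr(5)[OF that x] by simp
  qed (use w(1) dz Mr(4)[OF _ x] in auto)
  then have "(%c. ra (v c) x) - (%c. ra (v' c) x) = ap ra (%b. ra (w b) x) (dz 0)" using w(2)[symmetric] additive_on_diff[OF add ring_onD(1)[OF A] fsD(2)[OF v(1)] fsD(2)[OF v(2)]] by (auto simp: fun_eq_iff)
  then have "q ((%c. ra (v c) x) - (%c. ra (v' c) x)) = 0" using q(2) row[OF w(1) x] by blast
  then show ?thesis by (simp add: qd)
 qed
 have "ALL t. EX v. t : T --> v : free_on A (C 0) & t = lincomb ta v ez" using fr(6) by fastforce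
 then obtain ch where ch: "!!t. t : T ==> ch t : free_on A (C 0)" "!!t. t : T ==> t = lincomb ta (ch t) ez" by metis
 define \<gamma> where "\<gamma> x t = q (%c. ra (ch t c) x)" for x t
 have lT: "lincomb ta v ez : T" if "v : free_on A (C 0)" for v by (rule mod_lincomb_in[OF ta(1) that fr(5)])
 have \<gamma>: "\<gamma> x (lincomb ta v ez) = q (%c. ra (v c) x)" if v: "v : free_on A (C 0)" and x: "x : MM" for v x unfolding \<gamma>_def by (rule key[OF ch(1)[OF lT[OF v]] v _ x]) (use ch(2)[OF lT[OF v]] in simp)
 have \<gamma>bi: "biadd MM T \<gamma>"
 proof (rule biaddI)
  fix x x' t assume h: "x : MM" "x' : MM" "t : T"
  have "(%c. ra (ch t c) (x + x')) = (%c. ra (ch t c) x) + (%c. ra (ch t c) x')" using mod_on_distrib(1)[OF Mmod(2), simplified, OF fsD(2)[OF ch(1)[OF h(3)]] h(1,2)] by (simp add: fun_eq_iff)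
  then show "\<gamma> (x + x') t = \<gamma> x t + \<gamma> x' t" by (simp add: \<gamma>_def qa)
 next
  fix x t t' assume h: "x : MM" "t : T" "t' : T"
  note c = ch(1)[OF h(2)] ch(1)[OF h(3)]
  have "t + t' = lincomb ta (ch t + ch t') ez" using additive_on_add[OF lin_mapD(1)[OF lincomb_lin_map[OF ta(1) fr(5)]] c] ch(2)[OF h(2)] ch(2)[OF h(3)] by simp
  then have "\<gamma> x (t + t') = q (%c. ra ((ch t + ch t') c) x)" using \<gamma>[OF subgrp_add[OF subgrp_fs[OF ring_onD(1)[OF A]] c] h(1)] by simp
  also have "(%c. ra ((ch t + ch t') c) x) = (%c. ra (ch t c) x) + (%c. ra (ch t' c) x)" using mod_on_distrib(4)[OF Mmod(2), simplified, OF fsD(2)[OF c(1)] fsD(2)[OF c(2)] h(1)] by (simp add: fun_eq_iff)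
  finally show "\<gamma> x (t + t') = \<gamma> x t + \<gamma> x t'" unfolding \<gamma>_def qa .
 qed
 have \<gamma>bal: "\<gamma> (ra a x) t = \<gamma> x (ta a t)" if a: "a : carrier A" and x: "x : MM" and t: "t : T" for a x t
 proof -
  note c = ch(1)[OF t]
  have "ta a t = lincomb ta (free_smult A a (ch t)) ez" using lin_mapD(3)[OF lincomb_lin_map[OF ta(1) fr(5)] a c] ch(2)[OF t] by simp
  then have "\<gamma> x (ta a t) = q (%c. ra (free_smult A a (ch t) c) x)" using \<gamma>[OF mod_onD(4)[OF free_mod[OF A] a c] x] by simp
  also have "(%c. ra (free_smult A a (ch t) c) x) = (%c. ra (ch t c) (ra a x))" using Mr(5)[OF fsD(2)[OF c] a x] by (simp add: pws_def fun_eq_iff)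
  finally show ?thesis by (simp add: \<gamma>_def)
 qed
 have "rel_map R M (Suc n) (%w. \<gamma> (kM (hd w)) (p (tl w)))"
 proof (rule rel_mapI)
  fix u v x y assume h: "u @ x # v : words M (Suc n)" "y : carrier M"
  show "\<gamma> (kM (hd (u @ (x \<oplus>\<^bsub>M\<^esub> y) # v))) (p (tl (u @ (x \<oplus>\<^bsub>M\<^esub> y) # v))) =
   \<gamma> (kM (hd (u @ x # v))) (p (tl (u @ x # v))) + \<gamma> (kM (hd (u @ y # v))) (p (tl (u @ y # v)))"
  proof (cases u)
   case Nil
   then have "x : carrier M" "v : words M n" using h by (auto simp: words_def)
   then show ?thesis using Nil h(2) biadd_add(1)[OF \<gamma>bi, of "kM x" "kM y" "p v"] tf(2) by (simp add: kM_simps(2))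
  next
   case (Cons a u')
   then have a: "a : carrier M" "u' @ x # v : words M n" "u' @ y # v : words M n" using h by (auto simp: words_def)
   show ?thesis using Cons h(2) rel_mapD(1)[OF tf(3) a(2) h(2)] biadd_add(2)[OF \<gamma>bi _ tf(2)[OF a(2)] tf(2)[OF a(3)], of "kM a"] a(1) by simp
  qed
 next
  fix u v x y r assume h: "u @ x # y # v : words M (Suc n)" "r : carrier R"
  show "\<gamma> (kM (hd (u @ rsmult M x r # y # v))) (p (tl (u @ rsmult M x r # y # v))) =
   \<gamma> (kM (hd (u @ x # (r \<odot>\<^bsub>M\<^esub> y) # v))) (p (tl (u @ x # (r \<odot>\<^bsub>M\<^esub> y) # v)))"
  proof (cases u)
   case Nil
   then have x: "x : carrier M" "y # v : words M n" using h by (auto simp: words_def)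
   then show ?thesis using Nil h(2) \<gamma>bal[OF j_simps(4)[OF h(2)] _ tf(2)[OF x(2)], of "kM x"] ta(2)[OF h(2) x(2)] kM_simps(4)[OF h(2) x(1)] by simp
  next
   case (Cons a u')
   then have a: "u' @ x # y # v : words M n" using h by (auto simp: words_def)
   show ?thesis using Cons rel_mapD(2)[OF tf(3) a h(2)] by simp
  qed
 qed
 from tower_extend[OF T' this] obtain \<Phi> where \<Phi>: "additive_on T' \<Phi>" "!!w. w : words M (Suc n) ==> \<Phi> (p' w) = \<gamma> (kM (hd w)) (p (tl w))" by blast
 have \<Phi>\<beta>: "\<Phi> (\<beta> x t) = \<gamma> x t" if x: "x : MM" and t: "t : T" for x t
 proof (rule tower_eqI[OF T _ biadd_right[OF \<gamma>bi x] _ t, where F = "%t. \<Phi> (\<beta> x t)"])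
  show "additive_on T (%t. \<Phi> (\<beta> x t))" using \<beta>a[OF x] \<Phi>(1) \<beta>T[OF x] by (simp add: additive_on_def)
  fix w assume w: "w : words M n"
  obtain m where m: "m : carrier M" "x = kM m" using x by auto
  show "\<Phi> (\<beta> x (p w)) = \<gamma> x (p w)" using \<Phi>(2)[OF wS[OF m(1) w]] \<beta>[OF m(1) w] m(2) by simp
 qed
 have \<Phi>\<psi>: "\<Phi> (\<psi> m) = q m" if m: "m : fs MM (C 0)" for m
 proof -
  have "\<Phi> (\<psi> m) = lincomb (%x t. \<Phi> (\<beta> x t)) m ez" unfolding \<psi>_def by (rule lincomb_map[OF \<Phi>(1) tf'(1) m]) (use \<beta>T[OF fsD(2)[OF m] fr(5)] in auto)
  also have "... = (\<Sum>c | m c ~= 0. q (single c (m c)))" unfolding lincomb_def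
  proof (rule sum.cong[OF refl])
   fix c assume "c : {c. m c ~= 0}"
   then have c: "c : C 0" using fs_supp[OF m] by simp
   have "\<Phi> (\<beta> (m c) (ez c)) = \<gamma> (m c) (lincomb ta (single c (one A)) ez)" using \<Phi>\<beta>[OF fsD(2)[OF m] fr(5)[OF c]] lincomb_one[OF ta(1), where e = ez, OF fr(5)[OF c]] by simp
   also have "... = q (%c'. ra (single c (one A) c') (m c))" by (rule \<gamma>[OF fs_basis[OF A c] fsD(2)[OF m]])
   also have "(%c'. ra (single c (one A) c') (m c)) = single c (m c)" using Mr(6)[OF fsD(2)[OF m]] mod_on_0(1)[OF Mmod(2) fsD(2)[OF m]] by (auto simp: single_def fun_eq_iff)
   finally show "\<Phi> (\<beta> (m c) (ez c)) = q (single c (m c))" .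
  qed
  also have "... = q (\<Sum>c | m c ~= 0. single c (m c))" by (rule additive_on_sum[OF q(1), symmetric]) auto
  finally show ?thesis using fs_expand[OF m] by simp
 qed
 have ker: "\<psi> m = 0 <-> (EX m':fs MM (C 1). m = ap ra m' (dz 0))" if m: "m : fs MM (C 0)" for m
 proof
  assume "\<psi> m = 0"
  then have "q m = 0" using \<Phi>\<psi>[OF m] additive_on_0[OF \<Phi>(1) tf'(1)] by simp
  then show "EX m':fs MM (C 1). m = ap ra m' (dz 0)" using q(2) by blast
 qed (use \<psi>I in auto)
 show ?thesis using \<psi>a \<psi>T \<psi>l surj ker by (intro exI[of _ \<psi>]) (simp add: lin_map_def)
qed

lemma tower_one:
 assumes T: "tower R M 1 T p" and ta: "!!r w. r : carrier R ==> w : words M 1 ==> ta (j r) (p w) = p ((r \<odot>\<^bsub>M\<^esub> hd w) # tl w)"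
 shows "EX h. lin_map A MM la T ta h & inj_on h MM & h ` MM = T"
proof -
 let ?i = "tinv (carrier M) kM"
 note tf = tower_facts[OF T]
 have w1: "w : words M 1 <-> (EX m:carrier M. w = [m])" for w by (cases w) (auto simp: words_def)
 define h where "h x = p [?i x]" for x
 have h: "h (kM m) = p [m]" if "m : carrier M" for m using that by (simp add: h_def kM_inv)
 have hT: "h x : T" if "x : MM" for x using that h tf(2) w1 by auto
 have ha: "additive_on MM h" unfolding additive_on_def
 proof (intro ballI)
  fix x y assume "x : MM" "y : MM"
  then obtain m m' where m: "m : carrier M" "x = kM m" "m' : carrier M" "y = kM m'" by auto
  then show "h (x + y) = h x + h y" using rel_mapD(1)[OF tf(3), of "[]" m "[]" m'] w1 by (simp add: h closed(1) flip: kM_simps(2))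
 qed
 have lin: "lin_map A MM la T ta h" unfolding lin_map_def
 proof (intro conjI ballI ha hT)
  fix a x assume "a : carrier A" "x : MM"
  then obtain r m where "r : carrier R" "a = j r" "m : carrier M" "x = kM m" using rlinkD(3)[OF R] by auto
  then show "h (la a x) = ta a (h x)" using ta[of r "[m]"] w1 by (simp add: kM_simps(3) h closed(3))
 qed
 have "rel_map R M 1 (%w. kM (hd w))" by (rule rel_mapI) (auto simp: words_def kM_simps(2))
 from tower_extend[OF T this] obtain F where F: "additive_on T F" "!!w. w : words M 1 ==> F (p w) = kM (hd w)" by blast
 have Fh: "F (h x) = x" if "x : MM" for x using that F(2) w1 by (auto simp: h)
 have "inj_on h MM" by (rule inj_on_inverseI[of _ F]) (rule Fh)
 moreover have "T <= h ` MM"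
 proof
  fix t assume "t : T"
  then obtain c where "fkeys c <= words M 1" "t = fext p c" using tf(4) by blast
  then show "t : h ` MM" using fext_in[OF subgrp_image[OF mod_onD(2)[OF Mmod(1)] ha], of c p] w1 h by (metis (no_types, lifting) imageI subsetD)
 qed
 ultimately show ?thesis using lin hT by (intro exI[of _ h]) auto
qed

text \<open>The coding \<open>k\<close> evaluates the quotient embedding \<open>q\<close> at any
  member of a coset. Both actions are induced by maps of words and are treated together in
  \<open>word_op\<close>.\<close>

lemma tower_record:
 assumes n: "n >= 1"
 shows "EX (T :: 'm tower set) p k sl sr. tower R M n T p & k ` carrier (tpow R M n) = T &
  (ALL w:words M n. pure R M w : carrier (tpow R M n) & k (pure R M w) = p w) &
  mlink R j (left_of (tpow R M n)) k sl & mlink (opp R) j (right_of (tpow R M n)) k sr &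
  (ALL r:carrier R. ALL w:words M n. sl (j r) (p w) = p ((r \<odot>\<^bsub>M\<^esub> hd w) # tl w)) &
  (ALL r:carrier R. ALL w:words M n. sr (j r) (p w) = p (butlast w @ [rsmult M (last w) r]))"
proof -
 interpret o: class_bimodule "opp R" "op_bim M" j "opp A" kM ra la by (rule op)
 let ?TS = "tpow_sub R M n" and ?W = "{c :: 'm list \<Rightarrow>\<^sub>0 int. fkeys c <= words M n}"
 have TS: "subgrp ?TS" "?TS <= ?W" unfolding tpow_sub_zspan using subgrp_zspan zspan_least[OF subgrp_keys tpow_rels_keys] by auto
 obtain q :: "('m list \<Rightarrow>\<^sub>0 int) => (('m list \<Rightarrow>\<^sub>0 int) => circle) => circle" where q: "additive_on UNIV q" "!!c. q c = 0 <-> c : ?TS" using quotient_embedding[OF TS(1)] by blast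
 have qa: "q (a + b) = q a + q b" and qd: "q (a - b) = q a - q b" for a b using q(1) additive_on_diff[OF q(1)] by (simp_all add: additive_on_def)
 define p where "p w = q (frag_of w)" for w
 define T where "T = q ` ?W"
 have fp: "fext p c = q c" for c unfolding p_def by (rule fext_frag_of[OF q(1)])
 have T: "tower R M n T p" by (simp add: tower_def fp T_def q(2) tpow_sub_zspan)
 note tf = tower_facts[OF T]
 let ?cos = "tpow_class R M n"
 have cos: "?cos c = {h + c | h. h : ?TS}" for c by (simp add: tpow_class_def coset_free)
 have cin: "c : ?cos c" for c using subgrp_0[OF TS(1)] by (force simp: cos)
 have cq: "q c' = q c" if "c' : ?cos c" for c c' using that q(2) by (auto simp: cos qa)
 have ceq: "?cos c = ?cos c'" if "q c = q c'" for c c'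
 proof -
  have d: "c - c' : ?TS" using that q(2) by (simp add: qd flip: q(2))
  show ?thesis
  proof (intro equalityI subsetI)
   fix z assume "z : ?cos c"
   then obtain h where "h : ?TS" "z = h + c" by (auto simp: cos)
   then show "z : ?cos c'" using subgrp_add[OF TS(1) _ d, of h] by (auto simp: cos intro!: exI[of _ "h + (c - c')"])
  next
   fix z assume "z : ?cos c'"
   then obtain h where "h : ?TS" "z = h + c'" by (auto simp: cos)
   then show "z : ?cos c" using subgrp_diff[OF TS(1) _ d, of h] by (auto simp: cos intro!: exI[of _ "h - (c - c')"])
  qed
 qed
 define k where "k C = q (SOME c. c : C)" for C
 have k: "k (?cos c) = q c" for c unfolding k_def by (rule cq, rule someI, rule cin)
 have car: "carrier (tpow R M n) = ?cos ` ?W" by (auto simp: tpow_def Let_def carrier_FactGroup tpow_class_def)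
 have kT: "k ` carrier (tpow R M n) = T" unfolding car T_def by (simp add: image_image k)
 have inj: "inj_on k (carrier (tpow R M n))" unfolding car by (rule inj_onI, elim imageE, hypsubst) (simp only: k, erule ceq)
 have add: "?cos c \<oplus>\<^bsub>tpow R M n\<^esub> ?cos c' = ?cos (c + c')" for c c'
 proof -
  have "?cos c \<oplus>\<^bsub>tpow R M n\<^esub> ?cos c' = {x + y | x y. x : ?cos c & y : ?cos c'}" by (auto simp: tpow_def Let_def FactGroup_def set_mult_def)
  also have "... = ?cos (c + c')"
  proof (intro equalityI subsetI)
   fix z assume "z : {x + y | x y. x : ?cos c & y : ?cos c'}"
   then obtain h h' where "h : ?TS" "h' : ?TS" "z = (h + c) + (h' + c')" by (auto simp: cos)
   then show "z : ?cos (c + c')" using subgrp_add[OF TS(1), of h h'] by (auto simp: cos algebra_simps intro!: exI[of _ "h + h'"])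
  next
   fix z assume "z : ?cos (c + c')"
   then obtain h where h: "h : ?TS" "z = (h + c) + c'" by (auto simp: cos algebra_simps)
   then show "z : {x + y | x y. x : ?cos c & y : ?cos c'}" by (intro CollectI exI[of _ "h + c"] exI[of _ c']) (use cin[of c'] in "auto simp: cos[of c]")
  qed
  finally show ?thesis .
 qed
 have zero: "\<zero>\<^bsub>tpow R M n\<^esub> = ?cos 0" by (simp add: tpow_def Let_def cos)
 have addc: "x \<oplus>\<^bsub>tpow R M n\<^esub> y : carrier (tpow R M n) & k (x \<oplus>\<^bsub>tpow R M n\<^esub> y) = k x + k y" if xy: "x : carrier (tpow R M n)" "y : carrier (tpow R M n)" for x y
 proof -
  obtain c where c1: "c : ?W" "x = ?cos c" by (rule imageE[OF xy(1)[unfolded car]])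
  obtain c' where c2: "c' : ?W" "y = ?cos c'" by (rule imageE[OF xy(2)[unfolded car]])
  note c = c1(1) c2(1) c1(2) c2(2)
  show ?thesis unfolding c(3,4) add car k qa using imageI[OF subgrp_add[OF subgrp_keys c(1,2)], of ?cos] by simp
 qed
 have zc: "\<zero>\<^bsub>tpow R M n\<^esub> : carrier (tpow R M n)" "k \<zero>\<^bsub>tpow R M n\<^esub> = 0" unfolding zero car k by (simp_all add: additive_on_0[OF q(1)])
 have word_op: "(\<Union>c\<in>C. ?cos (frag_extend (%w. frag_of (g w)) c)) : carrier (tpow R M n) &
   k (\<Union>c\<in>C. ?cos (frag_extend (%w. frag_of (g w)) c)) = s (k C)" if g: "!!w. w : words M n ==> g w : words M n" and s: "additive_on T s" "!!w. w : words M n ==> s (p w) = p (g w)"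
   and C: "C : carrier (tpow R M n)" for g s C
 proof -
  let ?fe = "frag_extend (%w. frag_of (g w))"
  obtain c0 where c0: "c0 : ?W" "C = ?cos c0" using C unfolding car by blast
  have qfe: "q (?fe c) = s (q c)" if c: "c : ?W" for c
  proof -
   have "q (?fe c) = fext (%w. p (g w)) c" unfolding fp[symmetric] by (simp add: fext_frag_extend)
   also have "... = fext (%w. s (p w)) c" by (rule fext_cong) (use c s(2) in auto)
   also have "... = s (q c)" unfolding fp[symmetric] by (rule fext_map[OF tf(1) s(1), symmetric]) (use c tf(2) in auto)
   finally show ?thesis .
  qed
  have CW: "c : ?W" if "c : C" for c using that TS(2) subgrp_add[OF subgrp_keys _ c0(1)] unfolding c0(2) cos by blast
  have "?cos (?fe c) = ?cos (?fe c0)" if "c : C" for c by (rule ceq) (use that qfe[OF CW[OF that]] qfe[OF c0(1)] cq[of c c0] c0(2) in simp)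
  then have "(\<Union>c\<in>C. ?cos (?fe c)) = ?cos (?fe c0)" using cin[of c0] c0(2) by blast
  moreover have "?fe c0 : ?W" using keys_frag_extend[of "%w. frag_of (g w)" c0] g c0(1) by fastforce
  ultimately show ?thesis using qfe[OF c0(1)] k by (auto simp: car c0(2))
 qed
 obtain sl where sl: "mod_on A T sl" "!!r w. r : carrier R ==> w : words M n ==> sl (j r) (p w) = p ((r \<odot>\<^bsub>M\<^esub> hd w) # tl w)" using tower_action[OF T n] by blast
 obtain sr where sr0: "mod_on (opp A) T sr" "!!r w. r : carrier R ==> w : words M n ==> sr (j r) (p (rev w)) = p (rev (rsmult M (hd w) r # tl w))" using o.tower_action[OF tower_rev[OF T] n] by auto
 have sr: "sr (j r) (p w) = p (butlast w @ [rsmult M (last w) r])" if r: "r : carrier R" and w: "w : words M n" for r w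
 proof -
  have "rev w : words M n" using w by (simp add: words_def)
  moreover have "w ~= []" using w n by (auto simp: words_def)
  ultimately show ?thesis using sr0(2)[OF r, of "rev w"] by (simp add: hd_rev) (metis butlast_rev rev_rev_ident)
 qed
 have gl: "(r \<odot>\<^bsub>M\<^esub> hd w) # tl w : words M n" if "r : carrier R" "w : words M n" for r w using that n closed(3) by (cases w) (auto simp: words_def)
 have gr: "butlast w @ [rsmult M (last w) r] : words M n" if "r : carrier R" "w : words M n" for r w using that n closed(4) by (cases w rule: rev_cases) (auto simp: words_def)
 have sml: "r \<odot>\<^bsub>tpow R M n\<^esub> C = (\<Union>c\<in>C. ?cos (frag_extend (%w. frag_of ((r \<odot>\<^bsub>M\<^esub> hd w) # tl w)) c))"
  "rsmult (tpow R M n) C r = (\<Union>c\<in>C. ?cos (frag_extend (%w. frag_of (butlast w @ [rsmult M (last w) r])) c))" for r C by (simp_all add: tpow_def Let_def)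
 have "mlink R j (left_of (tpow R M n)) k sl"
 proof (rule mlink_intro[OF R])
  fix r C assume r: "r : carrier R" and C: "C : carrier (left_of (tpow R M n))"
  show "r \<odot>\<^bsub>left_of (tpow R M n)\<^esub> C : carrier (left_of (tpow R M n)) & k (r \<odot>\<^bsub>left_of (tpow R M n)\<^esub> C) = sl (j r) (k C)" unfolding left_right_of_simps sml by (rule word_op[where g = "%w. (r \<odot>\<^bsub>M\<^esub> hd w) # tl w", OF gl[OF r] biadd_right[OF mod_onD(3)[OF sl(1)] j_simps(4)[OF r]] sl(2)[OF r]])
    (use C in simp_all)
 qed (use sl(1) kT inj addc zc in simp_all)
 moreover have "mlink (opp R) j (right_of (tpow R M n)) k sr"
 proof (rule mlink_intro[OF rlink_opp[OF R]])
  fix r C assume r: "r : carrier (opp R)" and C: "C : carrier (right_of (tpow R M n))"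
  have r': "r : carrier R" using r by simp
  show "r \<odot>\<^bsub>right_of (tpow R M n)\<^esub> C : carrier (right_of (tpow R M n)) & k (r \<odot>\<^bsub>right_of (tpow R M n)\<^esub> C) = sr (j r) (k C)" unfolding left_right_of_simps sml by (rule word_op[where g = "%w. butlast w @ [rsmult M (last w) r]", OF gr[OF r'] biadd_right[OF mod_onD(3)[OF sr0(1)] o.j_simps(4)[OF r]] sr[OF r']])
    (use C in simp_all)
 qed (use sr0(1) kT inj addc zc in simp_all)
 moreover have "pure R M w : carrier (tpow R M n) & k (pure R M w) = p w" if "w : words M n" for w using that k[of "frag_of w"] by (auto simp: pure_def p_def car words_def)
 ultimately show ?thesis using T kT sl(2) sr by blast
qed

end

subsection \<open>The kernel ideal of a split extension\<close>

context class_bimodule begin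

definition is_mult :: "(('m list \<Rightarrow>\<^sub>0 int) set => 'm) => ('y => 'y => 'y) => bool" where
 "is_mult \<theta> mm <-> bimod_on A MM la ra mm &
  (ALL x:carrier M. ALL y:carrier M. \<theta> (pure R M [x, y]) : carrier M & mm (kM x) (kM y) = kM (\<theta> (pure R M [x, y])))"

text \<open>Balancedness of the product is a relation of the tensor square, and its linearity on
  both sides is that of \<open>\<theta>\<close>.\<close>

lemma is_mult_exists:
 assumes \<theta>: "\<theta> : bimodule_hom R (tpow R M 2) M"
  and assoc: "!!x y z. x : carrier M ==> y : carrier M ==> z : carrier M ==>
   \<theta> (pure R M [\<theta> (pure R M [x, y]), z]) = \<theta> (pure R M [x, \<theta> (pure R M [y, z])])"
 shows "EX mm. is_mult \<theta> mm"
proof -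
 have "(1::nat) <= 2" by simp
 from tower_record[OF this] obtain T :: "'m tower set" and p k sl sr where
  T: "tower R M 2 T p" and kT: "k ` carrier (tpow R M 2) = T"
  and pw: "!!w. w : words M 2 ==> pure R M w : carrier (tpow R M 2) & k (pure R M w) = p w"
  and L: "mlink R j (left_of (tpow R M 2)) k sl" and Rr: "mlink (opp R) j (right_of (tpow R M 2)) k sr"
  and sl: "!!r w. r : carrier R ==> w : words M 2 ==> sl (j r) (p w) = p ((r \<odot>\<^bsub>M\<^esub> hd w) # tl w)"
  and sr: "!!r w. r : carrier R ==> w : words M 2 ==> sr (j r) (p w) = p (butlast w @ [rsmult M (last w) r])" by blast
 note tf = tower_facts[OF T]
 define \<Theta> where "\<Theta> t = kM (\<theta> (tinv (carrier (tpow R M 2)) k t))" for t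
 have \<Theta>l: "lin_map A T sl MM la \<Theta>" using module_hom_lin_map[OF R L Lm, of \<theta>] \<theta> unfolding \<Theta>_def bimodule_hom_def by (simp add: kT)
 have \<Theta>r: "lin_map (opp A) T sr MM ra \<Theta>" using module_hom_lin_map[OF rlink_opp[OF R] Rr Rm, of \<theta>] \<theta> unfolding \<Theta>_def bimodule_hom_def by (simp add: kT)
 have \<theta>c: "\<theta> C : carrier M" if "C : carrier (tpow R M 2)" for C using \<theta> that by (auto simp: bimodule_hom_def module_hom_def hom_def)
 have w2: "[x, y] : words M 2" if "x : carrier M" "y : carrier M" for x y using that by (simp add: words_def)
 have inv: "tinv (carrier (tpow R M 2)) k (k C) = C" if "C : carrier (tpow R M 2)" for C using add_embeddingD(3)[OF mlinkD(2)[OF L]] that by simp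
 have \<Theta>p: "\<Theta> (p [x, y]) = kM (\<theta> (pure R M [x, y]))" if "x : carrier M" "y : carrier M" for x y using pw[OF w2[OF that]] inv[of "pure R M [x, y]"] by (simp add: \<Theta>_def)
 define mm where "mm a b = \<Theta> (p [tinv (carrier M) kM a, tinv (carrier M) kM b])" for a b
 have mm: "mm (kM x) (kM y) = \<Theta> (p [x, y])" if "x : carrier M" "y : carrier M" for x y using that by (simp add: mm_def kM_inv)
 have \<theta>M: "\<theta> (pure R M [x, y]) : carrier M" if "x : carrier M" "y : carrier M" for x y using \<theta>c pw[OF w2[OF that]] by blast
 have \<Theta>a: "\<Theta> (p v + p w) = \<Theta> (p v) + \<Theta> (p w)" if "v : words M 2" "w : words M 2" for v w using additive_on_add[OF lin_mapD(1)[OF \<Theta>l] tf(2)[OF that(1)] tf(2)[OF that(2)]] .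
 have bi: "biadd MM MM mm"
 proof (rule biaddI)
  fix a a' b assume "a : MM" "a' : MM" "b : MM"
  then obtain x x' y where x: "x : carrier M" "x' : carrier M" "y : carrier M" "a = kM x" "a' = kM x'" "b = kM y" by blast
  show "mm (a + a') b = mm a b + mm a' b" using rel_mapD(1)[OF tf(3), of "[]" x "[y]" x'] \<Theta>a w2 x by (simp add: mm closed(1) flip: kM_simps(2))
 next
  fix b a a' assume "b : MM" "a : MM" "a' : MM"
  then obtain x x' y where x: "x : carrier M" "x' : carrier M" "y : carrier M" "a = kM x" "a' = kM x'" "b = kM y" by blast
  show "mm b (a + a') = mm b a + mm b a'" using rel_mapD(1)[OF tf(3), of "[y]" x "[]" x'] \<Theta>a w2 x by (simp add: mm closed(1) flip: kM_simps(2))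
 qed
 have c1: "mm a b : MM" if "a : MM" "b : MM" for a b using that \<theta>M by (auto simp: mm \<Theta>p)
 have c2: "mm (mm a b) c = mm a (mm b c)" if "a : MM" "b : MM" "c : MM" for a b c using that \<theta>M assoc by (auto simp: mm \<Theta>p)
 have c3: "mm (la a x) y = la a (mm x y)" "mm x (ra a y) = ra a (mm x y)" "mm (ra a x) y = mm x (la a y)" if h: "a : carrier A" "x : MM" "y : MM" for a x y
 proof -
  obtain r m m' where r: "r : carrier R" "a = j r" and m: "m : carrier M" "x = kM m" "m' : carrier M" "y = kM m'" using h rlinkD(3)[OF R] by auto
  have pT: "p [m, m'] : T" by (rule tf(2)[OF w2[OF m(1,3)]])
  show "mm (la a x) y = la a (mm x y)" using lin_mapD(3)[OF \<Theta>l j_simps(4)[OF r(1)] pT] sl[OF r(1) w2[OF m(1,3)]] r m by (simp add: kM_simps(3) mm closed(3))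
  show "mm x (ra a y) = ra a (mm x y)" using lin_mapD(3)[OF \<Theta>r _ pT, of "j r"] j_simps(4)[OF r(1)] sr[OF r(1) w2[OF m(1,3)]] r m by (simp add: kM_simps(4) mm closed(4))
  show "mm (ra a x) y = mm x (la a y)" using rel_mapD(2)[OF tf(3), of "[]" m m' "[]" r] w2[OF m(1,3)] r m by (simp add: kM_simps(3,4) mm closed(3,4))
 qed
 have comm: "ra b (la a x) = la a (ra b x)" if h: "a : carrier A" "b : carrier A" "x : MM" for a b x
 proof -
  obtain r r' m where r: "r : carrier R" "a = j r" "r' : carrier R" "b = j r'" and m: "m : carrier M" "x = kM m" using h rlinkD(3)[OF R] by auto
  then show ?thesis by (simp add: kM_simps(3,4) closed(3,4) laws_bimodule)
 qed
 have "bimod_on A MM la ra mm" unfolding bimod_on_def by (intro conjI ballI Mmod bi c1 c2 c3 comm; assumption)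
 then show ?thesis using \<theta>M by (auto simp: is_mult_def mm \<Theta>p)
qed

lemma kernel_pd:
 fixes T :: "nat => 't::ab_group_add set"
 assumes bi: "bimod_on A MM la ra mm" and pd: "pdle A MM la {0} c"
  and T: "!!n. n >= 1 ==> tower R M n (T n) (p n)" "!!n. n >= 1 ==> mod_on A (T n) (ta n)"
   "!!n r w. n >= 1 ==> r : carrier R ==> w : words M n ==> ta n (j r) (p n w) = p n ((r \<odot>\<^bsub>M\<^esub> hd w) # tl w)"
  and ex: "!!n (C :: nat => ('a * 't) list set) dz ez i. n >= 1 ==> fres A (T n) (ta n) {0} C dz ez ==> ex_at ra MM C dz i"
  and N: "N >= 1" "T N = {0}"
 shows "EX k. pdle (sext A MM la ra mm) ({0} \<times> MM) (mult (sext A MM la ra mm)) {0} k"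
proof -
 interpret split_extension A MM la ra mm by standard (rule bi)
 have tens: "tens (T n) (ta n) (T (Suc n)) (ta (Suc n))" if n: "n >= 1" for n unfolding tens_def
 proof (intro allI impI conjI)
  fix C :: "nat => ('a * 't) list set" and dz ez i assume F: "fres A (T n) (ta n) {0} C dz ez"
  show "ex_at ra MM C dz i" by (rule ex[OF n F])
  have Sn: "Suc n >= 1" by simp
  show "EX \<psi>. lin_map A (fs MM (C 0)) (pws la) (T (Suc n)) (ta (Suc n)) \<psi> & (ALL t:T (Suc n). EX m:fs MM (C 0). \<psi> m = t) &
    (ALL m:fs MM (C 0). \<psi> m = 0 <-> (EX m':fs MM (C 1). m = ap ra m' (dz 0)))" by (rule tower_tens[OF n T(1)[OF n] T(1)[OF Sn] T(2)[OF n] T(3)[OF n] T(2)[OF Sn] T(3)[OF Sn] F])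
 qed
 obtain h where h: "lin_map A MM la (T 1) (ta 1) h" "inj_on h MM" "h ` MM = T 1" using tower_one[OF T(1)[OF order_refl] T(3)[OF order_refl]] by blast
 show ?thesis by (rule pdle_kernel_ideal[OF pd T(2) tens N h])
qed

lemma tower_records:
 "EX (T :: nat => 'm tower set) p k sl sr. ALL n>=1. tower R M n (T n) (p n) & k n ` carrier (tpow R M n) = T n &
  mlink R j (left_of (tpow R M n)) (k n) (sl n) & mlink (opp R) j (right_of (tpow R M n)) (k n) (sr n) &
  (ALL r:carrier R. ALL w:words M n. sl n (j r) (p n w) = p n ((r \<odot>\<^bsub>M\<^esub> hd w) # tl w)) &
  (ALL r:carrier R. ALL w:words M n. sr n (j r) (p n w) = p n (butlast w @ [rsmult M (last w) r]))"
proof -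
 define P where "P n z <-> (case z of (T :: 'm tower set, p, k, sl, sr) => tower R M n T p & k ` carrier (tpow R M n) = T &
  mlink R j (left_of (tpow R M n)) k sl & mlink (opp R) j (right_of (tpow R M n)) k sr &
  (ALL r:carrier R. ALL w:words M n. sl (j r) (p w) = p ((r \<odot>\<^bsub>M\<^esub> hd w) # tl w)) &
  (ALL r:carrier R. ALL w:words M n. sr (j r) (p w) = p (butlast w @ [rsmult M (last w) r])))" for n z
 have "EX z. P n z" if n: "n >= 1" for n
 proof -
  obtain T :: "'m tower set" and p k sl sr where "P n (T, p, k, sl, sr)" using tower_record[OF n] unfolding P_def prod.case by blast
  then show ?thesis by blast
 qed
 then have "ALL n. EX z. n >= 1 --> P n z" by blast
 then obtain z where z: "!!n. n >= 1 ==> P n (z n)" by metis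
 show ?thesis by (rule exI[of _ "%n. fst (z n)"], rule exI[of _ "%n. fst (snd (z n))"], rule exI[of _ "%n. fst (snd (snd (z n)))"],
   rule exI[of _ "%n. fst (snd (snd (snd (z n))))"], rule exI[of _ "%n. snd (snd (snd (snd (z n))))"])
   (use z in "simp add: P_def split_beta")
qed

lemma zero_module_image:
 assumes "zero_module (tpow R M n)" "mlink R j (left_of (tpow R M n)) k sl" shows "k ` carrier (tpow R M n) = {0}" using assms mlinkD(5)[OF assms(2)] by (simp add: zero_module_def)

lemma left_perfect_pd:
 assumes \<theta>: "is_mult \<theta> mm" and lp: "left_perfect R M" and N: "N >= 1" "zero_module (tpow R M N)"
 shows "EX k. pdle (sext A MM la ra mm) ({0} \<times> MM) (mult (sext A MM la ra mm)) {0} k"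
proof -
 obtain c where c: "pdle A MM la {0} c" using lp pd_finite_iff[OF R Lm] by (auto simp: left_perfect_def)
 obtain T :: "nat => 'm tower set" and p k sl sr where
  T: "!!n. n >= 1 ==> tower R M n (T n) (p n)" "!!n. n >= 1 ==> k n ` carrier (tpow R M n) = T n"
  "!!n. n >= 1 ==> mlink R j (left_of (tpow R M n)) (k n) (sl n)"
  "!!n r w. n >= 1 ==> r : carrier R ==> w : words M n ==> sl n (j r) (p n w) = p n ((r \<odot>\<^bsub>M\<^esub> hd w) # tl w)" using tower_records by (elim exE) blast
 have m: "mod_on A (T n) (sl n)" if "n >= 1" for n using mlink_mod_on[OF R T(3)[OF that]] T(2)[OF that] by simp
 have "ex_at ra MM C dz i" if n: "n >= 1" and F: "fres A (T n) (sl n) {0} C dz ez" for n i dz ez and C :: "nat => ('a * 'm tower) list set"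
 proof -
  have F': "fres A (k n ` carrier (left_of (tpow R M n))) (sl n) {0} C dz ez" using F T(2)[OF n] by simp
  have "Tor_zero R i (right_of M) (left_of (tpow R M n))" if "i >= 1" for i using lp that n by (simp add: left_perfect_def)
  from Tor_zero_ex_at[OF R Rm T(3)[OF n] F' this] show ?thesis by simp
 qed
 moreover have "T N = {0}" using zero_module_image[OF N(2) T(3)[OF N(1)]] T(2)[OF N(1)] by simp
 ultimately show ?thesis using kernel_pd[where T = T and p = p and ta = sl, OF _ c T(1) m T(4) _ N(1)] \<theta> unfolding is_mult_def by blast
qed

text \<open>The left-handed result for the opposite ring and bimodule, with reversed words supplying
  the tensor powers.\<close>

lemma right_perfect_pd:
 assumes \<theta>: "is_mult \<theta> mm" and rp: "right_perfect R M" and N: "N >= 1" "zero_module (tpow R M N)"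
 shows "EX k. pdle (opp (sext A MM la ra mm)) ({0} \<times> MM) (mult (opp (sext A MM la ra mm))) {0} k"
  "EX c. pdle (opp A) MM ra {0} c"
proof -
 interpret o: class_bimodule "opp R" "op_bim M" j "opp A" kM ra la by (rule op)
 show "EX c. pdle (opp A) MM ra {0} c" using rp pd_finite_iff[OF rlink_opp[OF R] Rm] by (auto simp: right_perfect_def)
 then obtain c where c: "pdle (opp A) MM ra {0} c" by blast
 obtain T :: "nat => 'm tower set" and p k sl sr where
  T: "!!n. n >= 1 ==> tower R M n (T n) (p n)" "!!n. n >= 1 ==> k n ` carrier (tpow R M n) = T n"
  "!!n. n >= 1 ==> mlink R j (left_of (tpow R M n)) (k n) (sl n)"
  "!!n. n >= 1 ==> mlink (opp R) j (right_of (tpow R M n)) (k n) (sr n)"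
  "!!n r w. n >= 1 ==> r : carrier R ==> w : words M n ==> sr n (j r) (p n w) = p n (butlast w @ [rsmult M (last w) r])" using tower_records by (elim exE) blast
 have m: "mod_on (opp A) (T n) (sr n)" if "n >= 1" for n using mlink_mod_on[OF rlink_opp[OF R] T(4)[OF that]] T(2)[OF that] by simp
 have act: "sr n (j r) (p n (rev w)) = p n (rev ((r \<odot>\<^bsub>op_bim M\<^esub> hd w) # tl w))" if h: "n >= 1" "r : carrier (opp R)" "w : words (op_bim M) n" for n r w
 proof -
  have "rev w : words M n" "w ~= []" using h by (auto simp: words_def)
  then show ?thesis using T(5)[OF h(1), of r "rev w"] h(2) by (cases w) auto
 qed
 have "ex_at la MM C dz i" if n: "n >= 1" and F: "fres (opp A) (T n) (sr n) {0} C dz ez" for n i dz ez and C :: "nat => ('a * 'm tower) list set"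
 proof -
  obtain B :: "nat => ('a * 'y) list set" and d e where B: "fres A MM la {0} B d e" using fres_exists_list[OF Mmod(1) submod_0[OF Mmod(1)]] by blast
  have B': "fres A (kM ` carrier (left_of M)) la {0} B d e" using B by simp
  have "Tor_zero R i (right_of (tpow R M n)) (left_of M)" if "i >= 1" for i using rp that n by (simp add: right_perfect_def)
  from Tor_zero_ex_at[OF R T(4)[OF n] Lm B' this] have "ex_at (sr n) (T n) B d i" using T(2)[OF n] by simp
  \<comment> \<open>Right perfectness gives Tor through a resolution of \<open>M\<close> as a left
    module; balancing moves it to resolutions of the tensor powers.\<close>
  from tor_balance[OF F B this] show ?thesis .
 qed
 moreover have "T N = {0}" using zero_module_image[OF N(2) T(3)[OF N(1)]] T(2)[OF N(1)] by simp
 moreover have "bimod_on (opp A) o.MM ra la (%x y. mm y x)" using bimod_on_opp[OF \<theta>[unfolded is_mult_def, THEN conjunct1]] by simp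
 ultimately have "EX k. pdle (sext (opp A) MM ra la (%x y. mm y x)) ({0} \<times> MM) (mult (sext (opp A) MM ra la (%x y. mm y x))) {0} k" using o.kernel_pd[where T = T and p = "%n w. p n (rev w)" and ta = sr, OF _ _ tower_rev[OF T(1)] m act _ N(1)] c by (simp only: op_bim_simps)
 then show "EX k. pdle (opp (sext A MM la ra mm)) ({0} \<times> MM) (mult (opp (sext A MM la ra mm))) {0} k" unfolding opp_sext .
qed

definition "jE = (%(a, x). (j a, kM x))"

lemma ext_link:
 assumes \<theta>: "is_mult \<theta> mm" shows "rlink (split_ext R M \<theta>) jE (sext A MM la ra mm)"
proof -
 interpret split_extension A MM la ra mm by standard (use \<theta> in "simp add: is_mult_def")
 interpret R: ring R by (rule rlinkD(1)[OF R])
 have \<theta>': "\<theta> (pure R M [x, y]) : carrier M" "mm (kM x) (kM y) = kM (\<theta> (pure R M [x, y]))" if "x : carrier M" "y : carrier M" for x y using \<theta> that by (auto simp: is_mult_def)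
 note jj = add_embeddingD(1,2)[OF rlinkD(2)[OF R]] and j0 = add_embedding_group(1)[OF R.is_abelian_group rlinkD(2)[OF R]]
 show ?thesis
 proof (rule rlink_intro[OF sext_ring_on])
  show "inj_on jE (carrier (split_ext R M \<theta>))" using inj_onD[OF jj(1)] inj_onD[OF kM_simps(1)] by (auto simp: inj_on_def jE_def split_ext_def)
 qed (auto simp: jE_def split_ext_def rlinkD(3-5)[OF R] jj(2) j0 mlinkD(5)[OF Lm, simplified] closed kM_simps(2-4) \<theta>' zero_prod_def)
qed

lemma ideal_link:
 assumes \<theta>: "is_mult \<theta> mm" shows "mlink (split_ext R M \<theta>) jE (ideal_module (split_ext R M \<theta>) (ext_ideal R M)) jE (mult (sext A MM la ra mm))"
  "mlink (opp (split_ext R M \<theta>)) jE (ideal_module (opp (split_ext R M \<theta>)) (ext_ideal R M)) jE (mult (opp (sext A MM la ra mm)))"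
  "jE ` carrier (ideal_module (split_ext R M \<theta>) (ext_ideal R M)) = {0} \<times> MM" "jE ` carrier (ideal_module (opp (split_ext R M \<theta>)) (ext_ideal R M)) = {0} \<times> MM"
proof -
 interpret split_extension A MM la ra mm by standard (use \<theta> in "simp add: is_mult_def")
 let ?E = "split_ext R M \<theta>"
 interpret R: ring R by (rule rlinkD(1)[OF R])
 note L = ext_link[OF \<theta>]
 have j0: "j \<zero>\<^bsub>R\<^esub> = 0" by (rule add_embedding_group(1)[OF R.is_abelian_group rlinkD(2)[OF R]])
 have \<theta>': "\<theta> (pure R M [x, y]) : carrier M" if "x : carrier M" "y : carrier M" for x y using \<theta> that by (auto simp: is_mult_def)
 have im: "jE ` ({\<zero>\<^bsub>R\<^esub>} \<times> carrier M) = {0} \<times> MM" by (force simp: jE_def j0)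
 have sub: "x : carrier ?E" if "x : {\<zero>\<^bsub>R\<^esub>} \<times> carrier M" for x using that by (auto simp: split_ext_def)
 note le = add_embeddingD(1,2)[OF rlinkD(2)[OF L]] and lm = rlinkD(5)[OF L]
 have inj: "inj_on jE ({\<zero>\<^bsub>R\<^esub>} \<times> carrier M)" by (rule inj_on_subset[OF le(1)]) (use sub in blast)
 have z: "\<zero>\<^bsub>?E\<^esub> : {\<zero>\<^bsub>R\<^esub>} \<times> carrier M" "jE \<zero>\<^bsub>?E\<^esub> = 0" by (auto simp: split_ext_def closed(2) jE_def j0 mlinkD(5)[OF Lm, simplified] zero_prod_def)
 show eq: "jE ` carrier (ideal_module (split_ext R M \<theta>) (ext_ideal R M)) = {0} \<times> MM" "jE ` carrier (ideal_module (opp ?E) (ext_ideal R M)) = {0} \<times> MM" using im by (simp_all add: ideal_module_def with_smult_def ext_ideal_def)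
 show "mlink ?E jE (ideal_module ?E (ext_ideal R M)) jE (mult E)" by (rule mlink_intro[OF L])
   (use kernel_ideal_left inj z le(2)[OF sub sub] lm[OF _ sub] \<theta>' in
    \<open>auto simp: eq simp del: sext_simps simp: ideal_module_def with_smult_def ext_ideal_def im closed split_ext_def[of R M \<theta>]\<close>)
 show "mlink (opp ?E) jE (ideal_module (opp ?E) (ext_ideal R M)) jE (mult (opp E))" by (rule mlink_intro[OF rlink_opp[OF L]])
   (use kernel_ideal_right inj z le(2)[OF sub sub] lm[OF sub] \<theta>' in
    \<open>auto simp: eq simp del: sext_simps simp: ideal_module_def with_smult_def ext_ideal_def im closed split_ext_def[of R M \<theta>]\<close>)
qed

lemma pd_ideal_left_finite:
 assumes \<theta>: "is_mult \<theta> mm"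
 shows "pd_ideal_left R M \<theta> < \<infinity> <-> (EX k. pdle (sext A MM la ra mm) ({0} \<times> MM) (mult (sext A MM la ra mm)) {0} k)" using pd_finite_iff[OF ext_link[OF \<theta>] ideal_link(1)[OF \<theta>]] unfolding ideal_link(3)[OF \<theta>] pd_ideal_left_def Let_def .

lemma pd_ideal_right_finite:
 assumes \<theta>: "is_mult \<theta> mm"
 shows "pd_ideal_right R M \<theta> < \<infinity> <-> (EX k. pdle (opp (sext A MM la ra mm)) ({0} \<times> MM) (mult (opp (sext A MM la ra mm))) {0} k)" using pd_finite_iff[OF rlink_opp[OF ext_link[OF \<theta>]] ideal_link(2)[OF \<theta>]] unfolding ideal_link(4)[OF \<theta>] pd_ideal_right_def Let_def .

subsection \<open>Nilpotency\<close>

definition "wprod mm w = foldl mm (kM (hd w)) (map kM (tl w))"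

text \<open>The product of a word is additive in each letter and balanced, hence factors through the
  \<open>N\<close>-th tensor power, which is zero.\<close>

lemma wprod_zero:
 assumes \<theta>: "is_mult \<theta> mm" and N: "N >= 1" "zero_module (tpow R M N)" and w: "w : words M N"
 shows "wprod mm w = 0"
proof -
 note b = bimod_onD[OF \<theta>[unfolded is_mult_def, THEN conjunct1]]
 have fM: "foldl mm a (map kM v) : MM" if "a : MM" "set v <= carrier M" for a v using that by (induction v arbitrary: a) (simp_all add: b(5))
 have fa: "foldl mm (a + a') (map kM v) = foldl mm a (map kM v) + foldl mm a' (map kM v)" if "a : MM" "a' : MM" "set v <= carrier M" for a a' v using that
 proof (induction v arbitrary: a a')
  case (Cons m v)
  then show ?case using b(5) biadd_add(1)[OF b(4), of a a' "kM m"] by simp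
 qed simp
 have "rel_map R M N (wprod mm)"
 proof (rule rel_mapI)
  fix u v x y assume h: "u @ x # v : words M N" "y : carrier M"
  then have s: "x : carrier M" "set u <= carrier M" "set v <= carrier M" by (auto simp: words_def)
  show "wprod mm (u @ (x \<oplus>\<^bsub>M\<^esub> y) # v) = wprod mm (u @ x # v) + wprod mm (u @ y # v)"
  proof (cases u)
   case Nil then show ?thesis using fa s h(2) by (simp add: wprod_def kM_simps(2))
  next
   case (Cons a u')
   let ?a = "foldl mm (kM a) (map kM u')"
   have "?a : MM" using fM[of "kM a" u'] s(2) Cons by simp
   then have "mm ?a (kM x + kM y) = mm ?a (kM x) + mm ?a (kM y)" "mm ?a (kM x) : MM" "mm ?a (kM y) : MM" using biadd_add(2)[OF b(4)] b(5) s(1) h(2) by auto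
   then show ?thesis using fa s h(2) Cons by (simp add: wprod_def kM_simps(2))
  qed
 next
  fix u v x y r assume h: "u @ x # y # v : words M N" "r : carrier R"
  then have s: "x : carrier M" "y : carrier M" "set u <= carrier M" by (auto simp: words_def)
  show "wprod mm (u @ rsmult M x r # y # v) = wprod mm (u @ x # (r \<odot>\<^bsub>M\<^esub> y) # v)"
  proof (cases u)
   case Nil then show ?thesis using b(9)[OF j_simps(4)[OF h(2)], of "kM x" "kM y"] s h(2) by (simp add: wprod_def kM_simps(3,4))
  next
   case (Cons a u')
   let ?a = "foldl mm (kM a) (map kM u')"
   have a: "?a : MM" using fM[of "kM a" u'] s(3) Cons by simp
   have "mm (mm ?a (ra (j r) (kM x))) (kM y) = mm (mm ?a (kM x)) (la (j r) (kM y))" using b(8)[OF j_simps(4)[OF h(2)] a, of "kM x"] b(9)[OF j_simps(4)[OF h(2)] b(5)[OF a], of "kM x" "kM y"] s by simp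
   then show ?thesis using Cons s h(2) by (simp add: wprod_def kM_simps(3,4))
  qed
 qed
 moreover obtain T :: "'m tower set" and p k sl where T: "tower R M N T p" "k ` carrier (tpow R M N) = T" "mlink R j (left_of (tpow R M N)) k sl" using tower_record[OF N(1)] by blast
 ultimately obtain F where F: "additive_on T F" "!!w. w : words M N ==> F (p w) = wprod mm w" using tower_extend[OF T(1)] by blast
 have "p w : {0}" using tower_facts(2)[OF T(1) w] T(2) zero_module_image[OF N(2) T(3)] by simp
 then show ?thesis using F(2)[OF w] additive_on_0[OF F(1) tower_facts(1)[OF T(1)]] by simp
qed

text \<open>Associativity turns the right-nested products of \<open>mpow\<close> into the
  left-nested products of words of length \<open>N + 1\<close>.\<close>

lemma mpow_zero:
 assumes \<theta>: "is_mult \<theta> mm" and N: "zero_module (tpow R M (Suc N))"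
 shows "mpow mm MM N <= {0}"
proof -
 note b = bimod_onD[OF \<theta>[unfolded is_mult_def, THEN conjunct1]]
 have fM: "foldl mm a (map kM v) : MM" if "a : MM" "set v <= carrier M" for a v using that by (induction v arbitrary: a) (simp_all add: b(5))
 have f: "mm x (foldl mm a (map kM v)) = foldl mm (mm x a) (map kM v)" if "x : MM" "a : MM" "set v <= carrier M" for x a v using that
 proof (induction v arbitrary: a)
  case (Cons m v)
  then show ?case using b(5)[of a "kM m"] b(6)[of x a "kM m"] by simp
 qed simp
 have "EX w:words M (Suc i). y = wprod mm w" if "y : mpow mm MM i" for i y using that
 proof (induction i arbitrary: y)
  case 0
  then obtain m where "m : carrier M" "y = kM m" by auto
  then show ?case by (intro bexI[of _ "[m]"]) (auto simp: wprod_def words_def)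
 next
  case (Suc i)
  then obtain x z where xz: "x : MM" "z : mpow mm MM i" "y = mm x z" by auto
  obtain w where w: "w : words M (Suc i)" "z = wprod mm w" using Suc.IH[OF xz(2)] by blast
  obtain m where m: "m : carrier M" "x = kM m" using xz(1) by auto
  obtain a v where av: "w = a # v" "a : carrier M" "set v <= carrier M" using w(1) by (cases w) (auto simp: words_def)
  have "y = wprod mm (m # w)" using f[OF xz(1), of "kM a" v] av xz(3) w(2) m(2) by (simp add: wprod_def)
  moreover have "m # w : words M (Suc (Suc i))" using w(1) m(1) by (auto simp: words_def)
  ultimately show ?case by blast
 qed
 then show ?thesis using wprod_zero[OF \<theta> _ N] by fastforce
qed

lemma mult_nilpotentI:
 assumes \<theta>: "is_mult \<theta> mm" and N: "N >= 1" "zero_module (tpow R M (Suc N))"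
 shows "mult_nilpotent R M \<theta>"
proof -
 interpret L: left_module R "left_of M" by (rule mlinkD(1)[OF Lm])
 interpret M: abelian_group M by (rule abelian_groupI) (use closed L.X.a_assoc L.X.a_comm L.X.l_zero L.X.add.l_inv_ex in simp_all)
 let ?f = "%w. foldl (%x y. \<theta> (pure R M [x, y])) (hd w) (tl w)"
 have \<theta>': "\<theta> (pure R M [x, y]) : carrier M" "mm (kM x) (kM y) = kM (\<theta> (pure R M [x, y]))" if "x : carrier M" "y : carrier M" for x y using \<theta> that by (auto simp: is_mult_def)
 have fold: "foldl (%x y. \<theta> (pure R M [x, y])) a v : carrier M & kM (foldl (%x y. \<theta> (pure R M [x, y])) a v) = foldl mm (kM a) (map kM v)" if "a : carrier M" "set v <= carrier M" for a v using that by (induction v arbitrary: a) (auto simp: \<theta>')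
 have f0: "?f w = \<zero>\<^bsub>M\<^esub>" if w: "w : words M (Suc N)" for w
 proof -
  have "hd w : carrier M" "set (tl w) <= carrier M" using w by (cases w; auto simp: words_def)+
  then show ?thesis using fold[of "hd w" "tl w"] wprod_zero[OF \<theta> _ N(2) w] mlinkD(6)[OF Lm, of "?f w"] by (simp add: wprod_def)
 qed
 \<comment> \<open>A zero tensor power consists of the subgroup of relations alone. On it the
   additive extension must be shown constant, because \<open>tpow_lift\<close> takes the only
   element of an image.\<close>
 have car: "carrier (tpow R M (Suc N)) = {tpow_sub R M (Suc N)}" using N(2) by (simp add: zero_module_def tpow_def Let_def)
 have sub: "tpow_sub R M (Suc N) <= {c. fkeys c <= words M (Suc N)}" "0 : tpow_sub R M (Suc N)" unfolding tpow_sub_zspan using zspan_least[OF subgrp_keys tpow_rels_keys] subgrp_0[OF subgrp_zspan] by auto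
 have pow: "add_pow M (i :: int) \<zero>\<^bsub>M\<^esub> = \<zero>\<^bsub>M\<^esub>" for i using group.int_pow_one[OF M.a_group, of i] by (simp add: add_pow_def)
 have "(\<Oplus>\<^bsub>M\<^esub>w\<in>fkeys c. add_pow M (Poly_Mapping.lookup c w) (?f w)) = \<zero>\<^bsub>M\<^esub>" if "c : tpow_sub R M (Suc N)" for c
 proof (rule M.add.finprod_one_eqI)
  fix w assume "w : fkeys c"
  then have "w : words M (Suc N)" using that sub(1) by blast
  then show "add_pow M (Poly_Mapping.lookup c w) (?f w) = \<zero>\<^bsub>M\<^esub>" using f0 pow by simp
 qed
 then have "(%c. \<Oplus>\<^bsub>M\<^esub>w\<in>fkeys c. add_pow M (Poly_Mapping.lookup c w) (?f w)) ` tpow_sub R M (Suc N) = {\<zero>\<^bsub>M\<^esub>}" using sub(2) by (auto simp: image_iff)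
 then have "mult_pow R M \<theta> (tpow_sub R M (Suc N)) = \<zero>\<^bsub>M\<^esub>" by (simp add: mult_pow_def tpow_lift_def)
 then show ?thesis unfolding mult_nilpotent_def using N(1) by (intro exI[of _ N]) (simp add: car)
qed

end

section \<open>Bounds for free resolutions\<close>

text \<open>\<open>bnd fl b TYPE('i) A\<close>: the resolutions (of finite length if \<open>fl\<close>, by finitely generated free modules if \<open>b\<close>)
 with index sets in \<open>'i\<close> become split at a common place.\<close>

definition bnd :: "bool => bool => 'i itself => 'a::ab_group_add ring => bool" where
 "bnd fl b _ A <-> (EX f. ALL (B :: nat => 'i set) d. (b --> (ALL n. finite (B n))) --> fcx A B d -->
  (ALL n. ex_at (mult (opp A)) (carrier A) B d n) --> (fl --> (EX n. freg A B d n)) --> freg A B d f)"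

lemma freg_mono:
 assumes c: "fcx A B d" and ex: "!!n. ex_at (mult (opp A)) (carrier A) B d n" and reg: "freg A B d n" and le: "n <= m"
 shows "freg A B d m" using preg_mono[OF fres_pres[OF fres_coker[OF c ex]] _ le] reg unfolding freg_preg[OF c] by blast

lemma shift_iff:
 "fcx A B d ==> fcx A (%i. B (i + s)) (%i. d (i + s))" "freg A (%i. B (i + s)) (%i. d (i + s)) n <-> freg A B d (n + s)"
 "ex_at t N (%i. B (i + s)) (%i. d (i + s)) n <-> ex_at t N B d (n + s)" by (simp_all add: fcx_def freg_def ex_at_def)

context split_extension begin

text \<open>Modulo the ideal the complex stays exact from \<open>Suc c\<close> on; the bound
  \<open>f\<close> for \<open>A\<close> is applied to the complex shifted by that amount, and the
  splitting is lifted to \<open>E\<close>. The extra step arises because exactness over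
  \<open>A\<close> at one place uses coefficients in the ideal at the place before.\<close>

lemma bnd_ext:
 assumes pd: "pdle (opp E) ({0} \<times> M) (mult (opp E)) {0} c" and nil: "mpow mm M N <= {0}" and b: "bnd fl b TYPE('i) A"
 shows "bnd fl b TYPE('i) E"
proof -
 obtain f where f: "!!(B :: nat => 'i set) d. (b --> (ALL n. finite (B n))) ==> fcx A B d ==>
  (!!n. ex_at (mult (opp A)) (carrier A) B d n) ==> (fl --> (EX n. freg A B d n)) ==> freg A B d f" using b unfolding bnd_def by blast
 have E: "ring_on E" by (rule sext_ring_on)
 have "freg E B d (f + Suc c)" if fin: "b --> (ALL n. finite (B n))" and cx: "fcx E B d"
  and ex: "!!n. ex_at (mult (opp E)) (carrier E) B d n" and reg: "fl --> (EX n. freg E B d n)" for B :: "nat => 'i set" and d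
 proof -
  let ?d = "%n b j. fst (d n b j)"
  have cA: "fcx A B ?d" by (rule fcx_base_change[OF cx bi_ring ring_map_fst])
  have exA: "ex_at (mult (opp A)) (carrier A) B ?d (n + Suc c)" for n
  proof -
   obtain C :: "nat => (('a * 'm) * ('a * 'm)) list set" and dz ez where C: "fres (opp E) ({0} \<times> M) (mult (opp E)) {0} C dz ez" "freg (opp E) C dz (n + c)" using pdle_mono[OF pd, of "n + c"] unfolding pdle_def by auto
   have "ex_at (mult (opp E)) ({0} \<times> M) B d (n + c)" by (rule tor_bound[OF C cx ex])
   from ex_at_fst[OF cx ex this] show ?thesis by simp
  qed
  have "fl --> (EX n. freg A (%i. B (i + Suc c)) (%i. ?d (i + Suc c)) n)"
  proof
   assume fl
   then obtain n where n: "freg E B d n" using reg by blast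
   have "freg E B d (n + Suc c)" by (rule freg_mono[OF cx ex n]) simp
   from freg_base_change[OF cx bi_ring ring_map_fst this]
   show "EX n. freg A (%i. B (i + Suc c)) (%i. ?d (i + Suc c)) n" unfolding shift_iff(2)[of A B _ ?d] by blast
  qed
  from f[OF _ shift_iff(1)[OF cA, of "Suc c"] _ this] fin exA
  have "freg A B ?d (f + Suc c)" unfolding shift_iff(2)[of A B _ ?d] shift_iff(3)[of _ _ B _ ?d] by blast
  from freg_lift[OF cx exA this nil] show ?thesis .
 qed
 then show ?thesis unfolding bnd_def by blast
qed

text \<open>The complex over \<open>E\<close> is exact from \<open>c\<close> on, and the splitting
  returns along \<open>fst\<close>, a left inverse of the inclusion of \<open>A\<close>; so here no
  lifting is involved.\<close>

lemma bnd_base: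
 assumes pd: "pdle (opp A) M ra {0} c" and b: "bnd fl b TYPE('i) E"
 shows "bnd fl b TYPE('i) A"
proof -
 obtain f where f: "!!(B :: nat => 'i set) d. (b --> (ALL n. finite (B n))) ==> fcx E B d ==>
  (!!n. ex_at (mult (opp E)) (carrier E) B d n) ==> (fl --> (EX n. freg E B d n)) ==> freg E B d f" using b unfolding bnd_def by blast
 have E: "ring_on E" by (rule sext_ring_on)
 have "freg A B d (f + c)" if fin: "b --> (ALL n. finite (B n))" and cx: "fcx A B d"
  and ex: "!!n. ex_at (mult (opp A)) (carrier A) B d n" and reg: "fl --> (EX n. freg A B d n)" for B :: "nat => 'i set" and d
 proof -
  let ?d = "%n b j. (d n b j, 0)"
  have cE: "fcx E B ?d" by (rule fcx_iota[OF cx])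
  have exE: "ex_at (mult (opp E)) (carrier E) B ?d (n + c)" for n
  proof -
   obtain C :: "nat => ('a * 'm) list set" and dz ez where C: "fres (opp A) M ra {0} C dz ez" "freg (opp A) C dz (n + c)" using pdle_mono[OF pd, of "n + c"] unfolding pdle_def by auto
   show ?thesis by (rule ex_at_iota[OF cx ex tor_bound[OF C cx ex]])
  qed
  have "fl --> (EX n. freg E (%i. B (i + c)) (%i. ?d (i + c)) n)"
  proof
   assume fl
   then obtain n where n: "freg A B d n" using reg by blast
   have "freg A B d (n + c)" by (rule freg_mono[OF cx ex n]) simp
   from freg_base_change[OF cx E ring_map_iota this]
   show "EX n. freg E (%i. B (i + c)) (%i. ?d (i + c)) n" unfolding shift_iff(2)[of E B _ ?d] by blast
  qed
  from f[OF _ shift_iff(1)[OF cE, of c] _ this] fin exE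
  have "freg E B ?d (f + c)" unfolding shift_iff(2)[of E B _ ?d] shift_iff(3)[of _ _ B _ ?d] by blast
  from freg_base_change[OF cE bi_ring ring_map_fst this] show ?thesis by simp
 qed
 then show ?thesis unfolding bnd_def by blast
qed

end

lemma Sup_enat_finite: "Sup S < (\<infinity> :: enat) <-> (EX f. ALL x:S. x <= enat f)"
proof
 assume "Sup S < \<infinity>"
 then obtain f where "Sup S = enat f" by (cases "Sup S") auto
 then show "EX f. ALL x:S. x <= enat f" by (intro exI[of _ f]) (metis Sup_upper)
next
 assume "EX f. ALL x:S. x <= enat f"
 then obtain f where "Sup S <= enat f" by (auto intro: Sup_least)
 then show "Sup S < \<infinity>" using enat_ord_simps(4) le_less_trans by blast
qed

lemma fgen_free:
 assumes A: "ring_on A" and B: "finite B" shows "fgen A (free_on A B) (free_smult A)"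
proof (rule fgenI[OF free_mod[OF A] B, where e = "%b. single b (one A)"])
 show "EX v:free_on A B. x = lincomb (free_smult A) v (%b. single b (one A))" if "x : free_on A B" for x using lincomb_basis[OF A that, symmetric] that by (rule bexI)
qed (rule fs_basis[OF A])

text \<open>The flags give the three dimensions: both true for \<open>fin_dim\<close>, only
  \<open>fl\<close> for \<open>Fin_dim\<close>, neither for \<open>gl_dim\<close>. A bound for
  modules passes to complexes through their cokernels, and back through resolutions of the
  modules.\<close>

lemma dim_bnd:
 fixes R :: "('r, 's) ring_scheme" and A :: "'a::ab_group_add ring"
 assumes R: "rlink R j A"
  and enc: "!!B0 :: 'i set. (b --> finite B0) ==> EX enc :: ('i => 'a) => 'z. inj_on enc (free_on A B0)"
  and res: "!!(X :: ('r, 'z) module) (k :: 'z => 'z bidual) s. mlink R j X k s ==> (b --> fin_gen R X) ==>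
   EX (B :: nat => 'i set) d e. fres A (k ` carrier X) s {0} B d e & (b --> (ALL n. finite (B n)))"
 shows "Sup {pd R X | X :: ('r, 'z) module. left_module R X & (b --> fin_gen R X) & (fl --> pd R X < \<infinity>)} < \<infinity> <-> bnd fl b TYPE('i) A"
  (is "Sup ?S < \<infinity> <-> _")
proof
 assume "Sup ?S < \<infinity>"
 then obtain f where "ALL x:?S. x <= enat f" unfolding Sup_enat_finite by blast
 then have f: "pd R X <= enat f" if "left_module R X" "b --> fin_gen R X" "fl --> pd R X < \<infinity>" for X :: "('r, 'z) module" using that by blast
 have A: "ring_on A" by (rule rlink_ring_on[OF R])
 have "freg A B d f" if fin: "b --> (ALL n. finite (B n))" and cx: "fcx A B d"
  and ex: "!!n. ex_at (mult (opp A)) (carrier A) B d n" and reg: "fl --> (EX n. freg A B d n)" for B :: "nat => 'i set" and d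
 proof -
  note F = fres_coker[OF cx ex]
  obtain enc' :: "('i => 'a) => 'z" where e: "inj_on enc' (free_on A (B 0))" using enc[of "B 0"] fin by blast
  obtain Z :: "('r, 'z) module" where Z: "left_module R Z" "fgen A (free_on A (B 0)) (free_smult A) ==> fin_gen R Z"
   "!!n. pd R Z <= enat n ==> pdle A (free_on A (B 0)) (free_smult A) ((%v. rmul A v (d 0)) ` free_on A (B 1)) n"
   "!!n. pdle A (free_on A (B 0)) (free_smult A) ((%v. rmul A v (d 0)) ` free_on A (B 1)) n ==> pd R Z <= enat (Suc n)" using coker_record[OF R fresD(1)[OF F] fresD(2)[OF F] e] by blast
  have "fgen A (free_on A (B 0)) (free_smult A)" if b by (rule fgen_free[OF A]) (use fin that in simp)
  then have bf: "b --> fin_gen R Z" using Z(2) by blast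
  have "fl --> pd R Z < \<infinity>"
  proof
   assume fl
   then obtain n where "freg A B d n" using reg by blast
   then have "pd R Z <= enat (Suc n)" using Z(4) pdle_fresI[OF F] by blast
   then show "pd R Z < \<infinity>" using enat_ord_simps(4) le_less_trans by blast
  qed
  then show ?thesis using pdle_freg[OF Z(3)[OF f[OF Z(1) bf]] F] by blast
 qed
 then show "bnd fl b TYPE('i) A" unfolding bnd_def by blast
next
 assume "bnd fl b TYPE('i) A"
 then obtain f where f: "!!(B :: nat => 'i set) d. (b --> (ALL n. finite (B n))) ==> fcx A B d ==>
  (!!n. ex_at (mult (opp A)) (carrier A) B d n) ==> (fl --> (EX n. freg A B d n)) ==> freg A B d f" unfolding bnd_def by blast
 have "pd R X <= enat (Suc f)" if X: "left_module R X" "b --> fin_gen R X" "fl --> pd R X < \<infinity>" for X :: "('r, 'z) module"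
 proof -
  obtain k :: "'z => 'z bidual" and s where L: "mlink R j X k s" using mlink_exists[OF R X(1)] by blast
  obtain B :: "nat => 'i set" and d e where F: "fres A (k ` carrier X) s {0} B d e" and fin: "b --> (ALL n. finite (B n))" using res[OF L X(2)] by blast
  have "fl --> (EX n. freg A B d n)" using X(3) pd_finite_iff[OF R L] pdle_freg[OF _ F] by blast
  from f[OF fin fresD(3,4)[OF F] this] have "pdle A (k ` carrier X) s {0} f" by (rule pdle_fresI[OF F])
  then show ?thesis by (rule pdle_imp_pd[OF R L])
 qed
 then show "Sup ?S < \<infinity>" unfolding Sup_enat_finite by blast
qed

lemma dim_bnd_universe:
 fixes R :: "('r, 's) ring_scheme" and A :: "'a::ab_group_add ring"
 assumes R: "rlink R j A" and inf: "infinite (UNIV :: 'u set)" and r: "inj (r :: 'r => 'u)"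
 shows "Sup {pd R X | X :: ('r, 'u) module. left_module R X & (fl --> pd R X < \<infinity>)} < \<infinity> <-> bnd fl False TYPE('u) A"
proof -
 let ?i = "tinv (carrier R) j"
 have i: "inj_on (%a. r (?i a)) (carrier A)" by (rule inj_onI) (metis add_embeddingD(5)[OF rlinkD(2)[OF R]] injD[OF r] rlinkD(3)[OF R])
 have enc: "EX enc :: ('u => 'a) => 'u. inj_on enc (free_on A B0)" for B0 using fs_inj[OF inf i inj_on_subset[OF inj_on_id2]] by blast
 have res: "EX (B :: nat => 'u set) d e. fres A (k ` carrier X) s {0} B d e" if "mlink R j X k s" for X :: "('r, 'u) module" and k :: "'u => 'u bidual" and s by (rule fres_exists_big(1)[OF R that inf r inj_on_id2])
 have "Sup {pd R X | X :: ('r, 'u) module. left_module R X & (False --> fin_gen R X) & (fl --> pd R X < \<infinity>)} < \<infinity> <-> bnd fl False TYPE('u) A" by (rule dim_bnd[OF R enc]) (use res in blast)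
 then show ?thesis by simp
qed

section \<open>Noetherian rings\<close>

lemma fgen_index:
 assumes X: "mod_on A X s" and fg: "fgen A X s"
 shows "EX (B :: nat set) e. finite B & (ALL b:B. e b : X) & (ALL x:X. EX v:free_on A B. x = lincomb s v e)"
proof -
 obtain S where S: "finite S" "S <= X" "!!x. x : X ==> EX v:free_on A S. x = lincomb s v (%y. y)" using fg by (auto simp: fgen_def)
 have A: "ring_on A" using mod_onD(1)[OF X] .
 obtain h where h: "bij_betw h {0..<card S} S" using ex_bij_betw_nat_finite[OF S(1)] by blast
 let ?B = "{0..<card S}" and ?i = "tinv {0..<card S} h"
 have i: "?i y : ?B" "h (?i y) = y" if "y : S" for y using bij_betwE[OF bij_betw_the_inv_into[OF h]] f_the_inv_into_f_bij_betw[OF h] that by auto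
 have d: "single (?i y) (one A) : free_on A ?B" if "y : S" for y by (rule fs_basis[OF A i(1)[OF that]])
 have e: "h b : X" if "b : ?B" for b using bij_betwE[OF h] that S(2) by blast
 have "EX v:free_on A ?B. x = lincomb s v h" if x: "x : X" for x
 proof -
  obtain v where v: "v : free_on A S" "x = lincomb s v (%y. y)" using S(3)[OF x] by blast
  have "lincomb s (rmul A v (%y. single (?i y) (one A))) h = lincomb s v (%y. lincomb s (single (?i y) (one A)) h)" by (rule lincomb_ap[OF X v(1) d e])
  also have "... = x" unfolding v(2) by (rule lincomb_cong[OF v(1)]) (simp only: lincomb_one[OF X, where e = h, OF e[OF i(1)]] i(2))
  finally show ?thesis by (intro bexI[OF _ ap_in[OF mod_on_self_opp[OF A] v(1) d]]) simp_all
 qed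
 then show ?thesis using e by (intro exI[of _ ?B] exI[of _ h]) auto
qed

text \<open>Generation expressed by submodules avoids coefficients in the arguments that
  follow.\<close>

lemma fgen_iff:
 assumes X: "mod_on A X s"
 shows "fgen A X s <-> (EX S. finite S & S <= X & (ALL D. submod A X s D --> S <= D --> X <= D))"
proof
 assume "fgen A X s"
 then obtain S where S: "finite S" "S <= X" "!!x. x : X ==> EX v:free_on A S. x = lincomb s v (%y. y)" by (auto simp: fgen_def)
 have "X <= D" if D: "submod A X s D" "S <= D" for D
 proof
  fix x assume "x : X"
  then obtain v where v: "v : free_on A S" "x = lincomb s v (%y. y)" using S(3) by blast
  show "x : D" unfolding v(2) by (rule submod_lincomb_in[OF X D(1) v(1)]) (use D(2) in auto)
 qed
 then show "EX S. finite S & S <= X & (ALL D. submod A X s D --> S <= D --> X <= D)" using S(1,2) by blast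
next
 assume "EX S. finite S & S <= X & (ALL D. submod A X s D --> S <= D --> X <= D)"
 then obtain S where S: "finite S" "S <= X" "!!D. submod A X s D ==> S <= D ==> X <= D" by blast
 have A: "ring_on A" using mod_onD(1)[OF X] .
 let ?D = "(%v. lincomb s v (%y. y)) ` free_on A S"
 have "submod A X s ?D" by (rule submod_image[OF free_mod[OF A] lincomb_lin_map[OF X]]) (use S(2) in auto)
 moreover have "S <= ?D"
 proof
  fix x assume x: "x : S"
  then show "x : ?D" using lincomb_one[OF X, where e = "%y. y" and b = x] fs_basis[OF A x] S(2) by (intro image_eqI[of _ _ "single x (one A)"]) auto
 qed
 ultimately have "X <= ?D" by (rule S(3))
 then show "fgen A X s" unfolding fgen_def using S(1,2) by blast
qed

lemma submod_trans: "submod A X s D ==> submod A D s D' ==> submod A X s D'" by (auto simp: submod_def)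

lemma submod_inter: "submod A X s D ==> submod A X s D' ==> submod A D s (D \<inter> D')" by (auto simp: submod_def subgrp_inter)

lemma submod_cyclic_sum:
 assumes X: "mod_on A X s" and W: "submod A X s W" and x: "x : X"
 shows "submod A X s {s a x + w | a w. a : carrier A & w : W}" "W <= {s a x + w | a w. a : carrier A & w : W}"
  "x : {s a x + w | a w. a : carrier A & w : W}"
proof -
 let ?C = "{s a x + w | a w. a : carrier A & w : W}"
 note m = mod_onD[OF X] and w = submodD[OF W] and d = mod_on_distrib[OF X]
 have cA: "subgrp (carrier A)" by (rule mod_on_ring[OF X])
 have s0: "s 0 x = 0" by (rule mod_on_0(1)[OF X x])
 have W': "w : ?C" if "w : W" for w using s0 subgrp_0[OF cA] that by (intro CollectI exI[of _ 0] exI[of _ w]) auto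
 show "W <= ?C" using W' by blast
 show "x : ?C" using m(6)[OF x] ring_onD(2)[OF m(1)] subgrp_0[OF w(1)] by (intro CollectI exI[of _ "(one A)"] exI[of _ 0]) auto
 have "subgrp ?C" unfolding subgrp_def
 proof (intro conjI ballI)
  show "0 : ?C" by (rule W'[OF subgrp_0[OF w(1)]])
  fix y z assume "y : ?C" "z : ?C"
  then obtain a b w1 w2 where h: "a : carrier A" "b : carrier A" "w1 : W" "w2 : W" "y = s a x + w1" "z = s b x + w2" by blast
  have "s (a - b) x = s a x - s b x" by (rule additive_on_diff[OF biadd_left[OF m(3) x] cA h(1,2)])
  then show "y - z : ?C" using subgrp_diff[OF cA h(1,2)] subgrp_diff[OF w(1) h(3,4)] h(5,6) by (intro CollectI exI[of _ "a - b"] exI[of _ "w1 - w2"]) (simp add: algebra_simps)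
 qed
 moreover have "?C <= X" using m(2,4) w(2) x by (auto intro: subgrp_add)
 moreover have "s c y : ?C" if cy: "c : carrier A" "y : ?C" for c y
 proof -
  obtain a w1 where h: "a : carrier A" "w1 : W" "y = s a x + w1" using cy(2) by blast
  show ?thesis using ring_onD(4)[OF m(1) cy(1) h(1)] w(3)[OF cy(1) h(2)] h(3) d(1)[OF cy(1) m(4)[OF h(1) x] w(2)[OF h(2)]] m(5)[OF cy(1) h(1) x] by (intro CollectI exI[of _ "c \<otimes>\<^bsub>A\<^esub> a"] exI[of _ "s c w1"]) simp
 qed
 ultimately show "submod A X s ?C" by (simp add: submod_def)
qed

text \<open>These are the coefficients that \<open>x\<close> can have in elements of
  \<open>D\<close> modulo \<open>W\<close>; in the induction over generators, generators of this
  ideal are lifted to \<open>D\<close>.\<close>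

lemma submod_colon:
 assumes X: "mod_on A X s" and W: "submod A X s W" and D: "submod A X s D" and x: "x : X"
 shows "submod A (carrier A) (mult A) {a : carrier A. EX w:W. s a x + w : D}" (is "submod A _ _ ?J")
proof -
 note m = mod_onD[OF X] and w = submodD[OF W] and dd = submodD[OF D] and d = mod_on_distrib[OF X]
 have cA: "subgrp (carrier A)" by (rule mod_on_ring[OF X])
 have "subgrp ?J" unfolding subgrp_def
 proof (intro conjI ballI)
  show "0 : ?J" using subgrp_0[OF cA] subgrp_0[OF w(1)] subgrp_0[OF dd(1)] mod_on_0(1)[OF X x] by (auto intro: bexI[of _ 0])
  fix a b assume "a : ?J" "b : ?J"
  then obtain w1 w2 where h: "a : carrier A" "b : carrier A" "w1 : W" "w2 : W" "s a x + w1 : D" "s b x + w2 : D" by blast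
  have "s (a - b) x = s a x - s b x" by (rule additive_on_diff[OF biadd_left[OF m(3) x] cA h(1,2)])
  then have eq: "s (a - b) x + (w1 - w2) = (s a x + w1) - (s b x + w2)" by simp
  have "s (a - b) x + (w1 - w2) : D" unfolding eq by (rule subgrp_diff[OF dd(1) h(5,6)])
  then show "a - b : ?J" using subgrp_diff[OF cA h(1,2)] subgrp_diff[OF w(1) h(3,4)] by (intro CollectI conjI bexI)
 qed
 moreover have "c \<otimes>\<^bsub>A\<^esub> a : ?J" if ca: "c : carrier A" "a : ?J" for c a
 proof -
  obtain w1 where h: "a : carrier A" "w1 : W" "s a x + w1 : D" using ca(2) by blast
  have "s (c \<otimes>\<^bsub>A\<^esub> a) x + s c w1 = s c (s a x + w1)" using d(1)[OF ca(1) m(4)[OF h(1) x] w(2)[OF h(2)]] m(5)[OF ca(1) h(1) x] by simp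
  then have "s (c \<otimes>\<^bsub>A\<^esub> a) x + s c w1 : D" using dd(3)[OF ca(1) h(3)] by simp
  then show ?thesis using ring_onD(4)[OF m(1) ca(1) h(1)] w(3)[OF ca(1) h(2)] by (intro CollectI conjI bexI)
 qed
 ultimately show ?thesis by (auto simp: submod_def)
qed

text \<open>Induction on the number of generators: the possible coefficients of the new generator
  \<open>x\<close> in elements of \<open>D\<close> form a finitely generated ideal, and what remains
  lies in the span of the other generators.\<close>

lemma fgen_submod:
 assumes noeth: "!!I. submod A (carrier A) (mult A) I ==> fgen A I (mult A)"
  and X: "mod_on A X s" and fg: "fgen A X s" and D: "submod A X s D"
 shows "fgen A D s"
proof -
 have A: "ring_on A" using mod_onD(1)[OF X] .
 define span where "span S = \<Inter>{D. submod A X s D & S <= D}" for S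
 have span: "submod A X s (span S)" "S <= span S" if "S <= X" for S
 proof -
  have "span S <= X" using submod_self[OF X] that by (auto simp: span_def)
  then show "submod A X s (span S)" unfolding submod_def by (auto simp: span_def submod_def subgrp_def)
  show "S <= span S" by (auto simp: span_def)
 qed
 have span_least: "span S <= D" if "submod A X s D" "S <= D" for S D using that by (auto simp: span_def)
 have mD: "mod_on A D s" if "submod A X s D" for D by (rule submod_mod_on[OF X that])
 have main: "fgen A D s" if "finite S" "S <= X" "submod A X s D" "D <= span S" for S D using that
 proof (induction S arbitrary: D rule: finite_induct)
  case empty
  have "D <= {0}" using empty(3) span_least[OF submod_0[OF X], of "{}"] by blast
  then have "D <= D'" if "submod A D s D'" for D' using subgrp_0[OF submodD(1)[OF that]] by blast
  then show ?case unfolding fgen_iff[OF mD[OF empty(2)]] by (intro exI[of _ "{}"]) auto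
 next
  case (insert x S)
  have S: "S <= X" "x : X" using insert.prems(1) by auto
  note sp = span(1)[OF S(1)] and DD = insert.prems(2)
  let ?J = "%D. {a : carrier A. EX w:span S. s a x + w : D}"
  have sJ: "submod A (carrier A) (mult A) (?J D')" if "submod A X s D'" for D' by (rule submod_colon[OF X sp that S(2)])
  have "fgen A (?J D) (mult A)" by (rule noeth[OF sJ[OF DD]])
  then obtain G where G: "finite G" "G <= ?J D" "!!I. submod A (?J D) (mult A) I ==> G <= I ==> ?J D <= I" unfolding fgen_iff[OF submod_mod_on[OF mod_on_self[OF A] sJ[OF DD]]] by blast
  have "ALL g:G. EX w:span S. s g x + w : D" using G(2) by blast
  then obtain e where e: "!!g. g : G ==> e g : span S" "!!g. g : G ==> s g x + e g : D" by metis
  have D0: "submod A X s (D \<inter> span S)" using submod_trans[OF DD submod_inter[OF DD sp]] .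
  have "fgen A (D \<inter> span S) s" by (rule insert.IH[OF S(1) D0]) simp
  then obtain G0 where G0: "finite G0" "G0 <= D \<inter> span S" "!!I. submod A (D \<inter> span S) s I ==> G0 <= I ==> D \<inter> span S <= I" unfolding fgen_iff[OF mD[OF D0]] by blast
  have "D <= D'" if D': "submod A D s D'" and sub: "(%g. s g x + e g) ` G \<union> G0 <= D'" for D'
  proof
   have D'X: "submod A X s D'" by (rule submod_trans[OF DD D'])
   have "D' <= D" using D' by (auto simp: submod_def)
   then have "submod A (?J D) (mult A) (?J D')" using sJ[OF D'X] unfolding submod_def by blast
   moreover have "G <= ?J D'" using G(2) e(1) sub by blast
   ultimately have JJ: "?J D <= ?J D'" by (rule G(3))
   have "submod A (D \<inter> span S) s (D \<inter> span S \<inter> D')" by (rule submod_inter[OF D0 D'X])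
   then have DS: "D \<inter> span S <= D'" using G0(3)[of "D \<inter> span S \<inter> D'"] G0(2) sub by blast
   fix y assume y: "y : D"
   have "insert x S <= {s a x + w | a w. a : carrier A & w : span S}" using submod_cyclic_sum(2,3)[OF X sp S(2)] span(2)[OF S(1)] by blast
   then have "y : {s a x + w | a w. a : carrier A & w : span S}" using span_least[OF submod_cyclic_sum(1)[OF X sp S(2)]] insert.prems(3) y by blast
   then obtain a w where a: "a : carrier A" "w : span S" "y = s a x + w" by blast
   then have "a : ?J D'" using JJ y by blast
   then obtain w' where w': "w' : span S" "s a x + w' : D'" by blast
   have 1: "w - w' : span S" by (rule subgrp_diff[OF submodD(1)[OF sp] a(2) w'(1)])
   have eq: "w - w' = y - (s a x + w')" using a(3) by simp
   have "w - w' : D" unfolding eq by (rule subgrp_diff[OF submodD(1)[OF DD] y]) (use w'(2) \<open>D' <= D\<close> in blast)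
   then have "w - w' : D'" using DS 1 by blast
   from subgrp_add[OF submodD(1)[OF D'] this w'(2)] have "w - w' + (s a x + w') : D'" .
   also have "w - w' + (s a x + w') = y" using a(3) by simp
   finally show "y : D'" .
  qed
  then show ?case unfolding fgen_iff[OF mD[OF DD]] using G(1) G0(1,2) e(2) by (intro exI[of _ "(%g. s g x + e g) ` G \<union> G0"]) auto
 qed
 obtain S where S: "finite S" "S <= X" "!!D. submod A X s D ==> S <= D ==> X <= D" using fg unfolding fgen_iff[OF X] by blast
 have "D <= span S" using S(3)[OF span[OF S(2)]] D by (auto simp: submod_def)
 then show ?thesis by (rule main[OF S(1,2) D])
qed

lemma fgen_ext:
 assumes X: "mod_on A X s" and Y: "mod_on A Y t" and f: "lin_map A X s Y t f"
  and ker: "fgen A {x\<in>X. f x = 0} s" and im: "fgen A (f ` X) t"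
 shows "fgen A X s"
proof -
 let ?K = "{x\<in>X. f x = 0}"
 have sK: "submod A X s ?K" using submod_preimage[OF X f submod_0[OF Y]] by simp
 have sI: "submod A Y t (f ` X)" by (rule submod_image[OF X f])
 obtain S where S: "finite S" "S <= ?K" "!!D. submod A ?K s D ==> S <= D ==> ?K <= D" using ker unfolding fgen_iff[OF submod_mod_on[OF X sK]] by blast
 obtain S' where S': "finite S'" "S' <= f ` X" "!!D. submod A (f ` X) t D ==> S' <= D ==> f ` X <= D" using im unfolding fgen_iff[OF submod_mod_on[OF Y sI]] by blast
 define e where "e y = (SOME x. x : X & f x = y)" for y
 have e: "e y : X" "f (e y) = y" if "y : S'" for y using someI_ex[of "%x. x : X & f x = y"] S'(2) that by (auto simp: e_def)
 have "X <= D" if D: "submod A X s D" and sub: "S \<union> e ` S' <= D" for D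
 proof
  fix x assume x: "x : X"
  have DX: "D <= X" using D by (auto simp: submod_def)
  have "?K <= ?K \<inter> D" by (rule S(3)[OF submod_inter[OF sK D]]) (use S(2) sub in auto)
  then have KD: "?K <= D" by blast
  have "submod A Y t (f ` D)" by (rule submod_image[OF submod_mod_on[OF X D] lin_map_subset[OF f DX lin_mapD(2)[OF f]]]) (use DX in auto)
  then have "submod A (f ` X) t (f ` D)" using DX by (auto simp: submod_def)
  then have "f ` X <= f ` D" by (rule S'(3)) (use e sub in force)
  then obtain y where y: "y : D" "f x = f y" using x by blast
  have "f (x - y) = 0" using lin_map_diff[OF f mod_onD(2)[OF X] x] y DX by auto
  then have "x - y : D" using KD subgrp_diff[OF mod_onD(2)[OF X] x] y(1) DX by auto
  from subgrp_add[OF submodD(1)[OF D] this y(1)] show "x : D" by simp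
 qed
 then show ?thesis unfolding fgen_iff[OF X] using S(1,2) S'(1) e(1) by (intro exI[of _ "S \<union> e ` S'"]) auto
qed

text \<open>A minimal ideal \<open>N\<close> that is not finitely generated satisfies \<open>aN = 0\<close> or \<open>aN = N\<close> for all \<open>a\<close>,
 so that the quotient by its annihilator is a field; but every maximal proper subspace of a vector space has codimension one.\<close>

lemma artinian_noetherian:
 fixes K :: "'a::ab_group_add ring"
 assumes K: "ring_on K" and comm: "!!a b. a : carrier K ==> b : carrier K ==> a \<otimes>\<^bsub>K\<^esub> b = b \<otimes>\<^bsub>K\<^esub> a"
  and dcc: "!!I :: nat => 'a set. (!!n. submod K (carrier K) (mult K) (I n)) ==> (!!n. I (Suc n) <= I n) ==> EX n. I (Suc n) = I n"
  and I: "submod K (carrier K) (mult K) I"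
 shows "fgen K I (mult K)"
proof (rule ccontr)
 assume nI: "\<not> fgen K I (mult K)"
 let ?sub = "submod K (carrier K) (mult K)"
 note r = ring_onD[OF K] and mK = mod_on_self[OF K]
 \<comment> \<open>The chain condition yields a minimal counterexample \<open>N\<close>, below which
   all ideals are finitely generated.\<close>
 have "wf {(J, I). ?sub J & ?sub I & J \<subset> I}" unfolding wf_iff_no_infinite_down_chain
 proof (rule notI, elim exE)
  fix J assume J: "ALL i. (J (Suc i), J i) : {(J, I). ?sub J & ?sub I & J \<subset> I}"
  then have "EX n. J (Suc n) = J n" by (intro dcc) auto
  then show False using J by blast
 qed
 note wf = this
 have "I : {I. ?sub I & \<not> fgen K I (mult K)}" using I nI by simp
 from wf[unfolded wf_eq_minimal, rule_format, OF this] obtain N where N0: "N : {I. ?sub I & \<not> fgen K I (mult K)}"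
  and min0: "ALL J. (J, N) : {(J, I). ?sub J & ?sub I & J \<subset> I} --> J \<notin> {I. ?sub I & \<not> fgen K I (mult K)}" ..
 have N: "?sub N" "\<not> fgen K N (mult K)" using N0 by simp_all
 have min: "fgen K J (mult K)" if "?sub J" "J \<subset> N" for J using spec[OF min0, of J] N(1) that by simp
 have NK: "n : carrier K" if "n : N" for n using submodD(2)[OF N(1) that] .
 have mN: "mod_on K N (mult K)" by (rule submod_mod_on[OF mK N(1)])
 have mu: "lin_map K N (mult K) N (mult K) (%n. a \<otimes>\<^bsub>K\<^esub> n)" if a: "a : carrier K" for a unfolding lin_map_def
 proof (intro conjI ballI)
  show "additive_on N (%n. a \<otimes>\<^bsub>K\<^esub> n)" using biadd_right[OF mod_onD(3)[OF mN] a] .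
  show "a \<otimes>\<^bsub>K\<^esub> n : N" if "n : N" for n by (rule mod_onD(4)[OF mN a that])
  show "a \<otimes>\<^bsub>K\<^esub> (b \<otimes>\<^bsub>K\<^esub> n) = b \<otimes>\<^bsub>K\<^esub> (a \<otimes>\<^bsub>K\<^esub> n)" if "b : carrier K" "n : N" for b n using r(5)[OF a that(1) NK[OF that(2)]] r(5)[OF that(1) a NK[OF that(2)]] comm[OF a that(1)] by simp
 qed
 \<comment> \<open>Otherwise kernel and image of multiplication by \<open>a\<close> are both
   properly contained in \<open>N\<close>, hence finitely generated, and then so is
   \<open>N\<close>.\<close>
 have dich: "(%n. a \<otimes>\<^bsub>K\<^esub> n) ` N = N \<or> (ALL n:N. a \<otimes>\<^bsub>K\<^esub> n = 0)" if a: "a : carrier K" for a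
 proof (rule ccontr)
  let ?f = "%n. a \<otimes>\<^bsub>K\<^esub> n"
  assume h: "\<not> ?thesis"
  have "?f ` N \<subset> N" using h lin_mapD(2)[OF mu[OF a]] by blast
  then have "fgen K (?f ` N) (mult K)" by (rule min[OF submod_trans[OF N(1) submod_image[OF mN mu[OF a]]]])
  moreover have "{n\<in>N. ?f n = 0} \<subset> N" using h by blast
  then have "fgen K {n\<in>N. ?f n = 0} (mult K)" using min[OF submod_trans[OF N(1) submod_preimage[OF mN mu[OF a] submod_0[OF mN]]]] by simp
  ultimately show False using fgen_ext[OF mN mN mu[OF a]] N(2) by blast
 qed
 \<comment> \<open>The ideals generated by the powers of \<open>a\<close> become stationary, so
   \<open>a^n = a^(n+1) b\<close> for some \<open>n\<close> and \<open>b\<close>. Every element of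
   \<open>N\<close> is a multiple of \<open>a^n\<close>, hence \<open>b\<close> inverts
   \<open>a\<close> on \<open>N\<close>.\<close>
 have inverse: "EX b:carrier K. ALL n:N. n = a \<otimes>\<^bsub>K\<^esub> (b \<otimes>\<^bsub>K\<^esub> n)" if a: "a : carrier K" and surj: "(%n. a \<otimes>\<^bsub>K\<^esub> n) ` N = N" for a
 proof -
  define F where "F n = ((%r. a \<otimes>\<^bsub>K\<^esub> r) ^^ n)" for n
  have F: "F 0 x = x" "F (Suc n) x = a \<otimes>\<^bsub>K\<^esub> F n x" for n x by (simp_all add: F_def)
  have FK: "F n x : carrier K" if "x : carrier K" for n x using that by (induction n) (auto simp: F intro: r(4)[OF a])
  have Fm: "F n (x \<otimes>\<^bsub>K\<^esub> y) = F n x \<otimes>\<^bsub>K\<^esub> y" if "x : carrier K" "y : carrier K" for n x y using that by (induction n) (auto simp: F r(5)[OF a FK])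
  have FN: "EX m':N. m = F n m'" if "m : N" for n m using that
  proof (induction n arbitrary: m)
   case (Suc n)
   obtain m1 where m1: "m1 : N" "m = a \<otimes>\<^bsub>K\<^esub> m1" using surj Suc.prems by blast
   then show ?case using Suc.IH[OF m1(1)] by (auto simp: F)
  qed (auto simp: F)
  have lin: "lin_map K (carrier K) (mult K) (carrier K) (mult K) (F n)" for n
  proof (induction n)
   case (Suc n)
   have "lin_map K (carrier K) (mult K) (carrier K) (mult K) (%x. a \<otimes>\<^bsub>K\<^esub> x)" unfolding lin_map_def
   proof (intro conjI ballI biadd_right[OF r(3) a] r(4)[OF a])
    show "a \<otimes>\<^bsub>K\<^esub> (b \<otimes>\<^bsub>K\<^esub> x) = b \<otimes>\<^bsub>K\<^esub> (a \<otimes>\<^bsub>K\<^esub> x)" if "b : carrier K" "x : carrier K" for b x using r(5)[OF a that] r(5)[OF that(1) a that(2)] comm[OF a that(1)] by simp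
   qed
   from lin_map_comp[OF Suc this] show ?case by (simp add: F fun_eq_iff[of "F (Suc n)"])
  qed (simp add: F lin_map_id)
  have "EX n. F (Suc n) ` carrier K = F n ` carrier K"
  proof (rule dcc[where I = "%n. F n ` carrier K"])
   show "?sub (F n ` carrier K)" for n by (rule submod_image[OF mK lin])
   have "F (Suc n) x = F n (a \<otimes>\<^bsub>K\<^esub> x)" for n x by (induction n) (auto simp: F)
   then show "F (Suc n) ` carrier K <= F n ` carrier K" for n using r(4)[OF a] by auto
  qed
  then obtain n where n: "F (Suc n) ` carrier K = F n ` carrier K" by blast
  have "F n (one K) : F (Suc n) ` carrier K" unfolding n using r(2) by blast
  then obtain b where b: "b : carrier K" "F n (one K) = F (Suc n) b" by blast
  have "m = a \<otimes>\<^bsub>K\<^esub> (b \<otimes>\<^bsub>K\<^esub> m)" if m: "m : N" for m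
  proof -
   obtain m' where m': "m' : N" "m = F n m'" using FN[OF m] by blast
   have k: "m' : carrier K" "F n b : carrier K" "F n (one K) : carrier K" using NK[OF m'(1)] FK b(1) r(2) by auto
   have e1: "m = F n (one K) \<otimes>\<^bsub>K\<^esub> m'" using Fm[OF r(2) k(1), of n] r(6)[OF k(1)] m'(2) by simp
   have "b \<otimes>\<^bsub>K\<^esub> m = m \<otimes>\<^bsub>K\<^esub> b" by (rule comm[OF b(1) NK[OF m]])
   also have "... = F n (m' \<otimes>\<^bsub>K\<^esub> b)" using Fm[OF k(1) b(1)] m'(2) by simp
   also have "... = F n b \<otimes>\<^bsub>K\<^esub> m'" using Fm[OF b(1) k(1)] comm[OF b(1) k(1)] by simp
   finally have "a \<otimes>\<^bsub>K\<^esub> (b \<otimes>\<^bsub>K\<^esub> m) = F (Suc n) b \<otimes>\<^bsub>K\<^esub> m'" using r(5)[OF a k(2,1)] by (simp add: F)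
   then show ?thesis using e1 b(2) by simp
  qed
  then show ?thesis using b(1) by blast
 qed
 have "fgen K {0} (mult K)" unfolding fgen_iff[OF submod_mod_on[OF mK submod_0[OF mK]]] using subgrp_0[OF submodD(1)] by (intro exI[of _ "{}"]) auto
 then have "N ~= {0}" using N(2) by auto
 then obtain x where x: "x : N" "x ~= 0" using subgrp_0[OF submodD(1)[OF N(1)]] by blast
 \<comment> \<open>A submodule \<open>W\<close> maximal among those without \<open>x\<close> is
   proper, hence finitely generated by minimality of \<open>N\<close>. It remains to see in
   \<open>dec\<close> that \<open>x\<close> and \<open>W\<close> generate \<open>N\<close>.\<close>
 let ?W = "{W. submod K N (mult K) W & x \<notin> W}"
 have "EX W:?W. ALL X:?W. W <= X --> X = W"
 proof (rule subset_Zorn_nonempty)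
  show "?W ~= {}" using submod_0[OF mN] x(2) by blast
  fix \<C> assume C: "\<C> ~= {}" "subset.chain ?W \<C>"
  have cs: "submod K N (mult K) W" "x \<notin> W" if "W : \<C>" for W using C(2) that by (auto simp: subset.chain_def)
  have "subgrp (\<Union>\<C>)" unfolding subgrp_def
  proof (intro conjI ballI)
   obtain W where W: "W : \<C>" using C(1) by blast
   show "0 : \<Union>\<C>" using subgrp_0[OF submodD(1)[OF cs(1)[OF W]]] W by blast
   fix y z assume "y : \<Union>\<C>" "z : \<Union>\<C>"
   then obtain U V where UV: "U : \<C>" "V : \<C>" "y : U" "z : V" by blast
   then have "U <= V \<or> V <= U" using C(2) by (auto simp: subset.chain_def)
   then obtain U' where U': "U' : \<C>" "y : U'" "z : U'" using UV by blast
   show "y - z : \<Union>\<C>" using subgrp_diff[OF submodD(1)[OF cs(1)[OF U'(1)]] U'(2,3)] U'(1) by blast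
  qed
  then have "submod K N (mult K) (\<Union>\<C>)" using cs(1) unfolding submod_def by blast
  then show "\<Union>\<C> : ?W" using cs(2) by blast
 qed
 then obtain W where W: "submod K N (mult K) W" "x \<notin> W" and max: "!!X. submod K N (mult K) X ==> x \<notin> X ==> W <= X ==> X = W" by blast
 have WN: "W \<subset> N" using W x(1) by (auto simp: submod_def)
 have "fgen K W (mult K)" by (rule min[OF submod_trans[OF N(1) W(1)] WN])
 then obtain G where G: "finite G" "G <= W" "!!D. submod K W (mult K) D ==> G <= D ==> W <= D" unfolding fgen_iff[OF submod_mod_on[OF mN W(1)]] by blast
 have dec: "EX c:carrier K. EX w:W. y = c \<otimes>\<^bsub>K\<^esub> x + w" if y: "y : N" for y
 proof (cases "y : W")
  case True
  then show ?thesis using mod_on_0(1)[OF mN x(1)] subgrp_0[OF r(1)] by (intro bexI[of _ 0] bexI[of _ y]) auto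
 next
  case False
  \<comment> \<open>Maximality writes \<open>x\<close> as a multiple of \<open>y\<close> plus an
    element of \<open>W\<close>; the coefficient acts invertibly on \<open>N\<close>, so this can be
    solved for \<open>y\<close>.\<close>
  note C = submod_cyclic_sum[OF mN W(1) y]
  have "x : {a \<otimes>\<^bsub>K\<^esub> y + w | a w. a : carrier K & w : W}" using max[OF C(1) _ C(2)] C(3) False by blast
  then obtain a w where a: "a : carrier K" "w : W" "x = a \<otimes>\<^bsub>K\<^esub> y + w" by blast
  have "a \<otimes>\<^bsub>K\<^esub> y ~= 0" using a W(2) by auto
  then obtain b where b: "b : carrier K" "y = a \<otimes>\<^bsub>K\<^esub> (b \<otimes>\<^bsub>K\<^esub> y)" using dich[OF a(1)] inverse[OF a(1)] y by blast
  have wN: "w : N" using a(2) WN by blast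
  have "y = b \<otimes>\<^bsub>K\<^esub> (a \<otimes>\<^bsub>K\<^esub> y)" using lin_mapD(3)[OF mu[OF a(1)] b(1) y] b(2) by simp
  also have "a \<otimes>\<^bsub>K\<^esub> y = x - w" using a(3) by simp
  also have "b \<otimes>\<^bsub>K\<^esub> (x - w) = b \<otimes>\<^bsub>K\<^esub> x + - (b \<otimes>\<^bsub>K\<^esub> w)" using mod_on_distrib(2)[OF mN b(1) x(1) wN] by simp
  finally show ?thesis using b(1) subgrp_uminus[OF submodD(1)[OF W(1)] submodD(3)[OF W(1) b(1) a(2)]] by blast
 qed
 have "N <= D" if D: "submod K N (mult K) D" and sub: "insert x G <= D" for D
 proof
  fix y assume "y : N"
  then obtain c w where c: "c : carrier K" "w : W" "y = c \<otimes>\<^bsub>K\<^esub> x + w" using dec by blast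
  have "W <= W \<inter> D" by (rule G(3)[OF submod_inter[OF W(1) D]]) (use G(2) sub in auto)
  then show "y : D" using c subgrp_add[OF submodD(1)[OF D] submodD(3)[OF D c(1)]] sub by auto
 qed
 then have "fgen K N (mult K)" unfolding fgen_iff[OF mN] using G(1,2) WN x(1) by (intro exI[of _ "insert x G"]) auto
 then show False using N(2) by blast
qed

text \<open>A state is a finite index set with the kernel reached so far. That kernel is finitely
  generated because the ring is noetherian, and natural numbers index its generators as the next
  basis.\<close>

lemma fres_exists_fin:
 assumes noeth: "!!I. submod A (carrier A) (mult A) I ==> fgen A I (mult A)" and X: "mod_on A X s" and fg: "fgen A X s"
 shows "EX (B :: nat => nat set) d e. fres A X s {0} B d e & (ALL n. finite (B n))"
proof -
 have A: "ring_on A" using mod_onD(1)[OF X] .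
 obtain B0 :: "nat set" and e where B0: "finite B0" "!!b. b : B0 ==> e b : X" "!!x. x : X ==> EX v:free_on A B0. x = lincomb s v e" using fgen_index[OF X fg] by blast
 define P where "P z <-> finite (fst z) & submod A (free_on A (fst z)) (free_smult A) (snd z)" for z :: "nat set \<times> (nat => 'a) set"
 define Q where "Q z z' d <-> (ALL b:fst z'. d b : snd z) & (ALL v:snd z. EX w:free_on A (fst z'). v = rmul A w d) &
  snd z' = {v\<in>free_on A (fst z'). rmul A v d = 0}" for z z' :: "nat set \<times> (nat => 'a) set" and d
 let ?K0 = "{v\<in>free_on A B0. lincomb s v e = 0}"
 have "submod A (free_on A B0) (free_smult A) ?K0" using submod_preimage[OF free_mod[OF A] lincomb_lin_map[OF X B0(2)] submod_0[OF X]] by simp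
 then have P0: "P (B0, ?K0)" using B0(1) by (simp add: P_def)
 have step: "EX z'. P z' & (EX d. Q z z' d)" if z: "P z" for z
 proof -
  have sub: "submod A (free_on A (fst z)) (free_smult A) (snd z)" using z by (simp add: P_def)
  have "fgen A (free_on A (fst z)) (free_smult A)" by (rule fgen_free[OF A]) (use z in "simp add: P_def")
  from fgen_submod[OF noeth free_mod[OF A] this sub] have "fgen A (snd z) (free_smult A)" .
  from fgen_index[OF submod_mod_on[OF free_mod[OF A] sub] this] obtain B :: "nat set" and d where
   B: "finite B" "!!b. b : B ==> d b : snd z" "!!x. x : snd z ==> EX v:free_on A B. x = lincomb (free_smult A) v d" by blast
  have d: "d b : free_on A (fst z)" if "b : B" for b using submodD(2)[OF sub B(2)[OF that]] .
  have "submod A (free_on A B) (free_smult A) {v\<in>free_on A B. rmul A v d = 0}" using submod_preimage[OF free_mod[OF A] ap_lin_map[OF A d] submod_0[OF free_mod[OF A]]] by simp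
  then have "P (B, {v\<in>free_on A B. rmul A v d = 0})" using B(1) by (simp add: P_def)
  moreover have "Q z (B, {v\<in>free_on A B. rmul A v d = 0}) d" using B(2,3) by (simp add: Q_def ap_lincomb)
  ultimately show ?thesis by blast
 qed
 have "EX z. ALL n. (P (z n) & (n = 0 --> z n = (B0, ?K0))) & (EX d. Q (z n) (z (Suc n)) d)" by (rule dependent_nat_choice[where P = "%n z. P z & (n = 0 --> z = (B0, ?K0))" and Q = "%n z z'. EX d. Q z z' d"]) (use P0 step in auto)
 then obtain z where z: "ALL n. (P (z n) & (n = 0 --> z n = (B0, ?K0))) & (EX d. Q (z n) (z (Suc n)) d)" ..
 then have "ALL n. EX d. Q (z n) (z (Suc n)) d" by simp
 from choice[OF this] obtain d where "ALL n. Q (z n) (z (Suc n)) (d n)" ..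
 then have d: "Q (z n) (z (Suc n)) (d n)" for n by simp
 define B where "B n = fst (z n)" for n
 define K where "K n = snd (z n)" for n
 have zB: "B 0 = B0" "K 0 = ?K0" using spec[OF z, of 0] by (auto simp: B_def K_def)
 have sK: "submod A (free_on A (B n)) (free_smult A) (K n)" and finB: "finite (B n)" for n using spec[OF z, of n] by (auto simp: P_def B_def K_def)
 have dK: "!!b. b : B (Suc n) ==> d n b : K n" and surj: "!!v. v : K n ==> EX w:free_on A (B (Suc n)). v = rmul A w (d n)"
  and KS: "K (Suc n) = {v\<in>free_on A (B (Suc n)). rmul A v (d n) = 0}" for n using d[of n] by (auto simp: Q_def B_def K_def)
 have img: "rmul A w (d n) : K n" if "w : free_on A (B (Suc n))" for w n unfolding ap_lincomb by (rule submod_lincomb_in[OF free_mod[OF A] sK that dK])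
 have "fcx A B d" unfolding fcx_def using A submodD(2)[OF sK dK] dK KS by blast
 moreover have "ex_at (mult (opp A)) (carrier A) B d n" for n unfolding ex_at_def using surj[of _ "Suc n"] by (auto simp: KS)
 moreover have "lincomb s v e = 0 <-> (EX w:free_on A (B 1). v = rmul A w (d 0))" if "v : free_on A (B 0)" for v using that surj[of v 0] img[of _ 0] by (auto simp: zB)
 moreover have "EX v:free_on A (B 0). x - lincomb s v e : {0}" if "x : X" for x using B0(3)[OF that] by (auto simp: zB)
 ultimately have "fres A X s {0} B d e" using X submod_0[OF X] B0(2) by (simp add: fres_def zB)
 then show ?thesis using finB by blast
qed

section \<open>Artin algebras and their split extensions are noetherian\<close>

definition unital :: "'k::ab_group_add ring => 'a::ab_group_add ring => ('k => 'a) => bool" where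
 "unital K A \<rho> <-> ring_on K & ring_map K A \<rho> & \<rho> (one K) = (one A)"

lemma mod_restrict:
 assumes \<rho>: "unital K A \<rho>" and X: "mod_on A X s" shows "mod_on K X (%a. s (\<rho> a))"
proof -
 note m = mod_onD[OF X] and K = \<rho>[unfolded unital_def, THEN conjunct1] and r = ring_mapD[OF \<rho>[unfolded unital_def, THEN conjunct2, THEN conjunct1]]
 have "biadd (carrier K) X (%a. s (\<rho> a))" by (rule biaddI) (simp_all add: additive_on_add[OF r(1)] r(2) mod_on_distrib(1,4)[OF X])
 then show ?thesis using K m(2,4-6) r \<rho> unfolding mod_on_def unital_def by simp
qed

text \<open>A left ideal is a \<open>K\<close>-submodule of the finitely generated
  \<open>K\<close>-module \<open>A\<close>, and its generators over \<open>K\<close> also generate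
  it over \<open>A\<close>.\<close>

lemma noeth_algebra:
 assumes noeth: "!!I. submod K (carrier K) (mult K) I ==> fgen K I (mult K)" and \<rho>: "unital K A \<rho>" and A: "ring_on A"
  and fg: "fgen K (carrier A) (%a. mult A (\<rho> a))" and I: "submod A (carrier A) (mult A) I"
 shows "fgen A I (mult A)"
proof -
 have \<rho>A: "\<rho> a : carrier A" if "a : carrier K" for a using \<rho> that by (simp add: unital_def ring_map_def)
 have restr: "submod K X (%a. mult A (\<rho> a)) D" if "submod A X (mult A) D" for X D using that \<rho>A by (simp add: submod_def)
 have mI: "mod_on A I (mult A)" by (rule submod_mod_on[OF mod_on_self[OF A] I])
 have "fgen K I (%a. mult A (\<rho> a))" by (rule fgen_submod[OF noeth mod_restrict[OF \<rho> mod_on_self[OF A]] fg restr[OF I]])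
 then obtain S where S: "finite S" "S <= I" "!!D. submod K I (%a. mult A (\<rho> a)) D ==> S <= D ==> I <= D" unfolding fgen_iff[OF mod_restrict[OF \<rho> mI]] by blast
 show ?thesis unfolding fgen_iff[OF mI] by (intro exI[of _ S] conjI allI impI S(1,2) S(3)[OF restr])
qed

lemma artinian_cring_noetherian:
 fixes K :: "'a::ab_group_add ring"
 assumes k: "artinian_cring k" and L: "rlink k jk K" and I: "submod K (carrier K) (mult K) I"
 shows "fgen K I (mult K)"
proof (rule artinian_noetherian[OF rlink_ring_on[OF L] _ _ I])
 interpret k: cring k using k by (simp add: artinian_cring_def)
 note r = rlinkD[OF L] and j = add_embeddingD[OF rlinkD(2)[OF L]] and jg = add_embedding_group[OF k.is_abelian_group rlinkD(2)[OF L]]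
 note K = ring_onD[OF rlink_ring_on[OF L]]
 show comm: "a \<otimes>\<^bsub>K\<^esub> b = b \<otimes>\<^bsub>K\<^esub> a" if "a : carrier K" "b : carrier K" for a b using that unfolding r(3) by (auto simp: r(5) k.m_comm)
 fix J :: "nat => 'a set"
 assume J: "!!n. submod K (carrier K) (mult K) (J n)" and dec: "!!n. J (Suc n) <= J n"
 let ?J = "%n. {a : carrier k. jk a : J n}"
 have "ideal (?J n) k" for n
 proof (rule idealI)
  note s = submodD[OF J[of n]]
  have sm: "jk (x \<otimes>\<^bsub>k\<^esub> a) : J n" if "a : carrier k" "jk a : J n" "x : carrier k" for a x using s(3)[of "jk x" "jk a"] that r(3) r(5)[of x a] by simp
  show "x \<otimes>\<^bsub>k\<^esub> a : ?J n" "a \<otimes>\<^bsub>k\<^esub> x : ?J n" if "a : ?J n" "x : carrier k" for a x using that sm[of a x] k.m_comm[of a x] by auto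
  show "subgroup (?J n) (add_monoid k)"
  proof (rule k.add.subgroupI)
   show "?J n ~= {}" using subgrp_0[OF s(1)] jg(1) by force
   show "\<ominus>\<^bsub>k\<^esub> a : ?J n" if "a : ?J n" for a using that jg(4)[of a] subgrp_uminus[OF s(1), of "jk a"] by auto
   show "a \<oplus>\<^bsub>k\<^esub> b : ?J n" if "a : ?J n" "b : ?J n" for a b using that j(2)[of a b] subgrp_add[OF s(1), of "jk a" "jk b"] by auto
  qed auto
 qed (rule k.ring_axioms)
 moreover have "?J (Suc n) <= ?J n" for n using dec by blast
 ultimately have "EX N. ALL n>=N. ?J n = ?J N" by (intro k[unfolded artinian_cring_def, THEN conjunct2, THEN spec, of ?J, THEN mp] allI conjI)
 then obtain N where N0: "ALL n>=N. ?J n = ?J N" ..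
 have N: "?J (Suc N) = ?J N" by (rule N0[rule_format]) simp
 have "J N <= J (Suc N)"
 proof
  fix x assume x: "x : J N"
  then obtain a where "a : carrier k" "x = jk a" using submodD(2)[OF J x] r(3) by auto
  then show "x : J (Suc N)" using x N by blast
 qed
 then show "EX n. J (Suc n) = J n" using dec by blast
qed

lemma fin_dim_bnd:
 fixes R :: "('r, 's) ring_scheme" and A :: "'a::ab_group_add ring"
 assumes R: "rlink R j A" and noeth: "!!I. submod A (carrier A) (mult A) I ==> fgen A I (mult A)"
 shows "fin_dim R < \<infinity> <-> bnd True True TYPE(nat) A"
proof -
 let ?i = "tinv (carrier R) j"
 \<comment> \<open>A vector is coded as the singleton of its coordinate function, an element of the
   type from which \<open>fin_dim\<close> takes its modules.\<close>
 have enc: "EX enc :: (nat => 'a) => (nat => 'r) set. inj_on enc (free_on A B0)" for B0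
 proof (intro exI inj_onI)
  fix v w assume vw: "v : free_on A B0" "w : free_on A B0" and "(%v. {%i. ?i (v i)}) v = (%v. {%i. ?i (v i)}) w"
  then have eq: "?i (v i) = ?i (w i)" for i by (auto dest: fun_cong)
  have "j (?i (v i)) = v i" "j (?i (w i)) = w i" for i using add_embeddingD(5)[OF rlinkD(2)[OF R]] fsD(2)[OF vw(1)] fsD(2)[OF vw(2)] rlinkD(3)[OF R] by auto
  then show "v = w" using eq by (metis ext)
 qed
 have res: "EX (B :: nat => nat set) d e. fres A (k ` carrier X) s {0} B d e & (True --> (ALL n. finite (B n)))" if "mlink R j X k s" "True --> fin_gen R X" for X :: "('r, (nat => 'r) set) module" and k :: "(nat => 'r) set => (nat => 'r) set bidual" and s using fres_exists_fin[OF noeth mlink_mod_on[OF R that(1)]] that(2) fin_gen_iff_fgen[OF R that(1)] by simp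
 have "Sup {pd R X | X :: ('r, (nat => 'r) set) module. left_module R X & (True --> fin_gen R X) & (True --> pd R X < \<infinity>)} < \<infinity> <-> bnd True True TYPE(nat) A" by (rule dim_bnd[OF R enc res])
 then show ?thesis by (simp add: fin_dim_def)
qed

text \<open>Over \<open>K\<close> the ring \<open>E\<close> is an extension of \<open>A\<close> by
  \<open>M\<close>.\<close>

lemma (in split_extension) fgen_sext:
 assumes \<rho>: "unital K A \<rho>" and fA: "fgen K (carrier A) (%a. mult A (\<rho> a))" and fM: "fgen K M (%a. la (\<rho> a))"
 shows "unital K E (%a. (\<rho> a, 0))" "fgen K (carrier E) (%a. mult E (\<rho> a, 0))"
proof -
 have \<rho>A: "\<rho> a : carrier A" if "a : carrier K" for a using \<rho> that by (simp add: unital_def ring_map_def)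
 have z: "mm 0 x = 0" "la a 0 = 0" "ra a 0 = 0" if "x : M" "a : carrier A" for x a using bi_zero that by auto
 note b = bimod_onD[OF bi]
 have M0: "0 : M" by (rule subgrp_0[OF mod_onD(2)[OF b(1)]])
 show u: "unital K E (%a. (\<rho> a, 0))" using \<rho> M0 z[OF M0 \<rho>A] unfolding unital_def ring_map_def additive_on_def by (auto simp: z)
 note A = mod_restrict[OF \<rho> mod_on_self[OF bi_ring]] and EE = mod_restrict[OF u mod_on_self[OF sext_ring_on]]
  and Mk = mod_restrict[OF \<rho> b(1)]
 have f: "lin_map K (carrier E) (%a. mult E (\<rho> a, 0)) (carrier A) (%a. mult A (\<rho> a)) fst" by (auto simp: lin_map_def additive_on_def)
 have K0: "submod K (carrier E) (%a. mult E (\<rho> a, 0)) {x : carrier E. fst x = 0}" using submod_preimage[OF EE f submod_0[OF A]] by simp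
 have sM: "ra 0 y = 0" if "y : M" for y using bi_zero(5)[OF that] .
 have "fgen K {x : carrier E. fst x = 0} (%a. mult E (\<rho> a, 0))"
 proof (rule fgen_image[OF Mk submod_mod_on[OF EE K0] _ _ fM, where f = "%x. (0, x)"])
  show "lin_map K M (%a. la (\<rho> a)) {x : carrier E. fst x = 0} (%a. mult E (\<rho> a, 0)) (%x. (0, x))" using subgrp_0[OF ring_onD(1)[OF bi_ring]] z(1)[OF _ \<rho>A] sM[OF M0] \<rho>A mod_on_0(2)[OF mod_on_self[OF bi_ring]] by (auto simp: lin_map_def additive_on_def)
  show "(%x. (0, x)) ` M = {x : carrier E. fst x = 0}" using subgrp_0[OF ring_onD(1)[OF bi_ring]] by auto
 qed
 moreover have "fst ` carrier E = carrier A" using M0 by force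
 ultimately show "fgen K (carrier E) (%a. mult E (\<rho> a, 0))" using fgen_ext[OF EE A f] fA by simp
qed

theorem theoremD:
  fixes k :: "'k ring" and \<Gamma> :: "'r ring" and \<phi> :: "'k \<Rightarrow> 'r"
    and M :: "('r, 'm) bimodule" and \<theta> :: "('m list \<Rightarrow>\<^sub>0 int) set \<Rightarrow> 'm"
  assumes "artin_algebra k \<Gamma> \<phi>"
    and "mult_bimodule \<Gamma> M \<theta>"
    and "central_fin_gen k \<phi> M"
    and "tensor_nilpotent \<Gamma> M"
    and "perfect \<Gamma> M \<or> (right_perfect \<Gamma> M \<and> mult_zero \<Gamma> M \<theta>)"
  shows "removable \<Gamma> M \<theta> \<and>
    (fin_dim (split_ext \<Gamma> M \<theta>) < \<infinity> \<longleftrightarrow> fin_dim \<Gamma> < \<infinity>) \<and>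
    (Fin_dim TYPE(('r, 'm, 'x) module_universe) (split_ext \<Gamma> M \<theta>) < \<infinity>
       \<longleftrightarrow> Fin_dim TYPE(('r, 'm, 'x) module_universe) \<Gamma> < \<infinity>) \<and>
    (gl_dim TYPE(('r, 'm, 'x) module_universe) (split_ext \<Gamma> M \<theta>) < \<infinity>
       \<longleftrightarrow> gl_dim TYPE(('r, 'm, 'x) module_universe) \<Gamma> < \<infinity>)"
proof -
 have art: "artinian_cring k" and rG: "ring \<Gamma>" and \<phi>: "\<phi> : ring_hom k \<Gamma>" and fg: "fin_gen k (with_smult \<Gamma> (%a x. \<phi> a \<otimes>\<^bsub>\<Gamma>\<^esub> x))" using assms(1) by (auto simp: artin_algebra_def)
 have bim: "bimodule \<Gamma> M" and \<theta>h: "\<theta> : bimodule_hom \<Gamma> (tpow \<Gamma> M 2) M" using assms(2) by (auto simp: mult_bimodule_def)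
 have rp: "right_perfect \<Gamma> M" using assms(5) by (auto simp: perfect_def)
 obtain j :: "'r => 'r bidual" and A where R: "rlink \<Gamma> j A" using rlink_exists[OF rG] by blast
 have "ring k" using art by (simp add: artinian_cring_def cring_def)
 then obtain jk :: "'k => 'k bidual" and K where Kl: "rlink k jk K" using rlink_exists by blast
 have "left_module \<Gamma> (left_of M)" and lr: "left_module (opp \<Gamma>) (right_of M)" using bim by (auto simp: bimodule_def)
 then obtain kM :: "'m => 'm bidual" and la where Lm: "mlink \<Gamma> j (left_of M) kM la" using mlink_exists[OF R] by blast
 \<comment> \<open>The right action is read through the coding \<open>kM\<close> already chosen for
   the left one, so that both live on the same copy of \<open>M\<close>.\<close>
 define ra where "ra a y = kM (rsmult M (tinv (carrier M) kM y) (tinv (carrier \<Gamma>) j a))" for a y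
 have "mlink (opp \<Gamma>) j (right_of M) kM ra" using lr mlinkD(2)[OF Lm] add_embeddingD(3)[OF mlinkD(2)[OF Lm]] add_embeddingD(3)[OF rlinkD(2)[OF R]] by (auto simp: mlink_def add_embedding_def ra_def)
 then interpret c: class_bimodule \<Gamma> M j A kM la ra by unfold_locales (rule R bim Lm | assumption)+
 obtain mm where mm: "c.is_mult \<theta> mm" using c.is_mult_exists[OF \<theta>h] assms(2) unfolding mult_bimodule_def by blast
 interpret s: split_extension A c.MM la ra mm by unfold_locales (use mm in "simp add: c.is_mult_def")
 note EL = c.ext_link[OF mm]
 obtain i where i: "i > 1" "zero_module (tpow \<Gamma> M i)" using assms(4) by (auto simp: tensor_nilpotent_def)
 \<comment> \<open>The exponent in \<open>mult_nilpotent\<close> and the index of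
   \<open>mpow\<close> both count one less than the number of factors.\<close>
 define N where "N = i - 1"
 have N: "N >= 1" "zero_module (tpow \<Gamma> M (Suc N))" using i by (simp_all add: N_def)
 have i1: "i >= 1" using i(1) by simp
 obtain n1 where n1: "pdle (opp s.E) ({0} \<times> c.MM) (mult (opp s.E)) {0} n1" using c.right_perfect_pd(1)[OF mm rp i1 i(2)] by blast
 obtain n2 where n2: "pdle (opp A) c.MM ra {0} n2" using c.right_perfect_pd(2)[OF mm rp i1 i(2)] by blast
 have nil: "mpow mm c.MM N <= {0}" by (rule c.mpow_zero[OF mm N(2)])
 have bnd: "bnd fl b TYPE('i) s.E <-> bnd fl b TYPE('i) A" for fl b using s.bnd_ext[OF n1 nil] s.bnd_base[OF n2] by blast
 have mn: "mult_nilpotent \<Gamma> M \<theta>" by (rule c.mult_nilpotentI[OF mm N])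
 have pr: "pd_ideal_right \<Gamma> M \<theta> < \<infinity>" using c.pd_ideal_right_finite[OF mm] n1 by blast
 have "removable \<Gamma> M \<theta>"
 proof (cases "pd_ideal_left \<Gamma> M \<theta> < \<infinity>")
  case True
  then show ?thesis using mn pr by (simp add: removable_def two_sided_removable_def)
 next
  case False
  \<comment> \<open>An infinite left dimension excludes left perfectness, so the second alternative
    of the hypothesis holds and gives \<open>\<theta> = 0\<close>.\<close>
  then have "\<not> left_perfect \<Gamma> M" using c.left_perfect_pd[OF mm _ i1 i(2)] c.pd_ideal_left_finite[OF mm] by blast
  then have "mult_zero \<Gamma> M \<theta>" using assms(5) by (auto simp: perfect_def)
  then show ?thesis using mn pr False by (simp add: removable_def only_left_removable_def)
 qed
 moreover
 \<comment> \<open>Padding with \<open>undefined\<close> embeds the types of both rings into the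
   universe, so free resolutions over either ring can be indexed there.\<close>
 have "inj (%r. [((r, undefined), undefined)] :: ('r, 'm, 'x) module_universe)" and "inj (%p. [(p, undefined)] :: ('r, 'm, 'x) module_universe)" by (auto intro: injI)
 note U = dim_bnd_universe[OF R infinite_lists this(1)] dim_bnd_universe[OF EL infinite_lists this(2)]
 have "Fin_dim TYPE(('r, 'm, 'x) module_universe) (split_ext \<Gamma> M \<theta>) < \<infinity> <-> Fin_dim TYPE(('r, 'm, 'x) module_universe) \<Gamma> < \<infinity>" using U(1)[of True] U(2)[of True] s.bnd_ext[OF n1 nil] s.bnd_base[OF n2] unfolding Fin_dim_def by auto
 moreover have "gl_dim TYPE(('r, 'm, 'x) module_universe) (split_ext \<Gamma> M \<theta>) < \<infinity> <-> gl_dim TYPE(('r, 'm, 'x) module_universe) \<Gamma> < \<infinity>" using U(1)[of False] U(2)[of False] s.bnd_ext[OF n1 nil] s.bnd_base[OF n2] unfolding gl_dim_def by auto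
 moreover have "fin_dim (split_ext \<Gamma> M \<theta>) < \<infinity> <-> fin_dim \<Gamma> < \<infinity>"
 proof -
  \<comment> \<open>Here resolutions need finite bases. Both rings are finitely generated as modules
    over a copy \<open>K\<close> of the artinian ring \<open>k\<close>, and are noetherian for that
    reason.\<close>
  note noeth = artinian_cring_noetherian[OF art Kl]
  note jk = add_embeddingD[OF rlinkD(2)[OF Kl]] and jG = add_embeddingD[OF rlinkD(2)[OF R]]
  interpret k: ring k by fact
  interpret G: ring \<Gamma> by fact
  have \<phi>c: "\<phi> a : carrier \<Gamma>" if "a : carrier k" for a using \<phi> that by (auto simp: ring_hom_def)
  define \<rho> where "\<rho> a = j (\<phi> (tinv (carrier k) jk a))" for a
  have \<rho>: "\<rho> (jk a) = j (\<phi> a)" if "a : carrier k" for a using that jk(3) by (simp add: \<rho>_def)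
  have "ring_map K A \<rho>" unfolding ring_map_def additive_on_def rlinkD(3)[OF Kl] rlinkD(3)[OF R] using \<phi> \<phi>c by (auto simp: \<rho> rlinkD(5)[OF Kl] rlinkD(5)[OF R] ring_hom_def jG(2) simp flip: jk(2))
  moreover have "\<rho> (one K) = (one A)" using \<phi> by (simp add: rlinkD(4)[OF Kl] rlinkD(4)[OF R] \<rho> ring_hom_def)
  ultimately have u: "unital K A \<rho>" using rlink_ring_on[OF Kl] by (simp add: unital_def)
  have "mlink k jk (with_smult \<Gamma> (%a x. \<phi> a \<otimes>\<^bsub>\<Gamma>\<^esub> x)) j (%a. mult A (\<rho> a))"
  proof (rule mlink_intro[OF Kl])
   show "mod_on K (j ` carrier (with_smult \<Gamma> (%a x. \<phi> a \<otimes>\<^bsub>\<Gamma>\<^esub> x))) (%a. mult A (\<rho> a))" using mod_restrict[OF u mod_on_self[OF c.A]] by (simp add: with_smult_def rlinkD(3)[OF R])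
  qed (auto simp: with_smult_def jG(1,2) \<rho> \<phi>c rlinkD(5)[OF R] add_embedding_group(1)[OF G.is_abelian_group rlinkD(2)[OF R]])
  then have fA: "fgen K (carrier A) (%a. mult A (\<rho> a))" using fin_gen_iff_fgen[OF Kl] fg by (fastforce simp: with_smult_def rlinkD(3)[OF R])
  have "mlink k jk (with_smult M (%a x. \<phi> a \<odot>\<^bsub>M\<^esub> x)) kM (%a. la (\<rho> a))"
  proof (rule mlink_intro[OF Kl])
   show "mod_on K (kM ` carrier (with_smult M (%a x. \<phi> a \<odot>\<^bsub>M\<^esub> x))) (%a. la (\<rho> a))" using mod_restrict[OF u c.Mmod(1)] by (simp add: with_smult_def)
  qed (use mlinkD(5)[OF Lm] in \<open>auto simp: with_smult_def c.kM_simps(1-3) \<rho> \<phi>c c.closed\<close>)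
  then have fM: "fgen K c.MM (%a. la (\<rho> a))" using fin_gen_iff_fgen[OF Kl] assms(3) by (fastforce simp: with_smult_def central_fin_gen_def)
  note e = s.fgen_sext[OF u fA fM]
  have "fin_dim \<Gamma> < \<infinity> <-> bnd True True TYPE(nat) A" by (rule fin_dim_bnd[OF R noeth_algebra[OF noeth u c.A fA]])
  moreover have "fin_dim (split_ext \<Gamma> M \<theta>) < \<infinity> <-> bnd True True TYPE(nat) s.E" by (rule fin_dim_bnd[OF EL noeth_algebra[OF noeth e(1) s.sext_ring_on e(2)]])
  ultimately show ?thesis using s.bnd_ext[OF n1 nil] s.bnd_base[OF n2] by blast
 qed
 ultimately show ?thesis by blast
qed

end
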